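(* Let $u_0\in V$ be the solution of the homogenized problem $-\nabla\cdot(A^0(x)\nabla u_0)=f$ in $D$, $u_0=0$ on $\partial D$, and for $\rho>0$ let $(u_0^\rho(\cdot,\omega),u_1^\rho(\cdot,\cdot,\omega))\in V\times V_1^\rho$ be the solution of the truncated stochastic two-scale homogenized problem $$\frac1{|Y^\rho|}\int_D\int_{Y^\rho}A(x,T(y)\omega)(\nabla u_0^\rho+\nabla_yu_1^\rho)\cdot(\nabla\phi_0(x)+\nabla_y\phi_1(x,y))\,dy\,dx=\int_Df\phi_0\,dx\qquad\forall(\phi_0,\phi_1)\in V\times V_1^\rho .$$ Then almost surely $$\lim_{\rho\to\infty}\|u_0-u_0^\rho(\cdot,\omega)\|_V=0.$$
   Context: $D\subset\mathbb{R}^d$ is a bounded Lipschitz domain, $V=H^1_0(D)$ with $\|v\|_V=\|\nabla v\|_{L^2(D)^d}$, and $f\in V'$; $\int_D f\phi\,dx$ denotes the duality pairing. $(\Omega,\Sigma,\mathbb{P})$ is a probability space with an ergodic (measurable, measure preserving) dynamical system $T:\mathbb{R}^d\times\Omega\to\Omega$: $T(y+y')\omega=T(y)T(y')\omega$, and every $T$-invariant subset of $\Omega$ has probability $0$ or $1$. $A:\mathbb{R}^d\times\Omega\to\mathbb{R}^{d\times d}_{sym}$ satisfies, for constants $c_1,c_2>0$, $c_1|\xi|^2\le A(x,\omega)\xi\cdot\xi$ and $A(x,\omega)\xi\cdot\zeta\le c_2|\xi||\zeta|$ for all $\xi,\zeta\in\mathbb{R}^d$ and a.a. $x\in D$, $\omega\in\Omega$;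 moreover $A\in C(\bar D,L^\infty(\Omega))^{d\times d}$. $\partial=(\partial_1,\dots,\partial_d)$, where $\partial_i$ is the $L^2(\Omega)$-generator of the group of shifts $\phi\mapsto\phi(T(te^i)\cdot)$, $t\in\mathbb R$, with $e^i$ the $i$th standard basis vector. $L^2_{pot}(\Omega)$ is the closure in $L^2(\Omega)^d$ of $\{\partial\psi\}$ with $\psi$ in the domain of $\partial$; $L^2_{sol}(\Omega)$ is the closure in $L^2(\Omega)^d$ of the vector functions $\psi$ with components in the domain of $\partial$ and $\sum_i\partial_i\psi_i=0$. For each $x$, $w^i(x,\cdot)\in L^2_{pot}(\Omega)$ is the solution of the cell problem $A(x,\cdot)(w^i(x,\cdot)+e^i)\in L^2_{sol}(\Omega)$. The homogenized coefficient is $A^0_{ij}(x)=\int_\Omega A_{ik}(x,\omega)(w^j_k(x,\omega)+\delta_{kj})\,\mathbb{P}(d\omega)$ (repeated indices are summed). $Y^\rho=(-\rho,\rho)^d$, and $V_1^\rho=L^2(D,H^1_0(Y^\rho))$. *)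

theory Defs
  imports "HOL-Probability.Probability"
begin

subsection \<open>Lebesgue spaces\<close>

text \<open>Elements of the function spaces below are represented by functions (not by equivalence
  classes); all norms and integrals are insensitive to changes on null sets.\<close>

definition L2 :: "'a measure \<Rightarrow> ('a \<Rightarrow> 'b::euclidean_space) set" where
  "L2 M = {f \<in> borel_measurable M. integrable M (\<lambda>x. (norm (f x))\<^sup>2)}"

definition L2norm :: "'a measure \<Rightarrow> ('a \<Rightarrow> 'b::euclidean_space) \<Rightarrow> real" where
  "L2norm M f = sqrt (\<integral>x. (norm (f x))\<^sup>2 \<partial>M)"

definition L2_closure :: "'a measure \<Rightarrow> ('a \<Rightarrow> 'b::euclidean_space) set \<Rightarrow> ('a \<Rightarrow> 'b) set" where
  "L2_closure M S = {f \<in> L2 M. \<forall>e>0. \<exists>g\<in>S. L2norm M (\<lambda>x. f x - g x) < e}"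

definition Linf_norm :: "'a measure \<Rightarrow> ('a \<Rightarrow> real) \<Rightarrow> ereal" where
  "Linf_norm M f = esssup M (\<lambda>x. ereal \<bar>f x\<bar>)"

definition Linf :: "'a measure \<Rightarrow> ('a \<Rightarrow> real) set" where
  "Linf M = {f \<in> borel_measurable M. Linf_norm M f < \<infinity>}"

definition continuous_Linf :: "'x::topological_space set \<Rightarrow> 'a measure \<Rightarrow> ('x \<Rightarrow> 'a \<Rightarrow> real) \<Rightarrow> bool" where
  "continuous_Linf S M a \<longleftrightarrow> (\<forall>x\<in>S. a x \<in> Linf M) \<and>
     (\<forall>x\<in>S. ((\<lambda>x'. Linf_norm M (\<lambda>\<omega>. a x' \<omega> - a x \<omega>)) \<longlongrightarrow> 0) (at x within S))"

subsection \<open>Lipschitz domains\<close>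

text \<open>Near each boundary point the domain is the strict epigraph, in the direction of a unit
  vector \<open>\<nu>\<close>, of a Lipschitz function on the hyperplane orthogonal to \<open>\<nu>\<close>.\<close>

definition lipschitz_boundary :: "'a::euclidean_space set \<Rightarrow> bool" where
  "lipschitz_boundary D \<longleftrightarrow>
     (\<forall>p\<in>frontier D. \<exists>\<nu> \<gamma> r L. norm \<nu> = 1 \<and> r > 0 \<and> L-lipschitz_on {z. z \<bullet> \<nu> = 0} \<gamma> \<and>
        D \<inter> ball p r = {x \<in> ball p r. \<gamma> (x - (x \<bullet> \<nu>) *\<^sub>R \<nu>) < x \<bullet> \<nu>})"

definition bounded_lipschitz_domain :: "'a::euclidean_space set \<Rightarrow> bool" where
  "bounded_lipschitz_domain D \<longleftrightarrow>
     open D \<and> connected D \<and> D \<noteq> {} \<and> bounded D \<and> lipschitz_boundary D"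

subsection \<open>Sobolev spaces\<close>

definition pderiv_at :: "(real^'d \<Rightarrow> real) \<Rightarrow> 'd::finite \<Rightarrow> real^'d \<Rightarrow> real" where
  "pderiv_at \<phi> i x = frechet_derivative \<phi> (at x) (axis i 1)"

primrec Ck :: "nat \<Rightarrow> (real^'d::finite \<Rightarrow> real) \<Rightarrow> bool" where
  "Ck 0 \<phi> \<longleftrightarrow> continuous_on UNIV \<phi>"
| "Ck (Suc k) \<phi> \<longleftrightarrow> (\<forall>x. \<phi> differentiable (at x)) \<and> (\<forall>i. Ck k (pderiv_at \<phi> i))"

definition test_functions :: "(real^'d::finite) set \<Rightarrow> (real^'d \<Rightarrow> real) set" where
  "test_functions D =
     {\<phi>. (\<forall>k. Ck k \<phi>) \<and> compact (closure {x. \<phi> x \<noteq> 0}) \<and> closure {x. \<phi> x \<noteq> 0} \<subseteq> D}"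

definition has_weak_gradient ::
    "(real^'d::finite) set \<Rightarrow> (real^'d \<Rightarrow> real) \<Rightarrow> (real^'d \<Rightarrow> real^'d) \<Rightarrow> bool" where
  "has_weak_gradient D v g \<longleftrightarrow> v \<in> L2 (lebesgue_on D) \<and> g \<in> L2 (lebesgue_on D) \<and>
     (\<forall>\<phi>\<in>test_functions D. \<forall>i.
        (\<integral>x. v x * pderiv_at \<phi> i x \<partial>lebesgue_on D) = - (\<integral>x. g x $ i * \<phi> x \<partial>lebesgue_on D))"

definition wgrad :: "(real^'d::finite) set \<Rightarrow> (real^'d \<Rightarrow> real) \<Rightarrow> real^'d \<Rightarrow> real^'d" where
  "wgrad D v = (SOME g. has_weak_gradient D v g)"

definition H1 :: "(real^'d::finite) set \<Rightarrow> (real^'d \<Rightarrow> real) set" where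
  "H1 D = {v. \<exists>g. has_weak_gradient D v g}"

definition H1_norm :: "(real^'d::finite) set \<Rightarrow> (real^'d \<Rightarrow> real) \<Rightarrow> real" where
  "H1_norm D v = sqrt ((L2norm (lebesgue_on D) v)\<^sup>2 + (L2norm (lebesgue_on D) (wgrad D v))\<^sup>2)"

definition H10 :: "(real^'d::finite) set \<Rightarrow> (real^'d \<Rightarrow> real) set" where
  "H10 D = {v \<in> H1 D. \<forall>e>0. \<exists>\<phi>\<in>test_functions D. H1_norm D (\<lambda>x. v x - \<phi> x) < e}"

definition V_norm :: "(real^'d::finite) set \<Rightarrow> (real^'d \<Rightarrow> real) \<Rightarrow> real" where
  "V_norm D v = L2norm (lebesgue_on D) (wgrad D v)"

text \<open>Bounded linear functionals on \<open>H10 D\<close>; linearity and boundedness force \<open>f\<close> to agree on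
  functions that are equal almost everywhere in \<open>D\<close>.\<close>

definition in_V_dual :: "(real^'d::finite) set \<Rightarrow> ((real^'d \<Rightarrow> real) \<Rightarrow> real) \<Rightarrow> bool" where
  "in_V_dual D f \<longleftrightarrow>
     (\<forall>u\<in>H10 D. \<forall>v\<in>H10 D. f (\<lambda>x. u x + v x) = f u + f v) \<and>
     (\<forall>c. \<forall>v\<in>H10 D. f (\<lambda>x. c * v x) = c * f v) \<and>
     (\<exists>C. \<forall>v\<in>H10 D. \<bar>f v\<bar> \<le> C * V_norm D v)"

text \<open>The Bochner space of square integrable functions on \<open>D\<close> with values in \<open>H10 Y\<close>: strong
  measurability means almost everywhere approximability by simple functions.\<close>

definition L2_H10 ::
    "(real^'d::finite) set \<Rightarrow> (real^'d) set \<Rightarrow> (real^'d \<Rightarrow> real^'d \<Rightarrow> real) set" where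
  "L2_H10 D Y = {u. (\<forall>x\<in>D. u x \<in> H10 Y) \<and>
     (\<exists>s::nat \<Rightarrow> real^'d \<Rightarrow> real^'d \<Rightarrow> real.
        (\<forall>n. simple_function (lebesgue_on D) (s n) \<and> s n ` D \<subseteq> H10 Y) \<and>
        (AE x in lebesgue_on D. (\<lambda>n. V_norm Y (\<lambda>y. u x y - s n x y)) \<longlonglongrightarrow> 0)) \<and>
     integrable (lebesgue_on D) (\<lambda>x. (V_norm Y (u x))\<^sup>2)}"

subsection \<open>Ergodic dynamical systems and the stochastic derivative\<close>

definition ergodic_system :: "'w measure \<Rightarrow> (real^'d::finite \<Rightarrow> 'w \<Rightarrow> 'w) \<Rightarrow> bool" where
  "ergodic_system M T \<longleftrightarrow>
     (\<lambda>(y, \<omega>). T y \<omega>) \<in> measurable (borel \<Otimes>\<^sub>M M) M \<and>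
     (\<forall>y y'. \<forall>\<omega>\<in>space M. T (y + y') \<omega> = T y (T y' \<omega>)) \<and>
     (\<forall>y. distr M M (T y) = M) \<and>
     (\<forall>B\<in>sets M. (\<forall>y. T y -` B \<inter> space M = B) \<longrightarrow> measure M B = 0 \<or> measure M B = 1)"

definition has_shift_deriv ::
    "'w measure \<Rightarrow> (real^'d::finite \<Rightarrow> 'w \<Rightarrow> 'w) \<Rightarrow> 'd \<Rightarrow> ('w \<Rightarrow> real) \<Rightarrow> ('w \<Rightarrow> real) \<Rightarrow> bool" where
  "has_shift_deriv M T i \<phi> g \<longleftrightarrow> \<phi> \<in> L2 M \<and> g \<in> L2 M \<and>
     ((\<lambda>t. L2norm M (\<lambda>\<omega>. (\<phi> (T (t *\<^sub>R axis i 1) \<omega>) - \<phi> \<omega>) / t - g \<omega>)) \<longlongrightarrow> 0) (at 0)"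

definition dom_shift :: "'w measure \<Rightarrow> (real^'d::finite \<Rightarrow> 'w \<Rightarrow> 'w) \<Rightarrow> ('w \<Rightarrow> real) set" where
  "dom_shift M T = {\<phi>. \<forall>i. \<exists>g. has_shift_deriv M T i \<phi> g}"

definition shift_deriv ::
    "'w measure \<Rightarrow> (real^'d::finite \<Rightarrow> 'w \<Rightarrow> 'w) \<Rightarrow> 'd \<Rightarrow> ('w \<Rightarrow> real) \<Rightarrow> 'w \<Rightarrow> real" where
  "shift_deriv M T i \<phi> = (SOME g. has_shift_deriv M T i \<phi> g)"

definition L2_pot :: "'w measure \<Rightarrow> (real^'d::finite \<Rightarrow> 'w \<Rightarrow> 'w) \<Rightarrow> ('w \<Rightarrow> real^'d) set" where
  "L2_pot M T =
     L2_closure M ((\<lambda>\<psi> \<omega>. \<chi> i. shift_deriv M T i \<psi> \<omega>) ` dom_shift M T)"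

definition L2_sol :: "'w measure \<Rightarrow> (real^'d::finite \<Rightarrow> 'w \<Rightarrow> 'w) \<Rightarrow> ('w \<Rightarrow> real^'d) set" where
  "L2_sol M T =
     L2_closure M {\<psi>. (\<forall>i. (\<lambda>\<omega>. \<psi> \<omega> $ i) \<in> dom_shift M T) \<and>
       (AE \<omega> in M. (\<Sum>i\<in>UNIV. shift_deriv M T i (\<lambda>\<omega>'. \<psi> \<omega>' $ i) \<omega>) = 0)}"

subsection \<open>The coefficient and the two homogenized problems\<close>

text \<open>Joint measurability is implicit in an almost everywhere condition over \<open>x\<close> and \<open>\<omega>\<close>; it is
  also what makes \<open>(x, y) \<mapsto> A x (T y \<omega>)\<close> meaningful for almost every \<open>\<omega>\<close>.\<close>

definition admissible_coefficient ::
    "(real^'d::finite) set \<Rightarrow> 'w measure \<Rightarrow> real \<Rightarrow> real \<Rightarrow> (real^'d \<Rightarrow> 'w \<Rightarrow> real^'d^'d) \<Rightarrow> bool" where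
  "admissible_coefficient D M c1 c2 A \<longleftrightarrow>
     (\<lambda>(x, \<omega>). A x \<omega>) \<in> borel_measurable (borel \<Otimes>\<^sub>M M) \<and>
     (\<forall>x. \<forall>\<omega>\<in>space M. transpose (A x \<omega>) = A x \<omega>) \<and>
     (\<forall>\<xi> \<zeta>. AE (x, \<omega>) in lebesgue_on D \<Otimes>\<^sub>M M.
        c1 * (norm \<xi>)\<^sup>2 \<le> (A x \<omega> *v \<xi>) \<bullet> \<xi> \<and> (A x \<omega> *v \<xi>) \<bullet> \<zeta> \<le> c2 * norm \<xi> * norm \<zeta>) \<and>
     (\<forall>i j. continuous_Linf (closure D) M (\<lambda>x \<omega>. A x \<omega> $ i $ j))"

definition cell_solution ::
    "'w measure \<Rightarrow> (real^'d::finite \<Rightarrow> 'w \<Rightarrow> 'w) \<Rightarrow> ('w \<Rightarrow> real^'d^'d) \<Rightarrow> 'd \<Rightarrow> ('w \<Rightarrow> real^'d) \<Rightarrow> bool" where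
  "cell_solution M T a i w \<longleftrightarrow>
     w \<in> L2_pot M T \<and> (\<lambda>\<omega>. a \<omega> *v (w \<omega> + axis i 1)) \<in> L2_sol M T"

definition homogenized_coefficient ::
    "'w measure \<Rightarrow> (real^'d \<Rightarrow> 'w \<Rightarrow> real^'d^'d) \<Rightarrow> ('d::finite \<Rightarrow> real^'d \<Rightarrow> 'w \<Rightarrow> real^'d) \<Rightarrow>
      real^'d \<Rightarrow> real^'d^'d" where
  "homogenized_coefficient M A w x =
     (\<chi> i j. \<integral>\<omega>. (\<Sum>k\<in>UNIV. A x \<omega> $ i $ k * (w j x \<omega> $ k + (if k = j then 1 else 0))) \<partial>M)"

definition homogenized_solution ::
    "(real^'d::finite) set \<Rightarrow> (real^'d \<Rightarrow> real^'d^'d) \<Rightarrow> ((real^'d \<Rightarrow> real) \<Rightarrow> real) \<Rightarrow>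
      (real^'d \<Rightarrow> real) \<Rightarrow> bool" where
  "homogenized_solution D A0 f u \<longleftrightarrow> u \<in> H10 D \<and>
     (\<forall>\<phi>\<in>H10 D. (\<integral>x. (A0 x *v wgrad D u x) \<bullet> wgrad D \<phi> x \<partial>lebesgue_on D) = f \<phi>)"

definition cube :: "real \<Rightarrow> (real^'d::finite) set" where
  "cube \<rho> = {y. \<forall>i. - \<rho> < y $ i \<and> y $ i < \<rho>}"

definition truncated_solution ::
    "(real^'d::finite) set \<Rightarrow> (real^'d \<Rightarrow> 'w \<Rightarrow> 'w) \<Rightarrow> (real^'d \<Rightarrow> 'w \<Rightarrow> real^'d^'d) \<Rightarrow>
      ((real^'d \<Rightarrow> real) \<Rightarrow> real) \<Rightarrow> real \<Rightarrow> 'w \<Rightarrow>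
      (real^'d \<Rightarrow> real) \<Rightarrow> (real^'d \<Rightarrow> real^'d \<Rightarrow> real) \<Rightarrow> bool" where
  "truncated_solution D T A f \<rho> \<omega> u0 u1 \<longleftrightarrow>
     u0 \<in> H10 D \<and> u1 \<in> L2_H10 D (cube \<rho>) \<and>
     (\<forall>\<phi>0\<in>H10 D. \<forall>\<phi>1\<in>L2_H10 D (cube \<rho>).
        1 / measure lebesgue (cube \<rho> :: (real^'d) set) *
        (\<integral>x. (\<integral>y. (A x (T y \<omega>) *v (wgrad D u0 x + wgrad (cube \<rho>) (u1 x) y)) \<bullet>
                   (wgrad D \<phi>0 x + wgrad (cube \<rho>) (\<phi>1 x) y) \<partial>lebesgue_on (cube \<rho>))
          \<partial>lebesgue_on D) = f \<phi>0)"

end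

theory Submission
  imports Defs "HOL-Computational_Algebra.Polynomial" "HOL-Real_Asymp.Real_Asymp"
begin

text \<open>
  By the pointwise ergodic theorem, along almost every orbit the flux \<open>A(x)(w\<^sup>j(x) + e\<^sup>j)\<close>, which is
  divergence free there, has averages over \<open>Y\<^sup>\<rho>\<close> converging to \<open>A\<^sup>0(x) e\<^sup>j\<close>, and the potential field
  \<open>w\<^sup>j(x)\<close> is approximated by gradients of functions in \<open>H\<^sup>1\<^sub>0(Y\<^sup>\<rho>)\<close> up to an error \<open>o(sqrt |Y\<^sup>\<rho>|)\<close>: approximate
  it by the gradient of a smooth stationary field and cut off near the boundary of the cube. Continuity of \<open>A\<close> in \<open>x\<close> with
  values in essentially bounded functions reduces all \<open>x\<close> to finitely many, so that one null set suffices. Inserting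
  these correctors into the truncated problem and using ellipticity bounds the gradient of
  \<open>u\<^sub>0 - u\<^sub>0\<^sup>\<rho>\<close> by a small multiple of that of \<open>u\<^sub>0\<close>.
\<close>

subsection \<open>Square integrable functions\<close>

text \<open>The correctors \<open>v j (\<kappa> x)\<close> enter multiplied by the components of the
  gradient of \<open>u0\<close> at \<open>x\<close>, which are merely square integrable; this is
  admissible because \<open>L2_H10 D Y\<close> asks for no derivative in \<open>x\<close>. Tested
  with \<open>h + wgrad Y \<phi>\<close>, the exact flux sees only the constant \<open>h\<close>,
  since it is divergence free and \<open>\<phi>\<close> vanishes on the boundary of the cube. What
  remains is the error of the cut-off corrector, the fluctuation of the flux average and the error
  of freezing the coefficient, all absorbed by ellipticity. The resulting inequality is linear in
  the tolerance \<open>e\<close>; no compactness or weak limit of solutions enters.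

  The obstacle is the bookkeeping of null sets. They depend on points, test vectors and tolerances,
  so only countably many of these may be used, whereas \<rho> and the competing solutions range over
  uncountable sets and must be handled on one fixed orbit. Averages are therefore first shown to
  converge along integer radii, and then along real ones by monotonicity of integrals of nonnegative
  functions over growing cubes.\<close>

lemma L2D:
  assumes "f \<in> L2 M"
  shows "f \<in> borel_measurable M" "integrable M (\<lambda>x. (norm (f x))\<^sup>2)"
  using assms by (auto simp: L2_def)

lemma L2norm_nonneg [simp]: "0 \<le> L2norm M f"
  by (simp add: L2norm_def)

lemma L2norm_sq: "(L2norm M f)\<^sup>2 = (LINT x|M. (norm (f x))\<^sup>2)"
  by (simp add: L2norm_def)

lemma L2norm_cong_AE:
  assumes "f \<in> borel_measurable M" "g \<in> borel_measurable M" "AE x in M. f x = g x"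
  shows "L2norm M f = L2norm M g"
  unfolding L2norm_def
  by (intro arg_cong[of _ _ sqrt] integral_cong_AE) (use assms in \<open>auto elim: eventually_mono\<close>)

lemma L2_cong_AE:
  assumes "f \<in> L2 M" "g \<in> borel_measurable M" "AE x in M. f x = g x"
  shows "g \<in> L2 M"
proof -
  have "integrable M (\<lambda>x. (norm (g x))\<^sup>2)"
    by (rule integrable_cong_AE_imp[OF L2D(2)[OF assms(1)]])
      (use assms in \<open>auto elim: eventually_mono\<close>)
  then show ?thesis using assms by (auto simp: L2_def)
qed

lemma L2_dominated:
  fixes f :: "'a \<Rightarrow> 'b::euclidean_space" and g :: "'a \<Rightarrow> 'c::euclidean_space"
  assumes "g \<in> L2 M" "f \<in> borel_measurable M" "AE x in M. norm (f x) \<le> C * norm (g x)"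
  shows "f \<in> L2 M"
proof -
  note [measurable] = L2D(1)[OF assms(1)] assms(2)
  have "integrable M (\<lambda>x. C\<^sup>2 * (norm (g x))\<^sup>2)"
    using L2D(2)[OF assms(1)] by simp
  then have "integrable M (\<lambda>x. (norm (f x))\<^sup>2)"
  proof (rule Bochner_Integration.integrable_bound)
    show "AE x in M. norm ((norm (f x))\<^sup>2) \<le> norm (C\<^sup>2 * (norm (g x))\<^sup>2)"
      using assms(3)
    proof (rule eventually_mono)
      fix x assume "norm (f x) \<le> C * norm (g x)"
      then have "(norm (f x))\<^sup>2 \<le> (C * norm (g x))\<^sup>2"
        by (intro power_mono) auto
      then show "norm ((norm (f x))\<^sup>2) \<le> norm (C\<^sup>2 * (norm (g x))\<^sup>2)"
        by (simp add: power_mult_distrib)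
    qed
  qed simp
  then show ?thesis using assms by (auto simp: L2_def)
qed

lemma L2_scaleR: "f \<in> L2 M \<Longrightarrow> (\<lambda>x. c *\<^sub>R f x) \<in> L2 M"
  by (rule L2_dominated[where C="\<bar>c\<bar>" and g=f]) (auto dest: L2D)

lemma L2_mult: "f \<in> L2 M \<Longrightarrow> (\<lambda>x. c * f x :: real) \<in> L2 M"
  using L2_scaleR[of f M c] by simp

lemma L2_minus: "f \<in> L2 M \<Longrightarrow> (\<lambda>x. - f x) \<in> L2 M"
  using L2_scaleR[of f M "-1"] by simp

lemma L2_zero [simp]: "(\<lambda>x. 0) \<in> L2 M"
  by (simp add: L2_def)

lemma norm_add_sq_le:
  fixes a b :: "'a::real_inner"
  shows "(norm (a + b))\<^sup>2 \<le> 2 * (norm a)\<^sup>2 + 2 * (norm b)\<^sup>2"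
proof -
  have "(norm (a + b))\<^sup>2 + (norm (a - b))\<^sup>2 = 2 * (norm a)\<^sup>2 + 2 * (norm b)\<^sup>2"
    by (simp add: power2_norm_eq_inner inner_add inner_diff inner_commute algebra_simps)
  then show ?thesis by (smt (verit) zero_le_power2)
qed

lemma L2_add:
  assumes "f \<in> L2 M" "g \<in> L2 M"
  shows "(\<lambda>x. f x + g x) \<in> L2 M"
proof -
  note [measurable] = L2D(1)[OF assms(1)] L2D(1)[OF assms(2)]
  have "integrable M (\<lambda>x. 2 * (norm (f x))\<^sup>2 + 2 * (norm (g x))\<^sup>2)"
    using L2D(2)[OF assms(1)] L2D(2)[OF assms(2)] by simp
  then have "integrable M (\<lambda>x. (norm (f x + g x))\<^sup>2)"
    by (rule Bochner_Integration.integrable_bound) (auto intro!: AE_I2 norm_add_sq_le)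
  then show ?thesis by (auto simp: L2_def)
qed

lemma L2_diff:
  assumes "f \<in> L2 M" "g \<in> L2 M"
  shows "(\<lambda>x. f x - g x) \<in> L2 M"
  using L2_add[OF assms(1) L2_minus[OF assms(2)]] by simp

lemma L2_sum:
  assumes "\<And>i. i \<in> I \<Longrightarrow> f i \<in> L2 M"
  shows "(\<lambda>x. \<Sum>i\<in>I. f i x) \<in> L2 M"
  using assms by (induction I rule: infinite_finite_induct) (auto intro: L2_add)

lemma borel_measurable_nth' [measurable (raw)]:
  fixes f :: "'a \<Rightarrow> 'b::euclidean_space^'n::finite"
  assumes "f \<in> borel_measurable M"
  shows "(\<lambda>x. f x $ i) \<in> borel_measurable M"
  by (rule borel_measurable_continuous_on[OF _ assms]) (intro continuous_intros)

lemma L2_component: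
  fixes f :: "'a \<Rightarrow> real^'n::finite"
  shows "f \<in> L2 M \<Longrightarrow> (\<lambda>x. f x $ i) \<in> L2 M"
  by (rule L2_dominated[where C=1 and g=f])
     (auto simp: component_le_norm_cart dest!: L2D(1) intro!: borel_measurable_nth')

lemma borel_measurable_vec_lambda [measurable (raw)]:
  fixes f :: "'n::finite \<Rightarrow> 'a \<Rightarrow> real"
  assumes "\<And>i. f i \<in> borel_measurable M"
  shows "(\<lambda>x. \<chi> i. f i x) \<in> borel_measurable M"
proof -
  have "(\<lambda>x. \<chi> i. f i x) = (\<lambda>x. \<Sum>i\<in>UNIV. f i x *\<^sub>R axis i 1)"
    by (auto simp: vec_eq_iff axis_def if_distrib cong: if_cong)
  then show ?thesis using assms by simp
qed

lemma L2_vec: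
  fixes f :: "'n::finite \<Rightarrow> 'a \<Rightarrow> real"
  assumes "\<And>i. f i \<in> L2 M"
  shows "(\<lambda>x. \<chi> i. f i x) \<in> L2 M"
proof -
  have *: "(norm (\<chi> i. f i x))\<^sup>2 = (\<Sum>i\<in>UNIV. (norm (f i x))\<^sup>2)" for x
    by (simp only: power2_norm_eq_inner inner_vec_def vec_lambda_beta)
  show ?thesis using assms
    by (auto simp: L2_def * simp del: real_norm_def intro!: borel_measurable_vec_lambda)
qed

lemma integrable_norm_mult:
  assumes "f \<in> L2 M" "g \<in> L2 M"
  shows "integrable M (\<lambda>x. norm (f x) * norm (g x))"
proof -
  note [measurable] = L2D(1)[OF assms(1)] L2D(1)[OF assms(2)]
  have "integrable M (\<lambda>x. (norm (f x))\<^sup>2 + (norm (g x))\<^sup>2)"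
    using L2D(2)[OF assms(1)] L2D(2)[OF assms(2)] by simp
  then show ?thesis
  proof (rule Bochner_Integration.integrable_bound)
    show "AE x in M. norm (norm (f x) * norm (g x)) \<le> norm ((norm (f x))\<^sup>2 + (norm (g x))\<^sup>2)"
    proof (rule AE_I2)
      fix x
      have "0 \<le> (norm (f x) - norm (g x))\<^sup>2" by simp
      then have "2 * (norm (f x) * norm (g x)) \<le> (norm (f x))\<^sup>2 + (norm (g x))\<^sup>2"
        by (simp add: power2_eq_square algebra_simps)
      moreover have "0 \<le> norm (f x) * norm (g x)" by simp
      ultimately show "norm (norm (f x) * norm (g x)) \<le> norm ((norm (f x))\<^sup>2 + (norm (g x))\<^sup>2)"
        by (smt (verit) real_norm_def)
    qed
  qed simp
qed

lemma L2_Cauchy_Schwarz_norm: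
  assumes "f \<in> L2 M" "g \<in> L2 M"
  shows "(LINT x|M. norm (f x) * norm (g x)) \<le> L2norm M f * L2norm M g"
proof -
  note i = L2D(2)[OF assms(1)] L2D(2)[OF assms(2)] integrable_norm_mult[OF assms]
  define a b c where "a = (LINT x|M. (norm (f x))\<^sup>2)" and "b = (LINT x|M. (norm (g x))\<^sup>2)"
    and "c = (LINT x|M. norm (f x) * norm (g x))"
  have nn: "0 \<le> a" "0 \<le> b" "0 \<le> c" by (auto simp: a_def b_def c_def)
  \<comment> \<open>A nonnegative quadratic form in \<open>s\<close> and \<open>t\<close>. Taking
    \<open>s = c\<close>, \<open>t = a\<close> gives \<open>a * (a * b - c^2) \<ge> 0\<close>; for
    \<open>a = 0\<close> and \<open>t = 1\<close> the form is affine in \<open>s\<close>, which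
    forces \<open>c = 0\<close>.\<close>
  have q: "0 \<le> s\<^sup>2 * a - 2 * s * t * c + t\<^sup>2 * b" for s t
  proof -
    have "0 \<le> (LINT x|M. (s * norm (f x) - t * norm (g x))\<^sup>2)" by simp
    also have "\<dots> = (LINT x|M. s\<^sup>2 * (norm (f x))\<^sup>2 - 2 * s * t * (norm (f x) * norm (g x)) + t\<^sup>2 * (norm (g x))\<^sup>2)"
      by (simp add: power2_eq_square algebra_simps)
    also have "\<dots> = s\<^sup>2 * a - 2 * s * t * c + t\<^sup>2 * b"
      using i by (simp add: a_def b_def c_def)
    finally show ?thesis .
  qed
  have "c\<^sup>2 \<le> a * b"
  proof (cases "a = 0")
    case False
    then have "a > 0" using nn by simp
    have "0 \<le> a * (a * b - c\<^sup>2)" using q[of c a] by (simp add: power2_eq_square algebra_simps)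
    then show ?thesis using \<open>a > 0\<close> by (simp add: zero_le_mult_iff)
  next
    case True
    have "2 * c * s \<le> b" for s using q[of s 1] True by (simp add: mult_ac)
    from this[of "(b+1)/(2*c)"] nn have "c = 0" by (cases "c = 0") auto
    then show ?thesis using True by simp
  qed
  then have "sqrt (c\<^sup>2) \<le> sqrt (a * b)" by (rule real_sqrt_le_mono)
  then show ?thesis using nn by (simp add: L2norm_def a_def b_def c_def real_sqrt_mult)
qed

lemma L2_integrable_inner:
  assumes "f \<in> L2 M" "g \<in> L2 M"
  shows "integrable M (\<lambda>x. f x \<bullet> g x)"
  by (rule Bochner_Integration.integrable_bound[OF integrable_norm_mult[OF assms]])
     (use L2D(1)[OF assms(1)] L2D(1)[OF assms(2)] in \<open>auto intro!: AE_I2 Cauchy_Schwarz_ineq2\<close>)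

lemma L2_Cauchy_Schwarz:
  assumes "f \<in> L2 M" "g \<in> L2 M"
  shows "\<bar>LINT x|M. f x \<bullet> g x\<bar> \<le> L2norm M f * L2norm M g"
proof -
  have "\<bar>LINT x|M. f x \<bullet> g x\<bar> \<le> (LINT x|M. \<bar>f x \<bullet> g x\<bar>)"
    using integral_norm_bound[of M "\<lambda>x. f x \<bullet> g x"] by simp
  also have "\<dots> \<le> (LINT x|M. norm (f x) * norm (g x))"
    by (intro integral_mono integrable_abs L2_integrable_inner integrable_norm_mult assms Cauchy_Schwarz_ineq2)
  finally have "\<bar>LINT x|M. f x \<bullet> g x\<bar> \<le> (LINT x|M. norm (f x) * norm (g x))" .
  then show ?thesis using L2_Cauchy_Schwarz_norm[OF assms] by linarith
qed

lemma L2norm_scaleR: "L2norm M (\<lambda>x. c *\<^sub>R f x) = \<bar>c\<bar> * L2norm M f"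
  by (simp add: L2norm_def power_mult_distrib real_sqrt_mult)

lemma L2norm_minus: "L2norm M (\<lambda>x. - f x) = L2norm M f"
  by (simp add: L2norm_def)

lemma L2norm_diff_commute: "L2norm M (\<lambda>x. f x - g x) = L2norm M (\<lambda>x. g x - f x)"
  by (simp add: L2norm_def norm_minus_commute)

lemma L2norm_triangle:
  assumes "f \<in> L2 M" "g \<in> L2 M"
  shows "L2norm M (\<lambda>x. f x + g x) \<le> L2norm M f + L2norm M g"
proof -
  have "(L2norm M (\<lambda>x. f x + g x))\<^sup>2 = (LINT x|M. (norm (f x))\<^sup>2 + 2 * (f x \<bullet> g x) + (norm (g x))\<^sup>2)"
    unfolding L2norm_sq
    by (simp add: power2_norm_eq_inner inner_add inner_commute algebra_simps)
  also have "\<dots> = (L2norm M f)\<^sup>2 + 2 * (LINT x|M. f x \<bullet> g x) + (L2norm M g)\<^sup>2"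
    using L2D(2)[OF assms(1)] L2D(2)[OF assms(2)] L2_integrable_inner[OF assms]
    by (simp add: L2norm_sq)
  also have "\<dots> \<le> (L2norm M f + L2norm M g)\<^sup>2"
    using L2_Cauchy_Schwarz[OF assms] by (simp add: power2_eq_square algebra_simps)
  finally show ?thesis by (rule power2_le_imp_le) simp
qed

lemma L2norm_triangle_diff:
  assumes "f \<in> L2 M" "g \<in> L2 M"
  shows "L2norm M (\<lambda>x. f x - g x) \<le> L2norm M f + L2norm M g"
  using L2norm_triangle[OF assms(1) L2_minus[OF assms(2)]] by (simp add: L2norm_minus)

lemma L2norm_triangle3:
  assumes "f \<in> L2 M" "g \<in> L2 M" "h \<in> L2 M"
  shows "L2norm M (\<lambda>x. f x - h x) \<le> L2norm M (\<lambda>x. f x - g x) + L2norm M (\<lambda>x. g x - h x)"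
  using L2norm_triangle[OF L2_diff[OF assms(1,2)] L2_diff[OF assms(2,3)]] by simp

lemma L2norm_mono:
  fixes f :: "'a \<Rightarrow> 'b::euclidean_space" and g :: "'a \<Rightarrow> 'c::euclidean_space"
  assumes "g \<in> L2 M" "f \<in> borel_measurable M" "AE x in M. norm (f x) \<le> C * norm (g x)" "C \<ge> 0"
  shows "L2norm M f \<le> C * L2norm M g"
proof -
  have "f \<in> L2 M" by (rule L2_dominated[OF assms(1-3)])
  have "(LINT x|M. (norm (f x))\<^sup>2) \<le> (LINT x|M. C\<^sup>2 * (norm (g x))\<^sup>2)"
  proof (rule integral_mono_AE)
    show "AE x in M. (norm (f x))\<^sup>2 \<le> C\<^sup>2 * (norm (g x))\<^sup>2"
      using assms(3) by (rule eventually_mono) (metis norm_ge_zero power_mono power_mult_distrib)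
  qed (use L2D(2)[OF \<open>f \<in> L2 M\<close>] L2D(2)[OF assms(1)] in auto)
  then have "(L2norm M f)\<^sup>2 \<le> (C * L2norm M g)\<^sup>2"
    by (simp add: L2norm_sq power_mult_distrib)
  then show ?thesis by (rule power2_le_imp_le) (use assms(4) in simp)
qed

lemma L2norm_sum:
  assumes "\<And>i. i \<in> I \<Longrightarrow> f i \<in> L2 M"
  shows "L2norm M (\<lambda>x. \<Sum>i\<in>I. f i x) \<le> (\<Sum>i\<in>I. L2norm M (f i))"
  using assms
proof (induction I rule: infinite_finite_induct)
  case (insert i I)
  have "L2norm M (\<lambda>x. f i x + (\<Sum>i\<in>I. f i x)) \<le> L2norm M (f i) + L2norm M (\<lambda>x. \<Sum>i\<in>I. f i x)"
    using insert by (intro L2norm_triangle L2_sum) auto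
  also have "\<dots> \<le> L2norm M (f i) + (\<Sum>i\<in>I. L2norm M (f i))" using insert by auto
  finally show ?case using insert by simp
qed (auto simp: L2norm_def)

lemma (in finite_measure) L2_const [simp]: "(\<lambda>x. c) \<in> L2 M"
  by (simp add: L2_def)

lemma (in finite_measure) L2_imp_integrable:
  assumes "f \<in> L2 M"
  shows "integrable M f"
proof -
  have "integrable M (\<lambda>x. norm (f x) * norm (1::real))"
    by (rule integrable_norm_mult[OF assms L2_const])
  then show ?thesis using L2D(1)[OF assms] by (simp add: integrable_norm_iff)
qed

lemma (in prob_space) integral_norm_le_L2norm:
  assumes "f \<in> L2 M"
  shows "(LINT x|M. norm (f x)) \<le> L2norm M f"
  using L2_Cauchy_Schwarz_norm[OF assms, of "\<lambda>x. 1::real"] 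
  by (simp add: L2norm_def prob_space)

subsection \<open>Smooth functions\<close>

text \<open>The classical gradient. It is kept apart from \<open>wgrad\<close>, which is chosen by
  \<open>SOME\<close> and is determined only up to null sets.\<close>

definition cgrad :: "(real^'d \<Rightarrow> real) \<Rightarrow> real^'d \<Rightarrow> real^'d::finite" where
  "cgrad \<phi> y = (\<chi> i. pderiv_at \<phi> i y)"

lemma cgrad_nth [simp]: "cgrad \<phi> y $ i = pderiv_at \<phi> i y"
  by (simp add: cgrad_def)

lemma pderiv_atI:
  assumes "(\<phi> has_derivative \<phi>') (at x)"
  shows "pderiv_at \<phi> i x = \<phi>' (axis i 1)"
  using frechet_derivative_at[OF assms] by (simp add: pderiv_at_def)

lemma has_derivative_cgrad:
  fixes \<phi> :: "real^'d::finite \<Rightarrow> real"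
  assumes "\<phi> differentiable (at x)"
  shows "(\<phi> has_derivative (\<lambda>h. cgrad \<phi> x \<bullet> h)) (at x)"
proof -
  obtain \<phi>' where d: "(\<phi> has_derivative \<phi>') (at x)" using assms by (auto simp: differentiable_def)
  have lin: "linear \<phi>'" using d has_derivative_linear by blast
  have "\<phi>' h = cgrad \<phi> x \<bullet> h" for h
  proof -
    have "\<phi>' h = \<phi>' (\<Sum>i\<in>UNIV. (h $ i) *\<^sub>R axis i 1)"
      using basis_expansion[of h] by (simp add: scalar_mult_eq_scaleR)
    also have "\<dots> = (\<Sum>i\<in>UNIV. h $ i * \<phi>' (axis i 1))"
      by (simp add: linear_sum[OF lin] linear_scale[OF lin])
    also have "\<dots> = cgrad \<phi> x \<bullet> h"
      by (simp add: inner_vec_def pderiv_atI[OF d] mult.commute)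
    finally show ?thesis .
  qed
  then show ?thesis using d by (metis (no_types, lifting) ext)
qed

lemma differentiable_imp_continuous_on_UNIV:
  "(\<And>x. \<phi> differentiable (at x)) \<Longrightarrow> continuous_on UNIV \<phi>"
  by (simp add: continuous_on_eq_continuous_at differentiable_imp_continuous_within)

lemma Ck_continuous: "Ck k \<phi> \<Longrightarrow> continuous_on UNIV \<phi>"
  by (cases k) (use differentiable_imp_continuous_on_UNIV[of \<phi>] in auto)

lemma Ck_Suc_imp: "Ck (Suc k) \<phi> \<Longrightarrow> Ck k \<phi>"
proof (induction k arbitrary: \<phi>)
  case 0
  from Ck_continuous[OF 0] show ?case by simp
next
  case (Suc k)
  then show ?case by (metis Ck.simps(2))
qed

lemma pderiv_at_add:
  assumes "\<phi> differentiable (at x)" "\<psi> differentiable (at x)"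
  shows "pderiv_at (\<lambda>x. \<phi> x + \<psi> x) i x = pderiv_at \<phi> i x + pderiv_at \<psi> i x"
  using pderiv_atI[OF has_derivative_add[OF assms[THEN has_derivative_cgrad]], of i]
  by (simp add: inner_axis)

lemma pderiv_at_mult:
  assumes "\<phi> differentiable (at x)" "\<psi> differentiable (at x)"
  shows "pderiv_at (\<lambda>x. \<phi> x * \<psi> x) i x = \<phi> x * pderiv_at \<psi> i x + pderiv_at \<phi> i x * \<psi> x"
  using pderiv_atI[OF has_derivative_mult[OF assms[THEN has_derivative_cgrad]], of i]
  by (simp add: inner_axis)

lemma pderiv_at_const [simp]: "pderiv_at (\<lambda>x. c) i = (\<lambda>x. 0)"
  by (rule ext) (simp add: pderiv_atI[OF has_derivative_const])

lemma pderiv_at_nth: "pderiv_at (\<lambda>x::real^'d::finite. x $ j) i = (\<lambda>x. if i = j then 1 else 0)"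
proof
  fix x :: "real^'d::finite"
  have "((\<lambda>x::real^'d. x $ j) has_derivative (\<lambda>x. x $ j)) (at x)"
    by (rule bounded_linear_imp_has_derivative) (rule bounded_linear_vec_nth)
  then show "pderiv_at (\<lambda>x. x $ j) i x = (if i = j then 1 else 0)"
    by (simp add: pderiv_atI axis_def)
qed

lemma pderiv_at_affine:
  fixes \<phi> :: "real^'d::finite \<Rightarrow> real"
  assumes "\<phi> differentiable (at (c *\<^sub>R x + b))"
  shows "(\<lambda>x. \<phi> (c *\<^sub>R x + b)) differentiable (at x)"
    "pderiv_at (\<lambda>x. \<phi> (c *\<^sub>R x + b)) i x = c * pderiv_at \<phi> i (c *\<^sub>R x + b)"
proof -
  have "((\<lambda>x. c *\<^sub>R x + b) has_derivative (\<lambda>x. c *\<^sub>R x)) (at x)"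
    by (auto intro!: derivative_eq_intros)
  from has_derivative_compose[OF this has_derivative_cgrad[OF assms]]
  have d: "((\<lambda>x. \<phi> (c *\<^sub>R x + b)) has_derivative (\<lambda>h. cgrad \<phi> (c *\<^sub>R x + b) \<bullet> (c *\<^sub>R h))) (at x)" .
  then show "(\<lambda>x. \<phi> (c *\<^sub>R x + b)) differentiable (at x)" by (auto simp: differentiable_def)
  show "pderiv_at (\<lambda>x. \<phi> (c *\<^sub>R x + b)) i x = c * pderiv_at \<phi> i (c *\<^sub>R x + b)"
    using pderiv_atI[OF d, of i] by (simp add: inner_axis)
qed

lemma Ck_const [simp]: "Ck k (\<lambda>x. c)"
  by (induction k arbitrary: c) auto

lemma Ck_add: "Ck k \<phi> \<Longrightarrow> Ck k \<psi> \<Longrightarrow> Ck k (\<lambda>x. \<phi> x + \<psi> x)"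
proof (induction k arbitrary: \<phi> \<psi>)
  case (Suc k)
  then have "pderiv_at (\<lambda>x. \<phi> x + \<psi> x) i = (\<lambda>x. pderiv_at \<phi> i x + pderiv_at \<psi> i x)" for i
    by (auto intro!: ext pderiv_at_add)
  then show ?case using Suc by auto
qed (auto intro: continuous_intros)

lemma Ck_mult: "Ck k \<phi> \<Longrightarrow> Ck k \<psi> \<Longrightarrow> Ck k (\<lambda>x. \<phi> x * \<psi> x)"
proof (induction k arbitrary: \<phi> \<psi>)
  case (Suc k)
  have "pderiv_at (\<lambda>x. \<phi> x * \<psi> x) i = (\<lambda>x. \<phi> x * pderiv_at \<psi> i x + pderiv_at \<phi> i x * \<psi> x)" for i
    using Suc.prems by (auto intro!: ext pderiv_at_mult)
  moreover have "Ck k \<phi>" "Ck k \<psi>" using Suc.prems Ck_Suc_imp by blast+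
  ultimately show ?case using Suc by (auto intro!: Ck_add Suc.IH)
qed (auto intro: continuous_intros)

lemma Ck_nth: "Ck k (\<lambda>x. x $ j)"
  by (cases k) (auto simp: pderiv_at_nth intro!: continuous_intros bounded_linear_imp_differentiable bounded_linear_vec_nth)

lemma Ck_affine: "Ck k \<phi> \<Longrightarrow> Ck k (\<lambda>x. \<phi> (c *\<^sub>R x + b))"
proof (induction k arbitrary: \<phi>)
  case 0
  then show ?case by (auto intro!: continuous_intros continuous_on_compose2[of UNIV \<phi>])
next
  case (Suc k)
  have "pderiv_at (\<lambda>x. \<phi> (c *\<^sub>R x + b)) i = (\<lambda>x. c * pderiv_at \<phi> i (c *\<^sub>R x + b))" for i
    using Suc.prems by (auto intro!: ext pderiv_at_affine)
  then show ?case using Suc by (auto intro!: Ck_mult pderiv_at_affine)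
qed

text \<open>Suits convolutions: their partial derivatives are again convolutions, so one invariant
  \<open>P\<close> replaces an induction that would have to track the kernel.\<close>

lemma Ck_coinduct:
  assumes "P \<phi>" "\<And>\<phi> x. P \<phi> \<Longrightarrow> \<phi> differentiable (at x)" "\<And>\<phi> i. P \<phi> \<Longrightarrow> P (pderiv_at \<phi> i)"
  shows "Ck k \<phi>"
  using assms(1)
proof (induction k arbitrary: \<phi>)
  case 0
  then show ?case using assms(2) by (auto intro: differentiable_imp_continuous_on_UNIV)
next
  case (Suc k)
  then show ?case using assms(2,3) by auto
qed

section \<open>The smooth bump function\<close>

lemma exp_neg_poly_tendsto_0: "((\<lambda>s::real. s ^ k * poly p s * exp (- s)) \<longlongrightarrow> 0) at_top"
proof (induction p arbitrary: k)
  case (pCons a p)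
  have "((\<lambda>s. a * (s ^ k / exp s) + s ^ Suc k * poly p s * exp (- s)) \<longlongrightarrow> a * 0 + 0) at_top"
    by (intro tendsto_intros pCons.IH tendsto_power_div_exp_0)
  moreover have "(\<lambda>s. a * (s ^ k / exp s) + s ^ Suc k * poly p s * exp (- s)) =
      (\<lambda>s. s ^ k * poly (pCons a p) s * exp (- s))"
    by (auto simp: exp_minus field_simps)
  ultimately show ?case by simp
qed auto

text \<open>For \<open>p = 1\<close> this is the standard function exp(-1/t), extended by 0. The
  polynomial in 1/t makes the family closed under differentiation.\<close>

definition flat :: "real poly \<Rightarrow> real \<Rightarrow> real" where
  "flat p t = (if t > 0 then poly p (1/t) * exp (- (1/t)) else 0)"

text \<open>With s = 1/t one has d/dt = - s^2 d/ds, and the derivative of p(s) exp(-s) in s is (p' -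
  p)(s) exp(-s); \<open>[:0,0,1:]\<close> is the polynomial s^2. At 0 the difference quotient from
  the right is s p(s) exp(-s) with s growing to infinity.\<close>

lemma flat_deriv: "DERIV (flat p) t :> flat ([:0,0,1:] * (p - pderiv p)) t"
proof -
  consider "t > 0" | "t < 0" | "t = 0" by linarith
  then show ?thesis
  proof cases
    case 1
    have "DERIV (\<lambda>t. poly p (1/t) * exp (- (1/t))) t :> poly ([:0,0,1:] * (p - pderiv p)) (1/t) * exp (- (1/t))"
      using 1 by (auto intro!: derivative_eq_intros simp: field_simps power2_eq_square)
    moreover have "\<forall>\<^sub>F x in nhds t. flat p x = poly p (1/x) * exp (- (1/x))"
      using eventually_nhds_in_open[of "{0<..}" t] 1 by (auto simp: flat_def elim!: eventually_mono)
    ultimately show ?thesis using 1 by (subst DERIV_cong_ev[OF refl _ refl]) (auto simp: flat_def)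
  next
    case 2
    have "\<forall>\<^sub>F x in nhds t. flat p x = 0"
      using eventually_nhds_in_open[of "{..<0}" t] 2 by (auto simp: flat_def elim!: eventually_mono)
    then show ?thesis using 2 by (subst DERIV_cong_ev[OF refl _ refl]) (auto simp: flat_def)
  next
    case 3
    have "((\<lambda>h. flat p h / h) \<longlongrightarrow> 0) (at_left 0)"
      by (rule tendsto_eventually) (auto simp: flat_def eventually_at_filter)
    moreover have "((\<lambda>h. flat p h / h) \<longlongrightarrow> 0) (at_right 0)"
    proof -
      have "((\<lambda>h. (\<lambda>s. s ^ 1 * poly p s * exp (- s)) (inverse h)) \<longlongrightarrow> 0) (at_right 0)"
        by (rule filterlim_compose[OF exp_neg_poly_tendsto_0 filterlim_inverse_at_top_right])
      moreover have "\<forall>\<^sub>F h in at_right 0. (\<lambda>s. s ^ 1 * poly p s * exp (- s)) (inverse h) = flat p h / h"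
        by (auto simp: flat_def eventually_at_filter field_simps)
      ultimately show ?thesis by (rule Lim_transform_eventually)
    qed
    ultimately have "((\<lambda>h. flat p h / h) \<longlongrightarrow> 0) (at 0)"
      by (simp add: filterlim_split_at)
    then show ?thesis using 3 by (simp add: DERIV_def flat_def)
  qed
qed

text \<open>The chain rule only produces the factors \<open>-2 * y $ i\<close> and another
  polynomial, so the induction has to run over all \<open>p\<close> at once.\<close>

lemma Ck_flat_ball: "Ck k (\<lambda>y::real^'d::finite. flat p (1 - y \<bullet> y))"
proof (induction k arbitrary: p)
  case 0
  have "continuous_on UNIV (flat p)"
    using flat_deriv DERIV_isCont continuous_at_imp_continuous_on by blast
  then show ?case by (auto intro!: continuous_intros continuous_on_compose2[of UNIV "flat p"])
next
  case (Suc k)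
  let ?q = "[:0,0,1:] * (p - pderiv p)"
  have d: "((\<lambda>y::real^'d. flat p (1 - y \<bullet> y)) has_derivative (\<lambda>h. (- 2 * (y \<bullet> h)) * flat ?q (1 - y \<bullet> y))) (at y)" for y
  proof -
    have 1: "((\<lambda>y::real^'d. 1 - y \<bullet> y) has_derivative (\<lambda>h. - 2 * (y \<bullet> h))) (at y)"
      by (auto intro!: derivative_eq_intros simp: inner_commute)
    show ?thesis
      using has_derivative_compose[OF 1 has_field_derivative_imp_has_derivative[OF flat_deriv]]
      by (simp add: mult.commute)
  qed
  have "pderiv_at (\<lambda>y::real^'d. flat p (1 - y \<bullet> y)) i = (\<lambda>y. (-2 * y $ i) * flat ?q (1 - y \<bullet> y))" for i
    by (rule ext, subst pderiv_atI[OF d]) (simp add: inner_axis)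
  moreover have "Ck k (\<lambda>y::real^'d. (-2 * y $ i) * flat ?q (1 - y \<bullet> y))" for i
    by (intro Ck_mult Ck_const Ck_nth Suc.IH)
  moreover have "(\<lambda>y::real^'d. flat p (1 - y \<bullet> y)) differentiable (at y)" for y
    using d differentiable_def by blast
  ultimately show ?case by simp
qed

subsection \<open>Test functions\<close>

text \<open>Any compact set outside which \<open>\<phi>\<close> vanishes may serve as witness, so
  sums, products and derivatives need no computation of closures.\<close>

lemma test_functions_iff:
  "\<phi> \<in> test_functions D \<longleftrightarrow> (\<forall>k. Ck k \<phi>) \<and> (\<exists>K. compact K \<and> K \<subseteq> D \<and> (\<forall>x. x \<notin> K \<longrightarrow> \<phi> x = 0))"
proof -
  have "compact (closure {x. \<phi> x \<noteq> 0}) \<and> closure {x. \<phi> x \<noteq> 0} \<subseteq> D \<longleftrightarrow>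
     (\<exists>K. compact K \<and> K \<subseteq> D \<and> (\<forall>x. x \<notin> K \<longrightarrow> \<phi> x = 0))"
  proof
    assume "compact (closure {x. \<phi> x \<noteq> 0}) \<and> closure {x. \<phi> x \<noteq> 0} \<subseteq> D"
    moreover have "\<phi> x = 0" if "x \<notin> closure {x. \<phi> x \<noteq> 0}" for x
      using that closure_subset[of "{x. \<phi> x \<noteq> 0}"] by auto
    ultimately show "\<exists>K. compact K \<and> K \<subseteq> D \<and> (\<forall>x. x \<notin> K \<longrightarrow> \<phi> x = 0)"
      by metis
  next
    assume "\<exists>K. compact K \<and> K \<subseteq> D \<and> (\<forall>x. x \<notin> K \<longrightarrow> \<phi> x = 0)"
    then obtain K where K: "compact K" "K \<subseteq> D" "\<forall>x. x \<notin> K \<longrightarrow> \<phi> x = 0" by blast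
    then have "closure {x. \<phi> x \<noteq> 0} \<subseteq> K"
      by (intro closure_minimal compact_imp_closed) auto
    then show "compact (closure {x. \<phi> x \<noteq> 0}) \<and> closure {x. \<phi> x \<noteq> 0} \<subseteq> D"
      using K compact_Int_closed[OF K(1) closed_closure, of "{x. \<phi> x \<noteq> 0}"] by (simp add: Int_absorb1)
  qed
  then show ?thesis by (simp add: test_functions_def)
qed

lemma test_functionsD:
  assumes "\<phi> \<in> test_functions D"
  shows "Ck k \<phi>" "\<phi> differentiable (at x)" "continuous_on UNIV \<phi>" "\<phi> \<in> borel_measurable borel"
proof -
  show *: "Ck k \<phi>" for k using assms by (simp add: test_functions_def)
  show "\<phi> differentiable (at x)" using *[of 1] by simp
  show "continuous_on UNIV \<phi>" using *[of 0] by simp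
  then show "\<phi> \<in> borel_measurable borel" by (rule borel_measurable_continuous_onI)
qed

lemma test_functions_mono: "D \<subseteq> E \<Longrightarrow> test_functions D \<subseteq> test_functions E"
  by (auto simp: test_functions_def)

lemma test_functions_bounded_support:
  assumes "\<phi> \<in> test_functions D"
  obtains R where "R > 0" "\<And>x. norm x \<ge> R \<Longrightarrow> \<phi> x = 0"
proof -
  obtain K where K: "compact K" "\<forall>x. x \<notin> K \<longrightarrow> \<phi> x = 0" using assms by (auto simp: test_functions_iff)
  obtain B where B: "\<forall>x\<in>K. norm x \<le> B" using K(1) compact_imp_bounded bounded_iff by metis
  show ?thesis
  proof (rule that[of "\<bar>B\<bar> + 1"])
    show "\<phi> x = 0" if "\<bar>B\<bar> + 1 \<le> norm x" for x
    proof -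
      have "x \<notin> K"
      proof
        assume "x \<in> K"
        then have "norm x \<le> B" using B by blast
        then show False using that by linarith
      qed
      then show ?thesis using K(2) by blast
    qed
  qed simp
qed

lemma test_functions_UNIV_I:
  assumes "\<And>k. Ck k \<phi>" "\<And>x. norm x \<ge> R \<Longrightarrow> \<phi> x = 0"
  shows "\<phi> \<in> test_functions UNIV"
proof -
  have "\<phi> x = 0" if "x \<notin> cball 0 R" for x
    using that by (intro assms(2)) simp
  then show ?thesis unfolding test_functions_iff using assms(1) compact_cball by blast
qed

lemma test_functions_mult_smooth:
  assumes "\<phi> \<in> test_functions D" "\<And>k. Ck k \<psi>"
  shows "(\<lambda>x. \<psi> x * \<phi> x) \<in> test_functions D"
proof -
  obtain K where "compact K" "K \<subseteq> D" "\<forall>x. x \<notin> K \<longrightarrow> \<phi> x = 0" using assms by (auto simp: test_functions_iff)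
  moreover have "Ck k (\<lambda>x. \<psi> x * \<phi> x)" for k
    by (intro Ck_mult test_functionsD(1)[OF assms(1)] assms(2))
  ultimately show ?thesis unfolding test_functions_iff by auto
qed

lemma test_functions_cmult:
  assumes "\<phi> \<in> test_functions D"
  shows "(\<lambda>x. c * \<phi> x) \<in> test_functions D"
  using test_functions_mult_smooth[OF assms, of "\<lambda>x. c"] by simp

lemma test_functions_zero: "(\<lambda>x. 0) \<in> test_functions D"
  unfolding test_functions_iff by auto

lemma test_functions_add:
  assumes "\<phi> \<in> test_functions D" "\<psi> \<in> test_functions D"
  shows "(\<lambda>x. \<phi> x + \<psi> x) \<in> test_functions D"
proof -
  obtain K L where "compact K" "K \<subseteq> D" "\<forall>x. x \<notin> K \<longrightarrow> \<phi> x = 0" "compact L" "L \<subseteq> D" "\<forall>x. x \<notin> L \<longrightarrow> \<psi> x = 0"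
    using assms by (auto simp: test_functions_iff)
  then have "compact (K \<union> L)" "K \<union> L \<subseteq> D" "\<forall>x. x \<notin> K \<union> L \<longrightarrow> \<phi> x + \<psi> x = 0"
    by auto
  moreover have "Ck k (\<lambda>x. \<phi> x + \<psi> x)" for k
    by (intro Ck_add test_functionsD(1)[OF assms(1)] test_functionsD(1)[OF assms(2)])
  ultimately show ?thesis unfolding test_functions_iff by blast
qed

lemma pderiv_at_test_functions:
  assumes "\<phi> \<in> test_functions D"
  shows "pderiv_at \<phi> i \<in> test_functions D"
proof -
  obtain K where K: "compact K" "K \<subseteq> D" "\<forall>x. x \<notin> K \<longrightarrow> \<phi> x = 0" using assms by (auto simp: test_functions_iff)
  have "pderiv_at \<phi> i x = 0" if "x \<notin> K" for x
  proof -
    have "(\<phi> has_derivative (\<lambda>h. 0)) (at x)"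
      by (rule has_derivative_transform_within_open[of "\<lambda>x. 0" _ _ _ "- K"])
        (use that K in \<open>auto simp: compact_imp_closed\<close>)
    then show ?thesis by (simp add: pderiv_atI)
  qed
  moreover have "Ck k (pderiv_at \<phi> i)" for k
    using test_functionsD(1)[OF assms, of "Suc k"] by simp
  ultimately show ?thesis using K unfolding test_functions_iff by blast
qed

lemma test_functions_affine:
  assumes "\<phi> \<in> test_functions UNIV" "c \<noteq> 0"
  shows "(\<lambda>x. \<phi> (c *\<^sub>R x + b)) \<in> test_functions UNIV"
proof -
  obtain R where R: "\<And>x. norm x \<ge> R \<Longrightarrow> \<phi> x = 0" using test_functions_bounded_support[OF assms(1)] by metis
  have "\<phi> (c *\<^sub>R x + b) = 0" if "norm x \<ge> (R + norm b) / \<bar>c\<bar>" for x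
  proof (rule R)
    have "R + norm b \<le> norm (c *\<^sub>R x)" using that assms(2) by (simp add: field_simps)
    also have "\<dots> \<le> norm (c *\<^sub>R x + b) + norm b" using norm_triangle_ineq4[of "c *\<^sub>R x + b" b] by simp
    finally show "R \<le> norm (c *\<^sub>R x + b)" by simp
  qed
  then show ?thesis
    by (intro test_functions_UNIV_I) (auto intro: Ck_affine test_functionsD(1)[OF assms(1)])
qed

lemma continuous_compact_support_bounded:
  fixes \<phi> :: "'a::euclidean_space \<Rightarrow> 'b::real_normed_vector"
  assumes "continuous_on UNIV \<phi>" "\<And>x. norm x \<ge> R \<Longrightarrow> \<phi> x = 0"
  obtains B where "B \<ge> 0" "\<And>x. norm (\<phi> x) \<le> B"
proof -
  have "compact (\<phi> ` cball 0 R)"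
    by (intro compact_continuous_image continuous_on_subset[OF assms(1)]) auto
  then obtain B where B: "\<forall>x\<in>cball 0 R. norm (\<phi> x) \<le> B"
    using compact_imp_bounded bounded_iff by (metis imageI)
  show ?thesis
  proof (rule that[of "\<bar>B\<bar>"])
    show "norm (\<phi> x) \<le> \<bar>B\<bar>" for x
    proof (cases "norm x \<le> R")
      case True
      then have "norm (\<phi> x) \<le> B" using B by simp
      then show ?thesis by linarith
    qed (use assms(2)[of x] in simp)
  qed simp
qed

lemma test_functions_bounded:
  assumes "\<phi> \<in> test_functions D"
  obtains B where "B \<ge> 0" "\<And>x. \<bar>\<phi> x\<bar> \<le> B"
proof -
  obtain R where "\<And>x. norm x \<ge> R \<Longrightarrow> \<phi> x = 0" using test_functions_bounded_support[OF assms] by metis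
  from continuous_compact_support_bounded[OF test_functionsD(3)[OF assms] this]
  show ?thesis using that by (metis real_norm_def)
qed

text \<open>Uniformity in \<open>y\<close> comes from the uniform continuity of
  \<open>cgrad \<phi>\<close> on a ball. Increments of norm below 1 either stay inside the ball of
  radius \<open>R + 2\<close> or, when started outside the ball of radius \<open>R + 1\<close>,
  remain where the gradient vanishes. This replaces differentiation under the integral sign
  later.\<close>

lemma uniform_taylor:
  fixes \<phi> :: "real^'d::finite \<Rightarrow> real"
  assumes "\<phi> \<in> test_functions UNIV" "e > 0"
  obtains \<delta> where "\<delta> > 0" "\<And>h y. norm h < \<delta> \<Longrightarrow> \<bar>\<phi> (y + h) - \<phi> y - cgrad \<phi> y \<bullet> h\<bar> \<le> e * norm h"
proof -
  obtain R where R: "R > 0" "\<And>x. norm x \<ge> R \<Longrightarrow> \<phi> x = 0" using test_functions_bounded_support[OF assms(1)] by metis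
  have g0: "cgrad \<phi> x = 0" if "norm x > R" for x
  proof -
    have "(\<phi> has_derivative (\<lambda>h. 0)) (at x)"
      by (rule has_derivative_transform_within_open[of "\<lambda>x. 0" _ _ _ "- cball 0 R"])
        (use that R in \<open>auto simp: dist_norm\<close>)
    then show ?thesis by (simp add: pderiv_atI vec_eq_iff)
  qed
  have "continuous_on UNIV (cgrad \<phi>)" unfolding cgrad_def
    by (intro continuous_on_vec_lambda test_functionsD(3)[OF pderiv_at_test_functions[OF assms(1)]])
  then have "uniformly_continuous_on (cball 0 (R+2)) (cgrad \<phi>)"
    by (intro compact_uniformly_continuous continuous_on_subset[OF \<open>continuous_on UNIV (cgrad \<phi>)\<close>]) auto
  then obtain d where d: "d > 0" "\<And>x x'. x \<in> cball 0 (R+2) \<Longrightarrow> x' \<in> cball 0 (R+2) \<Longrightarrow> dist x' x < d \<Longrightarrow> dist (cgrad \<phi> x') (cgrad \<phi> x) < e"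
    using assms(2) unfolding uniformly_continuous_on_def by metis
  show ?thesis
  proof (rule that[of "min d 1"])
    fix h y :: "real^'d" assume h: "norm h < min d 1"
    have gd: "norm (cgrad \<phi> (y + t *\<^sub>R h) - cgrad \<phi> y) \<le> e" if t: "0 < t" "t < 1" for t
    proof -
      have th: "norm (t *\<^sub>R h) \<le> norm h" using t by (simp add: mult_left_le_one_le)
      show ?thesis
      proof (cases "norm y \<le> R + 1")
        case True
        then have "norm (y + t *\<^sub>R h) \<le> R + 2"
          using norm_triangle_ineq[of y "t *\<^sub>R h"] th h by auto
        then have 1: "y + t *\<^sub>R h \<in> cball 0 (R+2)" by (simp only: mem_cball_0)
        have 2: "y \<in> cball 0 (R+2)" using True by simp
        have 3: "dist (y + t *\<^sub>R h) y < d" using th h by (simp add: dist_norm)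
        show ?thesis using d(2)[OF 2 1 3] by (simp add: dist_norm)
      next
        case False
        then have "norm (y + t *\<^sub>R h) > R"
          using norm_triangle_ineq4[of "y + t *\<^sub>R h" "t *\<^sub>R h"] th h by auto
        then show ?thesis using False g0[of y] g0 assms(2) by auto
      qed
    qed
    have "\<exists>t\<in>{0<..<1}. \<phi> (y + 1 *\<^sub>R h) - \<phi> (y + 0 *\<^sub>R h) = (\<lambda>s. cgrad \<phi> (y + t *\<^sub>R h) \<bullet> (s *\<^sub>R h)) (1 - 0)"
    proof (rule mvt_simple)
      fix t :: real
      have "((\<lambda>t. y + t *\<^sub>R h) has_derivative (\<lambda>s. s *\<^sub>R h)) (at t within {0..1})"
        by (auto intro!: derivative_eq_intros)
      from has_derivative_compose[OF this has_derivative_cgrad[OF test_functionsD(2)[OF assms(1)]]]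
      show "((\<lambda>t. \<phi> (y + t *\<^sub>R h)) has_derivative (\<lambda>s. cgrad \<phi> (y + t *\<^sub>R h) \<bullet> (s *\<^sub>R h))) (at t within {0..1})" .
    qed simp
    then obtain t where t: "0 < t" "t < 1" "\<phi> (y + h) - \<phi> y = cgrad \<phi> (y + t *\<^sub>R h) \<bullet> h" by auto
    have "\<bar>\<phi> (y + h) - \<phi> y - cgrad \<phi> y \<bullet> h\<bar> = \<bar>(cgrad \<phi> (y + t *\<^sub>R h) - cgrad \<phi> y) \<bullet> h\<bar>"
      using t by (simp add: inner_diff_left)
    also have "\<dots> \<le> norm (cgrad \<phi> (y + t *\<^sub>R h) - cgrad \<phi> y) * norm h" by (rule Cauchy_Schwarz_ineq2)
    also have "\<dots> \<le> e * norm h" by (intro mult_right_mono gd t) auto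
    finally show "\<bar>\<phi> (y + h) - \<phi> y - cgrad \<phi> y \<bullet> h\<bar> \<le> e * norm h" .
  qed (use d in auto)
qed

subsection \<open>Integration on Euclidean space\<close>

lemma lborel_integral_translate:
  fixes f :: "'a::euclidean_space \<Rightarrow> 'b::{banach,second_countable_topology}"
  assumes [measurable]: "f \<in> borel_measurable borel"
  shows "(LINT x|lborel. f (c + x)) = (LINT x|lborel. f x)"
proof -
  have "(LINT x|lborel. f x) = (\<integral>x. f x \<partial>distr lborel borel ((+) c))"
    by (simp only: lborel_distr_plus)
  also have "\<dots> = (LINT x|lborel. f (c + x))" by (subst integral_distr) auto
  finally show ?thesis by simp
qed

lemma lborel_integrable_translate:
  fixes f :: "'a::euclidean_space \<Rightarrow> 'b::{banach,second_countable_topology}"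
  assumes [measurable]: "f \<in> borel_measurable borel"
  shows "integrable lborel (\<lambda>x. f (c + x)) \<longleftrightarrow> integrable lborel f"
proof -
  have "integrable lborel f \<longleftrightarrow> integrable (distr lborel borel ((+) c)) f"
    by (simp only: lborel_distr_plus)
  also have "\<dots> \<longleftrightarrow> integrable lborel (\<lambda>x. f (c + x))" by (subst integrable_distr_eq) auto
  finally show ?thesis by simp
qed

lemma lborel_nn_integral_translate:
  fixes f :: "'a::euclidean_space \<Rightarrow> ennreal"
  assumes [measurable]: "f \<in> borel_measurable borel"
  shows "(\<integral>\<^sup>+x. f (c + x) \<partial>lborel) = (\<integral>\<^sup>+x. f x \<partial>lborel)"
proof -
  have "(\<integral>\<^sup>+x. f x \<partial>lborel) = (\<integral>\<^sup>+x. f x \<partial>distr lborel borel ((+) c))"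
    by (simp only: lborel_distr_plus)
  also have "\<dots> = (\<integral>\<^sup>+x. f (c + x) \<partial>lborel)" by (subst nn_integral_distr) auto
  finally show ?thesis by simp
qed

lemma integrable_bounded_support:
  fixes f :: "'a::euclidean_space \<Rightarrow> real"
  assumes [measurable]: "f \<in> borel_measurable borel"
    and "\<And>x. \<bar>f x\<bar> \<le> B" "\<And>x. norm x > R \<Longrightarrow> f x = 0"
  shows "integrable lborel f"
proof (rule Bochner_Integration.integrable_bound)
  show "integrable lborel (\<lambda>x. B * indicator (cball 0 R) x :: real)"
    by (intro integrable_mult_right integrable_real_indicator emeasure_lborel_cball_finite) simp
  show "AE x in lborel. norm (f x) \<le> norm (B * indicator (cball 0 R) x)"
  proof (rule AE_I2)
    fix x show "norm (f x) \<le> norm (B * indicator (cball 0 R) x)"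
      using assms(2)[of x] assms(3)[of x] by (cases "norm x > R") (auto simp: indicator_def)
  qed
qed simp

text \<open>Local integrability, tested on balls about the origin, which exhaust the space. Almost
  every orbit of an integrable random variable satisfies it, whereas integrability over the whole
  space fails in general.\<close>

definition loc_int :: "('a::euclidean_space \<Rightarrow> real) \<Rightarrow> bool" where
  "loc_int H \<longleftrightarrow> H \<in> borel_measurable borel \<and>
     (\<forall>R. integrable lborel (\<lambda>z. indicator (cball 0 R) z * H z))"

lemma loc_intI_bounded:
  fixes H :: "'a::euclidean_space \<Rightarrow> real"
  assumes [measurable]: "H \<in> borel_measurable borel" and "\<And>x. \<bar>H x\<bar> \<le> B"
  shows "loc_int H"
  unfolding loc_int_def
proof (intro conjI allI assms(1))
  have "0 \<le> B" using assms(2)[of 0] by linarith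
  then show "integrable lborel (\<lambda>z. indicator (cball 0 R) z * H z)" for R
    by (intro integrable_bounded_support[where B=B and R=R])
      (use assms(2) in \<open>auto simp: indicator_def dist_norm\<close>)
qed

lemma loc_int_bound:
  fixes H k :: "'a::euclidean_space \<Rightarrow> real"
  assumes "loc_int H" and [measurable]: "k \<in> borel_measurable borel"
    and "\<And>x. \<bar>k x\<bar> \<le> B" "\<And>x. norm x > R \<Longrightarrow> k x = 0"
  shows "integrable lborel (\<lambda>z. k z * H z)"
    "\<bar>LINT z|lborel. k z * H z\<bar> \<le> B * (LINT z|lborel. \<bar>indicator (cball 0 R) z * H z\<bar>)"
proof -
  have [measurable]: "H \<in> borel_measurable borel" using assms(1) by (simp add: loc_int_def)
  have i: "integrable lborel (\<lambda>z. B * \<bar>indicator (cball 0 R) z * H z\<bar>)"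
    using assms(1) by (intro integrable_mult_right integrable_abs) (simp add: loc_int_def)
  have b: "norm (k z * H z) \<le> B * \<bar>indicator (cball 0 R) z * H z\<bar>" for z
    using assms(3)[of z] assms(4)[of z]
    by (cases "norm z > R") (auto simp: indicator_def abs_mult intro: mult_right_mono)
  show 1: "integrable lborel (\<lambda>z. k z * H z)"
    by (rule Bochner_Integration.integrable_bound[OF i]) (auto intro!: AE_I2 order_trans[OF b[unfolded real_norm_def]])
  have "\<bar>LINT z|lborel. k z * H z\<bar> \<le> (LINT z|lborel. norm (k z * H z))"
    using integral_norm_bound[of lborel "\<lambda>z. k z * H z"] by simp
  also have "\<dots> \<le> (LINT z|lborel. B * \<bar>indicator (cball 0 R) z * H z\<bar>)"
    by (intro integral_mono integrable_norm 1 i b)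
  finally show "\<bar>LINT z|lborel. k z * H z\<bar> \<le> B * (LINT z|lborel. \<bar>indicator (cball 0 R) z * H z\<bar>)"
    by simp
qed

lemma test_functions_integrable_mult:
  assumes "\<phi> \<in> test_functions D" "loc_int H"
  shows "integrable lborel (\<lambda>z. \<phi> z * H z)"
proof -
  obtain R where R: "R > 0" "\<And>x. norm x \<ge> R \<Longrightarrow> \<phi> x = 0" using test_functions_bounded_support[OF assms(1)] by blast
  obtain B where "\<And>x. \<bar>\<phi> x\<bar> \<le> B" using test_functions_bounded[OF assms(1)] by metis
  then show ?thesis using R by (intro loc_int_bound(1)[OF assms(2) test_functionsD(4)[OF assms(1)], of B R]) auto
qed

lemma test_functions_integrable:
  assumes "\<phi> \<in> test_functions D"
  shows "integrable lborel \<phi>"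
  using test_functions_integrable_mult[OF assms loc_intI_bounded[of "\<lambda>x. 1" 1]] by simp

text \<open>By translation invariance the integral of \<open>\<phi> (h + y) - \<phi> y\<close> is 0,
  while \<open>uniform_taylor\<close> compares this difference with \<open>t\<close> times the
  partial derivative, uniformly and on a fixed ball.\<close>

lemma integral_pderiv_at:
  fixes \<phi> :: "real^'d::finite \<Rightarrow> real"
  assumes \<phi>: "\<phi> \<in> test_functions UNIV"
  shows "(LINT y|lborel. pderiv_at \<phi> i y) = 0"
proof -
  note [measurable] = test_functionsD(4)[OF \<phi>] test_functionsD(4)[OF pderiv_at_test_functions[OF \<phi>]]
  obtain R where R: "R > 0" "\<And>x. norm x \<ge> R \<Longrightarrow> \<phi> x = 0" using test_functions_bounded_support[OF \<phi>] by blast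
  obtain R' where R': "R' > 0" "\<And>x. norm x \<ge> R' \<Longrightarrow> pderiv_at \<phi> i x = 0"
    using test_functions_bounded_support[OF pderiv_at_test_functions[OF \<phi>]] by blast
  \<comment> \<open>The additional 1 covers the shift by \<open>h\<close>, whose norm
    \<open>t\<close> is at most 1.\<close>
  define S where "S = max R R' + 1"
  define m where "m = measure lborel (cball (0::real^'d) S)"
  have iphi: "integrable lborel \<phi>" "integrable lborel (pderiv_at \<phi> i)"
    by (intro test_functions_integrable[of _ UNIV] pderiv_at_test_functions \<phi>)+
  have "\<bar>LINT y|lborel. pderiv_at \<phi> i y\<bar> \<le> e" if "e > 0" for e
  proof -
    define e' where "e' = e / (m + 1)"
    have "m \<ge> 0" by (simp add: m_def)
    have "e' > 0" using that \<open>m \<ge> 0\<close> by (simp add: e'_def)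
    then obtain \<delta> where \<delta>: "\<delta> > 0" "\<And>h y. norm h < \<delta> \<Longrightarrow> \<bar>\<phi> (y + h) - \<phi> y - cgrad \<phi> y \<bullet> h\<bar> \<le> e' * norm h"
      using uniform_taylor[OF \<phi>] by blast
    define t where "t = min (\<delta> / 2) 1"
    have t: "t > 0" "t < \<delta>" "t \<le> 1" using \<delta>(1) by (auto simp: t_def)
    define h where "h = t *\<^sub>R axis i (1::real)"
    have nh: "norm h = t" using t by (simp add: h_def norm_axis_1)
    define f where "f y = \<phi> (h + y) - \<phi> y - t * pderiv_at \<phi> i y" for y
    have fm [measurable]: "f \<in> borel_measurable borel" unfolding f_def by measurable
    have fb: "\<bar>f y\<bar> \<le> e' * t" for y
      using \<delta>(2)[of h y] nh t by (simp add: f_def h_def inner_axis add.commute mult.commute)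
    have f0: "f y = 0" if "norm y > S" for y
    proof -
      have "norm y \<le> norm (h + y) + norm h" using norm_triangle_ineq4[of "h + y" h] by simp
      then have "\<phi> (h + y) = 0" using that nh t by (intro R(2)) (auto simp: S_def)
      moreover have "\<phi> y = 0" "pderiv_at \<phi> i y = 0" using that by (auto intro!: R(2) R'(2) simp: S_def)
      ultimately show ?thesis by (simp add: f_def)
    qed
    have i1: "integrable lborel (\<lambda>y. \<phi> (h + y))" using iphi by (subst lborel_integrable_translate) auto
    have "(LINT y|lborel. f y) = - t * (LINT y|lborel. pderiv_at \<phi> i y)"
      unfolding f_def using iphi i1 by (simp add: lborel_integral_translate)
    moreover have "\<bar>LINT y|lborel. f y * 1\<bar> \<le> (e' * t) * (LINT z|(lborel :: (real^'d) measure). \<bar>indicator (cball 0 S) z * 1\<bar>)"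
      by (rule loc_int_bound(2)[OF _ fm fb f0]) (auto intro: loc_intI_bounded[of _ 1])
    moreover have "(LINT z|(lborel :: (real^'d) measure). \<bar>indicator (cball 0 S) z * 1\<bar>) = m"
      by (simp add: m_def)
    ultimately have "t * \<bar>LINT y|lborel. pderiv_at \<phi> i y\<bar> \<le> t * (e' * m)"
      using t by (simp add: abs_mult mult_ac)
    then have "\<bar>LINT y|lborel. pderiv_at \<phi> i y\<bar> \<le> e' * m" using t by simp
    also have "\<dots> \<le> e" using that \<open>m \<ge> 0\<close> by (simp add: e'_def field_simps)
    finally show ?thesis .
  qed
  then show ?thesis by (metis abs_le_zero_iff dense_ge)
qed

text \<open>\<open>v\<close> times a test function is a test function, so the product rule and
  \<open>integral_pderiv_at\<close> suffice; \<open>v\<close> itself may grow without bound.\<close>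

lemma integral_by_parts_smooth:
  fixes v :: "real^'d::finite \<Rightarrow> real"
  assumes v: "\<And>k. Ck k v" and \<phi>: "\<phi> \<in> test_functions UNIV"
  shows "(LINT y|lborel. v y * pderiv_at \<phi> i y) = - (LINT y|lborel. pderiv_at v i y * \<phi> y)"
proof -
  have p: "\<And>k. Ck k (pderiv_at v i)" using v[of "Suc _"] by simp
  have d: "v differentiable (at x)" for x using v[of 1] by simp
  have "pderiv_at (\<lambda>x. v x * \<phi> x) i = (\<lambda>x. v x * pderiv_at \<phi> i x + pderiv_at v i x * \<phi> x)"
    by (rule ext, rule pderiv_at_mult[OF d test_functionsD(2)[OF \<phi>]])
  moreover have "(LINT y|lborel. pderiv_at (\<lambda>x. v x * \<phi> x) i y) = 0"
    by (intro integral_pderiv_at test_functions_mult_smooth \<phi> v)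
  moreover have "integrable lborel (\<lambda>x. v x * pderiv_at \<phi> i x)" "integrable lborel (\<lambda>x. pderiv_at v i x * \<phi> x)"
    by (intro test_functions_integrable[of _ UNIV] test_functions_mult_smooth pderiv_at_test_functions \<phi> v p)+
  ultimately show ?thesis by simp
qed

subsection \<open>Convolution\<close>

text \<open>A correlation rather than a convolution: the kernel is evaluated at
  \<open>z - y\<close>. This matches averages along orbits (\<open>mol_orbit\<close>) and is the
  source of the minus sign in \<open>pderiv_at_conv\<close>.\<close>

definition conv :: "('a::euclidean_space \<Rightarrow> real) \<Rightarrow> ('a \<Rightarrow> real) \<Rightarrow> 'a \<Rightarrow> real" where
  "conv k H y = (LINT z|lborel. k (z - y) * H z)"

lemma test_functions_shift:
  "\<phi> \<in> test_functions UNIV \<Longrightarrow> (\<lambda>z. \<phi> (z - y)) \<in> test_functions UNIV"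
  using test_functions_affine[of \<phi> 1 "- y"] by simp

lemma integrable_conv:
  assumes "k \<in> test_functions UNIV" "loc_int H"
  shows "integrable lborel (\<lambda>z. k (z - y) * H z)"
  by (rule test_functions_integrable_mult[OF test_functions_shift[OF assms(1)] assms(2)])

text \<open>All derivatives fall on the kernel, so \<open>H\<close> need only be locally integrable.
  The Taylor remainder of the kernel is uniformly small by \<open>uniform_taylor\<close> and
  supported in the ball of radius \<open>S\<close> as long as the increment has norm below 1;
  \<open>m\<close> is the mass of \<open>H\<close> there.\<close>

lemma conv_has_derivative:
  fixes k :: "real^'d::finite \<Rightarrow> real"
  assumes k: "k \<in> test_functions UNIV" and H: "loc_int H"
  shows "(conv k H has_derivative (\<lambda>h. \<Sum>i\<in>UNIV. h $ i * - conv (pderiv_at k i) H y)) (at y)"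
  unfolding has_derivative_at_alt
proof (intro conjI allI impI)
  show "bounded_linear (\<lambda>h. \<Sum>i\<in>UNIV. h $ i * - conv (pderiv_at k i) H y)"
    by (intro bounded_linear_intros bounded_linear_mult_const[OF bounded_linear_vec_nth])
  fix e :: real assume "e > 0"
  note [measurable] = test_functionsD(4)[OF k] test_functionsD(4)[OF pderiv_at_test_functions[OF k]]
  obtain R where R: "R > 0" "\<And>x. norm x \<ge> R \<Longrightarrow> k x = 0" using test_functions_bounded_support[OF k] by blast
  have "\<forall>i. \<exists>R. \<forall>x. norm x \<ge> R \<longrightarrow> pderiv_at k i x = 0"
    using test_functions_bounded_support[OF pderiv_at_test_functions[OF k]] by metis
  then obtain R' where R': "\<And>i x. norm x \<ge> R' i \<Longrightarrow> pderiv_at k i x = 0" by metis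
  define S where "S = Max (insert R (range R')) + norm y + 1"
  have "R \<le> Max (insert R (range R'))" "R' i \<le> Max (insert R (range R'))" for i
    by (intro Max_ge; simp)+
  then have S: "R + norm y + 1 \<le> S" "R' i + norm y + 1 \<le> S" for i
    by (auto simp only: S_def add_right_mono)
  define m where "m = (LINT z|lborel. \<bar>indicator (cball 0 S) z * H z\<bar>)"
  have "m \<ge> 0" by (simp add: m_def)
  define e' where "e' = e / (m + 1)"
  have "e' > 0" using \<open>e > 0\<close> \<open>m \<ge> 0\<close> by (simp add: e'_def)
  then obtain \<delta> where \<delta>: "\<delta> > 0" "\<And>h y. norm h < \<delta> \<Longrightarrow> \<bar>k (y + h) - k y - cgrad k y \<bullet> h\<bar> \<le> e' * norm h"
    using uniform_taylor[OF k] by blast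
  show "\<exists>d>0. \<forall>ya. norm (ya - y) < d \<longrightarrow>
      norm (conv k H ya - conv k H y - (\<Sum>i\<in>UNIV. (ya - y) $ i * - conv (pderiv_at k i) H y)) \<le> e * norm (ya - y)"
  proof (intro exI[of _ "min \<delta> 1"] conjI allI impI)
    fix x assume x: "norm (x - y) < min \<delta> 1"
    define h where "h = x - y"
    define f where "f z = k (z - x) - k (z - y) + cgrad k (z - y) \<bullet> h" for z
    have fe: "f z = k (z - x) - k (z - y) + (\<Sum>i\<in>UNIV. h $ i * pderiv_at k i (z - y))" for z
      by (simp add: f_def inner_vec_def mult.commute)
    have fm [measurable]: "f \<in> borel_measurable borel" unfolding fe by measurable
    have fb: "\<bar>f z\<bar> \<le> e' * norm h" for z
    proof -
      have 1: "z - y + - h = z - x" by (simp add: h_def)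
      have "\<bar>k (z - y + - h) - k (z - y) - cgrad k (z - y) \<bullet> - h\<bar> \<le> e' * norm (- h)"
        by (rule \<delta>(2)) (use x[folded h_def] in simp)
      then show ?thesis unfolding 1 f_def by simp
    qed
    have f0: "f z = 0" if "norm z > S" for z
    proof -
      have a: "norm z \<le> norm (z - y) + norm y" using norm_triangle_ineq[of "z - y" y] by simp
      have b: "norm z \<le> norm (z - x) + norm x" using norm_triangle_ineq[of "z - x" x] by simp
      have c: "norm x \<le> norm y + 1" using norm_triangle_ineq[of "x - y" y] x by simp
      have "k (z - x) = 0" "k (z - y) = 0" using a b c S(1) that by (auto intro!: R(2))
      moreover have "pderiv_at k i (z - y) = 0" for i using a S(2)[of i] that by (intro R') auto
      ultimately show ?thesis by (simp add: fe)
    qed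
    have i: "integrable lborel (\<lambda>z. k (z - x) * H z)" "integrable lborel (\<lambda>z. k (z - y) * H z)"
      "integrable lborel (\<lambda>z. pderiv_at k i (z - y) * H z)" for i
      by (intro integrable_conv H k pderiv_at_test_functions)+
    have "f z * H z = k (z - x) * H z - k (z - y) * H z + (\<Sum>i\<in>UNIV. h $ i * (pderiv_at k i (z - y) * H z))" for z
      unfolding fe by (simp add: algebra_simps sum_distrib_left sum_distrib_right)
    then have "(LINT z|lborel. f z * H z) = conv k H x - conv k H y + (\<Sum>i\<in>UNIV. h $ i * conv (pderiv_at k i) H y)"
      using i by (simp add: conv_def)
    then have "norm (conv k H x - conv k H y - (\<Sum>i\<in>UNIV. (x - y) $ i * - conv (pderiv_at k i) H y))
       = \<bar>LINT z|lborel. f z * H z\<bar>" by (simp add: h_def sum_negf)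
    also have "\<dots> \<le> e' * norm h * m"
      unfolding m_def by (rule loc_int_bound(2)[OF H fm fb f0])
    also have "\<dots> = (e' * m) * norm h" by simp
    also have "\<dots> \<le> e * norm h"
      using \<open>e > 0\<close> \<open>m \<ge> 0\<close> by (intro mult_right_mono) (auto simp: e'_def field_simps)
    finally show "norm (conv k H x - conv k H y - (\<Sum>i\<in>UNIV. (x - y) $ i * - conv (pderiv_at k i) H y)) \<le> e * norm (x - y)"
      by (simp add: h_def)
  qed (use \<delta> in simp)
qed

lemma pderiv_at_conv:
  fixes k :: "real^'d::finite \<Rightarrow> real"
  assumes k: "k \<in> test_functions UNIV" and H: "loc_int H"
  shows "pderiv_at (conv k H) i = (\<lambda>y. - conv (pderiv_at k i) H y)"
  by (rule ext, subst pderiv_atI[OF conv_has_derivative[OF assms]]) (simp add: axis_def sum_negf if_distrib[of "\<lambda>x. x * _"] cong: if_cong)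

lemma conv_uminus: "conv (\<lambda>z. - k z) H = (\<lambda>y. - conv k H y)"
  by (rule ext) (simp add: conv_def)

lemma Ck_conv:
  fixes k :: "real^'d::finite \<Rightarrow> real"
  assumes "k \<in> test_functions UNIV" and H: "loc_int H"
  shows "Ck n (conv k H)"
proof (rule Ck_coinduct[where P="\<lambda>f. \<exists>k\<in>test_functions UNIV. f = conv k H"])
  show "\<exists>k'\<in>test_functions UNIV. conv k H = conv k' H" using assms by blast
next
  fix \<phi> x assume "\<exists>k\<in>test_functions UNIV. \<phi> = conv k H"
  then show "\<phi> differentiable at x" using conv_has_derivative[OF _ H] differentiable_def by blast
next
  fix \<phi> i assume "\<exists>k\<in>test_functions UNIV. \<phi> = conv k H"
  then obtain k where k: "k \<in> test_functions UNIV" "\<phi> = conv k H" by blast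
  have "pderiv_at \<phi> i = conv (\<lambda>z. - pderiv_at k i z) H"
    by (simp add: k pderiv_at_conv[OF k(1) H] conv_uminus)
  moreover have "(\<lambda>z. - pderiv_at k i z) \<in> test_functions UNIV"
    using test_functions_cmult[OF pderiv_at_test_functions[OF k(1)], of "-1"] by simp
  ultimately show "\<exists>k\<in>test_functions UNIV. pderiv_at \<phi> i = conv k H" by blast
qed

lemma conv_support:
  assumes "\<And>z. norm z \<ge> r \<Longrightarrow> k z = 0" "\<And>z. z \<notin> K \<Longrightarrow> H z = 0" "conv k H y \<noteq> 0"
  obtains z where "z \<in> K" "norm (z - y) < r"
proof -
  have "\<exists>z. k (z - y) * H z \<noteq> 0"
  proof (rule ccontr)
    assume "\<not> ?thesis"
    then have "(\<lambda>z. k (z - y) * H z) = (\<lambda>z. 0)" by auto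
    then have "conv k H y = 0" unfolding conv_def by simp
    then show False using assms(3) by simp
  qed
  then obtain z where "k (z - y) \<noteq> 0" "H z \<noteq> 0" by auto
  then show ?thesis using that[of z] assms(1)[of "z - y"] assms(2)[of z] by force
qed

lemma conv_alt:
  assumes "k \<in> borel_measurable borel" "H \<in> borel_measurable borel"
  shows "conv k H y = (LINT z|lborel. k z * H (y + z))"
proof -
  have "(LINT z|lborel. k (z - y) * H z) = (LINT z|lborel. (\<lambda>z. k (z - y) * H z) (y + z))"
    by (rule lborel_integral_translate[symmetric]) (use assms in measurable)
  then show ?thesis by (simp add: conv_def)
qed

section \<open>Mollifiers and approximation in the mean\<close>

definition mollifier :: "real \<Rightarrow> (real^'d::finite \<Rightarrow> real) \<Rightarrow> bool" where
  "mollifier r k \<longleftrightarrow> k \<in> test_functions UNIV \<and> (\<forall>z. 0 \<le> k z) \<and> (\<forall>z. norm z \<ge> r \<longrightarrow> k z = 0) \<and>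
     (LINT z|lborel. k z) = 1"

lemma mollifierD:
  assumes "mollifier r k"
  shows "k \<in> test_functions UNIV" "0 \<le> k z" "norm z \<ge> r \<Longrightarrow> k z = 0" "(LINT z|lborel. k z) = 1"
    "k \<in> borel_measurable borel" "integrable lborel k" "(\<integral>\<^sup>+z. k z \<partial>lborel) = 1"
proof -
  show 1: "k \<in> test_functions UNIV" "0 \<le> k z" "norm z \<ge> r \<Longrightarrow> k z = 0" "(LINT z|lborel. k z) = 1" for z
    using assms by (auto simp: mollifier_def)
  show "k \<in> borel_measurable borel" using 1 test_functionsD by blast
  show i: "integrable lborel k" using 1(1) by (rule test_functions_integrable)
  show "(\<integral>\<^sup>+z. k z \<partial>lborel) = 1" using nn_integral_eq_integral[OF i] 1 by simp
qed

lemma mollifier_exists: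
  assumes "r > 0"
  obtains k :: "real^'d::finite \<Rightarrow> real" where "mollifier r k"
proof -
  define q :: "real^'d \<Rightarrow> real" where "q z = flat 1 (1 - ((1/r) *\<^sub>R z + 0) \<bullet> ((1/r) *\<^sub>R z + 0))" for z
  have nn: "q z \<ge> 0" for z by (simp add: q_def flat_def)
  have eq: "((1/r) *\<^sub>R z + 0) \<bullet> ((1/r) *\<^sub>R z + 0) = (norm z / r)\<^sup>2" for z :: "real^'d"
    by (simp add: power_divide power2_norm_eq_inner[symmetric] power2_eq_square[symmetric])
  have z0: "q z = 0" if "norm z \<ge> r" for z
  proof -
    have "1 \<le> (norm z / r)\<^sup>2" using that assms by (simp add: one_le_power)
    then show ?thesis unfolding q_def eq by (simp add: flat_def)
  qed
  have pos: "q z > 0" if "norm z < r" for z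
  proof -
    have "(norm z / r)\<^sup>2 < 1" using that assms by (intro power_less_one_iff[THEN iffD2]) (auto simp: abs_square_less_1)
    then show ?thesis unfolding q_def eq by (simp add: flat_def)
  qed
  have "Ck j q" for j
    unfolding q_def by (rule Ck_affine[OF Ck_flat_ball])
  then have q: "q \<in> test_functions UNIV"
    using z0 by (rule test_functions_UNIV_I)
  note i = test_functions_integrable[OF q]
  define I where "I = (LINT z|lborel. q z)"
  have "I \<ge> 0" by (simp add: I_def nn)
  moreover have "I \<noteq> 0"
  proof
    assume "I = 0"
    then have "AE z in lborel. q z = 0" using integral_nonneg_eq_0_iff_AE[OF i] nn by (simp add: I_def)
    then have "AE z in lebesgue. q z = 0" by (rule AE_completion)
    then have "AE z in lebesgue. z \<notin> ball (0::real^'d) r" by (rule eventually_mono) (use pos in force)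
    then have "ball (0::real^'d) r \<in> null_sets lebesgue"
      by (subst AE_iff_null_sets) (auto simp: AE_iff_null_sets)
    then have "negligible (ball (0::real^'d) r)" by (simp add: negligible_iff_null_sets)
    then show False using open_not_negligible[of "ball (0::real^'d) r"] assms by simp
  qed
  ultimately have "I > 0" by simp
  have "mollifier r (\<lambda>z. (1/I) * q z)"
    unfolding mollifier_def using \<open>I > 0\<close> nn z0 q
    by (auto simp: I_def intro!: test_functions_cmult[OF q, of "1/I", simplified I_def, simplified])
  then show ?thesis by (rule that)
qed

text \<open>Lebesgue measurability supplies continuous functions converging to \<open>h\<close> off
  a negligible set. Clipping them to [-B, B] and cutting them off beyond \<open>R + 1\<close> makes
  dominated convergence applicable, and for a continuous function with compact support the claim is
  uniform continuity.\<close>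

lemma translation_L1:
  fixes h :: "real^'d::finite \<Rightarrow> real"
  assumes [measurable]: "h \<in> borel_measurable borel" and B: "\<And>x. \<bar>h x\<bar> \<le> B" and R: "\<And>x. norm x > R \<Longrightarrow> h x = 0"
    and "e > 0"
  obtains \<delta> where "\<delta> > 0" "\<And>t. norm t < \<delta> \<Longrightarrow> (LINT y|lborel. \<bar>h (t + y) - h y\<bar>) \<le> e"
proof -
  have "B \<ge> 0" using B[of 0] by linarith
  have ih: "integrable lborel h" by (rule integrable_bounded_support[OF _ B R]) auto
  have "h \<in> borel_measurable lebesgue" by (rule measurable_completion) simp
  then have "h measurable_on UNIV" by (rule lebesgue_measurable_imp_measurable_on) simp
  then obtain N g where N: "negligible N" and g: "\<And>n. continuous_on UNIV (g n)"
    and gl: "\<And>x. x \<notin> N \<Longrightarrow> (\<lambda>n. g n x) \<longlonglongrightarrow> h x"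
    unfolding measurable_on_def by auto
  define c :: "real^'d \<Rightarrow> real" where "c x = max 0 (min 1 (R + 1 - norm x))" for x
  define G where "G n x = c x * max (-B) (min B (g n x))" for n x
  have Gc: "continuous_on UNIV (G n)" for n
    unfolding G_def c_def by (intro continuous_intros g)
  have [measurable]: "G n \<in> borel_measurable borel" for n
    by (rule borel_measurable_continuous_onI[OF Gc])
  have Gb: "\<bar>G n x\<bar> \<le> B" for n x
  proof -
    have "\<bar>G n x\<bar> = c x * \<bar>max (-B) (min B (g n x))\<bar>" by (simp add: G_def abs_mult c_def)
    also have "\<dots> \<le> 1 * B" using \<open>B \<ge> 0\<close> by (intro mult_mono) (auto simp: c_def)
    finally show ?thesis by simp
  qed
  have G0: "G n x = 0" if "norm x > R + 1" for n x using that by (simp add: G_def c_def)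
  have Gl: "(\<lambda>n. G n x) \<longlonglongrightarrow> h x" if "x \<notin> N" for x
  proof -
    have "(\<lambda>n. G n x) \<longlonglongrightarrow> c x * max (-B) (min B (h x))"
      unfolding G_def by (intro tendsto_intros gl that)
    moreover have "max (-B) (min B (h x)) = h x" using B[of x] by auto
    moreover have "c x * h x = h x" using R[of x] by (cases "norm x > R") (auto simp: c_def)
    ultimately show ?thesis by simp
  qed
  have "AE x in lebesgue. x \<notin> N" using N by (auto simp: negligible_iff_null_sets intro: AE_not_in)
  then have AEN: "AE x in lborel. x \<notin> N" by (simp add: AE_completion_iff)
  have iG: "integrable lborel (G n)" for n by (rule integrable_bounded_support[OF _ Gb G0]) auto
  have "(\<lambda>n. \<integral>y. \<bar>G n y - h y\<bar> \<partial>lborel) \<longlonglongrightarrow> (LINT y|(lborel :: (real^'d) measure). 0)"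
  proof (rule integral_dominated_convergence[where w="\<lambda>y. 2 * B * indicator (cball 0 (R+1)) y"])
    show "integrable lborel (\<lambda>y::real^'d. 2 * B * indicator (cball 0 (R+1)) y)"
      by (intro integrable_mult_right integrable_real_indicator emeasure_lborel_cball_finite) simp
    show "AE y in lborel. (\<lambda>n. \<bar>G n y - h y\<bar>) \<longlonglongrightarrow> 0"
      using AEN by (rule eventually_mono) (auto dest!: Gl simp: tendsto_rabs_zero_iff LIM_zero)
    show "AE y in lborel. norm \<bar>G n y - h y\<bar> \<le> 2 * B * indicator (cball 0 (R+1)) y" for n
    proof (rule AE_I2)
      fix y show "norm \<bar>G n y - h y\<bar> \<le> 2 * B * indicator (cball 0 (R+1)) y"
        using Gb[of n y] B[of y] G0[of y n] R[of y]
        by (cases "norm y > R + 1") (auto simp: indicator_def)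
    qed
  qed auto
  then have "(\<lambda>n. \<integral>y. \<bar>G n y - h y\<bar> \<partial>lborel) \<longlonglongrightarrow> 0" by simp
  then have "\<forall>\<^sub>F n in sequentially. (LINT y|lborel. \<bar>G n y - h y\<bar>) < e / 3"
    using \<open>e > 0\<close> by (intro order_tendstoD) auto
  then obtain n where n: "(LINT y|lborel. \<bar>G n y - h y\<bar>) < e / 3" by (auto simp: eventually_sequentially)
  \<comment> \<open>Outside this ball both \<open>G n\<close> and its translate by a vector of norm
    below 1 vanish, because \<open>G n\<close> is supported in radius \<open>R + 1\<close>.\<close>
  define m where "m = measure lborel (cball (0::real^'d) (R+2))"
  have "m \<ge> 0" by (simp add: m_def)
  define e' where "e' = e / (3 * (m + 1))"
  have "e' > 0" using \<open>e > 0\<close> \<open>m \<ge> 0\<close> by (simp add: e'_def)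
  have "uniformly_continuous_on (cball 0 (R+3)) (G n)"
    by (intro compact_uniformly_continuous continuous_on_subset[OF Gc]) auto
  then obtain d where d: "d > 0" "\<And>x x'. x \<in> cball 0 (R+3) \<Longrightarrow> x' \<in> cball 0 (R+3) \<Longrightarrow> dist x' x < d \<Longrightarrow> dist (G n x') (G n x) < e'"
    using \<open>e' > 0\<close> unfolding uniformly_continuous_on_def by metis
  show ?thesis
  proof (rule that[of "min d 1"])
    fix t :: "real^'d" assume t: "norm t < min d 1"
    have nt: "norm (t + y) \<le> norm y + 1" "norm y \<le> norm (t + y) + 1" for y
      using norm_triangle_ineq[of t y] norm_triangle_ineq4[of "t + y" t] t by auto
    have Gt: "\<bar>G n (t + y) - G n y\<bar> \<le> e' * indicator (cball 0 (R+2)) y" for y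
    proof (cases "norm y \<le> R + 2")
      case True
      then have "t + y \<in> cball 0 (R+3)" "y \<in> cball 0 (R+3)"
        using nt(1)[of y] by (auto simp only: mem_cball_0)
      then have "dist (G n (t + y)) (G n y) < e'"
        using t by (intro d(2)) (auto simp: dist_norm)
      then show ?thesis using True by (simp add: dist_real_def)
    next
      case False
      then have "G n (t + y) = 0" "G n y = 0" using nt(2)[of y] by (auto intro!: G0)
      then show ?thesis using \<open>e' > 0\<close> by simp
    qed
    have it: "integrable lborel (\<lambda>y. h (t + y))" "integrable lborel (\<lambda>y. G n (t + y))"
      using ih iG[of n] by (auto simp: lborel_integrable_translate)
    have ib: "integrable lborel (\<lambda>y::real^'d. e' * indicator (cball 0 (R+2)) y)"
      by (intro integrable_mult_right integrable_real_indicator emeasure_lborel_cball_finite) simp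
    have "(LINT y|lborel. \<bar>h (t + y) - h y\<bar>)
       \<le> (LINT y|lborel. \<bar>G n (t + y) - h (t + y)\<bar> + e' * indicator (cball 0 (R+2)) y + \<bar>G n y - h y\<bar>)"
    proof (rule integral_mono)
      show "\<bar>h (t + y) - h y\<bar> \<le> \<bar>G n (t + y) - h (t + y)\<bar> + e' * indicator (cball 0 (R+2)) y + \<bar>G n y - h y\<bar>" for y
        using Gt[of y] by linarith
    qed (use it ih iG[of n] ib in auto)
    also have "\<dots> = (LINT y|lborel. \<bar>G n (t + y) - h (t + y)\<bar>) + e' * m + (LINT y|lborel. \<bar>G n y - h y\<bar>)"
      using it ih iG[of n] ib by (simp add: m_def)
    also have "(LINT y|lborel. \<bar>G n (t + y) - h (t + y)\<bar>) = (LINT y|lborel. \<bar>G n y - h y\<bar>)"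
      by (rule lborel_integral_translate[of "\<lambda>y. \<bar>G n y - h y\<bar>"]) measurable
    also have "e' * m \<le> e / 3" using \<open>e > 0\<close> \<open>m \<ge> 0\<close> by (simp add: e'_def field_simps)
    finally show "(LINT y|lborel. \<bar>h (t + y) - h y\<bar>) \<le> e" using n by linarith
  qed (use d in auto)
qed

lemma conv_mollifier_bounded:
  fixes h :: "real^'d::finite \<Rightarrow> real"
  assumes k: "mollifier r k" and [measurable]: "h \<in> borel_measurable borel" and B: "\<And>x. \<bar>h x\<bar> \<le> B"
  shows "\<bar>conv k h y\<bar> \<le> B"
proof -
  note [measurable] = mollifierD(5)[OF k]
  have "B \<ge> 0" using B[of 0] by linarith
  have "\<bar>conv k h y\<bar> \<le> (LINT z|lborel. norm (k z * h (y + z)))"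
    unfolding conv_alt[OF mollifierD(5)[OF k] assms(2)]
    using integral_norm_bound[of lborel "\<lambda>z. k z * h (y + z)"] by simp
  also have "\<dots> \<le> (LINT z|lborel. k z * B)"
  proof (rule integral_mono)
    have b: "norm (k z * h (y + z)) \<le> k z * B" for z
      using B[of "y + z"] mollifierD(2)[OF k, of z] by (simp add: abs_mult mult_left_mono)
    then show "norm (k z * h (y + z)) \<le> k z * B" for z .
    have "integrable lborel (\<lambda>z. k z * B)" using mollifierD(6)[OF k] by simp
    then show "integrable lborel (\<lambda>z. norm (k z * h (y + z)))"
      by (rule Bochner_Integration.integrable_bound) (auto intro!: AE_I2 order_trans[OF b[simplified]])
  qed (use mollifierD(6)[OF k] in simp)
  also have "\<dots> = B" using mollifierD(4)[OF k] by simp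
  finally show ?thesis .
qed

text \<open>By Tonelli, the error in the mean is at most the kernel average of the errors under
  translation, and these are small as soon as the kernel sits inside the ball of radius \<delta>
  from \<open>translation_L1\<close>.\<close>

lemma mollify_L1:
  fixes h :: "real^'d::finite \<Rightarrow> real"
  assumes [measurable]: "h \<in> borel_measurable borel" and B: "\<And>x. \<bar>h x\<bar> \<le> B" and R: "\<And>x. norm x > R \<Longrightarrow> h x = 0"
    and "e > 0" "r0 > 0"
  obtains r k where "0 < r" "r \<le> r0" "mollifier r k"
    "(LINT y|lborel. \<bar>conv k h y - h y\<bar>) \<le> e" "integrable lborel (\<lambda>y. conv k h y - h y)"
proof -
  obtain \<delta> where \<delta>: "\<delta> > 0" "\<And>t. norm t < \<delta> \<Longrightarrow> (LINT y|lborel. \<bar>h (t + y) - h y\<bar>) \<le> e"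
    using translation_L1[OF assms(1) B R \<open>e > 0\<close>] by blast
  define r where "r = min \<delta> r0"
  have r: "0 < r" "r \<le> r0" "r \<le> \<delta>" using \<delta> assms(5) by (auto simp: r_def)
  obtain k :: "real^'d \<Rightarrow> real" where k: "mollifier r k" using mollifier_exists[OF r(1)] by blast
  note [measurable] = mollifierD(5)[OF k]
  have lh: "loc_int h" by (rule loc_intI_bounded[OF assms(1) B])
  have [measurable]: "conv k h \<in> borel_measurable borel"
    using Ck_conv[OF mollifierD(1)[OF k] lh, of 0] by (intro borel_measurable_continuous_onI) simp
  have ih: "integrable lborel h" by (rule integrable_bounded_support[OF assms(1) B R])
  have ic: "integrable lborel (conv k h)"
  proof (rule integrable_bounded_support)
    show "\<bar>conv k h y\<bar> \<le> B" for y by (rule conv_mollifier_bounded[OF k assms(1) B])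
    show "conv k h y = 0" if "norm y > R + r" for y
    proof (rule ccontr)
      assume "conv k h y \<noteq> 0"
      then obtain z where "z \<in> cball 0 R" "norm (z - y) < r"
        using conv_support[of r k "cball 0 R" h y] mollifierD(3)[OF k] R by (metis mem_cball_0 not_le)
      then show False using that norm_triangle_ineq4[of z "z - y"] by simp
    qed
  qed simp
  have ihd: "integrable lborel (\<lambda>y. \<bar>h (z + y) - h y\<bar>)" for z
    using ih lborel_integrable_translate[of h z] by auto
  have pt: "ennreal \<bar>conv k h y - h y\<bar> \<le> (\<integral>\<^sup>+z. ennreal (k z * \<bar>h (z + y) - h y\<bar>) \<partial>lborel)" for y
  proof -
    have i1: "integrable lborel (\<lambda>z. k z * h (y + z))"
      by (rule test_functions_integrable_mult[OF mollifierD(1)[OF k]], rule loc_intI_bounded[of _ B]) (auto simp: B)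
    have i2: "integrable lborel (\<lambda>z. k z * h y)" using mollifierD(6)[OF k] by simp
    have "conv k h y - h y = (LINT z|lborel. k z * h (y + z)) - (LINT z|lborel. k z * h y)"
      using mollifierD(4)[OF k] by (simp add: conv_alt[OF mollifierD(5)[OF k] assms(1)])
    also have "\<dots> = (LINT z|lborel. k z * (h (z + y) - h y))"
      using i1 i2 by (simp add: right_diff_distrib add.commute)
    finally have "ennreal \<bar>conv k h y - h y\<bar> = ennreal (norm (LINT z|lborel. k z * (h (z + y) - h y)))" by simp
    also have "\<dots> \<le> (\<integral>\<^sup>+z. ennreal (norm (k z * (h (z + y) - h y))) \<partial>lborel)"
      by (rule integral_norm_bound_ennreal) (use i1 i2 in \<open>simp add: right_diff_distrib add.commute\<close>)
    also have "\<dots> = (\<integral>\<^sup>+z. ennreal (k z * \<bar>h (z + y) - h y\<bar>) \<partial>lborel)"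
      using mollifierD(2)[OF k] by (simp add: abs_mult)
    finally show ?thesis .
  qed
  have "ennreal (LINT y|lborel. \<bar>conv k h y - h y\<bar>) = (\<integral>\<^sup>+y. ennreal \<bar>conv k h y - h y\<bar> \<partial>lborel)"
    by (rule nn_integral_eq_integral[symmetric]) (use ic ih in auto)
  also have "\<dots> \<le> (\<integral>\<^sup>+y. (\<integral>\<^sup>+z. ennreal (k z * \<bar>h (z + y) - h y\<bar>) \<partial>lborel) \<partial>lborel)"
    by (intro nn_integral_mono pt)
  also have "\<dots> = (\<integral>\<^sup>+z. (\<integral>\<^sup>+y. ennreal (k z * \<bar>h (z + y) - h y\<bar>) \<partial>lborel) \<partial>lborel)"
    by (rule lborel_pair.Fubini') measurable
  also have "\<dots> \<le> (\<integral>\<^sup>+z. ennreal (k z) * ennreal e \<partial>lborel)"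
  proof (rule nn_integral_mono)
    fix z :: "real^'d"
    have "(\<integral>\<^sup>+y. ennreal (k z * \<bar>h (z + y) - h y\<bar>) \<partial>lborel) = ennreal (k z * (LINT y|lborel. \<bar>h (z + y) - h y\<bar>))"
      using ihd[of z] mollifierD(2)[OF k] by (subst nn_integral_eq_integral) auto
    also have "\<dots> \<le> ennreal (k z * e)"
    proof (cases "norm z < r")
      case True
      then show ?thesis using \<delta>(2)[of z] r mollifierD(2)[OF k] by (intro ennreal_leI mult_left_mono) auto
    next
      case False
      then show ?thesis using mollifierD(3)[OF k] by simp
    qed
    also have "\<dots> = ennreal (k z) * ennreal e" using mollifierD(2)[OF k] \<open>e > 0\<close> by (simp add: ennreal_mult)
    finally show "(\<integral>\<^sup>+y. ennreal (k z * \<bar>h (z + y) - h y\<bar>) \<partial>lborel) \<le> ennreal (k z) * ennreal e" .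
  qed
  also have "\<dots> = ennreal e" using mollifierD(7)[OF k] by (simp add: nn_integral_multc)
  finally have "(LINT y|lborel. \<bar>conv k h y - h y\<bar>) \<le> e" using \<open>e > 0\<close> by (simp add: ennreal_le_iff)
  then show ?thesis using that[OF r(1,2) k] ic ih by auto
qed

subsection \<open>The fundamental lemma of the calculus of variations\<close>

text \<open>Tested with mollifications of the sign of \<open>g\<close> on the box, which are bounded
  by 1 and have compact support in \<open>U\<close> once the radius is at most \<open>r0\<close>.
  They converge in the mean, hence almost everywhere along a subsequence, and dominated convergence
  shows that the integral of |g| over the box is 0.\<close>

lemma fundamental_lemma_cbox:
  fixes g :: "real^'d::finite \<Rightarrow> real"
  assumes g: "loc_int g" and U: "open U" "cbox a b \<subseteq> U"
    and 0: "\<And>\<phi>. \<phi> \<in> test_functions U \<Longrightarrow> (LINT x|lborel. \<phi> x * g x) = 0"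
  shows "AE x in lborel. x \<in> cbox a b \<longrightarrow> g x = 0"
proof -
  have [measurable]: "g \<in> borel_measurable borel" using g by (simp add: loc_int_def)
  obtain r0 where r0: "r0 > 0" "(\<Union>x\<in>cbox a b. cball x r0) \<subseteq> U"
    using compact_subset_open_imp_cball_epsilon_subset[OF compact_cbox U(1,2)] by blast
  obtain R where R: "\<And>x. x \<in> cbox a b \<Longrightarrow> norm x \<le> R" using bounded_cbox bounded_iff by metis
  define h where "h x = indicator (cbox a b) x * sgn (g x)" for x
  have hm [measurable]: "h \<in> borel_measurable borel" unfolding h_def by measurable
  have hB: "\<bar>h x\<bar> \<le> 1" for x by (auto simp: h_def indicator_def sgn_if)
  have hR: "h x = 0" if "norm x > R" for x using R[of x] that by (auto simp: h_def indicator_def)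
  have hK: "h x = 0" if "x \<notin> cbox a b" for x using that by (simp add: h_def)
  have "\<forall>n. \<exists>\<phi>. \<phi> \<in> test_functions U \<and> (\<forall>x. \<bar>\<phi> x\<bar> \<le> 1) \<and> (\<forall>x. norm x > R + r0 \<longrightarrow> \<phi> x = 0) \<and>
     (LINT y|lborel. \<bar>\<phi> y - h y\<bar>) \<le> 1 / real (Suc n) \<and> integrable lborel (\<lambda>y. \<phi> y - h y)"
  proof
    fix n
    have en: "1 / real (Suc n) > 0" by simp
    obtain r k where k: "0 < r" "r \<le> r0" "mollifier r k"
      "(LINT y|lborel. \<bar>conv k h y - h y\<bar>) \<le> 1 / real (Suc n)" "integrable lborel (\<lambda>y. conv k h y - h y)"
      by (rule mollify_L1[where h=h and B=1 and R=R and e="1 / real (Suc n)", OF hm hB hR en r0(1)])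
    have sup: "\<exists>z\<in>cbox a b. dist z y \<le> r0" if nz: "conv k h y \<noteq> 0" for y
    proof -
      obtain z where z: "z \<in> cbox a b" "norm (z - y) < r"
        by (rule conv_support[OF mollifierD(3)[OF k(3)] hK nz])
      then show ?thesis using k(2) by (intro bexI[of _ z]) (auto simp: dist_norm)
    qed
    define K where "K = {x + y |x y. x \<in> cbox a b \<and> y \<in> cball 0 r0}"
    have "compact K" unfolding K_def by (intro compact_sums compact_cbox compact_cball)
    moreover have "K \<subseteq> U" using r0(2) by (force simp: K_def dist_norm)
    moreover have "conv k h y = 0" if "y \<notin> K" for y
    proof (rule ccontr)
      assume "conv k h y \<noteq> 0"
      then obtain z where z: "z \<in> cbox a b" "dist z y \<le> r0" using sup by blast
      then have "y = z + (y - z)" "y - z \<in> cball 0 r0" by (auto simp: dist_norm norm_minus_commute)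
      then show False using z(1) that unfolding K_def by blast
    qed
    moreover have "Ck j (conv k h)" for j
      by (intro Ck_conv mollifierD(1)[OF k(3)] loc_intI_bounded[OF hm hB])
    ultimately have "conv k h \<in> test_functions U" unfolding test_functions_iff by blast
    moreover have "conv k h y = 0" if "norm y > R + r0" for y
    proof (rule ccontr)
      assume "conv k h y \<noteq> 0"
      then obtain z where "z \<in> cbox a b" "dist z y \<le> r0" using sup by blast
      then show False using R[of z] that norm_triangle_ineq4[of z "z - y"] by (simp add: dist_norm)
    qed
    ultimately show "\<exists>\<phi>. \<phi> \<in> test_functions U \<and> (\<forall>x. \<bar>\<phi> x\<bar> \<le> 1) \<and> (\<forall>x. norm x > R + r0 \<longrightarrow> \<phi> x = 0) \<and>
     (LINT y|lborel. \<bar>\<phi> y - h y\<bar>) \<le> 1 / real (Suc n) \<and> integrable lborel (\<lambda>y. \<phi> y - h y)"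
      using k conv_mollifier_bounded[OF k(3) hm hB] by blast
  qed
  from choice[OF this] obtain \<phi> where "\<forall>n. \<phi> n \<in> test_functions U \<and> (\<forall>x. \<bar>\<phi> n x\<bar> \<le> 1) \<and> (\<forall>x. norm x > R + r0 \<longrightarrow> \<phi> n x = 0) \<and>
     (LINT y|lborel. \<bar>\<phi> n y - h y\<bar>) \<le> 1 / real (Suc n) \<and> integrable lborel (\<lambda>y. \<phi> n y - h y)" by blast
  then have \<phi>: "\<And>n. \<phi> n \<in> test_functions U" "\<And>n x. \<bar>\<phi> n x\<bar> \<le> 1" "\<And>n x. norm x > R + r0 \<Longrightarrow> \<phi> n x = 0"
    "\<And>n. (LINT y|lborel. \<bar>\<phi> n y - h y\<bar>) \<le> 1 / real (Suc n)" "\<And>n. integrable lborel (\<lambda>y. \<phi> n y - h y)"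
    by blast+
  have "(\<lambda>n. \<integral>y. norm (\<phi> n y - h y) \<partial>lborel) \<longlonglongrightarrow> 0"
    by (rule tendsto_sandwich[OF _ _ tendsto_const LIMSEQ_inverse_real_of_nat])
      (use \<phi>(4) in \<open>auto simp: inverse_eq_divide intro!: always_eventually\<close>)
  then obtain s where s: "strict_mono s" "AE x in lborel. (\<lambda>n. \<phi> (s n) x - h x) \<longlonglongrightarrow> 0"
    using tendsto_L1_AE_subseq[of lborel "\<lambda>n y. \<phi> n y - h y", OF \<phi>(5)] by blast
  note [measurable] = test_functionsD(4)[OF \<phi>(1)]
  have ig: "integrable lborel (\<lambda>x. \<bar>indicator (cball 0 (R + r0)) x * g x\<bar>)"
    using g by (intro integrable_abs) (simp add: loc_int_def)
  have "(\<lambda>n. \<integral>x. \<phi> (s n) x * g x \<partial>lborel) \<longlonglongrightarrow> (LINT x|lborel. h x * g x)"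
  proof (rule integral_dominated_convergence[OF _ _ ig])
    show "AE x in lborel. (\<lambda>n. \<phi> (s n) x * g x) \<longlonglongrightarrow> h x * g x"
      using s(2) by (rule eventually_mono) (auto intro!: tendsto_intros simp: LIM_zero_iff)
    show "AE x in lborel. norm (\<phi> (s n) x * g x) \<le> \<bar>indicator (cball 0 (R + r0)) x * g x\<bar>" for n
    proof (rule AE_I2)
      fix x show "norm (\<phi> (s n) x * g x) \<le> \<bar>indicator (cball 0 (R + r0)) x * g x\<bar>"
        using \<phi>(2)[of "s n" x] \<phi>(3)[of x "s n"]
        by (cases "norm x > R + r0") (auto simp: indicator_def abs_mult mult_left_le_one_le)
    qed
  qed measurable
  moreover have "(LINT x|lborel. \<phi> (s n) x * g x) = 0" for n by (rule 0[OF \<phi>(1)])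
  ultimately have "(LINT x|lborel. h x * g x) = 0" by (simp add: LIMSEQ_const_iff)
  moreover have hg: "h x * g x = indicator (cbox a b) x * \<bar>g x\<bar>" for x
    by (auto simp: h_def indicator_def sgn_if)
  moreover have "integrable lborel (\<lambda>x. h x * g x)"
    by (rule loc_int_bound(1)[OF g hm hB hR])
  ultimately have "AE x in lborel. indicator (cbox a b) x * \<bar>g x\<bar> = 0"
    using integral_nonneg_eq_0_iff_AE[of lborel "\<lambda>x. indicator (cbox a b) x * \<bar>g x\<bar>"] by simp
  then show ?thesis by (rule eventually_mono) (auto simp: indicator_def split: if_splits)
qed

text \<open>An open set is a countable union of boxes, so only countably many null sets are
  united.\<close>

lemma fundamental_lemma:
  fixes g :: "real^'d::finite \<Rightarrow> real"
  assumes g: "loc_int g" and U: "open U"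
    and 0: "\<And>\<phi>. \<phi> \<in> test_functions U \<Longrightarrow> (LINT x|lborel. \<phi> x * g x) = 0"
  shows "AE x in lborel. x \<in> U \<longrightarrow> g x = 0"
proof -
  obtain \<D> where \<D>: "countable \<D>" "\<D> \<subseteq> Pow U" "\<And>X. X \<in> \<D> \<Longrightarrow> \<exists>a b. X = cbox a b" "\<Union>\<D> = U"
    using open_countable_Union_open_cbox[OF U] by blast
  have "AE x in lborel. \<forall>X\<in>\<D>. x \<in> X \<longrightarrow> g x = 0"
  proof (subst AE_ball_countable[OF \<D>(1)], rule ballI)
    fix X assume X: "X \<in> \<D>"
    then obtain a b where "X = cbox a b" using \<D>(3) by blast
    then show "AE x in lborel. x \<in> X \<longrightarrow> g x = 0"
      using fundamental_lemma_cbox[OF g U _ 0] X \<D>(2) by blast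
  qed
  then show ?thesis by (rule eventually_mono) (use \<D>(4) in blast)
qed

subsection \<open>Integrals over domains\<close>

lemma AE_lebesgue_on_iff:
  assumes "U \<in> sets lebesgue"
  shows "(AE x in lebesgue_on U. P x) \<longleftrightarrow> (AE x in lborel. x \<in> U \<longrightarrow> P x)"
  using assms by (simp add: AE_restrict_space_iff AE_completion_iff)

text \<open>The function spaces use completed Lebesgue measure on a subset, whereas translation,
  convolution and Tonelli are carried out for Borel functions on the whole space. A Borel function
  that agrees almost everywhere with the extension by 0 links the two.\<close>

lemma lebesgue_on_borel_representative:
  fixes f :: "'a::euclidean_space \<Rightarrow> real"
  assumes U: "U \<in> sets lebesgue" and f: "f \<in> borel_measurable (lebesgue_on U)"
  obtains F where "F \<in> borel_measurable borel" "AE x in lborel. F x = indicator U x * f x"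
proof -
  have "(\<lambda>x. indicator U x *\<^sub>R f x) \<in> borel_measurable lebesgue"
    using f U by (subst borel_measurable_restrict_space_iff[symmetric]) auto
  from completion_ex_borel_measurable_real[OF this] obtain F where
    F: "F \<in> borel_measurable lborel" "AE x in lborel. indicator U x *\<^sub>R f x = F x" by blast
  show ?thesis by (rule that[of F]) (use F in \<open>auto elim: eventually_mono\<close>)
qed

lemma integral_lebesgue_on_lborel:
  fixes f F :: "'a::euclidean_space \<Rightarrow> 'b::{banach,second_countable_topology}"
  assumes U: "U \<in> sets lebesgue" and F: "F \<in> borel_measurable borel"
    and f: "f \<in> borel_measurable (lebesgue_on U)" and e: "AE x in lborel. F x = indicator U x *\<^sub>R f x"
  shows "(LINT x|lebesgue_on U. f x) = (LINT x|lborel. F x)"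
    "integrable (lebesgue_on U) f \<longleftrightarrow> integrable lborel F"
proof -
  have [measurable]: "(\<lambda>x. indicator U x *\<^sub>R f x) \<in> borel_measurable lebesgue"
    using f U by (subst borel_measurable_restrict_space_iff[symmetric]) auto
  have F': "F \<in> borel_measurable lborel" using F by simp
  have [measurable]: "F \<in> borel_measurable lebesgue" using F by (intro measurable_completion) simp
  have e': "AE x in lebesgue. F x = indicator U x *\<^sub>R f x" using e by (rule AE_completion)
  have "(LINT x|lebesgue_on U. f x) = (LINT x|lebesgue. indicator U x *\<^sub>R f x)"
    using U by (simp add: integral_restrict_space)
  also have "\<dots> = (LINT x|lebesgue. F x)"
    by (rule integral_cong_AE) (use e' in \<open>auto elim: eventually_mono\<close>)
  also have "\<dots> = (LINT x|lborel. F x)" by (rule integral_completion[OF F'])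
  finally show "(LINT x|lebesgue_on U. f x) = (LINT x|lborel. F x)" .
  have "integrable (lebesgue_on U) f \<longleftrightarrow> integrable lebesgue (\<lambda>x. indicator U x *\<^sub>R f x)"
    using U by (simp add: integrable_restrict_space)
  also have "\<dots> \<longleftrightarrow> integrable lebesgue F"
    by (rule integrable_cong_AE) (use e' in \<open>auto elim: eventually_mono\<close>)
  also have "\<dots> \<longleftrightarrow> integrable lborel F" by (rule integrable_completion[OF F'])
  finally show "integrable (lebesgue_on U) f \<longleftrightarrow> integrable lborel F" .
qed

lemma borel_measurable_lebesgue_on [measurable_dest]:
  "f \<in> borel_measurable borel \<Longrightarrow> f \<in> borel_measurable (lebesgue_on U)"
  by (intro measurable_restrict_space1 measurable_completion) simp

lemma L2_imp_loc_int:
  fixes F :: "'a::euclidean_space \<Rightarrow> real"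
  assumes "F \<in> L2 lborel"
  shows "loc_int F"
  unfolding loc_int_def
proof (intro conjI allI)
  show "F \<in> borel_measurable borel" using L2D(1)[OF assms] by simp
  fix R :: real
  have [measurable]: "(\<lambda>x::'a. indicator (cball 0 R) x :: real) \<in> borel_measurable borel"
    by (rule borel_measurable_indicator) simp
  have "integrable lborel (\<lambda>x::'a. (norm (indicator (cball 0 R) x :: real))\<^sup>2)"
    by (rule integrable_bounded_support[of _ 1 R]) (measurable, auto simp: indicator_def)
  then have "(\<lambda>x::'a. indicator (cball 0 R) x :: real) \<in> L2 lborel"
    unfolding L2_def using \<open>(\<lambda>x::'a. indicator (cball 0 R) x :: real) \<in> borel_measurable borel\<close> by simp
  from L2_integrable_inner[OF this assms]
  show "integrable lborel (\<lambda>z. indicator (cball 0 R) z * F z)" by simp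
qed

lemma fundamental_lemma_lebesgue_on:
  fixes g :: "real^'d::finite \<Rightarrow> real"
  assumes g: "g \<in> L2 (lebesgue_on U)" and U: "open U"
    and 0: "\<And>\<phi>. \<phi> \<in> test_functions U \<Longrightarrow> (LINT x|lebesgue_on U. g x * \<phi> x) = 0"
  shows "AE x in lebesgue_on U. g x = 0"
proof -
  have U': "U \<in> sets lebesgue" using U by (simp add: sets_completionI_sets)
  obtain F where F [measurable]: "F \<in> borel_measurable borel" "AE x in lborel. F x = indicator U x * g x"
    using lebesgue_on_borel_representative[OF U' L2D(1)[OF g]] .
  have "integrable lborel (\<lambda>x. (norm (F x))\<^sup>2)"
  proof (subst integral_lebesgue_on_lborel(2)[OF U', symmetric])
    show "AE x in lborel. (norm (F x))\<^sup>2 = indicator U x *\<^sub>R (norm (g x))\<^sup>2"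
      using F(2) by (rule eventually_mono) (auto simp: indicator_def)
  qed (use L2D[OF g] in auto)
  then have "F \<in> L2 lborel" by (simp add: L2_def)
  then have lF: "loc_int F" by (rule L2_imp_loc_int)
  have "AE x in lborel. x \<in> U \<longrightarrow> F x = 0"
  proof (rule fundamental_lemma[OF lF U])
    fix \<phi> assume \<phi>: "\<phi> \<in> test_functions U"
    note [measurable] = test_functionsD(4)[OF \<phi>] borel_measurable_lebesgue_on[OF test_functionsD(4)[OF \<phi>]] L2D(1)[OF g]
    have "(LINT x|lebesgue_on U. g x * \<phi> x) = (LINT x|lborel. \<phi> x * F x)"
      by (rule integral_lebesgue_on_lborel(1)[OF U'])
       (use F(2) in \<open>auto elim!: eventually_mono\<close>)
    then show "(LINT x|lborel. \<phi> x * F x) = 0" using 0[OF \<phi>] by simp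
  qed
  then show ?thesis unfolding AE_lebesgue_on_iff[OF U'] using F(2) by eventually_elim auto
qed

subsection \<open>Weak gradients\<close>

lemma open_sets_lebesgue: "open U \<Longrightarrow> U \<in> sets lebesgue"
  by (simp add: sets_completionI_sets)

lemma test_functions_L2:
  assumes "\<phi> \<in> test_functions D" "open U"
  shows "\<phi> \<in> L2 (lebesgue_on U)"
proof -
  obtain R where R: "R > 0" "\<And>x. norm x \<ge> R \<Longrightarrow> \<phi> x = 0" using test_functions_bounded_support[OF assms(1)] by blast
  obtain B where B: "B \<ge> 0" "\<And>x. \<bar>\<phi> x\<bar> \<le> B" using test_functions_bounded[OF assms(1)] by blast
  note [measurable] = test_functionsD(4)[OF assms(1)]
  have "integrable lborel (\<lambda>x. (norm (\<phi> x))\<^sup>2)"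
  proof (rule integrable_bounded_support)
    show "\<bar>(norm (\<phi> x))\<^sup>2\<bar> \<le> B\<^sup>2" for x using power_mono[OF B(2)[of x], of 2] by simp
    show "norm x > R \<Longrightarrow> (norm (\<phi> x))\<^sup>2 = 0" for x using R(2)[of x] by simp
  qed simp
  then have i: "integrable lebesgue (\<lambda>x. (norm (\<phi> x))\<^sup>2)" by (subst integrable_completion) auto
  have "integrable (lebesgue_on U) (\<lambda>x. (norm (\<phi> x))\<^sup>2)"
    using open_sets_lebesgue[OF assms(2)] integrable_mult_indicator[OF _ i, of U]
    by (subst integrable_restrict_space) auto
  then show ?thesis
    by (auto simp: L2_def intro: borel_measurable_lebesgue_on)
qed

lemma cgrad_test_functions_L2:
  assumes "\<phi> \<in> test_functions D" "open U"
  shows "cgrad \<phi> \<in> L2 (lebesgue_on U)"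
  unfolding cgrad_def[abs_def] by (intro L2_vec test_functions_L2[OF pderiv_at_test_functions[OF assms(1)] assms(2)])

lemma integral_lebesgue_on_test_functions:
  assumes "\<phi> \<in> test_functions U" "open U" "f \<in> borel_measurable borel"
  shows "(LINT x|lebesgue_on U. f x * \<phi> x) = (LINT x|lborel. f x * \<phi> x)"
proof (rule integral_lebesgue_on_lborel(1)[OF open_sets_lebesgue[OF assms(2)]])
  note [measurable] = test_functionsD(4)[OF assms(1)] assms(3)
  show "(\<lambda>x. f x * \<phi> x) \<in> borel_measurable borel" by measurable
  then show "(\<lambda>x. f x * \<phi> x) \<in> borel_measurable (lebesgue_on U)" by (rule borel_measurable_lebesgue_on)
  show "AE x in lborel. f x * \<phi> x = indicator U x *\<^sub>R (f x * \<phi> x)"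
    using assms(1) by (intro AE_I2) (auto simp: test_functions_iff indicator_def)
qed

lemma test_functions_has_weak_gradient:
  fixes \<phi> :: "real^'d::finite \<Rightarrow> real"
  assumes "\<phi> \<in> test_functions U" "open U"
  shows "has_weak_gradient U \<phi> (cgrad \<phi>)"
  unfolding has_weak_gradient_def
proof (intro conjI ballI allI)
  fix \<theta> i assume \<theta>: "\<theta> \<in> test_functions U"
  have \<theta>': "\<theta> \<in> test_functions UNIV" using \<theta> test_functions_mono by blast
  show "(LINT x|lebesgue_on U. \<phi> x * pderiv_at \<theta> i x) = - (LINT x|lebesgue_on U. cgrad \<phi> x $ i * \<theta> x)"
    using integral_by_parts_smooth[OF test_functionsD(1)[OF assms(1)] \<theta>', of i]
    by (simp add: integral_lebesgue_on_test_functions[OF \<theta> assms(2) test_functionsD(4)[OF pderiv_at_test_functions[OF assms(1)]]]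
       integral_lebesgue_on_test_functions[OF pderiv_at_test_functions[OF \<theta>] assms(2) test_functionsD(4)[OF assms(1)]])
qed (use assms in \<open>auto intro: test_functions_L2 cgrad_test_functions_L2\<close>)

lemma has_weak_gradientD:
  assumes "has_weak_gradient U v g"
  shows "v \<in> L2 (lebesgue_on U)" "g \<in> L2 (lebesgue_on U)"
    "\<phi> \<in> test_functions U \<Longrightarrow>
      (LINT x|lebesgue_on U. v x * pderiv_at \<phi> i x) = - (LINT x|lebesgue_on U. g x $ i * \<phi> x)"
  using assms by (auto simp: has_weak_gradient_def)

lemma L2_integrable_mult:
  fixes f g :: "'a \<Rightarrow> real"
  assumes "f \<in> L2 M" "g \<in> L2 M"
  shows "integrable M (\<lambda>x. f x * g x)"
  using L2_integrable_inner[OF assms] by simp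

lemma has_weak_gradient_add:
  assumes "has_weak_gradient U v g" "has_weak_gradient U v' g'" "open U"
  shows "has_weak_gradient U (\<lambda>x. v x + v' x) (\<lambda>x. g x + g' x)"
  unfolding has_weak_gradient_def
proof (intro conjI ballI allI)
  fix \<phi> i assume \<phi>: "\<phi> \<in> test_functions U"
  note * = test_functions_L2[OF \<phi> assms(3)] test_functions_L2[OF pderiv_at_test_functions[OF \<phi>] assms(3)]
    has_weak_gradientD(1,2)[OF assms(1)] has_weak_gradientD(1,2)[OF assms(2)]
  show "(LINT x|lebesgue_on U. (v x + v' x) * pderiv_at \<phi> i x) = - (LINT x|lebesgue_on U. (g x + g' x) $ i * \<phi> x)"
    using has_weak_gradientD(3)[OF assms(1) \<phi>] has_weak_gradientD(3)[OF assms(2) \<phi>]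
    by (simp add: distrib_right L2_integrable_mult L2_component *)
qed (intro L2_add has_weak_gradientD(1,2)[OF assms(1)] has_weak_gradientD(1,2)[OF assms(2)])+

lemma has_weak_gradient_cmult:
  assumes "has_weak_gradient U v g"
  shows "has_weak_gradient U (\<lambda>x. c * v x) (\<lambda>x. c *\<^sub>R g x)"
  unfolding has_weak_gradient_def
proof (intro conjI ballI allI)
  fix \<phi> i assume \<phi>: "\<phi> \<in> test_functions U"
  show "(LINT x|lebesgue_on U. (c * v x) * pderiv_at \<phi> i x) = - (LINT x|lebesgue_on U. (c *\<^sub>R g x) $ i * \<phi> x)"
    using has_weak_gradientD(3)[OF assms(1) \<phi>, of i] by (simp add: mult.assoc)
qed (intro L2_mult L2_scaleR has_weak_gradientD(1,2)[OF assms(1)])+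

lemma has_weak_gradient_diff:
  assumes "has_weak_gradient U v g" "has_weak_gradient U v' g'" "open U"
  shows "has_weak_gradient U (\<lambda>x. v x - v' x) (\<lambda>x. g x - g' x)"
  using has_weak_gradient_add[OF assms(1) has_weak_gradient_cmult[OF assms(2), of "-1"] assms(3)] by simp

text \<open>The difference of two weak gradients is a weak gradient of 0, so each component is
  orthogonal to all test functions. This makes norms of \<open>wgrad\<close> independent of the
  choice made by \<open>SOME\<close>.\<close>

lemma has_weak_gradient_unique:
  fixes v :: "real^'d::finite \<Rightarrow> real"
  assumes "has_weak_gradient U v g" "has_weak_gradient U v g'" "open U"
  shows "AE x in lebesgue_on U. g x = g' x"
proof -
  note h = has_weak_gradient_diff[OF assms]
  have "AE x in lebesgue_on U. (g x - g' x) $ i = 0" for i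
  proof (rule fundamental_lemma_lebesgue_on[OF L2_component[OF has_weak_gradientD(2)[OF h]] assms(3)])
    fix \<phi> assume "\<phi> \<in> test_functions U"
    then show "(LINT x|lebesgue_on U. (g x - g' x) $ i * \<phi> x) = 0"
      using has_weak_gradientD(3)[OF h, of \<phi> i] by simp
  qed
  then have "AE x in lebesgue_on U. \<forall>i\<in>UNIV. (g x - g' x) $ i = 0"
    by (intro AE_finite_allI) auto
  then show ?thesis by (rule eventually_mono) (simp add: vec_eq_iff)
qed

lemma H1_has_weak_gradient: "v \<in> H1 U \<Longrightarrow> has_weak_gradient U v (wgrad U v)"
  using someI_ex[of "has_weak_gradient U v"] by (simp add: H1_def wgrad_def)

lemma wgrad_eq:
  assumes "has_weak_gradient U v g" "open U"
  shows "AE x in lebesgue_on U. wgrad U v x = g x"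
  using H1_has_weak_gradient[of v U] assms by (intro has_weak_gradient_unique) (auto simp: H1_def)

lemma H1_wgrad_L2: "v \<in> H1 U \<Longrightarrow> v \<in> L2 (lebesgue_on U)" "v \<in> H1 U \<Longrightarrow> wgrad U v \<in> L2 (lebesgue_on U)"
  using H1_has_weak_gradient has_weak_gradientD by blast+

lemma V_norm_eq:
  assumes "has_weak_gradient U v g" "open U"
  shows "V_norm U v = L2norm (lebesgue_on U) g"
  unfolding V_norm_def
  by (rule L2norm_cong_AE[OF _ _ wgrad_eq[OF assms]])
    (use H1_wgrad_L2(2)[of v U] assms has_weak_gradientD(2)[OF assms(1)] in \<open>auto simp: H1_def dest: L2D\<close>)

lemma H1_norm_eq:
  assumes "has_weak_gradient U v g" "open U"
  shows "H1_norm U v = sqrt ((L2norm (lebesgue_on U) v)\<^sup>2 + (L2norm (lebesgue_on U) g)\<^sup>2)"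
  using V_norm_eq[OF assms] by (simp add: H1_norm_def V_norm_def)

text \<open>Any weak gradient may stand in for the chosen one, and the gradient of the approximant
  becomes the classical \<open>cgrad\<close>. The closure properties of \<open>H10\<close> below are
  proved through this form.\<close>

lemma H10_iff:
  fixes v :: "real^'d::finite \<Rightarrow> real"
  assumes v: "has_weak_gradient U v g" and U: "open U"
  shows "v \<in> H10 U \<longleftrightarrow> (\<forall>e>0. \<exists>\<phi>\<in>test_functions U. L2norm (lebesgue_on U) (\<lambda>x. v x - \<phi> x) < e \<and>
     L2norm (lebesgue_on U) (\<lambda>x. g x - cgrad \<phi> x) < e)" (is "_ \<longleftrightarrow> ?R")
proof -
  have v1: "v \<in> H1 U" using v by (auto simp: H1_def)
  have n: "H1_norm U (\<lambda>x. v x - \<phi> x) = sqrt ((L2norm (lebesgue_on U) (\<lambda>x. v x - \<phi> x))\<^sup>2 +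
     (L2norm (lebesgue_on U) (\<lambda>x. g x - cgrad \<phi> x))\<^sup>2)" if "\<phi> \<in> test_functions U" for \<phi>
    by (rule H1_norm_eq[OF has_weak_gradient_diff[OF v test_functions_has_weak_gradient[OF that U] U] U])
  show ?thesis
  proof
    assume H: "v \<in> H10 U"
    show ?R
    proof (intro allI impI)
      fix e :: real assume "e > 0"
      then obtain \<phi> where \<phi>: "\<phi> \<in> test_functions U" "H1_norm U (\<lambda>x. v x - \<phi> x) < e"
        using H by (auto simp: H10_def)
      let ?a = "L2norm (lebesgue_on U) (\<lambda>x. v x - \<phi> x)" and ?b = "L2norm (lebesgue_on U) (\<lambda>x. g x - cgrad \<phi> x)"
      have "?a \<le> sqrt (?a\<^sup>2 + ?b\<^sup>2)" "?b \<le> sqrt (?a\<^sup>2 + ?b\<^sup>2)"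
        by (auto intro!: real_le_rsqrt)
      with \<phi>(2)[unfolded n[OF \<phi>(1)]] have "?a < e" "?b < e" by linarith+
      then show "\<exists>\<phi>\<in>test_functions U. L2norm (lebesgue_on U) (\<lambda>x. v x - \<phi> x) < e \<and>
         L2norm (lebesgue_on U) (\<lambda>x. g x - cgrad \<phi> x) < e"
        using \<phi>(1) by blast
    qed
  next
    assume R: ?R
    show "v \<in> H10 U"
      unfolding H10_def mem_Collect_eq
    proof (intro conjI v1 allI impI)
      fix e :: real assume "e > 0"
      then obtain \<phi> where \<phi>: "\<phi> \<in> test_functions U" "L2norm (lebesgue_on U) (\<lambda>x. v x - \<phi> x) < e/2"
         "L2norm (lebesgue_on U) (\<lambda>x. g x - cgrad \<phi> x) < e/2"
        using R half_gt_zero by blast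
      have "H1_norm U (\<lambda>x. v x - \<phi> x) \<le> L2norm (lebesgue_on U) (\<lambda>x. v x - \<phi> x) + L2norm (lebesgue_on U) (\<lambda>x. g x - cgrad \<phi> x)"
        unfolding n[OF \<phi>(1)] by (rule sqrt_sum_squares_le_sum) auto
      then show "\<exists>\<phi>\<in>test_functions U. H1_norm U (\<lambda>x. v x - \<phi> x) < e"
        using \<phi> by (intro bexI[of _ \<phi>]) auto
    qed
  qed
qed

lemma H10_has_weak_gradient: "v \<in> H10 U \<Longrightarrow> has_weak_gradient U v (wgrad U v)"
  by (rule H1_has_weak_gradient) (simp add: H10_def)

lemma H10_wgrad_L2: "v \<in> H10 U \<Longrightarrow> wgrad U v \<in> L2 (lebesgue_on U)"
  using H10_has_weak_gradient has_weak_gradientD(2) by blast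

lemma test_functions_subset_H10:
  assumes "\<phi> \<in> test_functions U" "open U"
  shows "\<phi> \<in> H10 U"
  unfolding H10_iff[OF test_functions_has_weak_gradient[OF assms] assms(2)]
  using assms(1) by (auto intro!: bexI[of _ \<phi>] simp: L2norm_def)

lemma cgrad_add:
  assumes "\<phi> \<in> test_functions U" "\<psi> \<in> test_functions U"
  shows "cgrad (\<lambda>x. \<phi> x + \<psi> x) = (\<lambda>x. cgrad \<phi> x + cgrad \<psi> x)"
  by (rule ext) (simp add: vec_eq_iff pderiv_at_add test_functionsD(2)[OF assms(1)] test_functionsD(2)[OF assms(2)])

lemma cgrad_cmult:
  assumes "\<phi> \<in> test_functions U"
  shows "cgrad (\<lambda>x. c * \<phi> x) = (\<lambda>x. c *\<^sub>R cgrad \<phi> x)"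
  by (rule ext) (simp add: vec_eq_iff pderiv_at_mult test_functionsD(2)[OF assms(1)])

lemma H10_add:
  assumes u: "u \<in> H10 U" and v: "v \<in> H10 U" and U: "open U"
  shows "(\<lambda>x. u x + v x) \<in> H10 U"
proof -
  note hu = H10_has_weak_gradient[OF u] and hv = H10_has_weak_gradient[OF v]
  show ?thesis
    unfolding H10_iff[OF has_weak_gradient_add[OF hu hv U] U]
  proof (intro allI impI)
    fix e :: real assume "e > 0"
    then have e2: "e / 2 > 0" by simp
    obtain \<phi> where \<phi>: "\<phi> \<in> test_functions U" "L2norm (lebesgue_on U) (\<lambda>x. u x - \<phi> x) < e/2"
      "L2norm (lebesgue_on U) (\<lambda>x. wgrad U u x - cgrad \<phi> x) < e/2"
      using u e2 unfolding H10_iff[OF hu U] by blast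
    obtain \<psi> where \<psi>: "\<psi> \<in> test_functions U" "L2norm (lebesgue_on U) (\<lambda>x. v x - \<psi> x) < e/2"
      "L2norm (lebesgue_on U) (\<lambda>x. wgrad U v x - cgrad \<psi> x) < e/2"
      using v e2 unfolding H10_iff[OF hv U] by blast
    have 1: "L2norm (lebesgue_on U) (\<lambda>x. (u x - \<phi> x) + (v x - \<psi> x)) \<le>
       L2norm (lebesgue_on U) (\<lambda>x. u x - \<phi> x) + L2norm (lebesgue_on U) (\<lambda>x. v x - \<psi> x)"
      by (intro L2norm_triangle L2_diff has_weak_gradientD(1)[OF hu] has_weak_gradientD(1)[OF hv] test_functions_L2[OF \<phi>(1) U] test_functions_L2[OF \<psi>(1) U])
    have 2: "L2norm (lebesgue_on U) (\<lambda>x. (wgrad U u x - cgrad \<phi> x) + (wgrad U v x - cgrad \<psi> x)) \<le>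
       L2norm (lebesgue_on U) (\<lambda>x. wgrad U u x - cgrad \<phi> x) + L2norm (lebesgue_on U) (\<lambda>x. wgrad U v x - cgrad \<psi> x)"
      by (intro L2norm_triangle L2_diff has_weak_gradientD(2)[OF hu] has_weak_gradientD(2)[OF hv] cgrad_test_functions_L2[OF \<phi>(1) U] cgrad_test_functions_L2[OF \<psi>(1) U])
    show "\<exists>\<theta>\<in>test_functions U. L2norm (lebesgue_on U) (\<lambda>x. u x + v x - \<theta> x) < e \<and>
       L2norm (lebesgue_on U) (\<lambda>x. wgrad U u x + wgrad U v x - cgrad \<theta> x) < e"
    proof (intro bexI[of _ "\<lambda>x. \<phi> x + \<psi> x"] conjI)
      show "(\<lambda>x. \<phi> x + \<psi> x) \<in> test_functions U" by (rule test_functions_add[OF \<phi>(1) \<psi>(1)])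
      show "L2norm (lebesgue_on U) (\<lambda>x. u x + v x - (\<phi> x + \<psi> x)) < e"
        using 1 \<phi>(2) \<psi>(2) by (simp add: algebra_simps)
      show "L2norm (lebesgue_on U) (\<lambda>x. wgrad U u x + wgrad U v x - cgrad (\<lambda>x. \<phi> x + \<psi> x) x) < e"
        unfolding cgrad_add[OF \<phi>(1) \<psi>(1)] using 2 \<phi>(3) \<psi>(3) by (simp add: algebra_simps)
    qed
  qed
qed

lemma H10_cmult:
  assumes u: "u \<in> H10 U" and U: "open U"
  shows "(\<lambda>x. c * u x) \<in> H10 U"
proof -
  note hu = H10_has_weak_gradient[OF u]
  show ?thesis
    unfolding H10_iff[OF has_weak_gradient_cmult[OF hu] U]
  proof (intro allI impI)
    fix e :: real assume "e > 0"
    define e' where "e' = e / (\<bar>c\<bar> + 1)"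
    have e': "e' > 0" "\<bar>c\<bar> * e' < e" using \<open>e > 0\<close> by (auto simp: e'_def field_simps)
    obtain \<phi> where \<phi>: "\<phi> \<in> test_functions U" "L2norm (lebesgue_on U) (\<lambda>x. u x - \<phi> x) < e'"
      "L2norm (lebesgue_on U) (\<lambda>x. wgrad U u x - cgrad \<phi> x) < e'"
      using u e'(1) unfolding H10_iff[OF hu U] by blast
    have "\<bar>c\<bar> * L2norm (lebesgue_on U) (\<lambda>x. u x - \<phi> x) \<le> \<bar>c\<bar> * e'"
      "\<bar>c\<bar> * L2norm (lebesgue_on U) (\<lambda>x. wgrad U u x - cgrad \<phi> x) \<le> \<bar>c\<bar> * e'"
      using \<phi> by (auto intro: mult_left_mono)
    then show "\<exists>\<phi>\<in>test_functions U. L2norm (lebesgue_on U) (\<lambda>x. c * u x - \<phi> x) < e \<and>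
       L2norm (lebesgue_on U) (\<lambda>x. c *\<^sub>R wgrad U u x - cgrad \<phi> x) < e"
      using test_functions_cmult[OF \<phi>(1), of c] e'(2)
        L2norm_scaleR[of "lebesgue_on U" c "\<lambda>x. u x - \<phi> x"] L2norm_scaleR[of "lebesgue_on U" c "\<lambda>x. wgrad U u x - cgrad \<phi> x"]
      by (intro bexI[of _ "\<lambda>x. c * \<phi> x"]) (auto simp: cgrad_cmult[OF \<phi>(1)] algebra_simps)
  qed
qed

lemma H10_diff:
  assumes "u \<in> H10 U" "v \<in> H10 U" "open U"
  shows "(\<lambda>x. u x - v x) \<in> H10 U"
  using H10_add[OF assms(1) H10_cmult[OF assms(2,3), of "-1"] assms(3)] by simp

lemma H10_zero: "open U \<Longrightarrow> (\<lambda>x. 0) \<in> H10 U"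
  by (rule test_functions_subset_H10[OF test_functions_zero])

lemma H10_sum:
  assumes "\<And>i. i \<in> I \<Longrightarrow> v i \<in> H10 U" "open U"
  shows "(\<lambda>x. \<Sum>i\<in>I. v i x) \<in> H10 U"
  using assms by (induction I rule: infinite_finite_induct) (auto intro: H10_add H10_zero)

lemma has_weak_gradient_sum:
  assumes "\<And>i. i \<in> I \<Longrightarrow> has_weak_gradient U (v i) (g i)" "open U"
  shows "has_weak_gradient U (\<lambda>x. \<Sum>i\<in>I. v i x) (\<lambda>x. \<Sum>i\<in>I. g i x)"
proof -
  have z: "has_weak_gradient U (\<lambda>x. 0) (\<lambda>x. 0)" by (simp add: has_weak_gradient_def)
  show ?thesis using assms
    by (induction I rule: infinite_finite_induct) (auto intro: z has_weak_gradient_add)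
qed

text \<open>Density of test functions in the gradient norm and Cauchy-Schwarz. It is applied to
  fluxes along orbits and to constant fields.\<close>

lemma divergence_free_H10:
  fixes \<sigma> :: "real^'d::finite \<Rightarrow> real^'d"
  assumes \<sigma>: "\<sigma> \<in> L2 (lebesgue_on U)" and U: "open U" and v: "v \<in> H10 U"
    and 0: "\<And>\<phi>. \<phi> \<in> test_functions U \<Longrightarrow> (LINT x|lebesgue_on U. \<sigma> x \<bullet> cgrad \<phi> x) = 0"
  shows "(LINT x|lebesgue_on U. \<sigma> x \<bullet> wgrad U v x) = 0"
proof -
  note hv = H10_has_weak_gradient[OF v]
  have "\<bar>LINT x|lebesgue_on U. \<sigma> x \<bullet> wgrad U v x\<bar> \<le> e" if "e > 0" for e
  proof -
    let ?n = "L2norm (lebesgue_on U) \<sigma>"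
    define e' where "e' = e / (?n + 1)"
    have "?n + 1 > 0" by (rule add_nonneg_pos) simp_all
    then have e': "e' > 0" "?n * e' \<le> e" using that by (auto simp: e'_def pos_divide_le_eq mult.commute)
    obtain \<phi> where \<phi>: "\<phi> \<in> test_functions U" "L2norm (lebesgue_on U) (\<lambda>x. wgrad U v x - cgrad \<phi> x) < e'"
      using v e'(1) unfolding H10_iff[OF hv U] by blast
    have c: "cgrad \<phi> \<in> L2 (lebesgue_on U)" by (rule cgrad_test_functions_L2[OF \<phi>(1) U])
    note w = has_weak_gradientD(2)[OF hv]
    have "(LINT x|lebesgue_on U. \<sigma> x \<bullet> wgrad U v x) = (LINT x|lebesgue_on U. \<sigma> x \<bullet> (wgrad U v x - cgrad \<phi> x))"
      using 0[OF \<phi>(1)] L2_integrable_inner[OF \<sigma> c] L2_integrable_inner[OF \<sigma> w] by (simp add: inner_diff_right)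
    then have "\<bar>LINT x|lebesgue_on U. \<sigma> x \<bullet> wgrad U v x\<bar> \<le> ?n * L2norm (lebesgue_on U) (\<lambda>x. wgrad U v x - cgrad \<phi> x)"
      using L2_Cauchy_Schwarz[OF \<sigma> L2_diff[OF w c]] by simp
    also have "\<dots> \<le> ?n * e'" using \<phi>(2) by (intro mult_left_mono) auto
    finally show ?thesis using e'(2) by linarith
  qed
  then have "\<bar>LINT x|lebesgue_on U. \<sigma> x \<bullet> wgrad U v x\<bar> \<le> 0"
    by (rule field_le_epsilon) simp
  then show ?thesis by simp
qed

text \<open>Integration by parts in each component; the compact support of \<open>\<phi>\<close> in
  \<open>U\<close> lets the integral over \<open>U\<close> be taken over the whole space.\<close>

lemma integral_inner_cgrad_smooth:
  fixes \<sigma> :: "real^'d::finite \<Rightarrow> real^'d"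
  assumes sm: "\<And>i k. Ck k (\<lambda>y. \<sigma> y $ i)" and \<phi>: "\<phi> \<in> test_functions U" and U: "open U"
    and 0: "AE y in lborel. (\<Sum>i\<in>UNIV. pderiv_at (\<lambda>y. \<sigma> y $ i) i y) = 0"
  shows "(LINT x|lebesgue_on U. \<sigma> x \<bullet> cgrad \<phi> x) = 0"
proof -
  have \<phi>': "\<phi> \<in> test_functions UNIV" using \<phi> test_functions_mono by blast
  note [measurable] = test_functionsD(4)[OF \<phi>] test_functionsD(4)[OF pderiv_at_test_functions[OF \<phi>]]
  have m: "(\<lambda>y. \<sigma> y $ i) \<in> borel_measurable borel" for i
    using sm[of 0 i] by (intro borel_measurable_continuous_onI) simp
  have p: "Ck k (pderiv_at (\<lambda>y. \<sigma> y $ i) i)" for i k using sm[of "Suc k" i] by simp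
  have i1: "integrable lborel (\<lambda>x. \<sigma> x $ i * pderiv_at \<phi> i x)" for i
    by (intro test_functions_integrable[of _ UNIV] test_functions_mult_smooth pderiv_at_test_functions \<phi>' sm)
  have i2: "integrable lborel (\<lambda>x. pderiv_at (\<lambda>y. \<sigma> y $ i) i x * \<phi> x)" for i
    by (intro test_functions_integrable[of _ UNIV] test_functions_mult_smooth \<phi>' p)
  have f0: "pderiv_at \<phi> i x = 0" if "x \<notin> U" for x i
    using pderiv_at_test_functions[OF \<phi>, of i] that by (auto simp: test_functions_iff)
  have [measurable]: "(\<lambda>x. \<sigma> x \<bullet> cgrad \<phi> x) \<in> borel_measurable borel"
    unfolding inner_vec_def inner_real_def cgrad_nth using m by measurable
  then have [measurable]: "(\<lambda>x. \<sigma> x \<bullet> cgrad \<phi> x) \<in> borel_measurable (lebesgue_on U)"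
    by (rule borel_measurable_lebesgue_on)
  have "(LINT x|lebesgue_on U. \<sigma> x \<bullet> cgrad \<phi> x) = (LINT x|lborel. \<sigma> x \<bullet> cgrad \<phi> x)"
    by (rule integral_lebesgue_on_lborel(1)[OF open_sets_lebesgue[OF U]])
      (measurable, auto simp: inner_vec_def indicator_def f0 intro!: AE_I2)
  also have "\<dots> = (\<Sum>i\<in>UNIV. \<integral>x. \<sigma> x $ i * pderiv_at \<phi> i x \<partial>lborel)"
    using i1 by (simp add: inner_vec_def)
  also have "\<dots> = - (\<Sum>i\<in>UNIV. \<integral>x. pderiv_at (\<lambda>y. \<sigma> y $ i) i x * \<phi> x \<partial>lborel)"
    using integral_by_parts_smooth[OF sm \<phi>'] by (simp add: sum_negf)
  also have "\<dots> = - (LINT x|lborel. (\<Sum>i\<in>UNIV. pderiv_at (\<lambda>y. \<sigma> y $ i) i x) * \<phi> x)"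
    using i2 by (simp add: sum_distrib_right)
  also have "(LINT x|lborel. (\<Sum>i\<in>UNIV. pderiv_at (\<lambda>y. \<sigma> y $ i) i x) * \<phi> x) = 0"
    by (rule integral_eq_zero_AE) (use 0 in \<open>auto elim: eventually_mono\<close>)
  finally show ?thesis by simp
qed

text \<open>Constant fields are divergence free. This orthogonality between constants and gradients
  separates \<open>h\<close> from the corrector part in \<open>cell_estimate\<close>.\<close>

lemma integral_const_inner_wgrad:
  fixes v :: "real^'d::finite \<Rightarrow> real"
  assumes U: "open U" "bounded U" and v: "v \<in> H10 U"
  shows "(LINT x|lebesgue_on U. c \<bullet> wgrad U v x) = 0"
proof (rule divergence_free_H10[OF _ U(1) v])
  have "U \<in> lmeasurable" using U by (simp add: lmeasurable_open)
  then interpret finite_measure "lebesgue_on U" by (simp add: finite_measure_lebesgue_on)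
  show "(\<lambda>x. c) \<in> L2 (lebesgue_on U)" by simp
  show "(LINT x|lebesgue_on U. c \<bullet> cgrad \<phi> x) = 0" if "\<phi> \<in> test_functions U" for \<phi>
    by (rule integral_inner_cgrad_smooth[OF _ that U(1)]) auto
qed

text \<open>The gap between \<open>s\<close> and 1 is cut into three steps of length
  \<open>r\<close>: the indicator of the closed cube of half side \<open>s + r\<close>, mollified
  with radius \<open>r\<close>, equals 1 on \<open>cube s\<close> and vanishes off the closed cube
  of half side \<open>s + 2 * r\<close>.\<close>

lemma cutoff_exists:
  assumes "0 < s" "s < 1"
  obtains \<eta> :: "real^'d::finite \<Rightarrow> real" where "\<eta> \<in> test_functions (cube 1)" "\<And>y. 0 \<le> \<eta> y" "\<And>y. \<eta> y \<le> 1" "\<And>y. y \<in> cube s \<Longrightarrow> \<eta> y = 1"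
proof -
  define r where "r = (1 - s) / 3"
  have r: "r > 0" "s + 3 * r = 1" using assms by (auto simp: r_def field_simps)
  obtain k :: "real^'d \<Rightarrow> real" where k: "mollifier r k" using mollifier_exists[OF r(1)] by blast
  define h :: "real^'d \<Rightarrow> real" where "h = indicator (cbox (vec (- (s + r))) (vec (s + r)))"
  have h01: "0 \<le> h x" "h x \<le> 1" for x by (auto simp: h_def indicator_def)
  have hm [measurable]: "h \<in> borel_measurable borel" unfolding h_def by (rule borel_measurable_indicator) simp
  note [measurable] = mollifierD(5)[OF k]
  have lh: "loc_int h" by (rule loc_intI_bounded[of _ 1]) (use h01 in \<open>auto simp: abs_of_nonneg\<close>)
  have mem: "x \<in> cbox (vec (- (s + r))) (vec (s + r)) \<longleftrightarrow> (\<forall>i. \<bar>x $ i\<bar> \<le> s + r)" for x :: "real^'d"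
  proof -
    have "(- (s + r) \<le> t \<and> t \<le> s + r) = (\<bar>t\<bar> \<le> s + r)" for t by arith
    then show ?thesis by (simp only: mem_box_cart vec_component)
  qed
  have c: "conv k h y = (LINT z|lborel. k z * h (y + z))" for y by (rule conv_alt) auto
  have int: "integrable lborel (\<lambda>z. k z * h (y + z))" for y
    by (rule test_functions_integrable_mult[OF mollifierD(1)[OF k]], rule loc_intI_bounded[of _ 1])
      (use h01 in \<open>auto simp: abs_of_nonneg\<close>)
  have n: "\<bar>z $ i\<bar> \<le> norm z" for z :: "real^'d" and i by (rule component_le_norm_cart)
  define K :: "(real^'d) set" where "K = cbox (vec (- (s + 2 * r))) (vec (s + 2 * r))"
  show ?thesis
  proof (rule that[of "conv k h"])
    show "conv k h \<in> test_functions (cube 1)"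
      unfolding test_functions_iff
    proof (intro conjI allI exI[of _ K] impI)
      show "Ck j (conv k h)" for j by (rule Ck_conv[OF mollifierD(1)[OF k] lh])
      show "compact K" by (simp add: K_def)
      show "K \<subseteq> cube 1"
      proof
        fix x :: "real^'d" assume "x \<in> K"
        then have "- (s + 2 * r) \<le> x $ i" "x $ i \<le> s + 2 * r" for i by (auto simp: mem_box_cart K_def)
        then have "- 1 < x $ i \<and> x $ i < 1" for i using r by (smt (verit))
        then show "x \<in> cube 1" by (simp add: cube_def)
      qed
      fix y :: "real^'d" assume y: "y \<notin> K"
      show "conv k h y = 0"
      proof (rule ccontr)
        assume nz: "conv k h y \<noteq> 0"
        obtain z where z: "z \<in> cbox (vec (- (s + r))) (vec (s + r))" "norm (z - y) < r"
          by (rule conv_support[OF mollifierD(3)[OF k] _ nz, of r "cbox (vec (- (s + r))) (vec (s + r))"])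
            (auto simp: h_def)
        have "- (s + 2 * r) \<le> y $ i \<and> y $ i \<le> s + 2 * r" for i
          using z(1)[unfolded mem, rule_format, of i] n[of "z - y" i] z(2) by (auto simp: abs_le_iff)
        then have "y \<in> K" unfolding K_def mem_box_cart vec_component by blast
        then show False using y by simp
      qed
    qed
    show "0 \<le> conv k h y" for y unfolding c using h01 mollifierD(2)[OF k] by simp
    show "conv k h y \<le> 1" for y
    proof -
      have "conv k h y \<le> (LINT z|lborel. k z)" unfolding c
        by (rule integral_mono[OF int mollifierD(6)[OF k]]) (use h01 mollifierD(2)[OF k] in \<open>simp add: mult_left_le\<close>)
      then show ?thesis using mollifierD(4)[OF k] by simp
    qed
    show "conv k h y = 1" if y: "y \<in> cube s" for y
    proof -
      have "k z * h (y + z) = k z" for z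
      proof (cases "norm z < r")
        case True
        have "\<bar>(y + z) $ i\<bar> \<le> s + r" for i
        proof -
          have "- s < y $ i" "y $ i < s" using y by (auto simp: cube_def)
          then show ?thesis using n[of z i] True by (auto simp: abs_le_iff)
        qed
        then have "y + z \<in> cbox (vec (- (s + r))) (vec (s + r))" by (simp only: mem) simp
        then show ?thesis by (simp add: h_def)
      next
        case False
        then show ?thesis using mollifierD(3)[OF k] by simp
      qed
      then have "(\<lambda>z. k z * h (y + z)) = k" by blast
      then show ?thesis unfolding c using mollifierD(4)[OF k] by (simp only:)
    qed
  qed
qed

subsection \<open>Cubes\<close>

lemma cube_eq_box: "(cube \<rho> :: (real^'d::finite) set) = box (vec (- \<rho>)) (vec \<rho>)"
  by (auto simp: cube_def mem_box_cart)

lemma open_cube [simp]: "open (cube \<rho>)" and bounded_cube [simp]: "bounded (cube \<rho>)"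
  and cube_borel [measurable, simp]: "cube \<rho> \<in> sets borel"
  unfolding cube_eq_box by (auto simp: bounded_box)

lemma cube_mono:
  assumes "r \<le> s"
  shows "cube r \<subseteq> cube s"
proof
  fix y assume "y \<in> cube r"
  then have "- s < y $ i \<and> y $ i < s" for i
    using assms by (simp add: cube_def) (meson le_less_trans neg_le_iff_le order_less_le_trans)
  then show "y \<in> cube s" by (simp add: cube_def)
qed

lemma emeasure_cube:
  assumes "\<rho> \<ge> 0"
  shows "emeasure lborel (cube \<rho> :: (real^'d::finite) set) = ennreal ((2 * \<rho>) ^ CARD('d))"
proof -
  have "emeasure lborel (cube \<rho> :: (real^'d) set) = ennreal (\<Prod>b\<in>(Basis::(real^'d) set). (vec \<rho> - vec (- \<rho>)) \<bullet> b)"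
    unfolding cube_eq_box
    by (rule emeasure_lborel_box) (use assms in \<open>auto simp: Basis_vec_def inner_axis\<close>)
  also have "(\<Prod>b\<in>(Basis::(real^'d) set). (vec \<rho> - vec (- \<rho>)) \<bullet> b) = (\<Prod>b\<in>(Basis::(real^'d) set). 2 * \<rho>)"
    by (rule prod.cong) (auto simp: Basis_vec_def inner_axis)
  also have "\<dots> = (2 * \<rho>) ^ CARD('d)" by simp
  finally show ?thesis .
qed

lemma measure_cube:
  assumes "\<rho> \<ge> 0"
  shows "measure lborel (cube \<rho> :: (real^'d::finite) set) = (2 * \<rho>) ^ CARD('d)"
  using emeasure_cube[OF assms, where 'd='d] assms by (simp add: measure_def)

lemma norm_le_cube:
  assumes "y \<in> cube \<rho>"
  shows "norm (y :: real^'d::finite) \<le> sqrt (CARD('d)) * \<rho>"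
proof -
  have c: "\<bar>y $ i\<bar> \<le> \<rho>" for i using assms by (auto simp: cube_def abs_le_iff less_imp_le) (metis less_imp_le minus_le_iff)
  have "norm y \<le> L2_set (\<lambda>i. \<rho>) (UNIV::'d set)"
    unfolding norm_vec_def by (intro L2_set_mono) (use c in auto)
  also have "\<dots> = sqrt (CARD('d)) * \<bar>\<rho>\<bar>" by (simp add: L2_set_def real_sqrt_mult)
  also have "\<bar>\<rho>\<bar> = \<rho>" using c[of undefined] by linarith
  finally show ?thesis .
qed

lemma cube_add:
  assumes "y \<in> cube r" "norm z \<le> s"
  shows "y + z \<in> cube (r + s)"
proof -
  have "\<bar>z $ i\<bar> \<le> s" for i using component_le_norm_cart[of z i] assms(2) by linarith
  then have "- (r + s) < (y + z) $ i \<and> (y + z) $ i < r + s" for i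
    using assms(1) by (auto simp: cube_def abs_le_iff) (smt (verit))+
  then show ?thesis by (simp add: cube_def)
qed

lemma norm_less_cube: "norm z < r \<Longrightarrow> z \<in> cube r"
  using component_le_norm_cart[of z] by (auto simp: cube_def) (smt (verit))+

text \<open>Enclosing the ball in a cube gives a crude bound, which is enough for the constant of
  the maximal inequality.\<close>

lemma emeasure_ball_le:
  assumes "r > 0"
  shows "emeasure lborel (ball (c::real^'d::finite) r) \<le> ennreal ((2 * r) ^ CARD('d))"
proof -
  have "emeasure lborel (ball c r) \<le> emeasure lborel (box (c - vec r) (c + vec r))"
  proof (rule emeasure_mono)
    show "ball c r \<subseteq> box (c - vec r) (c + vec r)"
    proof
      fix x assume "x \<in> ball c r"
      then have "norm (x - c) < r" by (simp add: dist_norm norm_minus_commute)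
      then have "x - c \<in> cube r" by (rule norm_less_cube)
      then have "c $ i - r < x $ i \<and> x $ i < c $ i + r" for i unfolding cube_def by (auto simp: algebra_simps)
      then show "x \<in> box (c - vec r) (c + vec r)" unfolding mem_box_cart by simp
    qed
  qed simp
  also have "\<dots> = ennreal (\<Prod>b\<in>(Basis::(real^'d) set). (c + vec r - (c - vec r)) \<bullet> b)"
    by (rule emeasure_lborel_box) (use assms in \<open>auto simp: Basis_vec_def inner_axis\<close>)
  also have "(\<Prod>b\<in>(Basis::(real^'d) set). (c + vec r - (c - vec r)) \<bullet> b) = (\<Prod>b\<in>(Basis::(real^'d) set). 2 * r)"
    by (rule prod.cong) (auto simp: Basis_vec_def inner_axis)
  also have "\<dots> = (2 * r) ^ CARD('d)" by simp
  finally show ?thesis .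
qed

subsection \<open>Ergodic dynamical systems\<close>

locale ergodic = prob_space M for M :: "'w measure" +
  fixes T :: "real^'d::finite \<Rightarrow> 'w \<Rightarrow> 'w"
  assumes system: "ergodic_system M T"
begin

sublocale YM: pair_sigma_finite lborel M ..

lemma T_pair [measurable]: "(\<lambda>(y, \<omega>). T y \<omega>) \<in> borel \<Otimes>\<^sub>M M \<rightarrow>\<^sub>M M"
  using system by (simp add: ergodic_system_def)

lemma T_comp [measurable (raw)]:
  assumes "f \<in> borel_measurable N" "g \<in> N \<rightarrow>\<^sub>M M"
  shows "(\<lambda>x. T (f x) (g x)) \<in> N \<rightarrow>\<^sub>M M"
proof -
  have "(\<lambda>x. (f x, g x)) \<in> N \<rightarrow>\<^sub>M borel \<Otimes>\<^sub>M M" using assms by measurable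
  from measurable_compose[OF this T_pair] show ?thesis by simp
qed

lemma T_space [simp]: "\<omega> \<in> space M \<Longrightarrow> T y \<omega> \<in> space M"
  using measurable_space[OF T_pair, of "(y, \<omega>)"] by (simp add: space_pair_measure)

lemma T_add: "\<omega> \<in> space M \<Longrightarrow> T y (T z \<omega>) = T (y + z) \<omega>"
  using system by (simp add: ergodic_system_def)

lemma distr_T: "distr M M (T y) = M"
  using system by (simp add: ergodic_system_def)

lemma T_orbit_measurable:
  "\<omega> \<in> space M \<Longrightarrow> (\<lambda>y. T y \<omega>) \<in> borel \<rightarrow>\<^sub>M M"
  by (rule T_comp) auto

lemma T_measurable: "T y \<in> M \<rightarrow>\<^sub>M M"
  using T_comp[of "\<lambda>_. y" M "\<lambda>x. x"] by simp

lemma AE_shift: "(AE \<omega> in M. P \<omega>) \<Longrightarrow> AE \<omega> in M. P (T y \<omega>)"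
  by (rule AE_distrD[OF T_measurable]) (subst distr_T)

lemma nn_integral_shift:
  "f \<in> borel_measurable M \<Longrightarrow> (\<integral>\<^sup>+\<omega>. f (T y \<omega>) \<partial>M) = (\<integral>\<^sup>+\<omega>. f \<omega> \<partial>M)"
  using nn_integral_distr[of "T y" M M f] distr_T[of y] by simp

lemma integral_shift:
  fixes f :: "'w \<Rightarrow> 'b::{banach,second_countable_topology}"
  shows "f \<in> borel_measurable M \<Longrightarrow> (LINT \<omega>|M. f (T y \<omega>)) = (LINT \<omega>|M. f \<omega>)"
  using integral_distr[of "T y" M M f] distr_T[of y] by simp

lemma integrable_shift:
  fixes f :: "'w \<Rightarrow> 'b::{banach,second_countable_topology}"
  shows "f \<in> borel_measurable M \<Longrightarrow> integrable M (\<lambda>\<omega>. f (T y \<omega>)) \<longleftrightarrow> integrable M f"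
  using integrable_distr_eq[of "T y" M M f] distr_T[of y] by simp

lemma invariant_zero_one:
  assumes "B \<in> sets M" "\<And>y. T y -` B \<inter> space M = B"
  shows "prob B = 0 \<or> prob B = 1"
  using system assms by (simp add: ergodic_system_def)

text \<open>Invariance makes each shifted exceptional set null, and Tonelli exchanges the
  quantifiers over \<open>y\<close> and \<omega>. \<open>P\<close> need not be measurable, hence the
  passage to a measurable null set \<open>N\<close>.\<close>

lemma AE_orbit:
  assumes "AE \<omega> in M. P \<omega>"
  shows "AE \<omega> in M. AE y in lborel. P (T y \<omega>)"
proof -
  obtain N where N: "N \<in> null_sets M" "{\<omega> \<in> space M. \<not> P \<omega>} \<subseteq> N"
    using assms by (auto simp: eventually_ae_filter)
  have [measurable]: "N \<in> sets M" using N by auto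
  have "AE \<omega> in M. T y \<omega> \<notin> N" for y by (rule AE_shift[OF AE_not_in[OF N(1)]])
  then have "AE y in lborel. AE \<omega> in M. T y \<omega> \<notin> N" by simp
  then have "AE \<omega> in M. AE y in lborel. T y \<omega> \<notin> N"
    by (subst YM.AE_commute[symmetric]) measurable
  then show ?thesis
    using AE_space
  proof eventually_elim
    fix \<omega> assume a: "AE y in lborel. T y \<omega> \<notin> N" and \<omega>: "\<omega> \<in> space M"
    from a show "AE y in lborel. P (T y \<omega>)"
    proof (rule eventually_mono)
      fix y assume "T y \<omega> \<notin> N"
      then show "P (T y \<omega>)" using N(2) T_space[OF \<omega>, of y] by blast
    qed
  qed
qed

subsection \<open>The maximal inequality\<close>

text \<open>Extended nonnegative averages: they make sense on every orbit, before integrability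
  along orbits is known. The denominator is the volume of the cube.\<close>

definition eavg :: "('w \<Rightarrow> ennreal) \<Rightarrow> real \<Rightarrow> 'w \<Rightarrow> ennreal" where
  "eavg f \<rho> \<omega> = (\<integral>\<^sup>+y. f (T y \<omega>) * indicator (cube \<rho>) y \<partial>lborel) / ennreal ((2 * \<rho>) ^ CARD('d))"

text \<open>Only integer radii enter, so that measurability is immediate from a countable
  limsup.\<close>

definition upper_avg :: "('w \<Rightarrow> ennreal) \<Rightarrow> 'w \<Rightarrow> ennreal" where
  "upper_avg f \<omega> = limsup (\<lambda>n. eavg f (real (Suc n)) \<omega>)"

lemma eavg_measurable [measurable]:
  assumes [measurable]: "f \<in> borel_measurable M"
  shows "eavg f \<rho> \<in> borel_measurable M"
  unfolding eavg_def[abs_def] by measurable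

lemma upper_avg_measurable [measurable]:
  assumes [measurable]: "f \<in> borel_measurable M"
  shows "upper_avg f \<in> borel_measurable M"
  unfolding upper_avg_def[abs_def] by measurable

text \<open>Moving the cube by \<open>z\<close> keeps it inside the cube enlarged by
  \<open>s\<close>; the factor is the ratio of the two volumes.\<close>

lemma eavg_shift_le:
  assumes [measurable]: "f \<in> borel_measurable M" and \<omega>: "\<omega> \<in> space M" and s: "norm z \<le> s" and \<rho>: "\<rho> > 0"
  shows "eavg f \<rho> (T z \<omega>) \<le> eavg f (\<rho> + s) \<omega> * ennreal (((\<rho> + s) / \<rho>) ^ CARD('d))"
proof -
  have [measurable]: "(\<lambda>y. T y \<omega>) \<in> borel \<rightarrow>\<^sub>M M" by (rule T_orbit_measurable[OF \<omega>])
  have "s \<ge> 0" using s norm_ge_zero order_trans by blast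
  have "(\<integral>\<^sup>+y. f (T y (T z \<omega>)) * indicator (cube \<rho>) y \<partial>lborel)
      = (\<integral>\<^sup>+y. (\<lambda>y. f (T y \<omega>) * indicator (cube \<rho>) (y - z)) (z + y) \<partial>lborel)"
    by (simp add: T_add[OF \<omega>] add.commute)
  also have "\<dots> = (\<integral>\<^sup>+y. f (T y \<omega>) * indicator (cube \<rho>) (y - z) \<partial>lborel)"
    by (rule lborel_nn_integral_translate) measurable
  also have "\<dots> \<le> (\<integral>\<^sup>+y. f (T y \<omega>) * indicator (cube (\<rho> + s)) y \<partial>lborel)"
  proof (intro nn_integral_mono mult_left_mono)
    fix y show "indicator (cube \<rho>) (y - z) \<le> (indicator (cube (\<rho> + s)) y :: ennreal)"
      using cube_add[of "y - z" \<rho> z s] s by (auto simp: indicator_def)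
  qed simp
  finally have 1: "(\<integral>\<^sup>+y. f (T y (T z \<omega>)) * indicator (cube \<rho>) y \<partial>lborel)
    \<le> (\<integral>\<^sup>+y. f (T y \<omega>) * indicator (cube (\<rho> + s)) y \<partial>lborel)" (is "_ \<le> ?I") .
  have "eavg f \<rho> (T z \<omega>) \<le> ?I / ennreal ((2 * \<rho>) ^ CARD('d))"
    unfolding eavg_def by (rule divide_right_mono_ennreal[OF 1])
  also have "\<dots> = ?I / ennreal ((2 * \<rho>) ^ CARD('d) * ((\<rho> + s) / \<rho>) ^ CARD('d)) * ennreal (((\<rho> + s) / \<rho>) ^ CARD('d))"
  proof -
    have "x / ennreal (a * c) * ennreal c = x / ennreal a" if "a > 0" "c > 0" for x :: ennreal and a c :: real
    proof -
      have "x / ennreal (a * c) * ennreal c = x * (ennreal c / ennreal (a * c))" by (rule ennreal_divide_times)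
      also have "ennreal c / ennreal (a * c) = 1 / ennreal a" using that divide_ennreal[of 1 a] by (simp add: divide_ennreal)
      finally show ?thesis by (simp add: ennreal_times_divide)
    qed
    then show ?thesis using \<rho> \<open>s \<ge> 0\<close> by simp
  qed
  also have "(2 * \<rho>) ^ CARD('d) * ((\<rho> + s) / \<rho>) ^ CARD('d) = (2 * (\<rho> + s)) ^ CARD('d)"
    unfolding power_mult_distrib[symmetric] using \<rho> by simp
  also have "?I / ennreal ((2 * (\<rho> + s)) ^ CARD('d)) = eavg f (\<rho> + s) \<omega>" by (simp add: eavg_def)
  finally show ?thesis .
qed

text \<open>The ratio of volumes tends to 1 as the radius grows. Enlarging by an integer
  \<open>m\<close> above the norm of \<open>z\<close> keeps the radii integral, so that the
  enlargement is a mere shift of the index.\<close>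

lemma upper_avg_shift_le:
  assumes f: "f \<in> borel_measurable M" and \<omega>: "\<omega> \<in> space M"
  shows "upper_avg f (T z \<omega>) \<le> upper_avg f \<omega>"
proof (cases "upper_avg f \<omega> = \<top>")
  case False
  obtain m :: nat where m: "norm z \<le> real m" using real_arch_simple by blast
  define r where "r n = ((real (Suc n) + real m) / real (Suc n)) ^ CARD('d)" for n
  have le: "eavg f (real (Suc n)) (T z \<omega>) \<le> eavg f (real (Suc (n + m))) \<omega> * ennreal (r n)" for n
    using eavg_shift_le[OF f \<omega> m, of "real (Suc n)"] by (simp add: r_def add.assoc)
  have "(\<lambda>n. (1 + real m * inverse (real (Suc n))) ^ CARD('d)) \<longlonglongrightarrow> (1 + real m * 0) ^ CARD('d)"
    by (intro tendsto_intros LIMSEQ_inverse_real_of_nat)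
  then have r1: "r \<longlonglongrightarrow> 1" by (simp add: r_def[abs_def] add_divide_distrib divide_inverse distrib_right del: of_nat_Suc)
  from False obtain c where c: "c \<ge> 0" "upper_avg f \<omega> = ennreal c"
    by (metis ennreal_cases infinity_ennreal_def)
  have bound: "upper_avg f (T z \<omega>) \<le> ennreal ((c + e) * (1 + e))" if "e > 0" for e
  proof -
    have "\<forall>\<^sub>F n in sequentially. r n < 1 + e" using r1 that by (intro order_tendstoD) auto
    moreover have "limsup (\<lambda>n. eavg f (real (Suc (n + m))) \<omega>) < ennreal (c + e)"
      using limsup_shift_k[of "\<lambda>n. eavg f (real (Suc n)) \<omega>" m] c that
      by (simp add: upper_avg_def ennreal_lessI)
    then have "\<forall>\<^sub>F n in sequentially. eavg f (real (Suc (n + m))) \<omega> < ennreal (c + e)"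
      by (rule Limsup_lessD)
    ultimately have "\<forall>\<^sub>F n in sequentially. eavg f (real (Suc n)) (T z \<omega>) \<le> ennreal ((c + e) * (1 + e))"
    proof eventually_elim
      case (elim n)
      have "eavg f (real (Suc (n + m))) \<omega> * ennreal (r n) \<le> ennreal (c + e) * ennreal (1 + e)"
        using elim by (intro mult_mono ennreal_leI) auto
      also have "\<dots> = ennreal ((c + e) * (1 + e))" using c that by (simp add: ennreal_mult)
      finally show ?case using le[of n] by (rule order_trans[rotated])
    qed
    then show ?thesis unfolding upper_avg_def by (rule Limsup_bounded)
  qed
  have "(\<lambda>n. ennreal ((c + inverse (real (Suc n))) * (1 + inverse (real (Suc n))))) \<longlonglongrightarrow> ennreal ((c + 0) * (1 + 0))"
    by (intro tendsto_ennrealI tendsto_intros LIMSEQ_inverse_real_of_nat)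
  then have "upper_avg f (T z \<omega>) \<le> ennreal ((c + 0) * (1 + 0))"
    by (rule LIMSEQ_le_const) (intro exI[of _ 0] allI impI bound, simp)
  then show ?thesis by (simp add: c)
qed simp

lemma upper_avg_shift:
  assumes f: "f \<in> borel_measurable M" and \<omega>: "\<omega> \<in> space M"
  shows "upper_avg f (T z \<omega>) = upper_avg f \<omega>"
proof (rule antisym[OF upper_avg_shift_le[OF assms]])
  \<comment> \<open>\<open>T 0\<close> is absorbed by any further shift, so orbit averages cannot
    distinguish \<omega> from \<open>T 0 \<omega>\<close>, even though \<open>T 0\<close> need not
    be the identity.\<close>
  have "upper_avg f \<omega> = upper_avg f (T 0 \<omega>)"
    by (simp add: upper_avg_def eavg_def T_add[OF \<omega>])
  also have "T 0 \<omega> = T (- z) (T z \<omega>)" by (simp add: T_add[OF \<omega>])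
  also have "upper_avg f \<dots> \<le> upper_avg f (T z \<omega>)"
    by (rule upper_avg_shift_le[OF f]) (use \<omega> in simp)
  finally show "upper_avg f \<omega> \<le> upper_avg f (T z \<omega>)" .
qed

text \<open>\<open>upper_avg_shift\<close> holds at every point of the space, so these sets are
  invariant in the strict sense that \<open>ergodic_system\<close> demands, not merely up to null
  sets.\<close>

lemma upper_avg_zero_one:
  assumes [measurable]: "f \<in> borel_measurable M" and A: "A \<in> sets borel"
  shows "prob {\<omega> \<in> space M. upper_avg f \<omega> \<in> A} = 0 \<or> prob {\<omega> \<in> space M. upper_avg f \<omega> \<in> A} = 1"
proof (rule invariant_zero_one)
  note A [measurable]
  show "{\<omega> \<in> space M. upper_avg f \<omega> \<in> A} \<in> sets M" by measurable
  show "T y -` {\<omega> \<in> space M. upper_avg f \<omega> \<in> A} \<inter> space M = {\<omega> \<in> space M. upper_avg f \<omega> \<in> A}" for y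
    using upper_avg_shift[OF assms(1)] by auto
qed

text \<open>The Hardy-Littlewood maximal inequality on a single orbit. The cube with large average
  about \<open>y\<close> lies in the ball of radius \<open>r y\<close>, which is sqrt(d) times
  \<open>n y\<close>; Vitali's lemma selects disjoint such balls whose fivefold dilations cover
  \<open>W\<close>. The volume of a dilated ball is at most (5 sqrt(d))^d times that of the
  corresponding cube, which explains the constant.\<close>

lemma maximal_cover:
  assumes f [measurable]: "f \<in> borel_measurable M" and \<omega>: "\<omega> \<in> space M" and t: "t > 0"
    and W: "\<And>y. y \<in> W \<Longrightarrow> y \<in> cube L" "\<And>y. y \<in> W \<Longrightarrow> \<exists>n\<in>{1..N}. eavg f (real n) (T y \<omega>) > ennreal t"
    and [measurable]: "W \<in> sets borel"
  shows "ennreal t * emeasure lborel W \<le> ennreal ((5 * sqrt (CARD('d))) ^ CARD('d)) *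
     (\<integral>\<^sup>+y. f (T y \<omega>) * indicator (cube (L + sqrt (CARD('d)) * real N + 1)) y \<partial>lborel)"
proof -
  let ?d = "CARD('d)"
  let ?sd = "sqrt (real ?d)"
  define F where "F y = f (T y \<omega>)" for y
  have [measurable]: "(\<lambda>y. T y \<omega>) \<in> borel \<rightarrow>\<^sub>M M" by (rule T_orbit_measurable[OF \<omega>])
  have [measurable]: "F \<in> borel_measurable borel" unfolding F_def by measurable
  note [measurable] = borel_closed[OF closed_cball] borel_open[OF open_ball]
  have sd: "?sd > 0" by simp
  have "\<forall>y. \<exists>n. y \<in> W \<longrightarrow> n \<in> {1..N} \<and> eavg f (real n) (T y \<omega>) > ennreal t" using W(2) by blast
  from choice[OF this] obtain n where n: "\<And>y. y \<in> W \<Longrightarrow> n y \<in> {1..N}"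
     "\<And>y. y \<in> W \<Longrightarrow> eavg f (real (n y)) (T y \<omega>) > ennreal t" by blast
  define r where "r y = ?sd * real (n y)" for y
  have r: "0 < r y \<and> r y \<le> ?sd * real N" if "y \<in> W" for y
    using n(1)[OF that] sd unfolding r_def by (auto intro: mult_left_mono mult_pos_pos)
  obtain C where C: "countable C" "C \<subseteq> W"
    "pairwise (\<lambda>i j. disjnt (cball i (r i)) (cball j (r j))) C"
    "\<And>i. i \<in> W \<Longrightarrow> \<exists>j. j \<in> C \<and> \<not> disjnt (cball i (r i)) (cball j (r j)) \<and> cball i (r i) \<subseteq> ball j (5 * r j)"
    using Vitali_covering_lemma_cballs_balls[where a="\<lambda>x. x" and r=r, OF r] by (metis (no_types, lifting))
  have local: "ennreal t * ennreal ((2 * real (n y)) ^ ?d) \<le> (\<integral>\<^sup>+x. F x * indicator (cball y (r y)) x \<partial>lborel)" if y: "y \<in> W" for y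
  proof -
    have ny: "real (n y) > 0" using n(1)[OF y] by simp
    have "ennreal t < (\<integral>\<^sup>+x. F (y + x) * indicator (cube (real (n y))) x \<partial>lborel) / ennreal ((2 * real (n y)) ^ ?d)"
      using n(2)[OF y] by (simp add: eavg_def F_def T_add[OF \<omega>] add.commute)
    then have "ennreal t * ennreal ((2 * real (n y)) ^ ?d) \<le> (\<integral>\<^sup>+x. F (y + x) * indicator (cube (real (n y))) x \<partial>lborel)"
    proof -
      assume a: "ennreal t < (\<integral>\<^sup>+x. F (y + x) * indicator (cube (real (n y))) x \<partial>lborel) / ennreal ((2 * real (n y)) ^ ?d)"
      have "ennreal t * ennreal ((2 * real (n y)) ^ ?d) \<le>
         (\<integral>\<^sup>+x. F (y + x) * indicator (cube (real (n y))) x \<partial>lborel) / ennreal ((2 * real (n y)) ^ ?d) * ennreal ((2 * real (n y)) ^ ?d)"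
        using a by (intro mult_right_mono) auto
      also have "\<dots> = (\<integral>\<^sup>+x. F (y + x) * indicator (cube (real (n y))) x \<partial>lborel)"
        using ny by (simp add: ennreal_divide_times ennreal_divide_self)
      finally show ?thesis .
    qed
    also have "\<dots> \<le> (\<integral>\<^sup>+x. (\<lambda>x. F x * indicator (cball y (r y)) x) (y + x) \<partial>lborel)"
    proof (intro nn_integral_mono)
      fix x
      show "F (y + x) * indicator (cube (real (n y))) x \<le> F (y + x) * indicator (cball y (r y)) (y + x)"
        using norm_le_cube[of x "real (n y)"] by (intro mult_left_mono) (auto simp: indicator_def r_def dist_norm)
    qed
    also have "\<dots> = (\<integral>\<^sup>+x. F x * indicator (cball y (r y)) x \<partial>lborel)"
      by (rule lborel_nn_integral_translate) measurable
    finally show ?thesis .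
  qed
  have bl: "ennreal t * emeasure lborel (ball y (5 * r y)) \<le> ennreal ((5 * ?sd) ^ ?d) * (\<integral>\<^sup>+x. F x * indicator (cball y (r y)) x \<partial>lborel)"
    if y: "y \<in> W" for y
  proof -
    have "emeasure lborel (ball y (5 * r y)) \<le> ennreal ((2 * (5 * r y)) ^ ?d)"
      by (rule emeasure_ball_le) (use r[OF y] in simp)
    also have "(2 * (5 * r y)) ^ ?d = ((5 * ?sd) * (2 * real (n y))) ^ ?d"
      by (rule arg_cong[of _ _ "\<lambda>x. x ^ ?d"]) (simp add: r_def)
    also have "\<dots> = (5 * ?sd) ^ ?d * (2 * real (n y)) ^ ?d" by (rule power_mult_distrib)
    finally have "emeasure lborel (ball y (5 * r y)) \<le> ennreal ((5 * ?sd) ^ ?d) * ennreal ((2 * real (n y)) ^ ?d)"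
      by (simp add: ennreal_mult)
    then have "ennreal t * emeasure lborel (ball y (5 * r y)) \<le> ennreal t * (ennreal ((5 * ?sd) ^ ?d) * ennreal ((2 * real (n y)) ^ ?d))"
      by (rule mult_left_mono) simp
    also have "\<dots> = ennreal ((5 * ?sd) ^ ?d) * (ennreal t * ennreal ((2 * real (n y)) ^ ?d))" by (simp only: mult_ac)
    also have "\<dots> \<le> ennreal ((5 * ?sd) ^ ?d) * (\<integral>\<^sup>+x. F x * indicator (cball y (r y)) x \<partial>lborel)"
      by (rule mult_left_mono[OF local[OF y]]) simp
    finally show ?thesis .
  qed
  have "emeasure lborel W = (\<integral>\<^sup>+x. indicator W x \<partial>lborel)" by simp
  also have "\<dots> \<le> (\<integral>\<^sup>+x. (\<integral>\<^sup>+c. indicator (ball c (5 * r c)) x \<partial>count_space C) \<partial>lborel)"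
  proof (rule nn_integral_mono)
    fix x
    show "indicator W x \<le> (\<integral>\<^sup>+c. indicator (ball c (5 * r c)) x \<partial>count_space C)"
    proof (cases "x \<in> W")
      case True
      then obtain j where j: "j \<in> C" "cball x (r x) \<subseteq> ball j (5 * r j)" using C(4) by blast
      then have "x \<in> ball j (5 * r j)" using r[OF True] by (meson centre_in_cball less_imp_le subsetD)
      then have "(\<integral>\<^sup>+c. indicator {j} c \<partial>count_space C) \<le> (\<integral>\<^sup>+c. (indicator (ball c (5 * r c)) x :: ennreal) \<partial>count_space C)"
        by (intro nn_integral_mono) (auto simp: indicator_def)
      moreover have "(\<integral>\<^sup>+c. indicator {j} c \<partial>count_space C) = (1::ennreal)"
        using j(1) by (subst nn_integral_indicator) (auto simp: emeasure_count_space_finite)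
      ultimately show ?thesis using True by simp
    qed simp
  qed
  also have "\<dots> = (\<integral>\<^sup>+c. (\<integral>\<^sup>+x. indicator (ball c (5 * r c)) x \<partial>lborel) \<partial>count_space C)"
    by (rule nn_integral_count_space_nn_integral[OF C(1)]) measurable
  also have "\<dots> = (\<integral>\<^sup>+c. emeasure lborel (ball c (5 * r c)) \<partial>count_space C)" by simp
  finally have "ennreal t * emeasure lborel W \<le> ennreal t * (\<integral>\<^sup>+c. emeasure lborel (ball c (5 * r c)) \<partial>count_space C)"
    by (rule mult_left_mono) simp
  also have "\<dots> = (\<integral>\<^sup>+c. ennreal t * emeasure lborel (ball c (5 * r c)) \<partial>count_space C)"
    by (rule nn_integral_cmult[symmetric]) simp
  also have "\<dots> \<le> (\<integral>\<^sup>+c. ennreal ((5 * ?sd) ^ ?d) * (\<integral>\<^sup>+x. F x * indicator (cball c (r c)) x \<partial>lborel) \<partial>count_space C)"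
    using C(2) by (intro nn_integral_mono bl) auto
  also have "\<dots> = ennreal ((5 * ?sd) ^ ?d) * (\<integral>\<^sup>+c. (\<integral>\<^sup>+x. F x * indicator (cball c (r c)) x \<partial>lborel) \<partial>count_space C)"
    by (rule nn_integral_cmult) simp
  also have "(\<integral>\<^sup>+c. (\<integral>\<^sup>+x. F x * indicator (cball c (r c)) x \<partial>lborel) \<partial>count_space C)
    = (\<integral>\<^sup>+x. (\<integral>\<^sup>+c. F x * indicator (cball c (r c)) x \<partial>count_space C) \<partial>lborel)"
    by (rule nn_integral_count_space_nn_integral[OF C(1), symmetric]) measurable
  also have "\<dots> \<le> (\<integral>\<^sup>+x. F x * indicator (cube (L + ?sd * real N + 1)) x \<partial>lborel)"
  proof (rule nn_integral_mono)
    fix x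
    have "(\<integral>\<^sup>+c. F x * indicator (cball c (r c)) x \<partial>count_space C) = F x * (\<integral>\<^sup>+c. indicator (cball c (r c)) x \<partial>count_space C)"
      by (rule nn_integral_cmult) simp
    \<comment> \<open>By disjointness at most one selected ball contains \<open>x\<close>, and such
      a ball stays in the enlarged cube because its centre is in \<open>cube L\<close>.\<close>
    also have "(\<integral>\<^sup>+c. indicator (cball c (r c)) x \<partial>count_space C) \<le> (indicator (cube (L + ?sd * real N + 1)) x :: ennreal)"
    proof (cases "\<exists>c\<in>C. x \<in> cball c (r c)")
      case True
      then obtain c where c: "c \<in> C" "x \<in> cball c (r c)" by blast
      have "x \<notin> cball c' (r c')" if "c' \<in> C" "c' \<noteq> c" for c'
        using C(3) that c unfolding pairwise_def disjnt_def by blast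
      then have "(\<integral>\<^sup>+c. indicator (cball c (r c)) x \<partial>count_space C) \<le> (\<integral>\<^sup>+c'. (indicator {c} c' :: ennreal) \<partial>count_space C)"
        by (intro nn_integral_mono) (auto simp: indicator_def)
      also have "\<dots> = (1::ennreal)"
        using c(1) by (subst nn_integral_indicator) (auto simp: emeasure_count_space_finite)
      finally have 1: "(\<integral>\<^sup>+c. indicator (cball c (r c)) x \<partial>count_space C) \<le> (1::ennreal)" .
      have cW: "c \<in> W" using c(1) C(2) by blast
      have "norm (x - c) \<le> ?sd * real N"
        using c(2) r[OF cW] by (simp add: dist_norm norm_minus_commute)
      then have "c + (x - c) \<in> cube (L + (?sd * real N + 1))"
        using W(1)[OF cW] by (intro cube_add) auto
      then show ?thesis using 1 by (simp add: add.assoc)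
    next
      case False
      then have "(\<integral>\<^sup>+c. indicator (cball c (r c)) x \<partial>count_space C) = (\<integral>\<^sup>+c. (0::ennreal) \<partial>count_space C)"
        by (intro nn_integral_cong) (auto simp: indicator_def)
      then show ?thesis by simp
    qed
    finally show "(\<integral>\<^sup>+c. F x * indicator (cball c (r c)) x \<partial>count_space C) \<le> F x * indicator (cube (L + ?sd * real N + 1)) x"
      by (simp add: mult_left_mono)
  qed
  finally show ?thesis by (simp add: F_def mult_left_mono)
qed

text \<open>Tonelli and the invariance of \<open>M\<close>. This is how expectations are transferred
  to orbit integrals and back.\<close>

lemma nn_integral_orbit:
  assumes [measurable]: "f \<in> borel_measurable M" "A \<in> sets borel"
  shows "(\<integral>\<^sup>+\<omega>. (\<integral>\<^sup>+y. f (T y \<omega>) * indicator A y \<partial>lborel) \<partial>M) = (\<integral>\<^sup>+\<omega>. f \<omega> \<partial>M) * emeasure lborel A"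
proof -
  have "(\<integral>\<^sup>+\<omega>. (\<integral>\<^sup>+y. f (T y \<omega>) * indicator A y \<partial>lborel) \<partial>M) = (\<integral>\<^sup>+y. (\<integral>\<^sup>+\<omega>. f (T y \<omega>) * indicator A y \<partial>M) \<partial>lborel)"
    by (rule YM.Fubini') measurable
  also have "\<dots> = (\<integral>\<^sup>+y. (\<integral>\<^sup>+\<omega>. f \<omega> \<partial>M) * indicator A y \<partial>lborel)"
    by (intro nn_integral_cong) (simp add: nn_integral_multc nn_integral_shift)
  also have "\<dots> = (\<integral>\<^sup>+\<omega>. f \<omega> \<partial>M) * emeasure lborel A"
    by (simp add: nn_integral_cmult)
  finally show ?thesis .
qed

text \<open>Transference: the orbit inequality is applied to the set of \<open>y\<close> in
  \<open>cube L\<close> whose shift lies in the bad set \<open>G\<close>, and integrated over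
  \<omega>. Both sides then scale like volumes of cubes, of half sides \<open>L\<close> and
  \<open>L + m\<close>; dividing and letting \<open>L\<close> grow removes the boundary layer
  \<open>m\<close>.\<close>

lemma maximal_prob:
  assumes f [measurable]: "f \<in> borel_measurable M" and t: "t > 0" and I: "I \<ge> 0" "(\<integral>\<^sup>+\<omega>. f \<omega> \<partial>M) = ennreal I"
  shows "t * prob {\<omega> \<in> space M. \<exists>n\<in>{1..N}. eavg f (real n) \<omega> > ennreal t} \<le> (5 * sqrt (CARD('d))) ^ CARD('d) * I"
proof -
  let ?d = "CARD('d)"
  define K where "K = (5 * sqrt (real ?d)) ^ ?d"
  define m where "m = sqrt (real ?d) * real N + 1"
  have "K \<ge> 0" "m > 0" by (auto simp: K_def m_def add_nonneg_pos)
  define G where "G = {\<omega> \<in> space M. \<exists>n\<in>{1..N}. eavg f (real n) \<omega> > ennreal t}"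
  have [measurable]: "G \<in> sets M" unfolding G_def by measurable
  have nnd: "(\<integral>\<^sup>+\<omega>. (\<integral>\<^sup>+y. f (T y \<omega>) * indicator (cube \<rho>) y \<partial>lborel) \<partial>M) = ennreal ((2 * \<rho>) ^ ?d) * (\<integral>\<^sup>+\<omega>. f \<omega> \<partial>M)"
    if "\<rho> \<ge> 0" and [measurable]: "f \<in> borel_measurable M" for \<rho> and f :: "'w \<Rightarrow> ennreal"
    using nn_integral_orbit[OF that(2) cube_borel, of \<rho>] emeasure_cube[OF that(1), where 'd='d] by (simp add: mult.commute)
  have main: "t * prob G * (2 * L) ^ ?d \<le> K * I * (2 * (L + m)) ^ ?d" if L: "L > 0" for L
  proof -
    have "ennreal t * (ennreal ((2 * L) ^ ?d) * emeasure M G) = ennreal t * (\<integral>\<^sup>+\<omega>. (\<integral>\<^sup>+y. indicator G (T y \<omega>) * indicator (cube L) y \<partial>lborel) \<partial>M)"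
      using L by (subst nnd) auto
    also have "\<dots> = (\<integral>\<^sup>+\<omega>. ennreal t * (\<integral>\<^sup>+y. indicator G (T y \<omega>) * indicator (cube L) y \<partial>lborel) \<partial>M)"
      by (rule nn_integral_cmult[symmetric]) measurable
    also have "\<dots> \<le> (\<integral>\<^sup>+\<omega>. ennreal K * (\<integral>\<^sup>+y. f (T y \<omega>) * indicator (cube (L + m)) y \<partial>lborel) \<partial>M)"
    proof (rule nn_integral_mono)
      fix \<omega> assume \<omega>: "\<omega> \<in> space M"
      have [measurable]: "(\<lambda>y. T y \<omega>) \<in> borel \<rightarrow>\<^sub>M M" by (rule T_orbit_measurable[OF \<omega>])
      define W where "W = {y \<in> cube L. T y \<omega> \<in> G}"
      have [measurable]: "W \<in> sets borel"
      proof -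
        have "W = cube L \<inter> ((\<lambda>y. T y \<omega>) -` G \<inter> space borel)" by (auto simp: W_def)
        also have "\<dots> \<in> sets borel" by (intro sets.Int cube_borel measurable_sets[OF T_orbit_measurable[OF \<omega>]]) simp
        finally show ?thesis .
      qed
      have "(\<integral>\<^sup>+y. indicator G (T y \<omega>) * indicator (cube L) y \<partial>lborel) = (\<integral>\<^sup>+y. indicator W y \<partial>lborel)"
        by (intro nn_integral_cong) (auto simp: W_def indicator_def)
      also have "\<dots> = emeasure lborel W" by simp
      finally have e: "(\<integral>\<^sup>+y. indicator G (T y \<omega>) * indicator (cube L) y \<partial>lborel) = emeasure lborel W" .
      show "ennreal t * (\<integral>\<^sup>+y. indicator G (T y \<omega>) * indicator (cube L) y \<partial>lborel) \<le>
         ennreal K * (\<integral>\<^sup>+y. f (T y \<omega>) * indicator (cube (L + m)) y \<partial>lborel)"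
        unfolding e K_def m_def add.assoc[symmetric]
        by (rule maximal_cover[OF f \<omega> t]) (auto simp: W_def G_def)
    qed
    also have "\<dots> = ennreal K * (ennreal ((2 * (L + m)) ^ ?d) * ennreal I)"
      using L \<open>m > 0\<close> by (subst nn_integral_cmult, measurable) (subst nnd, auto simp: I)
    finally have "ennreal (t * ((2 * L) ^ ?d * prob G)) \<le> ennreal (K * ((2 * (L + m)) ^ ?d * I))"
      using t L \<open>m > 0\<close> \<open>K \<ge> 0\<close> I by (simp add: emeasure_eq_measure ennreal_mult)
    then show ?thesis
      using t L \<open>m > 0\<close> \<open>K \<ge> 0\<close> I by (subst (asm) ennreal_le_iff) (auto simp: mult_ac)
  qed
  have le: "t * prob G \<le> K * I * (1 + m * inverse (real (Suc n))) ^ ?d" for n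
  proof -
    let ?L = "real (Suc n)"
    have "(2 * (?L + m)) ^ ?d = (2 * ?L) ^ ?d * (1 + m * inverse ?L) ^ ?d"
      unfolding power_mult_distrib[symmetric]
      by (rule arg_cong[of _ _ "\<lambda>x. x ^ ?d"]) (simp add: field_simps)
    then have "t * prob G * (2 * ?L) ^ ?d \<le> (K * I * (1 + m * inverse ?L) ^ ?d) * (2 * ?L) ^ ?d"
      using main[of ?L] by (simp add: mult_ac del: of_nat_Suc)
    then show ?thesis by (rule mult_right_le_imp_le) simp
  qed
  have "(\<lambda>n. K * I * (1 + m * inverse (real (Suc n))) ^ ?d) \<longlonglongrightarrow> K * I * (1 + m * 0) ^ ?d"
    by (intro tendsto_intros LIMSEQ_inverse_real_of_nat)
  then have "t * prob G \<le> K * I * (1 + m * 0) ^ ?d"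
    by (rule LIMSEQ_le_const) (use le in blast)
  then show ?thesis by (simp add: G_def K_def)
qed

text \<open>By the zero-one law the set where \<open>upper_avg f\<close> exceeds \<open>t\<close>
  has probability 0 or 1. Probability 1 would force \<open>t\<close> to be at most the constant,
  through the maximal inequality over \<open>{1..N}\<close> and continuity from below in
  \<open>N\<close>.\<close>

lemma upper_avg_le:
  assumes f [measurable]: "f \<in> borel_measurable M" and I: "I \<ge> 0" "(\<integral>\<^sup>+\<omega>. f \<omega> \<partial>M) = ennreal I"
  shows "AE \<omega> in M. upper_avg f \<omega> \<le> ennreal ((5 * sqrt (CARD('d))) ^ CARD('d) * I)"
proof -
  let ?c = "(5 * sqrt (real CARD('d))) ^ CARD('d) * I"
  have c: "?c \<ge> 0" using I by simp
  have "AE \<omega> in M. upper_avg f \<omega> \<le> ennreal t" if t: "t > ?c" for t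
  proof -
    have t0: "t > 0" using t c by linarith
    let ?S = "{\<omega> \<in> space M. upper_avg f \<omega> \<in> {ennreal t<..}}"
    have [measurable]: "?S \<in> sets M" by measurable
    have "prob ?S \<noteq> 1"
    proof
      assume S1: "prob ?S = 1"
      define G where "G N = {\<omega> \<in> space M. \<exists>n\<in>{1..N}. eavg f (real n) \<omega> > ennreal t}" for N :: nat
      have [measurable]: "G N \<in> sets M" for N unfolding G_def by measurable
      have "?S \<subseteq> (\<Union>N. G N)"
      proof
        fix \<omega> assume \<omega>: "\<omega> \<in> ?S"
        have "\<exists>n. eavg f (real (Suc n)) \<omega> > ennreal t"
        proof (rule ccontr)
          assume "\<not> ?thesis"
          then have "upper_avg f \<omega> \<le> ennreal t"
            unfolding upper_avg_def by (intro Limsup_bounded always_eventually) (simp add: not_less)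
          then show False using \<omega> leD by auto
        qed
        then obtain n where "eavg f (real (Suc n)) \<omega> > ennreal t" by blast
        then have "\<omega> \<in> G (Suc n)" using \<omega> unfolding G_def by (auto intro!: bexI[of _ "Suc n"])
        then show "\<omega> \<in> (\<Union>N. G N)" by blast
      qed
      moreover have "(\<Union>N. G N) \<in> sets M" by measurable
      ultimately have "prob ?S \<le> prob (\<Union>N. G N)" by (rule finite_measure_mono)
      then have "1 \<le> prob (\<Union>N. G N)" unfolding S1 .
      have "incseq G" by (fastforce simp: incseq_def G_def)
      then have "(\<lambda>N. prob (G N)) \<longlonglongrightarrow> prob (\<Union>N. G N)"
        by (intro finite_Lim_measure_incseq) auto
      then have "(\<lambda>N. t * prob (G N)) \<longlonglongrightarrow> t * prob (\<Union>N. G N)" by (intro tendsto_intros)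
      then have tc: "t * prob (\<Union>N. G N) \<le> ?c"
        by (rule LIMSEQ_le_const2) (use maximal_prob[OF f t0 I] in \<open>auto simp: G_def\<close>)
      have "t * 1 \<le> t * prob (\<Union>N. G N)"
        using t0 \<open>1 \<le> prob (\<Union>N. G N)\<close> by (intro mult_left_mono) auto
      with tc have "t \<le> ?c" by linarith
      then show False using t by linarith
    qed
    then have "prob ?S = 0" using upper_avg_zero_one[OF f, of "{ennreal t<..}"] by auto
    then have "AE \<omega> in M. \<omega> \<notin> ?S"
      by (intro AE_not_in) (simp add: null_setsI emeasure_eq_measure)
    then show ?thesis using AE_space by eventually_elim auto
  qed
  from this[of "?c + inverse (real (Suc k))" for k]
  have "AE \<omega> in M. upper_avg f \<omega> \<le> ennreal (?c + inverse (real (Suc k)))" for k by simp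
  then have "AE \<omega> in M. \<forall>k. upper_avg f \<omega> \<le> ennreal (?c + inverse (real (Suc k)))"
    by (simp add: AE_all_countable)
  then show ?thesis
  proof (rule eventually_mono)
    fix \<omega> assume a: "\<forall>k. upper_avg f \<omega> \<le> ennreal (?c + inverse (real (Suc k)))"
    have "(\<lambda>k. ennreal (?c + inverse (real (Suc k)))) \<longlonglongrightarrow> ennreal (?c + 0)"
      by (intro tendsto_ennrealI tendsto_intros LIMSEQ_inverse_real_of_nat)
    then have "upper_avg f \<omega> \<le> ennreal (?c + 0)"
      by (rule LIMSEQ_le_const) (use a in blast)
    then show "upper_avg f \<omega> \<le> ennreal ?c" by simp
  qed
qed

subsection \<open>The pointwise ergodic theorem\<close>

text \<open>The expected integral of |f| over a ball is finite by \<open>nn_integral_orbit\<close>,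
  and balls of integer radius suffice.\<close>

lemma AE_loc_int:
  fixes f :: "'w \<Rightarrow> real"
  assumes f: "integrable M f"
  shows "AE \<omega> in M. loc_int (\<lambda>y. f (T y \<omega>))"
proof -
  have [measurable]: "f \<in> borel_measurable M" using f by simp
  note [measurable] = borel_closed[OF closed_cball]
  have "AE \<omega> in M. (\<integral>\<^sup>+y. ennreal \<bar>f (T y \<omega>)\<bar> * indicator (cball 0 (real n)) y \<partial>lborel) \<noteq> \<infinity>" for n :: nat
  proof (rule nn_integral_PInf_AE)
    have "(\<integral>\<^sup>+\<omega>. (\<integral>\<^sup>+y. ennreal \<bar>f (T y \<omega>)\<bar> * indicator (cball 0 (real n)) y \<partial>lborel) \<partial>M)
      = (\<integral>\<^sup>+\<omega>. ennreal \<bar>f \<omega>\<bar> \<partial>M) * emeasure lborel (cball (0::real^'d) (real n))"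
      by (rule nn_integral_orbit[of "\<lambda>\<omega>. ennreal \<bar>f \<omega>\<bar>"]) auto
    also have "\<dots> \<noteq> \<infinity>"
      using f emeasure_lborel_cball_finite[of "0::real^'d" "real n"]
      by (auto simp: integrable_iff_bounded ennreal_mult_eq_top_iff)
    finally show "(\<integral>\<^sup>+\<omega>. (\<integral>\<^sup>+y. ennreal \<bar>f (T y \<omega>)\<bar> * indicator (cball 0 (real n)) y \<partial>lborel) \<partial>M) \<noteq> \<infinity>" .
  qed measurable
  then have "AE \<omega> in M. \<forall>n::nat. (\<integral>\<^sup>+y. ennreal \<bar>f (T y \<omega>)\<bar> * indicator (cball 0 (real n)) y \<partial>lborel) \<noteq> \<infinity>"
    by (simp add: AE_all_countable)
  then show ?thesis
    using AE_space
  proof eventually_elim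
    case (elim \<omega>)
    have [measurable]: "(\<lambda>y. T y \<omega>) \<in> borel \<rightarrow>\<^sub>M M" using elim by (intro T_orbit_measurable)
    have "integrable lborel (\<lambda>z. indicator (cball 0 R) z * f (T z \<omega>))" for R
    proof -
      obtain n :: nat where n: "R \<le> real n" using real_arch_simple by blast
      have "(\<integral>\<^sup>+z. ennreal (norm (indicator (cball 0 R) z * f (T z \<omega>))) \<partial>lborel)
         \<le> (\<integral>\<^sup>+y. ennreal \<bar>f (T y \<omega>)\<bar> * indicator (cball 0 (real n)) y \<partial>lborel)"
        using n by (intro nn_integral_mono) (auto simp: indicator_def)
      also have "\<dots> < \<infinity>" using elim(1) by (simp add: less_top)
      finally show ?thesis by (simp add: integrable_iff_bounded)
    qed
    then show "loc_int (\<lambda>y. f (T y \<omega>))" by (simp add: loc_int_def)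
  qed
qed

section \<open>Real averages and the functions for which they converge\<close>

definition ravg :: "('w \<Rightarrow> real) \<Rightarrow> real \<Rightarrow> 'w \<Rightarrow> real" where
  "ravg f \<rho> \<omega> = (LINT y|lborel. indicator (cube \<rho>) y * f (T y \<omega>)) / (2 * \<rho>) ^ CARD('d)"

lemma integrable_cube:
  fixes H :: "real^'e::finite \<Rightarrow> real"
  assumes "loc_int H"
  shows "integrable lborel (\<lambda>y. indicator (cube \<rho>) y * H y)"
proof (rule loc_int_bound(1)[OF assms])
  show "indicator (cube \<rho>) x = (0::real)" if "norm x > sqrt (CARD('e)) * \<rho>" for x :: "real^'e"
    using norm_le_cube[of x \<rho>] that by (auto simp: indicator_def)
  show "\<bar>indicator (cube \<rho>) x :: real\<bar> \<le> 1" for x :: "real^'e" by (simp add: indicator_def)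
qed simp

lemma ravg_add:
  assumes "loc_int (\<lambda>y. f (T y \<omega>))" "loc_int (\<lambda>y. g (T y \<omega>))"
  shows "ravg (\<lambda>\<omega>. f \<omega> + g \<omega>) \<rho> \<omega> = ravg f \<rho> \<omega> + ravg g \<rho> \<omega>"
  using integrable_cube[OF assms(1), of \<rho>] integrable_cube[OF assms(2), of \<rho>]
  by (simp add: ravg_def distrib_left add_divide_distrib)

lemma ravg_cmult: "ravg (\<lambda>\<omega>. c * f \<omega>) \<rho> \<omega> = c * ravg f \<rho> \<omega>"
proof -
  have "(\<lambda>y. indicator (cube \<rho>) y * (c * f (T y \<omega>))) = (\<lambda>y. c * (indicator (cube \<rho>) y * f (T y \<omega>)))" by (auto simp: mult_ac)
  then show ?thesis by (simp add: ravg_def)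
qed

lemma ravg_diff:
  assumes "loc_int (\<lambda>y. f (T y \<omega>))" "loc_int (\<lambda>y. g (T y \<omega>))"
  shows "ravg (\<lambda>\<omega>. f \<omega> - g \<omega>) \<rho> \<omega> = ravg f \<rho> \<omega> - ravg g \<rho> \<omega>"
  using integrable_cube[OF assms(1), of \<rho>] integrable_cube[OF assms(2), of \<rho>]
  by (simp add: ravg_def right_diff_distrib diff_divide_distrib)

lemma ravg_const:
  assumes "\<rho> > 0"
  shows "ravg (\<lambda>\<omega>. c) \<rho> \<omega> = c"
  using assms measure_cube[of \<rho>, where 'd='d] by (simp add: ravg_def)

lemma abs_ravg_le:
  assumes "\<rho> > 0" "loc_int (\<lambda>y. f (T y \<omega>))"
  shows "ennreal \<bar>ravg f \<rho> \<omega>\<bar> \<le> eavg (\<lambda>\<omega>. ennreal \<bar>f \<omega>\<bar>) \<rho> \<omega>"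
proof -
  let ?v = "(2 * \<rho>) ^ CARD('d)"
  have v: "?v > 0" using assms by simp
  have "ennreal \<bar>ravg f \<rho> \<omega>\<bar> = ennreal \<bar>LINT y|lborel. indicator (cube \<rho>) y * f (T y \<omega>)\<bar> / ennreal ?v"
    using v by (simp add: ravg_def divide_ennreal)
  also have "\<dots> \<le> (\<integral>\<^sup>+y. ennreal (norm (indicator (cube \<rho>) y * f (T y \<omega>))) \<partial>lborel) / ennreal ?v"
    using integral_norm_bound_ennreal[OF integrable_cube[OF assms(2), of \<rho>]]
    by (intro divide_right_mono_ennreal) simp
  also have "(\<integral>\<^sup>+y. ennreal (norm (indicator (cube \<rho>) y * f (T y \<omega>))) \<partial>lborel) = (\<integral>\<^sup>+y. ennreal \<bar>f (T y \<omega>)\<bar> * indicator (cube \<rho>) y \<partial>lborel)"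
    by (intro nn_integral_cong) (auto simp: indicator_def)
  finally show ?thesis by (simp add: eavg_def)
qed

text \<open>Convergence is asked along integer radii only; real radii are reached at the end,
  through \<open>ravg_tendsto_nonneg\<close>.\<close>

definition averages :: "('w \<Rightarrow> real) \<Rightarrow> bool" where
  "averages f \<longleftrightarrow> integrable M f \<and> (AE \<omega> in M. (\<lambda>n. ravg f (real (Suc n)) \<omega>) \<longlonglongrightarrow> (LINT \<omega>|M. f \<omega>))"

lemma averages_const: "averages (\<lambda>\<omega>. c)"
  by (simp add: averages_def ravg_const prob_space)

lemma averages_add:
  assumes "averages f" "averages g"
  shows "averages (\<lambda>\<omega>. f \<omega> + g \<omega>)"
  unfolding averages_def
proof (intro conjI)
  have i: "integrable M f" "integrable M g" using assms by (auto simp: averages_def)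
  then show "integrable M (\<lambda>\<omega>. f \<omega> + g \<omega>)" by simp
  have "AE \<omega> in M. (\<lambda>n. ravg f (real (Suc n)) \<omega>) \<longlonglongrightarrow> (LINT \<omega>|M. f \<omega>)" "AE \<omega> in M. (\<lambda>n. ravg g (real (Suc n)) \<omega>) \<longlonglongrightarrow> (LINT \<omega>|M. g \<omega>)"
    using assms by (auto simp: averages_def)
  then show "AE \<omega> in M. (\<lambda>n. ravg (\<lambda>\<omega>. f \<omega> + g \<omega>) (real (Suc n)) \<omega>) \<longlonglongrightarrow> (LINT \<omega>|M. f \<omega> + g \<omega>)"
    using AE_loc_int[OF i(1)] AE_loc_int[OF i(2)]
  proof eventually_elim
    case (elim \<omega>)
    show ?case using tendsto_add[OF elim(1,2)] i by (simp add: ravg_add[OF elim(3,4)])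
  qed
qed

lemma averages_cmult:
  assumes "averages f"
  shows "averages (\<lambda>\<omega>. c * f \<omega>)"
  using assms unfolding averages_def ravg_cmult by (auto intro: tendsto_mult_left elim!: eventually_mono)

text \<open>The Banach principle: \<open>upper_avg_le\<close> bounds the limsup of the averages of
  |f - g| almost surely by a constant times the L1 distance of \<open>f\<close> and
  \<open>g\<close>, so an L1 limit inherits convergence by splitting the tolerance into
  thirds.\<close>

lemma averages_closed:
  assumes f: "integrable M f" and ap: "\<And>e. e > 0 \<Longrightarrow> \<exists>g. averages g \<and> (LINT \<omega>|M. \<bar>f \<omega> - g \<omega>\<bar>) \<le> e"
  shows "averages f"
  unfolding averages_def
proof (intro conjI f)
  let ?C = "(5 * sqrt (real CARD('d))) ^ CARD('d)"
  have "?C \<ge> 0" by simp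
  have "\<forall>k::nat. \<exists>g. averages g \<and> (LINT \<omega>|M. \<bar>f \<omega> - g \<omega>\<bar>) \<le> 1 / real (Suc k)"
    using ap by simp
  from choice[OF this] obtain g where g: "\<And>k. averages (g k)" "\<And>k. (LINT \<omega>|M. \<bar>f \<omega> - g k \<omega>\<bar>) \<le> 1 / real (Suc k)" by blast
  have gi: "integrable M (g k)" for k using g(1) by (simp add: averages_def)
  have [measurable]: "f \<in> borel_measurable M" "g k \<in> borel_measurable M" for k using f gi[of k] by auto
  have "AE \<omega> in M. (\<lambda>n. ravg (g k) (real (Suc n)) \<omega>) \<longlonglongrightarrow> (LINT \<omega>|M. g k \<omega>)" for k
    using g(1) by (simp add: averages_def)
  then have a1: "AE \<omega> in M. \<forall>k. (\<lambda>n. ravg (g k) (real (Suc n)) \<omega>) \<longlonglongrightarrow> (LINT \<omega>|M. g k \<omega>)"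
    by (simp add: AE_all_countable)
  have "AE \<omega> in M. loc_int (\<lambda>y. g k (T y \<omega>))" for k by (rule AE_loc_int[OF gi])
  then have a2: "AE \<omega> in M. \<forall>k. loc_int (\<lambda>y. g k (T y \<omega>))" by (simp add: AE_all_countable)
  have "AE \<omega> in M. loc_int (\<lambda>y. f (T y \<omega>) - g k (T y \<omega>))" for k
    by (rule AE_loc_int[of "\<lambda>\<omega>. f \<omega> - g k \<omega>"]) (use f gi in simp)
  then have a5: "AE \<omega> in M. \<forall>k. loc_int (\<lambda>y. f (T y \<omega>) - g k (T y \<omega>))" by (simp add: AE_all_countable)
  have "AE \<omega> in M. upper_avg (\<lambda>\<omega>. ennreal \<bar>f \<omega> - g k \<omega>\<bar>) \<omega> \<le> ennreal (?C * (1 / real (Suc k)))" for k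
  proof -
    let ?I = "LINT \<omega>|M. \<bar>f \<omega> - g k \<omega>\<bar>"
    have u: "AE \<omega> in M. upper_avg (\<lambda>\<omega>. ennreal \<bar>f \<omega> - g k \<omega>\<bar>) \<omega> \<le> ennreal (?C * ?I)"
      by (rule upper_avg_le) (use f gi[of k] in \<open>auto intro!: nn_integral_eq_integral\<close>)
    have le: "ennreal (?C * ?I) \<le> ennreal (?C * (1 / real (Suc k)))"
      using g(2)[of k] \<open>?C \<ge> 0\<close> by (intro ennreal_leI mult_left_mono) auto
    show ?thesis using u by (rule eventually_mono) (rule order_trans[OF _ le])
  qed
  then have a3: "AE \<omega> in M. \<forall>k. upper_avg (\<lambda>\<omega>. ennreal \<bar>f \<omega> - g k \<omega>\<bar>) \<omega> \<le> ennreal (?C * (1 / real (Suc k)))"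
    by (simp add: AE_all_countable)
  show "AE \<omega> in M. (\<lambda>n. ravg f (real (Suc n)) \<omega>) \<longlonglongrightarrow> (LINT \<omega>|M. f \<omega>)"
    using a1 a2 a3 a5 AE_loc_int[OF f]
  proof eventually_elim
    case (elim \<omega>)
    show ?case
    proof (rule LIMSEQ_I)
      fix e :: real assume "e > 0"
      define C where "C = ?C"
      have "C \<ge> 0" by (simp add: C_def)
      have "e / (3 * (C + 1)) > 0" using \<open>e > 0\<close> \<open>C \<ge> 0\<close> by simp
      then obtain k :: nat where k: "inverse (real (Suc k)) < e / (3 * (C + 1))" using reals_Archimedean by blast
      have k': "1 / real (Suc k) < e / 3" "C * (1 / real (Suc k)) < e / 3"
      proof -
        have "(C + 1) * (1 / real (Suc k)) < e / 3"
          using k \<open>C \<ge> 0\<close> by (simp add: field_simps del: of_nat_Suc)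
        moreover have "0 \<le> C * (1 / real (Suc k))" "0 \<le> 1 / real (Suc k)" using \<open>C \<ge> 0\<close> by auto
        ultimately show "1 / real (Suc k) < e / 3" "C * (1 / real (Suc k)) < e / 3"
          by (auto simp only: distrib_right mult_1)
      qed
      have "limsup (\<lambda>n. eavg (\<lambda>\<omega>. ennreal \<bar>f \<omega> - g k \<omega>\<bar>) (real (Suc n)) \<omega>) < ennreal (e / 3)"
        using elim(3)[rule_format, of k] k'(2) \<open>e > 0\<close> unfolding upper_avg_def C_def
        by (intro order.strict_trans1[OF _ ennreal_lessI]) auto
      from Limsup_lessD[OF this]
      have 1: "\<forall>\<^sub>F n in sequentially. \<bar>ravg (\<lambda>\<omega>. f \<omega> - g k \<omega>) (real (Suc n)) \<omega>\<bar> < e / 3"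
      proof (rule eventually_mono)
        fix n assume "eavg (\<lambda>\<omega>. ennreal \<bar>f \<omega> - g k \<omega>\<bar>) (real (Suc n)) \<omega> < ennreal (e / 3)"
        then have "ennreal \<bar>ravg (\<lambda>\<omega>. f \<omega> - g k \<omega>) (real (Suc n)) \<omega>\<bar> < ennreal (e / 3)"
          using abs_ravg_le[of "real (Suc n)" "\<lambda>\<omega>. f \<omega> - g k \<omega>" \<omega>] elim(4) by (auto intro: order.strict_trans1)
        then show "\<bar>ravg (\<lambda>\<omega>. f \<omega> - g k \<omega>) (real (Suc n)) \<omega>\<bar> < e / 3"
          using \<open>e > 0\<close> by (simp add: ennreal_less_iff)
      qed
      have 2: "\<forall>\<^sub>F n in sequentially. \<bar>ravg (g k) (real (Suc n)) \<omega> - (LINT \<omega>|M. g k \<omega>)\<bar> < e / 3"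
        using tendstoD[OF elim(1)[rule_format, of k], of "e / 3"] \<open>e > 0\<close> by (simp add: dist_real_def)
      have 3: "\<bar>(LINT \<omega>|M. f \<omega>) - (LINT \<omega>|M. g k \<omega>)\<bar> < e / 3"
      proof -
        have "\<bar>(LINT \<omega>|M. f \<omega>) - (LINT \<omega>|M. g k \<omega>)\<bar> = \<bar>LINT \<omega>|M. f \<omega> - g k \<omega>\<bar>" using f gi by simp
        also have "\<dots> \<le> (LINT \<omega>|M. \<bar>f \<omega> - g k \<omega>\<bar>)" by (rule integral_abs_bound)
        finally show ?thesis using g(2)[of k] k'(1) by linarith
      qed
      from eventually_conj[OF 1 2] obtain N where N: "\<And>n. n \<ge> N \<Longrightarrow> \<bar>ravg (\<lambda>\<omega>. f \<omega> - g k \<omega>) (real (Suc n)) \<omega>\<bar> < e / 3 \<and>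
         \<bar>ravg (g k) (real (Suc n)) \<omega> - (LINT \<omega>|M. g k \<omega>)\<bar> < e / 3"
        by (auto simp: eventually_sequentially)
      show "\<exists>N. \<forall>n\<ge>N. norm (ravg f (real (Suc n)) \<omega> - (LINT \<omega>|M. f \<omega>)) < e"
      proof (intro exI[of _ N] allI impI)
        fix n assume "n \<ge> N"
        then show "norm (ravg f (real (Suc n)) \<omega> - (LINT \<omega>|M. f \<omega>)) < e"
          using N[of n] 3 ravg_diff[OF elim(5) elim(2)[rule_format, of k], of "real (Suc n)"] unfolding real_norm_def by linarith
      qed
    qed
  qed
qed

section \<open>Bounded functions: coboundaries, invariance and the hull of shifts\<close>

lemma bounded_integrable:
  fixes f :: "'w \<Rightarrow> real"
  assumes "f \<in> borel_measurable M" "\<And>\<omega>. \<bar>f \<omega>\<bar> \<le> B"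
  shows "integrable M f"
  by (rule integrable_const_bound[of _ B]) (use assms in auto)

text \<open>The two integrals run over a cube and its translate, which differ only in a boundary
  layer whose relative volume tends to 0.\<close>

lemma averages_coboundary:
  assumes f [measurable]: "f \<in> borel_measurable M" and B: "\<And>\<omega>. \<bar>f \<omega>\<bar> \<le> B"
  shows "averages (\<lambda>\<omega>. f \<omega> - f (T z \<omega>))"
proof -
  let ?d = "CARD('d)"
  have "B \<ge> 0" using B[of undefined] by linarith
  obtain m :: nat where m: "norm z \<le> real m" using real_arch_simple by blast
  have fi: "integrable M f" by (rule bounded_integrable[OF f B])
  have fzi: "integrable M (\<lambda>\<omega>. f (T z \<omega>))" using fi by (simp add: integrable_shift)
  have 0: "(LINT \<omega>|M. f \<omega> - f (T z \<omega>)) = 0" using fi fzi by (simp add: integral_shift)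
  have bnd: "\<bar>ravg (\<lambda>\<omega>. f \<omega> - f (T z \<omega>)) \<rho> \<omega>\<bar> \<le> 2 * B * ((1 + real m * inverse \<rho>) ^ ?d - 1)"
    if \<rho>: "\<rho> > 0" and \<omega>: "\<omega> \<in> space M" for \<rho> \<omega>
  proof -
    have [measurable]: "(\<lambda>y. T y \<omega>) \<in> borel \<rightarrow>\<^sub>M M" by (rule T_orbit_measurable[OF \<omega>])
    define F where "F y = f (T y \<omega>)" for y
    have [measurable]: "F \<in> borel_measurable borel" unfolding F_def by measurable
    have FB: "\<bar>F y\<bar> \<le> B" for y by (simp add: F_def B)
    have lF: "loc_int F" "loc_int (\<lambda>y. F (z + y))" by (rule loc_intI_bounded[of _ B]; simp add: FB)+
    let ?Q = "cube \<rho> :: (real^'d) set" and ?Q' = "cube (\<rho> + real m) :: (real^'d) set"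
    have iQ: "integrable lborel (\<lambda>y. indicator (cube r) y * H y)" if "loc_int H" for r and H :: "real^'d \<Rightarrow> real"
      by (rule integrable_cube[OF that])
    have i1: "integrable lborel (\<lambda>y. indicator ?Q (y - z) * F y)"
      using lborel_integrable_translate[of "\<lambda>y. indicator ?Q (y - z) * F y" z] iQ[OF lF(2), of \<rho>] by simp
    have tr: "(LINT y|lborel. indicator ?Q y * F (z + y)) = (LINT y|lborel. indicator ?Q (y - z) * F y)"
      using lborel_integral_translate[of "\<lambda>y. indicator ?Q (y - z) * F y" z] by simp
    have q0: "integrable lborel (\<lambda>y::real^'d. indicator (cube r) y :: real)" for r
      using iQ[of "\<lambda>y. 1" r] loc_intI_bounded[of "\<lambda>y::real^'d. 1" 1] by simp
    have qz: "integrable lborel (\<lambda>y. indicator ?Q (y - z) :: real)" "(LINT y|lborel. indicator ?Q (y - z)) = (\<integral>y. indicator ?Q y \<partial>lborel :: real)"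
      using lborel_integrable_translate[of "\<lambda>y. indicator ?Q y :: real" "- z"] q0
        lborel_integral_translate[of "\<lambda>y. indicator ?Q y :: real" "- z"] by simp_all
    have "(LINT y|lborel. indicator ?Q y * (f (T y \<omega>) - f (T z (T y \<omega>)))) = (LINT y|lborel. indicator ?Q y * F y - indicator ?Q y * F (z + y))"
      by (simp add: F_def T_add[OF \<omega>] right_diff_distrib)
    also have "\<dots> = (LINT y|lborel. indicator ?Q y * F y - indicator ?Q (y - z) * F y)"
      using iQ[OF lF(1)] iQ[OF lF(2)] i1 tr by simp
    finally have "\<bar>LINT y|lborel. indicator ?Q y * (f (T y \<omega>) - f (T z (T y \<omega>)))\<bar>
       \<le> (LINT y|lborel. \<bar>indicator ?Q y * F y - indicator ?Q (y - z) * F y\<bar>)"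
      by (simp only: integral_abs_bound)
    \<comment> \<open>Both the cube and its translate lie in \<open>?Q'\<close>; their symmetric
      difference is dominated by the two differences from \<open>?Q'\<close>, which have the same
      volume.\<close>
    also have "\<dots> \<le> (LINT y|lborel. B * ((indicator ?Q' y - indicator ?Q y) + (indicator ?Q' y - indicator ?Q (y - z))))"
    proof (rule integral_mono)
      show "\<bar>indicator ?Q y * F y - indicator ?Q (y - z) * F y\<bar> \<le> B * ((indicator ?Q' y - indicator ?Q y) + (indicator ?Q' y - indicator ?Q (y - z)))" for y
      proof -
        have "y \<in> ?Q \<Longrightarrow> y \<in> ?Q'" using cube_mono[of \<rho> "\<rho> + real m"] by auto
        moreover have "y - z \<in> ?Q \<Longrightarrow> y \<in> ?Q'" using cube_add[of "y - z" \<rho> z "real m"] m by simp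
        ultimately show ?thesis using FB[of y] \<open>B \<ge> 0\<close> by (auto simp: indicator_def)
      qed
    qed (use iQ[OF lF(1)] i1 q0 qz in auto)
    also have "\<dots> = 2 * B * (measure lborel ?Q' - measure lborel ?Q)"
      using q0 qz by (simp add: algebra_simps)
    also have "\<dots> = 2 * B * ((2 * (\<rho> + real m)) ^ ?d - (2 * \<rho>) ^ ?d)"
      using \<rho> by (simp add: measure_cube)
    finally have "\<bar>ravg (\<lambda>\<omega>. f \<omega> - f (T z \<omega>)) \<rho> \<omega>\<bar> \<le> 2 * B * ((2 * (\<rho> + real m)) ^ ?d - (2 * \<rho>) ^ ?d) / (2 * \<rho>) ^ ?d"
      using \<rho> by (simp add: ravg_def divide_right_mono)
    also have "\<dots> = 2 * B * ((2 * (\<rho> + real m)) ^ ?d / (2 * \<rho>) ^ ?d - 1)"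
    proof -
      have "2 * B * (x - y) / y = 2 * B * (x / y - 1)" if "y > 0" for x y
        using that by (simp add: field_simps)
      then show ?thesis using \<rho> by simp
    qed
    also have "(2 * (\<rho> + real m)) ^ ?d / (2 * \<rho>) ^ ?d = (1 + real m * inverse \<rho>) ^ ?d"
      unfolding power_divide[symmetric] by (rule arg_cong[of _ _ "\<lambda>x. x ^ ?d"]) (use \<rho> in \<open>simp add: field_simps\<close>)
    finally show ?thesis .
  qed
  show ?thesis
    unfolding averages_def 0
  proof (intro conjI)
    show "integrable M (\<lambda>\<omega>. f \<omega> - f (T z \<omega>))" using fi fzi by simp
    have "(\<lambda>n. 2 * B * ((1 + real m * inverse (real (Suc n))) ^ ?d - 1)) \<longlonglongrightarrow> 2 * B * ((1 + real m * 0) ^ ?d - 1)"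
      by (intro tendsto_intros LIMSEQ_inverse_real_of_nat)
    then have l: "(\<lambda>n. 2 * B * ((1 + real m * inverse (real (Suc n))) ^ ?d - 1)) \<longlonglongrightarrow> 0" by simp
    show "AE \<omega> in M. (\<lambda>n. ravg (\<lambda>\<omega>. f \<omega> - f (T z \<omega>)) (real (Suc n)) \<omega>) \<longlonglongrightarrow> 0"
    proof (rule AE_I2)
      fix \<omega> assume \<omega>: "\<omega> \<in> space M"
      show "(\<lambda>n. ravg (\<lambda>\<omega>. f \<omega> - f (T z \<omega>)) (real (Suc n)) \<omega>) \<longlonglongrightarrow> 0"
        by (rule Lim_null_comparison[OF _ l]) (intro always_eventually allI, simp only: real_norm_def, rule bnd[OF _ \<omega>], simp)
    qed
  qed
qed

text \<open>The invariance is only almost sure for each \<open>z\<close>, whereas ergodicity speaks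
  of strictly invariant sets. The detour is through \<open>upper_avg\<close>, which is strictly
  invariant and almost surely agrees with \<open>h\<close>, because \<open>h\<close> is constant
  almost everywhere along almost every orbit. Adding \<open>B\<close> makes \<open>h\<close>
  nonnegative. With \<open>e\<close> the mean, neither \<open>h > e\<close> nor \<open>h < e\<close>
  can have probability 1.\<close>

lemma invariant_imp_constant:
  fixes g :: "'w \<Rightarrow> real"
  assumes g [measurable]: "g \<in> borel_measurable M" and B: "\<And>\<omega>. \<bar>g \<omega>\<bar> \<le> B" and inv: "\<And>z. AE \<omega> in M. g (T z \<omega>) = g \<omega>"
  shows "AE \<omega> in M. g \<omega> = (LINT \<omega>|M. g \<omega>)"
proof -
  define h where "h \<omega> = g \<omega> + B" for \<omega>
  have hn: "h \<omega> \<ge> 0" for \<omega> using B[of \<omega>] unfolding h_def by linarith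
  have [measurable]: "h \<in> borel_measurable M" unfolding h_def by measurable
  have gi: "integrable M g" by (rule bounded_integrable[OF g B])
  have "AE y in lborel. AE \<omega> in M. h (T y \<omega>) = h \<omega>" using inv by (simp add: h_def)
  then have "AE \<omega> in M. AE y in lborel. h (T y \<omega>) = h \<omega>"
    by (subst YM.AE_commute[symmetric]) measurable
  then have U: "AE \<omega> in M. upper_avg (\<lambda>\<omega>. ennreal (h \<omega>)) \<omega> = ennreal (h \<omega>)"
    using AE_space
  proof eventually_elim
    case (elim \<omega>)
    have [measurable]: "(\<lambda>y. T y \<omega>) \<in> borel \<rightarrow>\<^sub>M M" using elim by (intro T_orbit_measurable)
    have "eavg (\<lambda>\<omega>. ennreal (h \<omega>)) (real (Suc n)) \<omega> = ennreal (h \<omega>)" for n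
    proof -
      have "(\<integral>\<^sup>+y. ennreal (h (T y \<omega>)) * indicator (cube (real (Suc n))) y \<partial>lborel)
         = (\<integral>\<^sup>+y. ennreal (h \<omega>) * indicator (cube (real (Suc n))) (y::real^'d) \<partial>lborel)"
        by (rule nn_integral_cong_AE) (use elim(1) in \<open>auto elim: eventually_mono\<close>)
      also have "\<dots> = ennreal (h \<omega>) * ennreal ((2 * real (Suc n)) ^ CARD('d))"
        by (simp add: nn_integral_cmult emeasure_cube del: of_nat_Suc)
      finally show ?thesis
        unfolding eavg_def by (simp add: ennreal_mult_divide_eq del: of_nat_Suc)
    qed
    then show ?case unfolding upper_avg_def by (simp add: Limsup_const)
  qed
  define e where "e = (LINT \<omega>|M. h \<omega>)"
  have hi: "integrable M h" unfolding h_def using gi by simp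
  have zo: "prob {\<omega> \<in> space M. h \<omega> \<in> S} = 0 \<or> prob {\<omega> \<in> space M. h \<omega> \<in> S} = 1"
    if S: "S = {e<..} \<or> S = {..<e}" for S
  proof -
    have e0: "e \<ge> 0" unfolding e_def using hn by simp
    obtain S' where S': "S' \<in> sets borel" "\<And>x. x \<ge> 0 \<Longrightarrow> (x \<in> S \<longleftrightarrow> ennreal x \<in> S')"
    proof (cases "S = {e<..}")
      case True
      then show ?thesis using e0 by (intro that[of "{ennreal e<..}"]) (auto simp: ennreal_less_iff)
    next
      case False
      then have "S = {..<e}" using S by blast
      then show ?thesis using e0 by (intro that[of "{..<ennreal e}"]) (auto simp: ennreal_less_iff)
    qed
    note [measurable] = S'(1)
    have [measurable]: "S \<in> sets borel" using S by auto
    have "prob {\<omega> \<in> space M. h \<omega> \<in> S} = prob {\<omega> \<in> space M. upper_avg (\<lambda>\<omega>. ennreal (h \<omega>)) \<omega> \<in> S'}"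
    proof (rule finite_measure_eq_AE)
      show "AE \<omega> in M. \<omega> \<in> {\<omega> \<in> space M. h \<omega> \<in> S} \<longleftrightarrow> \<omega> \<in> {\<omega> \<in> space M. upper_avg (\<lambda>\<omega>. ennreal (h \<omega>)) \<omega> \<in> S'}"
        using U by (rule eventually_mono) (simp add: S'(2)[OF hn])
    qed measurable
    then show ?thesis using upper_avg_zero_one[of "\<lambda>\<omega>. ennreal (h \<omega>)" S'] S'(1) by simp
  qed
  have AE1: "AE \<omega> in M. \<omega> \<notin> X" if "X \<in> sets M" "prob X = 0" for X
    using that by (intro AE_not_in) (simp add: null_setsI emeasure_eq_measure)
  have AE_in: "AE \<omega> in M. h \<omega> \<in> S" if "prob {\<omega> \<in> space M. h \<omega> \<in> S} = 1" and [measurable]: "S \<in> sets borel" for S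
    using that prob_eq_1[of "{\<omega> \<in> space M. h \<omega> \<in> S}"] by (auto elim: eventually_mono)
  have "prob {\<omega> \<in> space M. h \<omega> \<in> {e<..}} \<noteq> 1"
  proof
    assume "prob {\<omega> \<in> space M. h \<omega> \<in> {e<..}} = 1"
    from AE_in[OF this] have "AE \<omega> in M. e < h \<omega>" by simp
    then have "(LINT \<omega>|M. e) < (LINT \<omega>|M. h \<omega>)"
      by (intro integral_less_AE_space) (use hi emeasure_space_1 in auto)
    then show False by (simp add: e_def prob_space)
  qed
  then have p1: "prob {\<omega> \<in> space M. h \<omega> \<in> {e<..}} = 0" using zo by blast
  have "prob {\<omega> \<in> space M. h \<omega> \<in> {..<e}} \<noteq> 1"
  proof
    assume "prob {\<omega> \<in> space M. h \<omega> \<in> {..<e}} = 1"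
    from AE_in[OF this] have "AE \<omega> in M. h \<omega> < e" by simp
    then have "(LINT \<omega>|M. h \<omega>) < (LINT \<omega>|M. e)"
      by (intro integral_less_AE_space) (use hi emeasure_space_1 in auto)
    then show False by (simp add: e_def prob_space)
  qed
  then have p2: "prob {\<omega> \<in> space M. h \<omega> \<in> {..<e}} = 0" using zo by blast
  have "AE \<omega> in M. \<omega> \<notin> {\<omega> \<in> space M. h \<omega> \<in> {e<..}}" "AE \<omega> in M. \<omega> \<notin> {\<omega> \<in> space M. h \<omega> \<in> {..<e}}"
    by (rule AE1[OF _ p1], measurable) (rule AE1[OF _ p2], measurable)
  then have "AE \<omega> in M. h \<omega> = e"
    using AE_space by eventually_elim auto
  moreover have "e = (LINT \<omega>|M. g \<omega>) + B" unfolding e_def h_def using gi by (simp add: prob_space)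
  ultimately show ?thesis by (auto simp: h_def elim!: eventually_mono)
qed

text \<open>Closure under midpoints suffices in place of full convexity, since the parallelogram law
  only uses the midpoint of two elements.\<close>

inductive_set shift_hull :: "('w \<Rightarrow> real) \<Rightarrow> ('w \<Rightarrow> real) set" for f where
  base: "f \<in> shift_hull f"
| shift: "g \<in> shift_hull f \<Longrightarrow> (\<lambda>\<omega>. g (T z \<omega>)) \<in> shift_hull f"
| midpoint: "g \<in> shift_hull f \<Longrightarrow> h \<in> shift_hull f \<Longrightarrow> (\<lambda>\<omega>. (g \<omega> + h \<omega>) / 2) \<in> shift_hull f"

text \<open>For a shift, \<open>f \<omega> - g (T z \<omega>)\<close> is
  \<open>f \<omega> - g \<omega>\<close> plus the coboundary
  \<open>g \<omega> - g (T z \<omega>)\<close>; for a midpoint, the difference from \<open>f\<close>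
  is the mean of two earlier ones. Hence every element differs from \<open>f\<close> by a function
  whose averages tend to 0.\<close>

lemma shift_hull_properties:
  assumes "g \<in> shift_hull f" and f [measurable]: "f \<in> borel_measurable M" and B: "\<And>\<omega>. \<bar>f \<omega>\<bar> \<le> B"
  shows "g \<in> borel_measurable M \<and> (\<forall>\<omega>. \<bar>g \<omega>\<bar> \<le> B) \<and> (LINT \<omega>|M. g \<omega>) = (LINT \<omega>|M. f \<omega>) \<and> averages (\<lambda>\<omega>. f \<omega> - g \<omega>)"
  using assms(1)
proof induction
  case base
  then show ?case using f B averages_const[of 0] by simp
next
  case (shift g z)
  then have [measurable]: "g \<in> borel_measurable M" by simp
  have "averages (\<lambda>\<omega>. (f \<omega> - g \<omega>) + (g \<omega> - g (T z \<omega>)))"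
    using shift by (intro averages_add averages_coboundary) auto
  then show ?case using shift by (simp add: integral_shift)
next
  case (midpoint g h)
  then have [measurable]: "g \<in> borel_measurable M" "h \<in> borel_measurable M" by simp_all
  have i: "integrable M g" "integrable M h" using midpoint by (auto intro: bounded_integrable)
  have "averages (\<lambda>\<omega>. (1/2) * (f \<omega> - g \<omega>) + (1/2) * (f \<omega> - h \<omega>))"
    using midpoint by (intro averages_add averages_cmult) auto
  moreover have "(\<lambda>\<omega>. (1/2) * (f \<omega> - g \<omega>) + (1/2) * (f \<omega> - h \<omega>)) = (\<lambda>\<omega>. f \<omega> - (g \<omega> + h \<omega>) / 2)"
    by (auto simp: field_simps)
  moreover have "\<bar>(g \<omega> + h \<omega>) / 2\<bar> \<le> B" for \<omega>
  proof -
    have "\<bar>g \<omega>\<bar> \<le> B" "\<bar>h \<omega>\<bar> \<le> B" using midpoint.IH by blast+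
    then have "\<bar>g \<omega> + h \<omega>\<bar> \<le> 2 * B" by linarith
    then show ?thesis by simp
  qed
  ultimately show ?case using midpoint i by simp
qed

text \<open>The increments have a finite expected absolute sum, so the telescoping series converges
  absolutely almost surely.\<close>

lemma AE_convergent_of_summable_L1:
  fixes g :: "nat \<Rightarrow> 'w \<Rightarrow> real"
  assumes g: "\<And>n. integrable M (g n)" and s: "\<And>n. (LINT \<omega>|M. \<bar>g (Suc n) \<omega> - g n \<omega>\<bar>) \<le> c n" and "summable c"
  shows "AE \<omega> in M. convergent (\<lambda>n. g n \<omega>)"
proof -
  have [measurable]: "g n \<in> borel_measurable M" for n using g[of n] by simp
  have cn: "0 \<le> c n" for n by (rule order_trans[OF _ s[of n]]) simp
  have "(\<integral>\<^sup>+\<omega>. (\<Sum>n. ennreal \<bar>g (Suc n) \<omega> - g n \<omega>\<bar>) \<partial>M) = (\<Sum>n. \<integral>\<^sup>+\<omega>. ennreal \<bar>g (Suc n) \<omega> - g n \<omega>\<bar> \<partial>M)"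
    by (rule nn_integral_suminf) measurable
  also have "\<dots> \<le> (\<Sum>n. ennreal (c n))"
  proof (intro suminf_le allI)
    fix n
    have "(\<integral>\<^sup>+\<omega>. ennreal \<bar>g (Suc n) \<omega> - g n \<omega>\<bar> \<partial>M) = ennreal (LINT \<omega>|M. \<bar>g (Suc n) \<omega> - g n \<omega>\<bar>)"
      by (rule nn_integral_eq_integral) (use g in auto)
    also have "\<dots> \<le> ennreal (c n)" by (rule ennreal_leI[OF s])
    finally show "(\<integral>\<^sup>+\<omega>. ennreal \<bar>g (Suc n) \<omega> - g n \<omega>\<bar> \<partial>M) \<le> ennreal (c n)" .
  qed auto
  also have "\<dots> = ennreal (\<Sum>n. c n)" by (rule suminf_ennreal2[OF cn assms(3)])
  finally have "(\<integral>\<^sup>+\<omega>. (\<Sum>n. ennreal \<bar>g (Suc n) \<omega> - g n \<omega>\<bar>) \<partial>M) \<noteq> \<infinity>" by (auto simp: top_unique)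
  then have "AE \<omega> in M. (\<Sum>n. ennreal \<bar>g (Suc n) \<omega> - g n \<omega>\<bar>) \<noteq> \<infinity>"
    by (intro nn_integral_PInf_AE) measurable
  then show ?thesis
  proof (rule eventually_mono)
    fix \<omega> assume "(\<Sum>n. ennreal \<bar>g (Suc n) \<omega> - g n \<omega>\<bar>) \<noteq> \<infinity>"
    then have "summable (\<lambda>n. \<bar>g (Suc n) \<omega> - g n \<omega>\<bar>)"
      by (intro summable_suminf_not_top) auto
    then have "summable (\<lambda>n. g (Suc n) \<omega> - g n \<omega>)" by (rule summable_rabs_cancel)
    from tendsto_add[OF summable_LIMSEQ[OF this] tendsto_const[of "g 0 \<omega>"]]
    show "convergent (\<lambda>n. g n \<omega>)"
      unfolding sum_lessThan_telescope[of "\<lambda>n. g n \<omega>"] convergent_def by auto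
  qed
qed

text \<open>A minimising sequence of the quadratic norm over the convex hull of the shifts of \<open>f\<close> is Cauchy by
  the parallelogram law; its limit is shift invariant, hence constant by ergodicity.\<close>

lemma shift_hull_approximates_mean:
  assumes f [measurable]: "f \<in> borel_measurable M" and B: "\<And>\<omega>. \<bar>f \<omega>\<bar> \<le> B" and "e > 0"
  shows "\<exists>g\<in>shift_hull f. (LINT \<omega>|M. \<bar>g \<omega> - (LINT \<omega>|M. f \<omega>)\<bar>) \<le> e"
proof -
  have B0: "B \<ge> 0" using B[of undefined] by linarith
  define Q where "Q g = (LINT \<omega>|M. (g \<omega>)\<^sup>2)" for g :: "'w \<Rightarrow> real"
  note P = shift_hull_properties[OF _ f B]
  have hm: "g \<in> borel_measurable M" and hB: "\<bar>g \<omega>\<bar> \<le> B" and hE: "(LINT \<omega>|M. g \<omega>) = (LINT \<omega>|M. f \<omega>)" if "g \<in> shift_hull f" for g \<omega>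
    using P[OF that] by auto
  have hL: "g \<in> L2 M" if "g \<in> shift_hull f" for g
  proof -
    have "\<bar>(g \<omega>)\<^sup>2\<bar> \<le> B\<^sup>2" for \<omega> using power_mono[OF hB[OF that, of \<omega>], of 2] by simp
    then show ?thesis using hm[OF that] by (auto simp: L2_def intro!: bounded_integrable[of _ "B\<^sup>2"])
  qed
  define m where "m = Inf (Q ` shift_hull f)"
  have Q0: "Q g \<ge> 0" for g by (simp add: Q_def)
  have bdd: "bdd_below (Q ` shift_hull f)" using Q0 by (auto intro!: bdd_belowI[of _ 0])
  have mle: "m \<le> Q g" if "g \<in> shift_hull f" for g unfolding m_def by (rule cInf_lower[OF _ bdd]) (use that in blast)
  \<comment> \<open>The parallelogram law; the midpoint lies in the hull, so its quadratic norm is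
    at least \<open>m\<close>.\<close>
  have par: "(LINT \<omega>|M. (g \<omega> - h \<omega>)\<^sup>2) \<le> 2 * (Q g - m) + 2 * (Q h - m)" if "g \<in> shift_hull f" "h \<in> shift_hull f" for g h
  proof -
    have i: "integrable M (\<lambda>\<omega>. (g \<omega>)\<^sup>2)" "integrable M (\<lambda>\<omega>. (h \<omega>)\<^sup>2)" "integrable M (\<lambda>\<omega>. ((g \<omega> + h \<omega>) / 2)\<^sup>2)"
      using L2D(2)[OF hL[OF that(1)]] L2D(2)[OF hL[OF that(2)]] L2D(2)[OF hL[OF shift_hull.midpoint[OF that]]]
      unfolding real_norm_def power2_abs by blast+
    have "(LINT \<omega>|M. (g \<omega> - h \<omega>)\<^sup>2) = (LINT \<omega>|M. 2 * (g \<omega>)\<^sup>2 + 2 * (h \<omega>)\<^sup>2 - 4 * ((g \<omega> + h \<omega>) / 2)\<^sup>2)"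
      by (rule Bochner_Integration.integral_cong) (auto simp: power2_eq_square field_simps)
    also have "\<dots> = 2 * Q g + 2 * Q h - 4 * Q (\<lambda>\<omega>. (g \<omega> + h \<omega>) / 2)"
      unfolding Q_def using i by simp
    also have "\<dots> \<le> 2 * (Q g - m) + 2 * (Q h - m)"
      using mle[OF shift_hull.midpoint[OF that]] by simp
    finally show ?thesis .
  qed
  \<comment> \<open>The rate \<open>(1/4) ^ n\<close> makes the L1 distance of consecutive elements
    at most \<open>2 * (1/2) ^ n\<close>, which is summable, so that the sequence converges almost
    surely and not only in the mean.\<close>
  have "\<exists>g\<in>shift_hull f. Q g < m + (1/4) ^ n" for n :: nat
    using cInf_lessD[of "Q ` shift_hull f" "m + (1/4) ^ n"] shift_hull.base by (auto simp: m_def)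
  then have "\<forall>n. \<exists>g. g \<in> shift_hull f \<and> Q g < m + (1/4) ^ n" by blast
  from choice[OF this] obtain g where g: "\<And>n. g n \<in> shift_hull f" "\<And>n. Q (g n) < m + (1/4) ^ n" by blast
  have gm [measurable]: "g n \<in> borel_measurable M" for n by (rule hm[OF g(1)])
  have gi: "integrable M (g n)" for n by (rule bounded_integrable[OF gm hB[OF g(1)]])
  have L1: "(LINT \<omega>|M. \<bar>h \<omega> - g n \<omega>\<bar>) \<le> 2 * (1/2) ^ n" if h: "h \<in> shift_hull f" "Q h \<le> m + (1/4) ^ n" for h n
  proof -
    have "(LINT \<omega>|M. \<bar>h \<omega> - g n \<omega>\<bar>) \<le> L2norm M (\<lambda>\<omega>. h \<omega> - g n \<omega>)"
      using integral_norm_le_L2norm[OF L2_diff[OF hL[OF h(1)] hL[OF g(1)]]] by simp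
    also have "\<dots> \<le> sqrt (4 * (1/4) ^ n)"
      unfolding L2norm_def using par[OF h(1) g(1), of n] h(2) g(2)[of n] by (intro real_sqrt_le_mono) simp
    also have "\<dots> = 2 * (1/2) ^ n"
    proof -
      have "4 * (1/4) ^ n = (2 * (1/2) ^ n :: real)\<^sup>2" by (simp add: power_mult_distrib[symmetric] power_divide power2_eq_square)
      then show ?thesis by (simp only: real_sqrt_abs) simp
    qed
    finally show ?thesis .
  qed
  have "AE \<omega> in M. convergent (\<lambda>n. g n \<omega>)"
  proof (rule AE_convergent_of_summable_L1[OF gi])
    fix n
    have "Q (g (Suc n)) \<le> m + (1/4) ^ n"
    proof -
      have "(1/4::real) ^ Suc n \<le> (1/4) ^ n" by (rule power_decreasing) auto
      then show ?thesis using g(2)[of "Suc n"] by linarith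
    qed
    then show "(LINT \<omega>|M. \<bar>g (Suc n) \<omega> - g n \<omega>\<bar>) \<le> 2 * (1/2) ^ n" by (rule L1[OF g(1)])
  qed (intro summable_mult summable_geometric, simp)
  then have conv: "AE \<omega> in M. (\<lambda>n. g n \<omega>) \<longlonglongrightarrow> lim (\<lambda>n. g n \<omega>)"
    by (rule eventually_mono) (simp add: convergent_LIMSEQ_iff)
  \<comment> \<open>Almost surely the clipping to [-B, B] changes nothing; it gives a function
    bounded everywhere, as \<open>invariant_imp_constant\<close> requires.\<close>
  define l where "l \<omega> = max (- B) (min B (lim (\<lambda>n. g n \<omega>)))" for \<omega>
  have [measurable]: "(\<lambda>\<omega>. lim (\<lambda>n. g n \<omega>)) \<in> borel_measurable M"
    by (rule borel_measurable_lim_metric[OF gm])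
  have [measurable]: "l \<in> borel_measurable M"
    unfolding l_def by (intro borel_measurable_max borel_measurable_min borel_measurable_const) fact
  have lB: "\<bar>l \<omega>\<bar> \<le> B" for \<omega> using B0 by (auto simp: l_def)
  have gl: "AE \<omega> in M. (\<lambda>n. g n \<omega>) \<longlonglongrightarrow> l \<omega>"
    using conv
  proof (rule eventually_mono)
    fix \<omega> assume c: "(\<lambda>n. g n \<omega>) \<longlonglongrightarrow> lim (\<lambda>n. g n \<omega>)"
    have "\<bar>lim (\<lambda>n. g n \<omega>)\<bar> \<le> B"
      by (rule LIMSEQ_le_const2[OF tendsto_rabs[OF c]]) (use hB[OF g(1)] in blast)
    then have "l \<omega> = lim (\<lambda>n. g n \<omega>)" by (auto simp: l_def)
    then show "(\<lambda>n. g n \<omega>) \<longlonglongrightarrow> l \<omega>" using c by simp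
  qed
  have li: "integrable M l" by (rule bounded_integrable[OF _ lB]) simp
  have dom: "(\<lambda>n. \<integral>\<omega>. \<bar>g n \<omega> - h \<omega>\<bar> \<partial>M) \<longlonglongrightarrow> (LINT \<omega>|M. \<bar>l \<omega> - h \<omega>\<bar>)"
    if [measurable]: "h \<in> borel_measurable M" and hb: "\<And>\<omega>. \<bar>h \<omega>\<bar> \<le> B" for h
  proof (rule integral_dominated_convergence[where w="\<lambda>\<omega>. 2 * B"])
    show "AE \<omega> in M. (\<lambda>n. \<bar>g n \<omega> - h \<omega>\<bar>) \<longlonglongrightarrow> \<bar>l \<omega> - h \<omega>\<bar>"
      using gl by (rule eventually_mono) (intro tendsto_intros)
    show "AE \<omega> in M. norm \<bar>g n \<omega> - h \<omega>\<bar> \<le> 2 * B" for n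
    proof (rule AE_I2)
      fix \<omega>
      show "norm \<bar>g n \<omega> - h \<omega>\<bar> \<le> 2 * B" using hB[OF g(1), of n \<omega>] hb[of \<omega>] unfolding real_norm_def by linarith
    qed
  qed auto
  have "AE \<omega> in M. l (T z \<omega>) = l \<omega>" for z
  proof -
    \<comment> \<open>A shift of \<open>g n\<close> lies in the hull and has the same quadratic
      norm, hence is another near-minimiser, and two near-minimisers are close.\<close>
    have bz: "(LINT \<omega>|M. \<bar>g n (T z \<omega>) - g n \<omega>\<bar>) \<le> 2 * (1/2) ^ n" for n
    proof (rule L1[OF shift_hull.shift[OF g(1)]])
      have "Q (\<lambda>\<omega>. g n (T z \<omega>)) = Q (g n)" unfolding Q_def by (rule integral_shift[of "\<lambda>\<omega>. (g n \<omega>)\<^sup>2"]) measurable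
      then show "Q (\<lambda>\<omega>. g n (T z \<omega>)) \<le> m + (1/4) ^ n" using g(2)[of n] by simp
    qed
    have lz: "(\<lambda>n. 2 * (1/2) ^ n :: real) \<longlonglongrightarrow> 2 * 0" by (intro tendsto_intros LIMSEQ_power_zero) simp
    have z: "(\<lambda>n. \<integral>\<omega>. \<bar>g n (T z \<omega>) - g n \<omega>\<bar> \<partial>M) \<longlonglongrightarrow> 0"
    proof (rule tendsto_sandwich)
      show "\<forall>\<^sub>F n in sequentially. 0 \<le> (LINT \<omega>|M. \<bar>g n (T z \<omega>) - g n \<omega>\<bar>)" by simp
      show "\<forall>\<^sub>F n in sequentially. (LINT \<omega>|M. \<bar>g n (T z \<omega>) - g n \<omega>\<bar>) \<le> 2 * (1/2) ^ n" using bz by simp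
      show "(\<lambda>n. 2 * (1/2) ^ n :: real) \<longlonglongrightarrow> 0" using lz by simp
    qed simp
    have "(\<lambda>n. \<integral>\<omega>. \<bar>g n (T z \<omega>) - g n \<omega>\<bar> \<partial>M) \<longlonglongrightarrow> (LINT \<omega>|M. \<bar>l (T z \<omega>) - l \<omega>\<bar>)"
    proof (rule integral_dominated_convergence[where w="\<lambda>\<omega>. 2 * B"])
      show "AE \<omega> in M. (\<lambda>n. \<bar>g n (T z \<omega>) - g n \<omega>\<bar>) \<longlonglongrightarrow> \<bar>l (T z \<omega>) - l \<omega>\<bar>"
        using gl AE_shift[OF gl, of z] by eventually_elim (intro tendsto_intros)
      show "AE \<omega> in M. norm \<bar>g n (T z \<omega>) - g n \<omega>\<bar> \<le> 2 * B" for n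
      proof (rule AE_I2)
        fix \<omega>
        show "norm \<bar>g n (T z \<omega>) - g n \<omega>\<bar> \<le> 2 * B"
          using hB[OF g(1), of n \<omega>] hB[OF g(1), of n "T z \<omega>"] unfolding real_norm_def by linarith
      qed
    qed auto
    from LIMSEQ_unique[OF this z] have 0: "(LINT \<omega>|M. \<bar>l (T z \<omega>) - l \<omega>\<bar>) = 0" .
    have "integrable M (\<lambda>\<omega>. \<bar>l (T z \<omega>) - l \<omega>\<bar>)" using li by (auto simp: integrable_shift)
    from integral_nonneg_eq_0_iff_AE[OF this] 0 have "AE \<omega> in M. \<bar>l (T z \<omega>) - l \<omega>\<bar> = 0" by simp
    then show ?thesis by (auto elim!: eventually_mono)
  qed
  from invariant_imp_constant[OF _ lB this]
  have lc: "AE \<omega> in M. l \<omega> = (LINT \<omega>|M. l \<omega>)" by simp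
  have "(\<lambda>n. \<integral>\<omega>. g n \<omega> \<partial>M) \<longlonglongrightarrow> (LINT \<omega>|M. l \<omega>)"
    by (rule integral_dominated_convergence[where w="\<lambda>\<omega>. B"]) (use gl hB[OF g(1)] in auto)
  moreover have "(LINT \<omega>|M. g n \<omega>) = (LINT \<omega>|M. f \<omega>)" for n by (rule hE[OF g(1)])
  ultimately have lE: "(LINT \<omega>|M. l \<omega>) = (LINT \<omega>|M. f \<omega>)" by (simp add: LIMSEQ_const_iff)
  define E where "E = (LINT \<omega>|M. f \<omega>)"
  have EB: "\<bar>E\<bar> \<le> B"
  proof -
    have "\<bar>E\<bar> \<le> (LINT \<omega>|M. \<bar>f \<omega>\<bar>)" unfolding E_def by (rule integral_abs_bound)
    also have "\<dots> \<le> (LINT \<omega>|M. B)" by (intro integral_mono) (use B bounded_integrable[OF f B] in auto)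
    finally show ?thesis by (simp add: prob_space)
  qed
  have "(LINT \<omega>|M. \<bar>l \<omega> - E\<bar>) = (LINT \<omega>|M. 0)"
    by (rule integral_cong_AE) (use lc lE in \<open>auto simp: E_def elim: eventually_mono\<close>)
  with dom[of "\<lambda>\<omega>. E"] EB have "(\<lambda>n. \<integral>\<omega>. \<bar>g n \<omega> - E\<bar> \<partial>M) \<longlonglongrightarrow> 0" by simp
  then have "\<forall>\<^sub>F n in sequentially. (LINT \<omega>|M. \<bar>g n \<omega> - E\<bar>) < e" using \<open>e > 0\<close> by (rule order_tendstoD)
  then obtain n where "(LINT \<omega>|M. \<bar>g n \<omega> - E\<bar>) < e" by (auto simp: eventually_sequentially)
  then show ?thesis using g(1)[of n] unfolding E_def by (intro bexI[of _ "g n"]) auto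
qed

text \<open>The approximant is \<open>f - g\<close>, which averages by
  \<open>shift_hull_properties\<close>, plus the mean of \<open>f\<close>; its distance to
  \<open>f\<close> is that of \<open>g\<close> to the mean.\<close>

lemma averages_bounded:
  assumes f [measurable]: "f \<in> borel_measurable M" and B: "\<And>\<omega>. \<bar>f \<omega>\<bar> \<le> B"
  shows "averages f"
proof (rule averages_closed[OF bounded_integrable[OF f B]])
  fix e :: real assume "e > 0"
  then obtain g where g: "g \<in> shift_hull f" "(LINT \<omega>|M. \<bar>g \<omega> - (LINT \<omega>|M. f \<omega>)\<bar>) \<le> e"
    using shift_hull_approximates_mean[OF f B] by blast
  let ?G = "\<lambda>\<omega>. (f \<omega> - g \<omega>) + (LINT \<omega>|M. f \<omega>)"
  have "averages ?G" using shift_hull_properties[OF g(1) f B] by (intro averages_add averages_const) auto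
  moreover have "(LINT \<omega>|M. \<bar>f \<omega> - ?G \<omega>\<bar>) \<le> e" using g(2) by simp
  ultimately show "\<exists>g. averages g \<and> (LINT \<omega>|M. \<bar>f \<omega> - g \<omega>\<bar>) \<le> e" by blast
qed

lemma averages_integrable:
  assumes f: "integrable M f"
  shows "averages f"
proof (rule averages_closed[OF f])
  fix e :: real assume "e > 0"
  have [measurable]: "f \<in> borel_measurable M" using f by simp
  define g where "g n \<omega> = max (- real n) (min (real n) (f \<omega>))" for n \<omega>
  have [measurable]: "g n \<in> borel_measurable M" for n unfolding g_def by measurable
  have gf: "\<bar>f \<omega> - g n \<omega>\<bar> \<le> \<bar>f \<omega>\<bar>" for n \<omega> by (auto simp: g_def)
  have "(\<lambda>n. \<integral>\<omega>. \<bar>f \<omega> - g n \<omega>\<bar> \<partial>M) \<longlonglongrightarrow> (LINT \<omega>|M. 0)"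
  proof (rule integral_dominated_convergence[where w="\<lambda>\<omega>. \<bar>f \<omega>\<bar>"])
    show "AE \<omega> in M. (\<lambda>n. \<bar>f \<omega> - g n \<omega>\<bar>) \<longlonglongrightarrow> 0"
    proof (intro AE_I2 tendsto_eventually)
      fix \<omega>
      obtain N :: nat where N: "\<bar>f \<omega>\<bar> \<le> real N" using real_arch_simple by blast
      show "\<forall>\<^sub>F n in sequentially. \<bar>f \<omega> - g n \<omega>\<bar> = 0"
        using eventually_ge_at_top[of N]
      proof eventually_elim
        case (elim n)
        then have "real N \<le> real n" by simp
        then show ?case using N by (simp add: g_def)
      qed
    qed
  qed (use f gf in auto)
  then have "\<forall>\<^sub>F n in sequentially. (LINT \<omega>|M. \<bar>f \<omega> - g n \<omega>\<bar>) < e"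
    using \<open>e > 0\<close> by (intro order_tendstoD) auto
  then obtain n where n: "(LINT \<omega>|M. \<bar>f \<omega> - g n \<omega>\<bar>) < e" by (auto simp: eventually_sequentially)
  have "averages (g n)" by (rule averages_bounded[of _ "real n"]) (auto simp: g_def)
  then show "\<exists>g. averages g \<and> (LINT \<omega>|M. \<bar>f \<omega> - g \<omega>\<bar>) \<le> e" using n by (intro exI[of _ "g n"]) auto
qed

text \<open>For nonnegative \<open>f\<close> the integral over the cube increases with \<rho>, so
  the average is squeezed between those at neighbouring integer radii, with volume ratios tending to
  1.\<close>

lemma ravg_tendsto_nonneg:
  assumes H: "loc_int (\<lambda>y. f (T y \<omega>))" and nn: "\<And>\<omega>. f \<omega> \<ge> 0" and l: "(\<lambda>n. ravg f (real (Suc n)) \<omega>) \<longlonglongrightarrow> E"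
  shows "((\<lambda>\<rho>. ravg f \<rho> \<omega>) \<longlongrightarrow> E) at_top"
proof -
  let ?d = "CARD('d)"
  let ?n = "\<lambda>\<rho>::real. nat \<lfloor>\<rho>\<rfloor>"
  define J where "J r = (LINT y|lborel. indicator (cube r) y * f (T y \<omega>))" for r
  have Jm: "J r \<le> J s" if "r \<le> s" for r s
    unfolding J_def
    by (rule integral_mono[OF integrable_cube[OF H] integrable_cube[OF H]])
      (use subsetD[OF cube_mono[OF that]] nn in \<open>auto simp: indicator_def\<close>)
  have Jr: "J r = ravg f r \<omega> * (2 * r) ^ ?d" if "r > 0" for r using that by (simp add: J_def ravg_def)
  have fl: "filterlim (\<lambda>\<rho>::real. ?n \<rho>) at_top at_top" by real_asymp
  have fl1: "filterlim (\<lambda>\<rho>::real. ?n \<rho> - 1) at_top at_top" by real_asymp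
  have up: "((\<lambda>\<rho>. ravg f (real (Suc (?n \<rho>))) \<omega> * (real (Suc (?n \<rho>)) / \<rho>) ^ ?d) \<longlongrightarrow> E * 1 ^ ?d) at_top"
  proof (intro tendsto_intros)
    show "((\<lambda>\<rho>. ravg f (real (Suc (?n \<rho>))) \<omega>) \<longlongrightarrow> E) at_top" by (rule filterlim_compose[OF l fl])
    show "((\<lambda>\<rho>. real (Suc (?n \<rho>)) / \<rho>) \<longlongrightarrow> 1) at_top" by real_asymp
  qed
  \<comment> \<open>The sequence in \<open>l\<close> is indexed by \<open>Suc n\<close>, so the
    lower integer radius, the floor of \<rho>, is written as \<open>Suc (?n \<rho> - 1)\<close>; the
    two agree once \<rho> is at least 1.\<close>
  have lo: "((\<lambda>\<rho>. ravg f (real (Suc (?n \<rho> - 1))) \<omega> * (real (Suc (?n \<rho> - 1)) / \<rho>) ^ ?d) \<longlongrightarrow> E * 1 ^ ?d) at_top"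
  proof (intro tendsto_intros)
    show "((\<lambda>\<rho>. ravg f (real (Suc (?n \<rho> - 1))) \<omega>) \<longlongrightarrow> E) at_top" by (rule filterlim_compose[OF l fl1])
    show "((\<lambda>\<rho>. real (Suc (?n \<rho> - 1)) / \<rho>) \<longlongrightarrow> 1) at_top" by real_asymp
  qed
  have scale: "J r / (2 * \<rho>) ^ ?d = ravg f r \<omega> * (r / \<rho>) ^ ?d" if "r > 0" "\<rho> > 0" for r \<rho>
    using that by (simp add: Jr power_divide power_mult_distrib)
  have "\<forall>\<^sub>F \<rho>::real in at_top. ravg f (real (Suc (?n \<rho> - 1))) \<omega> * (real (Suc (?n \<rho> - 1)) / \<rho>) ^ ?d \<le> ravg f \<rho> \<omega>"
    using eventually_ge_at_top[of 1]
  proof eventually_elim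
    case (elim \<rho>)
    have "real (Suc (?n \<rho> - 1)) \<le> \<rho>"
    proof -
      have "?n \<rho> \<ge> 1" using elim by (simp add: le_nat_iff le_floor_iff)
      then have "Suc (?n \<rho> - 1) = ?n \<rho>" by simp
      then show ?thesis using elim by (simp add: of_nat_floor)
    qed
    from divide_right_mono[OF Jm[OF this], of "(2 * \<rho>) ^ ?d"]
    have "J (real (Suc (?n \<rho> - 1))) / (2 * \<rho>) ^ ?d \<le> J \<rho> / (2 * \<rho>) ^ ?d" using elim by simp
    moreover have "0 < real (Suc (?n \<rho> - 1))" "0 < \<rho>" using elim by auto
    ultimately show ?case using elim by (simp only: scale) simp
  qed
  moreover have "\<forall>\<^sub>F \<rho>::real in at_top. ravg f \<rho> \<omega> \<le> ravg f (real (Suc (?n \<rho>))) \<omega> * (real (Suc (?n \<rho>)) / \<rho>) ^ ?d"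
    using eventually_ge_at_top[of 1]
  proof eventually_elim
    case (elim \<rho>)
    have "\<rho> \<le> real (Suc (?n \<rho>))" 
    proof -
      have "real (Suc (?n \<rho>)) = of_int \<lfloor>\<rho>\<rfloor> + 1" using elim by simp
      then show ?thesis using real_of_int_floor_add_one_ge[of \<rho>] by linarith
    qed
    from divide_right_mono[OF Jm[OF this], of "(2 * \<rho>) ^ ?d"]
    have "J \<rho> / (2 * \<rho>) ^ ?d \<le> J (real (Suc (?n \<rho>))) / (2 * \<rho>) ^ ?d" using elim by simp
    moreover have "0 < real (Suc (?n \<rho>))" by (rule of_nat_0_less_iff[THEN iffD2]) simp
    moreover have "0 < \<rho>" using elim by simp
    ultimately show ?case using elim by (simp only: scale) simp
  qed
  ultimately show ?thesis using tendsto_sandwich[OF _ _ lo up] by simp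
qed

text \<open>The passage to real radii needs monotonicity in \<rho>, hence the split into positive
  and negative parts.\<close>

theorem pointwise_ergodic:
  assumes f: "integrable M f"
  shows "AE \<omega> in M. ((\<lambda>\<rho>. ravg f \<rho> \<omega>) \<longlongrightarrow> (LINT \<omega>|M. f \<omega>)) at_top"
proof -
  let ?p = "\<lambda>\<omega>. max (f \<omega>) 0" and ?m = "\<lambda>\<omega>. max (- f \<omega>) 0"
  have i: "integrable M ?p" "integrable M ?m" using f by auto
  have "AE \<omega> in M. (\<lambda>n. ravg ?p (real (Suc n)) \<omega>) \<longlonglongrightarrow> (LINT \<omega>|M. ?p \<omega>)"
    "AE \<omega> in M. (\<lambda>n. ravg ?m (real (Suc n)) \<omega>) \<longlonglongrightarrow> (LINT \<omega>|M. ?m \<omega>)"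
    using averages_integrable[OF i(1)] averages_integrable[OF i(2)] by (auto simp: averages_def)
  then show ?thesis
    using AE_loc_int[OF i(1)] AE_loc_int[OF i(2)]
  proof eventually_elim
    case (elim \<omega>)
    have pm: "?p \<omega> - ?m \<omega> = f \<omega>" for \<omega> by auto
    have "((\<lambda>\<rho>. ravg ?p \<rho> \<omega> - ravg ?m \<rho> \<omega>) \<longlongrightarrow> (LINT \<omega>|M. ?p \<omega>) - (LINT \<omega>|M. ?m \<omega>)) at_top"
      by (intro tendsto_diff ravg_tendsto_nonneg elim) auto
    moreover have "ravg ?p \<rho> \<omega> - ravg ?m \<rho> \<omega> = ravg f \<rho> \<omega>" for \<rho>
      using ravg_diff[OF elim(3,4), of \<rho>] by (simp add: pm)
    moreover have "(LINT \<omega>|M. ?p \<omega>) - (LINT \<omega>|M. ?m \<omega>) = (LINT \<omega>|M. f \<omega>)"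
      using Bochner_Integration.integral_diff[OF i] by (simp add: pm)
    ultimately show ?case by simp
  qed
qed

subsection \<open>Stochastic mollification\<close>

text \<open>Smoothing along the orbit. As a function of the starting shift it is \<open>conv\<close>
  of the orbit function (\<open>mol_orbit\<close>), so that stationary fields become smooth on
  almost every orbit.\<close>

definition mol :: "(real^'d \<Rightarrow> real) \<Rightarrow> ('w \<Rightarrow> real) \<Rightarrow> 'w \<Rightarrow> real" where
  "mol k f \<omega> = (LINT z|lborel. k z * f (T z \<omega>))"

lemma mol_measurable [measurable]:
  assumes [measurable]: "k \<in> borel_measurable borel" "f \<in> borel_measurable M"
  shows "mol k f \<in> borel_measurable M"
  unfolding mol_def[abs_def] by measurable

lemma mol_orbit:
  assumes "\<omega> \<in> space M" "k \<in> borel_measurable borel" "f \<in> borel_measurable M"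
  shows "mol k f (T y \<omega>) = conv k (\<lambda>z. f (T z \<omega>)) y"
proof -
  note [measurable] = assms(2,3)
  have [measurable]: "(\<lambda>y. T y \<omega>) \<in> borel \<rightarrow>\<^sub>M M" by (rule T_orbit_measurable[OF assms(1)])
  show ?thesis
    by (subst conv_alt) (simp_all add: mol_def T_add[OF assms(1)] add.commute)
qed

lemma mol_smooth:
  assumes \<omega>: "\<omega> \<in> space M" and k: "k \<in> test_functions UNIV" and f: "f \<in> borel_measurable M"
    and l: "loc_int (\<lambda>z. f (T z \<omega>))"
  shows "Ck n (\<lambda>y. mol k f (T y \<omega>))"
    "pderiv_at (\<lambda>y. mol k f (T y \<omega>)) i y = - mol (pderiv_at k i) f (T y \<omega>)"
  unfolding mol_orbit[OF \<omega> test_functionsD(4)[OF k] f]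
    mol_orbit[OF \<omega> test_functionsD(4)[OF pderiv_at_test_functions[OF k]] f]
  by (rule Ck_conv[OF k l]) (simp add: pderiv_at_conv[OF k l])

lemma mol_L1:
  assumes [measurable]: "k \<in> borel_measurable borel" and B: "\<And>x. \<bar>k x\<bar> \<le> B" and R: "\<And>x. norm x > R \<Longrightarrow> k x = 0"
    and f: "integrable M f"
  shows "integrable M (mol k f)"
    "(LINT \<omega>|M. \<bar>mol k f \<omega>\<bar>) \<le> B * measure lborel (cball (0::real^'d) R) * (LINT \<omega>|M. \<bar>f \<omega>\<bar>)"
proof -
  have [measurable]: "f \<in> borel_measurable M" using f by simp
  note [measurable] = borel_closed[OF closed_cball]
  have "B \<ge> 0" using B[of 0] by linarith
  let ?m = "measure lborel (cball (0::real^'d) R)"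
  have em: "emeasure lborel (cball (0::real^'d) R) = ennreal ?m"
    using emeasure_lborel_cball_finite[of "0::real^'d" R] by (simp add: emeasure_eq_ennreal_measure top_unique)
  have "(\<integral>\<^sup>+\<omega>. ennreal \<bar>mol k f \<omega>\<bar> \<partial>M) \<le> (\<integral>\<^sup>+\<omega>. ennreal B * (\<integral>\<^sup>+y. ennreal \<bar>f (T y \<omega>)\<bar> * indicator (cball 0 R) y \<partial>lborel) \<partial>M)"
  proof (rule nn_integral_mono_AE)
    show "AE \<omega> in M. ennreal \<bar>mol k f \<omega>\<bar> \<le> ennreal B * (\<integral>\<^sup>+y. ennreal \<bar>f (T y \<omega>)\<bar> * indicator (cball 0 R) y \<partial>lborel)"
      using AE_loc_int[OF f] AE_space
    proof eventually_elim
      case (elim \<omega>)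
      have [measurable]: "(\<lambda>y. T y \<omega>) \<in> borel \<rightarrow>\<^sub>M M" by (rule T_orbit_measurable[OF elim(2)])
      have "ennreal (norm (LINT z|lborel. k z * f (T z \<omega>))) \<le> (\<integral>\<^sup>+z. ennreal (norm (k z * f (T z \<omega>))) \<partial>lborel)"
        by (rule integral_norm_bound_ennreal, rule loc_int_bound(1)[OF elim(1) _ B R]) auto
      also have "\<dots> \<le> (\<integral>\<^sup>+z. ennreal B * (ennreal \<bar>f (T z \<omega>)\<bar> * indicator (cball 0 R) z) \<partial>lborel)"
      proof (rule nn_integral_mono)
        fix z
        show "ennreal (norm (k z * f (T z \<omega>))) \<le> ennreal B * (ennreal \<bar>f (T z \<omega>)\<bar> * indicator (cball 0 R) z)"
        proof (cases "norm z > R")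
          case False
          have "ennreal (norm (k z * f (T z \<omega>))) \<le> ennreal (B * \<bar>f (T z \<omega>)\<bar>)"
            using B[of z] by (intro ennreal_leI) (simp add: abs_mult mult_right_mono)
          then show ?thesis using False \<open>B \<ge> 0\<close> by (simp add: indicator_def ennreal_mult)
        qed (simp add: R)
      qed
      also have "\<dots> = ennreal B * (\<integral>\<^sup>+y. ennreal \<bar>f (T y \<omega>)\<bar> * indicator (cball 0 R) y \<partial>lborel)"
        by (rule nn_integral_cmult) measurable
      finally show ?case by (simp add: mol_def)
    qed
  qed
  also have "\<dots> = ennreal B * ((\<integral>\<^sup>+\<omega>. ennreal \<bar>f \<omega>\<bar> \<partial>M) * emeasure lborel (cball (0::real^'d) R))"
    by (subst nn_integral_cmult, measurable) (subst nn_integral_orbit[of "\<lambda>\<omega>. ennreal \<bar>f \<omega>\<bar>"], auto)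
  also have "(\<integral>\<^sup>+\<omega>. ennreal \<bar>f \<omega>\<bar> \<partial>M) = ennreal (LINT \<omega>|M. \<bar>f \<omega>\<bar>)"
    by (rule nn_integral_eq_integral) (use f in auto)
  also have "ennreal B * (ennreal (LINT \<omega>|M. \<bar>f \<omega>\<bar>) * emeasure lborel (cball (0::real^'d) R)) = ennreal (B * ?m * (LINT \<omega>|M. \<bar>f \<omega>\<bar>))"
    using \<open>B \<ge> 0\<close> by (simp add: em ennreal_mult mult_ac)
  finally have le: "(\<integral>\<^sup>+\<omega>. ennreal \<bar>mol k f \<omega>\<bar> \<partial>M) \<le> ennreal (B * ?m * (LINT \<omega>|M. \<bar>f \<omega>\<bar>))" .
  then show i: "integrable M (mol k f)"
    by (intro integrableI_bounded) (auto simp: le_less_trans[OF _ ennreal_less_top])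
  have "(\<integral>\<^sup>+\<omega>. ennreal \<bar>mol k f \<omega>\<bar> \<partial>M) = ennreal (LINT \<omega>|M. \<bar>mol k f \<omega>\<bar>)"
    by (rule nn_integral_eq_integral) (use i in auto)
  then show "(LINT \<omega>|M. \<bar>mol k f \<omega>\<bar>) \<le> B * ?m * (LINT \<omega>|M. \<bar>f \<omega>\<bar>)"
    using le \<open>B \<ge> 0\<close> by (simp add: ennreal_le_iff)
qed

subsection \<open>Strong continuity of the group of shifts\<close>

lemma L2_shift: "f \<in> L2 M \<Longrightarrow> (\<lambda>\<omega>. f (T z \<omega>)) \<in> L2 M"
  using integrable_shift[of "\<lambda>\<omega>. (norm (f \<omega>))\<^sup>2" z] by (auto simp: L2_def)

lemma L2norm_shift: "f \<in> L2 M \<Longrightarrow> L2norm M (\<lambda>\<omega>. f (T z \<omega>)) = L2norm M f"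
  using integral_shift[of "\<lambda>\<omega>. (norm (f \<omega>))\<^sup>2" z] by (auto simp: L2_def L2norm_def)

text \<open>\<open>T\<close> is only jointly measurable, so continuity has to be produced.
  Invariance allows averaging the expectation over \<open>y\<close> in \<open>cube 1\<close>; the
  inner orbit integral \<open>G n\<close> then tends to 0 for each \<omega> by continuity of
  translations in the mean, and dominated convergence applies.\<close>

lemma shift_continuous_L1_bounded:
  fixes f :: "'w \<Rightarrow> real"
  assumes f [measurable]: "f \<in> borel_measurable M" and B: "\<And>\<omega>. \<bar>f \<omega>\<bar> \<le> B"
  shows "((\<lambda>z. \<integral>\<omega>. \<bar>f (T z \<omega>) - f \<omega>\<bar> \<partial>M) \<longlongrightarrow> 0) (at (0 :: real^'d))"
proof (rule LIMSEQ_SEQ_conv[THEN iffD1, rule_format])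
  fix S :: "nat \<Rightarrow> real^'d" assume S: "(\<forall>n. S n \<noteq> 0) \<and> S \<longlonglongrightarrow> 0"
  let ?Q = "cube 1 :: (real^'d) set"
  have "B \<ge> 0" using B[of undefined] by linarith
  have vol: "emeasure lborel ?Q = ennreal (2 ^ CARD('d))" using emeasure_cube[of 1, where 'd='d] by simp
  define G where "G n \<omega> = (LINT y|lborel. indicator ?Q y * \<bar>f (T (S n + y) \<omega>) - f (T y \<omega>)\<bar>)" for n \<omega>
  have [measurable]: "G n \<in> borel_measurable M" for n unfolding G_def by measurable
  have qi: "integrable lborel (\<lambda>y. 2 * B * (indicator ?Q y :: real))"
    using vol by (intro integrable_mult_right integrable_real_indicator) auto
  have gi: "integrable lborel (\<lambda>y. indicator ?Q y * \<bar>f (T (S n + y) \<omega>) - f (T y \<omega>)\<bar>)" if "\<omega> \<in> space M" for n \<omega>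
  proof -
    have [measurable]: "(\<lambda>y. T y \<omega>) \<in> borel \<rightarrow>\<^sub>M M" by (rule T_orbit_measurable[OF that])
    have "(\<lambda>y. f (T y \<omega>)) \<in> borel_measurable borel"
      by (rule measurable_compose[OF T_orbit_measurable[OF that] f])
    moreover have "(\<lambda>y. f (T (S n + y) \<omega>)) \<in> borel_measurable borel"
      by (rule measurable_compose[OF T_comp f]) (use that in auto)
    ultimately have "(\<lambda>y. \<bar>f (T (S n + y) \<omega>) - f (T y \<omega>)\<bar>) \<in> borel_measurable borel" by simp
    moreover have "\<bar>\<bar>f (T (S n + y) \<omega>) - f (T y \<omega>)\<bar>\<bar> \<le> 2 * B" for y
      using B[of "T (S n + y) \<omega>"] B[of "T y \<omega>"] by linarith
    ultimately show ?thesis by (rule integrable_cube[OF loc_intI_bounded])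
  qed
  have b2: "\<bar>f (T x \<omega>) - f (T y \<omega>)\<bar> \<le> 2 * B" for x y \<omega> using B[of "T x \<omega>"] B[of "T y \<omega>"] by linarith
  have G0: "0 \<le> G n \<omega>" for n \<omega> by (simp add: G_def)
  have GB: "G n \<omega> \<le> 2 * B * 2 ^ CARD('d)" if "\<omega> \<in> space M" for n \<omega>
  proof -
    have "G n \<omega> \<le> (LINT y|lborel. 2 * B * (indicator ?Q y :: real))"
      unfolding G_def by (rule integral_mono[OF gi[OF that] qi]) (use b2 \<open>B \<ge> 0\<close> in \<open>auto simp: indicator_def\<close>)
    also have "\<dots> = 2 * B * 2 ^ CARD('d)" using vol by (simp add: measure_def)
    finally show ?thesis .
  qed
  have lim: "(\<lambda>n. G n \<omega>) \<longlonglongrightarrow> 0" if \<omega>: "\<omega> \<in> space M" for \<omega>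
  proof (rule LIMSEQ_I)
    fix e :: real assume "e > 0"
    have [measurable]: "(\<lambda>y. T y \<omega>) \<in> borel \<rightarrow>\<^sub>M M" by (rule T_orbit_measurable[OF \<omega>])
    \<comment> \<open>Restriction to \<open>cube 2\<close> makes the orbit function bounded with
      bounded support; points of \<open>cube 1\<close> moved by less than 1 stay inside it.\<close>
    define h where "h y = indicator (cube 2) y * f (T y \<omega>)" for y
    have hm [measurable]: "h \<in> borel_measurable borel" unfolding h_def by measurable
    have hB: "\<bar>h y\<bar> \<le> B" for y using B[of "T y \<omega>"] \<open>B \<ge> 0\<close> by (auto simp: h_def indicator_def)
    have hR: "h y = 0" if "norm y > sqrt (CARD('d)) * 2" for y
      using norm_le_cube[of y 2] that by (auto simp: h_def indicator_def)
    obtain \<delta> where \<delta>: "\<delta> > 0" "\<And>t. norm t < \<delta> \<Longrightarrow> (LINT y|lborel. \<bar>h (t + y) - h y\<bar>) \<le> e / 2"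
      by (rule translation_L1[where e="e / 2" and R="sqrt (real CARD('d)) * 2", OF hm hB hR])
        (use \<open>e > 0\<close> in auto)
    have "\<forall>\<^sub>F n in sequentially. dist (S n) 0 < min \<delta> 1"
      using S \<delta>(1) by (intro tendstoD) auto
    then obtain N where N: "\<And>n. n \<ge> N \<Longrightarrow> norm (S n) < min \<delta> 1" by (auto simp: eventually_sequentially)
    show "\<exists>N. \<forall>n\<ge>N. norm (G n \<omega> - 0) < e"
    proof (intro exI[of _ N] allI impI)
      fix n assume "n \<ge> N"
      then have Sn: "norm (S n) < \<delta>" "norm (S n) < 1" using N by auto
      have ih: "integrable lborel h" by (rule integrable_bounded_support[OF hm hB hR])
      have "G n \<omega> \<le> (LINT y|lborel. \<bar>h (S n + y) - h y\<bar>)"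
        unfolding G_def
      proof (rule integral_mono[OF gi[OF \<omega>]])
        show "integrable lborel (\<lambda>y. \<bar>h (S n + y) - h y\<bar>)"
          using ih lborel_integrable_translate[of h "S n"] by auto
        fix y
        show "indicator ?Q y * \<bar>f (T (S n + y) \<omega>) - f (T y \<omega>)\<bar> \<le> \<bar>h (S n + y) - h y\<bar>"
        proof (cases "y \<in> ?Q")
          case True
          have "y + S n \<in> cube (1 + 1)" by (rule cube_add[OF True]) (use Sn in simp)
          then have "S n + y \<in> cube 2" by (simp add: add.commute)
          moreover have "y \<in> cube 2" using True cube_mono[of 1 2] by auto
          ultimately show ?thesis using True by (simp add: h_def)
        qed simp
      qed
      then show "norm (G n \<omega> - 0) < e" using \<delta>(2)[OF Sn(1)] G0[of n \<omega>] \<open>e > 0\<close> by simp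
    qed
  qed
  have "(\<lambda>n. \<integral>\<omega>. G n \<omega> \<partial>M) \<longlonglongrightarrow> (LINT \<omega>|M. 0)"
    by (rule integral_dominated_convergence[where w="\<lambda>\<omega>. 2 * B * 2 ^ CARD('d)"])
      (use lim GB G0 in \<open>auto simp: abs_of_nonneg\<close>)
  moreover have "(LINT \<omega>|M. G n \<omega>) = 2 ^ CARD('d) * (LINT \<omega>|M. \<bar>f (T (S n) \<omega>) - f \<omega>\<bar>)" for n
  proof -
    have fi: "integrable M f" by (rule bounded_integrable[OF f B])
    have di: "integrable M (\<lambda>\<omega>. \<bar>f (T (S n) \<omega>) - f \<omega>\<bar>)" using fi by (auto simp: integrable_shift)
    have Gi: "integrable M (G n)"
      by (rule integrable_const_bound[of _ "2 * B * 2 ^ CARD('d)"]) (use GB G0 in \<open>auto simp: abs_of_nonneg\<close>)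
    have "ennreal (LINT \<omega>|M. G n \<omega>) = (\<integral>\<^sup>+\<omega>. ennreal (G n \<omega>) \<partial>M)"
      by (rule nn_integral_eq_integral[symmetric]) (use Gi G0 in auto)
    also have "\<dots> = (\<integral>\<^sup>+\<omega>. (\<integral>\<^sup>+y. (\<lambda>\<omega>. ennreal \<bar>f (T (S n) \<omega>) - f \<omega>\<bar>) (T y \<omega>) * indicator ?Q y \<partial>lborel) \<partial>M)"
    proof (rule nn_integral_cong)
      fix \<omega> assume \<omega>: "\<omega> \<in> space M"
      have "ennreal (G n \<omega>) = (\<integral>\<^sup>+y. ennreal (indicator ?Q y * \<bar>f (T (S n + y) \<omega>) - f (T y \<omega>)\<bar>) \<partial>lborel)"
        unfolding G_def by (rule nn_integral_eq_integral[symmetric]) (use gi[OF \<omega>] in auto)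
      also have "\<dots> = (\<integral>\<^sup>+y. (\<lambda>\<omega>. ennreal \<bar>f (T (S n) \<omega>) - f \<omega>\<bar>) (T y \<omega>) * indicator ?Q y \<partial>lborel)"
        by (intro nn_integral_cong) (auto simp: T_add[OF \<omega>] indicator_def)
      finally show "ennreal (G n \<omega>) = (\<integral>\<^sup>+y. (\<lambda>\<omega>. ennreal \<bar>f (T (S n) \<omega>) - f \<omega>\<bar>) (T y \<omega>) * indicator ?Q y \<partial>lborel)" .
    qed
    also have "\<dots> = (\<integral>\<^sup>+\<omega>. ennreal \<bar>f (T (S n) \<omega>) - f \<omega>\<bar> \<partial>M) * emeasure lborel ?Q"
      by (rule nn_integral_orbit) auto
    also have "(\<integral>\<^sup>+\<omega>. ennreal \<bar>f (T (S n) \<omega>) - f \<omega>\<bar> \<partial>M) = ennreal (LINT \<omega>|M. \<bar>f (T (S n) \<omega>) - f \<omega>\<bar>)"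
      by (rule nn_integral_eq_integral[OF di]) simp
    also have "\<dots> * emeasure lborel ?Q = ennreal (2 ^ CARD('d) * (LINT \<omega>|M. \<bar>f (T (S n) \<omega>) - f \<omega>\<bar>))"
      unfolding vol by (subst ennreal_mult[symmetric]) (auto simp: mult.commute)
    finally show ?thesis using G0 by (subst (asm) ennreal_inj) auto
  qed
  ultimately have "(\<lambda>n. 2 ^ CARD('d) * (LINT \<omega>|M. \<bar>f (T (S n) \<omega>) - f \<omega>\<bar>)) \<longlonglongrightarrow> 0" by simp
  from tendsto_mult_left[OF this, of "1 / 2 ^ CARD('d)"]
  show "(\<lambda>n. \<integral>\<omega>. \<bar>f (T (S n) \<omega>) - f \<omega>\<bar> \<partial>M) \<longlonglongrightarrow> 0" by simp
qed

text \<open>\<open>T 0\<close> is not assumed to be the identity, only the semigroup law and invariance of \<open>M\<close> are.\<close>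

lemma AE_T0:
  fixes f :: "'w \<Rightarrow> real"
  assumes [measurable]: "f \<in> borel_measurable M"
  shows "AE \<omega> in M. f (T 0 \<omega>) = f \<omega>"
proof -
  let ?X = "{\<omega> \<in> space M. f (T 0 \<omega>) \<noteq> f \<omega>}"
  have X: "?X \<in> sets M" by measurable
  \<comment> \<open>\<open>T 0\<close> never maps into \<open>?X\<close>, because
    \<open>T 0 (T 0 \<omega>)\<close> and \<open>T 0 \<omega>\<close> agree by the semigroup law;
    invariance then makes \<open>?X\<close> null.\<close>
  have "emeasure M ?X = (\<integral>\<^sup>+\<omega>. indicator ?X (T 0 \<omega>) \<partial>M)"
    using X by (subst nn_integral_shift) auto
  also have "\<dots> = (\<integral>\<^sup>+\<omega>. 0 \<partial>M)"
    by (intro nn_integral_cong) (auto simp: T_add indicator_def)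
  finally have "?X \<in> null_sets M" using X by (simp add: null_setsI)
  then have "AE \<omega> in M. \<omega> \<notin> ?X" by (rule AE_not_in)
  then show ?thesis using AE_space by eventually_elim auto
qed

lemma L2_truncation:
  fixes f :: "'w \<Rightarrow> real"
  assumes f: "f \<in> L2 M" and "e > 0"
  obtains g B where "g \<in> borel_measurable M" "\<And>\<omega>. \<bar>g \<omega>\<bar> \<le> B" "L2norm M (\<lambda>\<omega>. f \<omega> - g \<omega>) < e"
proof -
  note [measurable] = L2D(1)[OF f]
  define g where "g n \<omega> = max (- real n) (min (real n) (f \<omega>))" for n \<omega>
  have [measurable]: "g n \<in> borel_measurable M" for n unfolding g_def by measurable
  have gf: "\<bar>f \<omega> - g n \<omega>\<bar> \<le> \<bar>f \<omega>\<bar>" for n \<omega> by (auto simp: g_def)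
  have "(\<lambda>n. \<integral>\<omega>. (norm (f \<omega> - g n \<omega>))\<^sup>2 \<partial>M) \<longlonglongrightarrow> (LINT \<omega>|M. 0)"
  proof (rule integral_dominated_convergence[where w="\<lambda>\<omega>. (norm (f \<omega>))\<^sup>2"])
    show "AE \<omega> in M. (\<lambda>n. (norm (f \<omega> - g n \<omega>))\<^sup>2) \<longlonglongrightarrow> 0"
    proof (intro AE_I2 tendsto_eventually)
      fix \<omega>
      obtain N :: nat where N: "\<bar>f \<omega>\<bar> \<le> real N" using real_arch_simple by blast
      show "\<forall>\<^sub>F n in sequentially. (norm (f \<omega> - g n \<omega>))\<^sup>2 = 0"
        using eventually_ge_at_top[of N]
      proof eventually_elim
        case (elim n)
        then have "real N \<le> real n" by simp
        then show ?case using N by (simp add: g_def)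
      qed
    qed
    show "AE \<omega> in M. norm ((norm (f \<omega> - g n \<omega>))\<^sup>2) \<le> (norm (f \<omega>))\<^sup>2" for n
    proof (rule AE_I2)
      fix \<omega> show "norm ((norm (f \<omega> - g n \<omega>))\<^sup>2) \<le> (norm (f \<omega>))\<^sup>2"
        using power_mono[OF gf[of \<omega> n], of 2] by simp
    qed
  qed (use L2D(2)[OF f] in auto)
  then have "\<forall>\<^sub>F n in sequentially. (LINT \<omega>|M. (norm (f \<omega> - g n \<omega>))\<^sup>2) < e\<^sup>2"
    using \<open>e > 0\<close> by (intro order_tendstoD) auto
  then obtain n where n: "(LINT \<omega>|M. (norm (f \<omega> - g n \<omega>))\<^sup>2) < e\<^sup>2" by (auto simp: eventually_sequentially)
  have "L2norm M (\<lambda>\<omega>. f \<omega> - g n \<omega>) < sqrt (e\<^sup>2)"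
    unfolding L2norm_def using n by (rule real_sqrt_less_mono)
  then show ?thesis using \<open>e > 0\<close> by (intro that[of "g n" "real n"]) (auto simp: g_def)
qed

text \<open>Bounded functions are dense, and for them the square of the difference is at most
  \<open>2 * B\<close> times its absolute value, which reduces the claim to the L1 statement. The
  point \<open>z = 0\<close> is not covered by a limit at 0 and needs \<open>AE_T0\<close>.\<close>

lemma shift_continuous:
  fixes f :: "'w \<Rightarrow> real"
  assumes f: "f \<in> L2 M" and "e > 0"
  obtains \<delta> where "\<delta> > 0" "\<And>z. norm z < \<delta> \<Longrightarrow> L2norm M (\<lambda>\<omega>. f (T z \<omega>) - f \<omega>) \<le> e"
proof -
  obtain g B where g [measurable]: "g \<in> borel_measurable M" and B: "\<And>\<omega>. \<bar>g \<omega>\<bar> \<le> B" and fg: "L2norm M (\<lambda>\<omega>. f \<omega> - g \<omega>) < e / 3"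
    using L2_truncation[OF f, of "e/3"] \<open>e > 0\<close> by auto
  have "B \<ge> 0" using B[of undefined] by linarith
  have gL: "g \<in> L2 M"
    unfolding L2_def mem_Collect_eq
  proof (intro conjI g bounded_integrable[of _ "B\<^sup>2"])
    show "\<bar>(norm (g \<omega>))\<^sup>2\<bar> \<le> B\<^sup>2" for \<omega> using power_mono[OF B[of \<omega>], of 2] by simp
  qed simp
  have "e\<^sup>2 / (9 * (2 * B + 1)) > 0" using \<open>e > 0\<close> \<open>B \<ge> 0\<close> by simp
  from tendstoD[OF shift_continuous_L1_bounded[OF g B] this]
  obtain \<delta> where \<delta>: "\<delta> > 0" "\<And>z. z \<noteq> 0 \<Longrightarrow> norm z < \<delta> \<Longrightarrow> (LINT \<omega>|M. \<bar>g (T z \<omega>) - g \<omega>\<bar>) < e\<^sup>2 / (9 * (2 * B + 1))"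
    unfolding eventually_at by auto
  have T0: "L2norm M (\<lambda>\<omega>. g (T z \<omega>) - g \<omega>) \<le> e / 3" if z: "norm z < \<delta>" "z \<noteq> 0" for z
  proof -
    have gi: "integrable M (\<lambda>\<omega>. \<bar>g (T z \<omega>) - g \<omega>\<bar>)"
      using bounded_integrable[OF g B] by (auto simp: integrable_shift)
    have "(LINT \<omega>|M. (norm (g (T z \<omega>) - g \<omega>))\<^sup>2) \<le> (LINT \<omega>|M. 2 * B * \<bar>g (T z \<omega>) - g \<omega>\<bar>)"
    proof (rule integral_mono)
      show "integrable M (\<lambda>\<omega>. (norm (g (T z \<omega>) - g \<omega>))\<^sup>2)" by (rule L2D(2)[OF L2_diff[OF L2_shift[OF gL] gL]])
      show "integrable M (\<lambda>\<omega>. 2 * B * \<bar>g (T z \<omega>) - g \<omega>\<bar>)" using gi by simp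
      fix \<omega>
      have "\<bar>g (T z \<omega>) - g \<omega>\<bar> \<le> 2 * B" using B[of "T z \<omega>"] B[of \<omega>] by linarith
      then show "(norm (g (T z \<omega>) - g \<omega>))\<^sup>2 \<le> 2 * B * \<bar>g (T z \<omega>) - g \<omega>\<bar>"
        unfolding real_norm_def power2_eq_square by (intro mult_right_mono) auto
    qed
    also have "\<dots> = 2 * B * (LINT \<omega>|M. \<bar>g (T z \<omega>) - g \<omega>\<bar>)" by simp
    also have "\<dots> \<le> 2 * B * (e\<^sup>2 / (9 * (2 * B + 1)))"
      using \<delta>(2)[OF z(2,1)] \<open>B \<ge> 0\<close> by (intro mult_left_mono) auto
    also have "\<dots> \<le> (e / 3)\<^sup>2"
    proof -
      have "2 * B * (e\<^sup>2 / (9 * (2 * B + 1))) = (e / 3)\<^sup>2 * (2 * B / (2 * B + 1))"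
        by (simp add: power_divide)
      also have "\<dots> \<le> (e / 3)\<^sup>2 * 1" using \<open>B \<ge> 0\<close> by (intro mult_left_mono) auto
      finally show ?thesis by simp
    qed
    finally have "L2norm M (\<lambda>\<omega>. g (T z \<omega>) - g \<omega>) \<le> sqrt ((e / 3)\<^sup>2)"
      unfolding L2norm_def by (rule real_sqrt_le_mono)
    then show ?thesis using \<open>e > 0\<close> by simp
  qed
  have fz: "L2norm M (\<lambda>\<omega>. f (T z \<omega>) - f \<omega>) \<le> e" if z: "norm z < \<delta>" "z \<noteq> 0" for z
  proof -
    have 1: "L2norm M (\<lambda>\<omega>. f (T z \<omega>) - g (T z \<omega>)) < e / 3"
      using fg L2norm_shift[OF L2_diff[OF f gL], of z] by simp
    have "L2norm M (\<lambda>\<omega>. f (T z \<omega>) - f \<omega>) \<le> L2norm M (\<lambda>\<omega>. f (T z \<omega>) - g (T z \<omega>)) + L2norm M (\<lambda>\<omega>. g (T z \<omega>) - f \<omega>)"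
      by (rule L2norm_triangle3[OF L2_shift[OF f] L2_shift[OF gL] f])
    also have "L2norm M (\<lambda>\<omega>. g (T z \<omega>) - f \<omega>) \<le> L2norm M (\<lambda>\<omega>. g (T z \<omega>) - g \<omega>) + L2norm M (\<lambda>\<omega>. g \<omega> - f \<omega>)"
      by (rule L2norm_triangle3[OF L2_shift[OF gL] gL f])
    finally show ?thesis using 1 T0[OF z] fg by (simp add: L2norm_diff_commute[of M g])
  qed
  have "L2norm M (\<lambda>\<omega>. f (T 0 \<omega>) - f \<omega>) = L2norm M (\<lambda>\<omega>. 0 :: real)"
    using L2D(1)[OF f] by (intro L2norm_cong_AE) (auto intro: eventually_mono[OF AE_T0])
  then have "L2norm M (\<lambda>\<omega>. f (T z \<omega>) - f \<omega>) \<le> e" if "norm z < \<delta>" for z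
    using fz[OF that] \<open>e > 0\<close> by (cases "z = 0") (auto simp: L2norm_def)
  then show ?thesis using that \<delta>(1) by blast
qed

end

text \<open>Fatou: the expectation of |Y - Z| is at most the lower limit of the expectations of |X n
  - Z|.\<close>

lemma AE_eq_of_L1_limit:
  fixes X :: "nat \<Rightarrow> 'a \<Rightarrow> real"
  assumes i: "\<And>n. integrable M (\<lambda>\<omega>. X n \<omega> - Z \<omega>)" and l: "(\<lambda>n. \<integral>\<omega>. \<bar>X n \<omega> - Z \<omega>\<bar> \<partial>M) \<longlonglongrightarrow> 0"
    and Y: "AE \<omega> in M. (\<lambda>n. X n \<omega>) \<longlonglongrightarrow> Y \<omega>"
    and [measurable]: "\<And>n. X n \<in> borel_measurable M" "Y \<in> borel_measurable M" "Z \<in> borel_measurable M"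
  shows "AE \<omega> in M. Y \<omega> = Z \<omega>"
proof -
  have "(\<integral>\<^sup>+\<omega>. ennreal \<bar>Y \<omega> - Z \<omega>\<bar> \<partial>M) = (\<integral>\<^sup>+\<omega>. liminf (\<lambda>n. ennreal \<bar>X n \<omega> - Z \<omega>\<bar>) \<partial>M)"
    using Y by (intro nn_integral_cong_AE) (auto elim!: eventually_mono intro!: lim_imp_Liminf[symmetric] tendsto_intros)
  also have "\<dots> \<le> liminf (\<lambda>n. \<integral>\<^sup>+\<omega>. ennreal \<bar>X n \<omega> - Z \<omega>\<bar> \<partial>M)" by (rule nn_integral_liminf) measurable
  also have "\<dots> = liminf (\<lambda>n. ennreal (LINT \<omega>|M. \<bar>X n \<omega> - Z \<omega>\<bar>))" using i by (subst nn_integral_eq_integral) auto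
  also have "\<dots> = 0" using tendsto_ennrealI[OF l] by (intro lim_imp_Liminf) auto
  finally have "AE \<omega> in M. ennreal \<bar>Y \<omega> - Z \<omega>\<bar> = 0" by (subst nn_integral_0_iff_AE[symmetric]) auto
  then show ?thesis by (rule eventually_mono) simp
qed

context ergodic
begin

text \<open>Jensen's inequality for the probability density \<open>k\<close>, then Tonelli: the mean
  square error is at most the \<open>k\<close>-average of the squared shift errors.\<close>

lemma mol_L2_approx:
  fixes f :: "'w \<Rightarrow> real"
  assumes k: "mollifier r k" and f: "f \<in> L2 M" and e: "\<And>z. norm z < r \<Longrightarrow> L2norm M (\<lambda>\<omega>. f (T z \<omega>) - f \<omega>) \<le> e"
    and "e \<ge> 0"
  shows "mol k f \<in> L2 M" "L2norm M (\<lambda>\<omega>. mol k f \<omega> - f \<omega>) \<le> e"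
proof -
  note [measurable] = mollifierD(5)[OF k] L2D(1)[OF f]
  have fi: "integrable M f" by (rule L2_imp_integrable[OF f])
  have "(\<integral>\<^sup>+\<omega>. ennreal ((mol k f \<omega> - f \<omega>)\<^sup>2) \<partial>M) \<le> (\<integral>\<^sup>+\<omega>. (\<integral>\<^sup>+z. ennreal (k z * (f (T z \<omega>) - f \<omega>)\<^sup>2) \<partial>lborel) \<partial>M)"
  proof (rule nn_integral_mono_AE)
    show "AE \<omega> in M. ennreal ((mol k f \<omega> - f \<omega>)\<^sup>2) \<le> (\<integral>\<^sup>+z. ennreal (k z * (f (T z \<omega>) - f \<omega>)\<^sup>2) \<partial>lborel)"
      using AE_loc_int[OF fi] AE_space
    proof eventually_elim
      case (elim \<omega>)
      have [measurable]: "(\<lambda>y. T y \<omega>) \<in> borel \<rightarrow>\<^sub>M M" by (rule T_orbit_measurable[OF elim(2)])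
      define u where "u z = f (T z \<omega>) - f \<omega>" for z
      have [measurable]: "u \<in> borel_measurable borel" unfolding u_def by measurable
      show ?case
      proof (cases "(\<integral>\<^sup>+z. ennreal (k z * (u z)\<^sup>2) \<partial>lborel) = \<infinity>")
        case False
        have i2: "integrable lborel (\<lambda>z. k z * (u z)\<^sup>2)"
          by (rule integrableI_nonneg) (use False mollifierD(2)[OF k] in \<open>auto simp: less_top\<close>)
        \<comment> \<open>Splitting the kernel into square roots turns Cauchy-Schwarz into Jensen's
          inequality, since \<open>a\<close> has norm 1.\<close>
        define a b where "a z = sqrt (k z)" and "b z = sqrt (k z) * u z" for z
        have aL: "a \<in> L2 lborel"
          unfolding L2_def a_def using mollifierD(2,6)[OF k] by (auto simp: a_def)
        have b2: "(norm (b z))\<^sup>2 = k z * (u z)\<^sup>2" for z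
          using mollifierD(2)[OF k, of z] by (simp add: b_def power_mult_distrib)
        have bL: "b \<in> L2 lborel" unfolding L2_def mem_Collect_eq b2 using i2 by (auto simp: b_def[abs_def])
        have ab: "a z \<bullet> b z = k z * u z" for z
          using mollifierD(2)[OF k, of z] by (simp add: a_def b_def mult.assoc[symmetric])
        have an: "L2norm lborel a = 1"
          using mollifierD(2,4)[OF k] by (simp add: L2norm_def a_def)
        have i: "integrable lborel (\<lambda>z. k z * f (T z \<omega>))"
          by (rule test_functions_integrable_mult[OF mollifierD(1)[OF k] elim(1)])
        have "mol k f \<omega> - f \<omega> = (LINT z|lborel. k z * f (T z \<omega>)) - (LINT z|lborel. k z * f \<omega>)"
          using mollifierD(4)[OF k] by (simp add: mol_def)
        also have "\<dots> = (LINT z|lborel. k z * u z)"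
          using i mollifierD(6)[OF k] by (simp add: u_def right_diff_distrib)
        finally have "\<bar>mol k f \<omega> - f \<omega>\<bar> \<le> L2norm lborel b"
          using L2_Cauchy_Schwarz[OF aL bL] an by (simp only: ab)
        then have "(mol k f \<omega> - f \<omega>)\<^sup>2 \<le> (L2norm lborel b)\<^sup>2"
          by (metis L2norm_nonneg abs_le_square_iff abs_of_nonneg)
        also have "\<dots> = (LINT z|lborel. k z * (u z)\<^sup>2)" by (simp only: L2norm_sq b2)
        finally have "ennreal ((mol k f \<omega> - f \<omega>)\<^sup>2) \<le> ennreal (LINT z|lborel. k z * (u z)\<^sup>2)" by (rule ennreal_leI)
        also have "\<dots> = (\<integral>\<^sup>+z. ennreal (k z * (u z)\<^sup>2) \<partial>lborel)"
          by (rule nn_integral_eq_integral[OF i2, symmetric]) (use mollifierD(2)[OF k] in simp)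
        finally show ?thesis by (simp add: u_def)
      qed (simp add: u_def)
    qed
  qed
  also have "\<dots> = (\<integral>\<^sup>+z. (\<integral>\<^sup>+\<omega>. ennreal (k z * (f (T z \<omega>) - f \<omega>)\<^sup>2) \<partial>M) \<partial>lborel)"
    by (rule YM.Fubini') measurable
  also have "\<dots> \<le> (\<integral>\<^sup>+z. ennreal (k z) * ennreal (e\<^sup>2) \<partial>lborel)"
  proof (rule nn_integral_mono)
    fix z :: "real^'d"
    show "(\<integral>\<^sup>+\<omega>. ennreal (k z * (f (T z \<omega>) - f \<omega>)\<^sup>2) \<partial>M) \<le> ennreal (k z) * ennreal (e\<^sup>2)"
    proof (cases "norm z < r")
      case True
      have L: "(\<lambda>\<omega>. f (T z \<omega>) - f \<omega>) \<in> L2 M" by (rule L2_diff[OF L2_shift[OF f] f])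
      have "(\<integral>\<^sup>+\<omega>. ennreal (k z * (f (T z \<omega>) - f \<omega>)\<^sup>2) \<partial>M) = ennreal (k z) * (\<integral>\<^sup>+\<omega>. ennreal ((f (T z \<omega>) - f \<omega>)\<^sup>2) \<partial>M)"
        using mollifierD(2)[OF k, of z] by (subst nn_integral_cmult[symmetric]) (auto simp: ennreal_mult)
      also have "(\<integral>\<^sup>+\<omega>. ennreal ((f (T z \<omega>) - f \<omega>)\<^sup>2) \<partial>M) = ennreal ((L2norm M (\<lambda>\<omega>. f (T z \<omega>) - f \<omega>))\<^sup>2)"
        using nn_integral_eq_integral[OF L2D(2)[OF L]] by (simp add: L2norm_sq)
      also have "\<dots> \<le> ennreal (e\<^sup>2)" using e[OF True] by (intro ennreal_leI power_mono) auto
      finally show ?thesis by (simp add: mult_left_mono)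
    next
      case False
      then have "k z = 0" using mollifierD(3)[OF k] by simp
      then show ?thesis by simp
    qed
  qed
  also have "\<dots> = ennreal (e\<^sup>2)" using mollifierD(7)[OF k] by (simp add: nn_integral_multc)
  finally have le: "(\<integral>\<^sup>+\<omega>. ennreal ((mol k f \<omega> - f \<omega>)\<^sup>2) \<partial>M) \<le> ennreal (e\<^sup>2)" .
  have i: "integrable M (\<lambda>\<omega>. (mol k f \<omega> - f \<omega>)\<^sup>2)"
    by (rule integrableI_nonneg) (use le in \<open>auto intro: le_less_trans\<close>)
  then have "(\<lambda>\<omega>. mol k f \<omega> - f \<omega>) \<in> L2 M" by (simp add: L2_def)
  from L2_add[OF this f] show "mol k f \<in> L2 M" by simp
  have "(LINT \<omega>|M. (mol k f \<omega> - f \<omega>)\<^sup>2) \<le> e\<^sup>2"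
    using le nn_integral_eq_integral[OF i] by (simp add: ennreal_le_iff)
  then have "L2norm M (\<lambda>\<omega>. mol k f \<omega> - f \<omega>) \<le> sqrt (e\<^sup>2)" 
    unfolding L2norm_def real_norm_def power2_abs by (rule real_sqrt_le_mono)
  then show "L2norm M (\<lambda>\<omega>. mol k f \<omega> - f \<omega>) \<le> e" using \<open>e \<ge> 0\<close> by simp
qed

text \<open>The minimum of finitely many radii gives one kernel for all components, so that
  smoothing can commute with gradient and divergence.\<close>

lemma mollifier_family:
  fixes f :: "'d \<Rightarrow> 'w \<Rightarrow> real"
  assumes f: "\<And>i. f i \<in> L2 M" and "e > 0"
  obtains r k where "r > 0" "mollifier r k" "\<And>i. mol k (f i) \<in> L2 M" "\<And>i. L2norm M (\<lambda>\<omega>. mol k (f i) \<omega> - f i \<omega>) \<le> e"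
proof -
  have "\<forall>i. \<exists>\<delta>. \<delta> > 0 \<and> (\<forall>z. norm z < \<delta> \<longrightarrow> L2norm M (\<lambda>\<omega>. f i (T z \<omega>) - f i \<omega>) \<le> e)"
    using shift_continuous[OF f \<open>e > 0\<close>] by blast
  from choice[OF this] obtain \<delta> where \<delta>: "\<And>i. \<delta> i > 0" "\<And>i z. norm z < \<delta> i \<Longrightarrow> L2norm M (\<lambda>\<omega>. f i (T z \<omega>) - f i \<omega>) \<le> e" by blast
  define r where "r = Min (range \<delta>)"
  have r: "r > 0" "r \<le> \<delta> i" for i using \<delta>(1) by (auto simp: r_def)
  obtain k :: "real^'d \<Rightarrow> real" where k: "mollifier r k" using mollifier_exists[OF r(1)] by blast
  have s: "L2norm M (\<lambda>\<omega>. f i (T z \<omega>) - f i \<omega>) \<le> e" if "norm z < r" for i z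
    using \<delta>(2)[of z i] r(2)[of i] that by simp
  show ?thesis
    by (rule that[OF r(1) k]) (rule mol_L2_approx[OF k f s], use \<open>e > 0\<close> in simp_all)+
qed

subsection \<open>The stochastic derivative\<close>

lemma has_shift_derivD:
  assumes "has_shift_deriv M T i f g"
  shows "f \<in> L2 M" "g \<in> L2 M"
    "((\<lambda>t. L2norm M (\<lambda>\<omega>. (f (T (t *\<^sub>R axis i 1) \<omega>) - f \<omega>) / t - g \<omega>)) \<longlongrightarrow> 0) (at 0)"
  using assms by (auto simp: has_shift_deriv_def)

lemma dom_shift_deriv: "f \<in> dom_shift M T \<Longrightarrow> has_shift_deriv M T i f (shift_deriv M T i f)"
  using someI_ex[of "has_shift_deriv M T i f"] by (simp add: dom_shift_def shift_deriv_def)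

text \<open>Both sides are limits of the mollified difference quotients of \<open>f\<close>: the left one along almost every
  orbit, the right one in the mean.\<close>

lemma mol_pderiv_eq:
  assumes k: "k \<in> test_functions UNIV" and d: "has_shift_deriv M T i f g"
  shows "AE \<omega> in M. - mol (pderiv_at k i) f \<omega> = mol k g \<omega>"
proof -
  note fL = has_shift_derivD(1)[OF d] and gL = has_shift_derivD(2)[OF d]
  have fi: "integrable M f" and gi: "integrable M g" using fL gL by (auto intro: L2_imp_integrable)
  note [measurable] = L2D(1)[OF fL] L2D(1)[OF gL] test_functionsD(4)[OF k] test_functionsD(4)[OF pderiv_at_test_functions[OF k]]
  obtain R where R: "R > 0" "\<And>x. norm x \<ge> R \<Longrightarrow> k x = 0" using test_functions_bounded_support[OF k] by blast
  obtain B where B: "B \<ge> 0" "\<And>x. \<bar>k x\<bar> \<le> B" using test_functions_bounded[OF k] by blast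
  let ?m = "measure lborel (cball (0::real^'d) R)"
  define t where "t n = inverse (real (Suc n))" for n
  define h where "h n = t n *\<^sub>R axis i (1::real)" for n
  define q where "q n \<omega> = (f (T (h n) \<omega>) - f \<omega>) / t n" for n \<omega>
  have qL: "q n \<in> L2 M" for n
    using L2_mult[OF L2_diff[OF L2_shift[OF fL, of "h n"] fL], of "1 / t n"] by (simp add: q_def[abs_def])
  have qi: "integrable M (q n)" for n by (rule L2_imp_integrable[OF qL])
  note [measurable] = L2D(1)[OF qL]
  have t0: "filterlim t (at 0) sequentially"
    unfolding filterlim_at t_def using LIMSEQ_inverse_real_of_nat by auto
  have mk: "AE \<omega> in M. mol k (q n) \<omega> - mol k g \<omega> = mol k (\<lambda>\<omega>. q n \<omega> - g \<omega>) \<omega>" for n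
    using AE_loc_int[OF gi] AE_loc_int[OF qi, of n]
    by eventually_elim (simp add: mol_def right_diff_distrib test_functions_integrable_mult[OF k])
  have L1: "integrable M (mol k f)" "(LINT \<omega>|M. \<bar>mol k f \<omega>\<bar>) \<le> B * ?m * (LINT \<omega>|M. \<bar>f \<omega>\<bar>)" if "integrable M f" for f
    using mol_L1[of k B R f] B(2) R(2) that by simp_all
  show ?thesis
  proof (rule AE_eq_of_L1_limit[where X="\<lambda>n. mol k (q n)"])
    show "integrable M (\<lambda>\<omega>. mol k (q n) \<omega> - mol k g \<omega>)" for n
      by (intro Bochner_Integration.integrable_diff L1(1) qi gi)
    have le: "(LINT \<omega>|M. \<bar>mol k (q n) \<omega> - mol k g \<omega>\<bar>) \<le> B * ?m * L2norm M (\<lambda>\<omega>. q n \<omega> - g \<omega>)" for n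
    proof -
      have dL: "(\<lambda>\<omega>. q n \<omega> - g \<omega>) \<in> L2 M" by (rule L2_diff[OF qL gL])
      have "(LINT \<omega>|M. \<bar>mol k (q n) \<omega> - mol k g \<omega>\<bar>) = (LINT \<omega>|M. \<bar>mol k (\<lambda>\<omega>. q n \<omega> - g \<omega>) \<omega>\<bar>)"
        using mk[of n] by (intro integral_cong_AE) (auto elim: eventually_mono)
      also have "\<dots> \<le> B * ?m * (LINT \<omega>|M. \<bar>q n \<omega> - g \<omega>\<bar>)" by (rule L1(2)[OF L2_imp_integrable[OF dL]])
      also have "\<dots> \<le> B * ?m * L2norm M (\<lambda>\<omega>. q n \<omega> - g \<omega>)"
        using integral_norm_le_L2norm[OF dL] B(1) by (intro mult_left_mono) auto
      finally show ?thesis .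
    qed
    have "(\<lambda>n. B * ?m * L2norm M (\<lambda>\<omega>. q n \<omega> - g \<omega>)) \<longlonglongrightarrow> B * ?m * 0"
      unfolding q_def h_def by (intro tendsto_intros filterlim_compose[OF has_shift_derivD(3)[OF d] t0])
    then have z: "(\<lambda>n. B * ?m * L2norm M (\<lambda>\<omega>. q n \<omega> - g \<omega>)) \<longlonglongrightarrow> 0" by simp
    show "(\<lambda>n. \<integral>\<omega>. \<bar>mol k (q n) \<omega> - mol k g \<omega>\<bar> \<partial>M) \<longlonglongrightarrow> 0"
      by (rule Lim_null_comparison[OF _ z]) (use le in simp)
    show "AE \<omega> in M. (\<lambda>n. mol k (q n) \<omega>) \<longlonglongrightarrow> - mol (pderiv_at k i) f \<omega>"
      using AE_loc_int[OF fi] AE_space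
    proof eventually_elim
      case (elim \<omega>)
      define F where "F y = mol k f (T y \<omega>)" for y
      have T0: "mol k' f (T 0 \<omega>) = mol k' f \<omega>" for k' by (simp add: mol_def T_add[OF elim(2)])
      have i: "integrable lborel (\<lambda>z. k z * f (T z \<omega>))" "integrable lborel (\<lambda>z. k (z - h n) * f (T z \<omega>))" for n
        by (intro test_functions_integrable_mult[of _ UNIV] test_functions_shift k elim(1))+
      have ih: "integrable lborel (\<lambda>z. k z * f (T (h n + z) \<omega>))" for n
        using lborel_integrable_translate[of "\<lambda>z. k (z - h n) * f (T z \<omega>)" "h n"] i(2)[of n] by simp
      \<comment> \<open>By the semigroup law the smoothed difference quotient of \<open>f\<close> is
        the difference quotient at 0 of the smooth orbit function \<open>F\<close>, whose derivative
        is known from \<open>mol_smooth\<close>.\<close>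
      have q: "mol k (q n) \<omega> = (F (0 + t n *\<^sub>R axis i 1) - F 0) / t n" for n
        unfolding F_def T0 using i(1) ih[of n]
        by (simp add: mol_def q_def h_def T_add[OF elim(2)] right_diff_distrib add.commute)
      have "F differentiable (at 0)"
        using mol_smooth(1)[OF elim(2) k L2D(1)[OF fL] elim(1), of 1] by (simp add: F_def[abs_def])
      then have "(F has_derivative (\<lambda>h. cgrad F 0 \<bullet> h)) (at (0 + 0 *\<^sub>R axis i 1))"
        using has_derivative_cgrad by simp
      moreover have "((\<lambda>s. 0 + s *\<^sub>R axis i 1) has_derivative (\<lambda>s. s *\<^sub>R axis i (1::real))) (at 0)"
        by (auto intro!: derivative_eq_intros)
      ultimately have "((\<lambda>s. F (0 + s *\<^sub>R axis i 1)) has_derivative (\<lambda>s. cgrad F 0 \<bullet> (s *\<^sub>R axis i 1))) (at 0)"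
        using has_derivative_compose by blast
      then have "((\<lambda>s. F (0 + s *\<^sub>R axis i 1)) has_real_derivative - mol (pderiv_at k i) f \<omega>) (at 0)"
        by (rule has_derivative_imp_has_field_derivative)
          (use mol_smooth(2)[OF elim(2) k L2D(1)[OF fL] elim(1), of i 0] in \<open>simp add: inner_axis F_def[abs_def] T0\<close>)
      then have "((\<lambda>s. (F (0 + s *\<^sub>R axis i 1) - F 0) / s) \<longlongrightarrow> - mol (pderiv_at k i) f \<omega>) (at 0)"
        by (simp add: DERIV_def)
      from filterlim_compose[OF this t0] show ?case unfolding q by simp
    qed
  qed measurable
qed

end

lemma L2_Cauchy_Schwarz_le:
  assumes "f \<in> L2 M" "g \<in> L2 M" "L2norm M f \<le> a" "L2norm M g \<le> b"
  shows "\<bar>LINT x|M. f x \<bullet> g x\<bar> \<le> a * b"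
proof (rule order_trans[OF L2_Cauchy_Schwarz[OF assms(1,2)]])
  have "0 \<le> a" using L2norm_nonneg[of M f] assms(3) by linarith
  then show "L2norm M f * L2norm M g \<le> a * b" using assms(3,4) by (intro mult_mono) simp_all
qed

lemma L2norm_vec_le:
  fixes f :: "'n::finite \<Rightarrow> 'a \<Rightarrow> real"
  assumes "\<And>i. f i \<in> L2 M"
  shows "L2norm M (\<lambda>x. \<chi> i. f i x) \<le> (\<Sum>i\<in>UNIV. L2norm M (f i))"
proof -
  have e: "(\<lambda>x. \<chi> i. f i x) = (\<lambda>x. \<Sum>i\<in>UNIV. f i x *\<^sub>R axis i (1::real))"
    by (auto simp: vec_eq_iff axis_def if_distrib cong: if_cong)
  have 1: "(\<lambda>x. f i x *\<^sub>R axis i (1::real)) \<in> L2 M" for i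
    by (rule L2_dominated[OF assms, where C=1]) (use L2D(1)[OF assms[of i]] in \<open>auto simp: norm_axis_1\<close>)
  have "L2norm M (\<lambda>x. \<Sum>i\<in>UNIV. f i x *\<^sub>R axis i (1::real)) \<le> (\<Sum>i\<in>UNIV. L2norm M (\<lambda>x. f i x *\<^sub>R axis i (1::real)))"
    by (rule L2norm_sum[OF 1])
  also have "\<dots> = (\<Sum>i\<in>UNIV. L2norm M (f i))"
    by (simp add: L2norm_def norm_axis_1)
  finally show ?thesis unfolding e .
qed

lemma integral_lebesgue_on_cube:
  fixes f :: "real^'d::finite \<Rightarrow> 'b::euclidean_space"
  assumes [measurable]: "f \<in> borel_measurable borel"
  shows "(LINT y|lebesgue_on (cube \<rho>). f y) = (LINT y|lborel. indicator (cube \<rho>) y *\<^sub>R f y)"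
    "integrable (lebesgue_on (cube \<rho>)) f \<longleftrightarrow> integrable lborel (\<lambda>y. indicator (cube \<rho>) y *\<^sub>R f y)"
  by (rule integral_lebesgue_on_lborel[OF open_sets_lebesgue[OF open_cube]],
      (auto intro!: borel_measurable_lebesgue_on)[3])+

context ergodic
begin

lemma orbit_borel: "f \<in> borel_measurable M \<Longrightarrow> \<omega> \<in> space M \<Longrightarrow> (\<lambda>y. f (T y \<omega>)) \<in> borel_measurable borel"
  by (rule measurable_compose[OF T_orbit_measurable])

lemma ravg_eq_integral:
  assumes "f \<in> borel_measurable M" "\<omega> \<in> space M" "\<rho> > 0"
  shows "(LINT y|lebesgue_on (cube \<rho>). f (T y \<omega>)) = (2 * \<rho>) ^ CARD('d) * ravg f \<rho> \<omega>"
  using integral_lebesgue_on_cube(1)[OF orbit_borel[OF assms(1,2)], of \<rho>] assms(3) by (simp add: ravg_def)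

lemma eavg_eq_ravg:
  assumes "loc_int (\<lambda>y. f (T y \<omega>))" "\<And>\<omega>. f \<omega> \<ge> 0" "\<rho> > 0"
  shows "eavg (\<lambda>\<omega>. ennreal (f \<omega>)) \<rho> \<omega> = ennreal (ravg f \<rho> \<omega>)"
proof -
  have "(\<integral>\<^sup>+y. ennreal (f (T y \<omega>)) * indicator (cube \<rho>) y \<partial>lborel) = (\<integral>\<^sup>+y. ennreal (indicator (cube \<rho>) y * f (T y \<omega>)) \<partial>lborel)"
    by (intro nn_integral_cong) (auto simp: indicator_def)
  also have "\<dots> = ennreal (LINT y|lborel. indicator (cube \<rho>) y * f (T y \<omega>))"
    by (rule nn_integral_eq_integral[OF integrable_cube[OF assms(1)]]) (use assms(2) in auto)
  finally show ?thesis using assms(3) assms(2) unfolding eavg_def ravg_def by (simp add: divide_ennreal)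
qed

lemma ravg_mono_cube:
  assumes "loc_int (\<lambda>y. f (T y \<omega>))" "\<And>\<omega>. f \<omega> \<ge> 0" "0 < r" "r \<le> s"
  shows "(2 * r) ^ CARD('d) * ravg f r \<omega> \<le> (2 * s) ^ CARD('d) * ravg f s \<omega>"
proof -
  have "(LINT y|lborel. indicator (cube r) y * f (T y \<omega>)) \<le> (LINT y|lborel. indicator (cube s) y * f (T y \<omega>))"
    by (rule integral_mono[OF integrable_cube[OF assms(1)] integrable_cube[OF assms(1)]])
      (use subsetD[OF cube_mono[OF assms(4)]] assms(2) in \<open>auto simp: indicator_def\<close>)
  then show ?thesis using assms(3,4) by (simp add: ravg_def)
qed

lemma orbit_L2:
  fixes f :: "'w \<Rightarrow> 'b::euclidean_space"
  assumes f: "f \<in> borel_measurable M" and \<omega>: "\<omega> \<in> space M" and l: "loc_int (\<lambda>y. (norm (f (T y \<omega>)))\<^sup>2)" and "\<rho> > 0"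
  shows "(\<lambda>y. f (T y \<omega>)) \<in> L2 (lebesgue_on (cube \<rho>))"
    "(L2norm (lebesgue_on (cube \<rho>)) (\<lambda>y. f (T y \<omega>)))\<^sup>2 = (2 * \<rho>) ^ CARD('d) * ravg (\<lambda>\<omega>. (norm (f \<omega>))\<^sup>2) \<rho> \<omega>"
proof -
  note [measurable] = f orbit_borel[OF f \<omega>]
  have "integrable (lebesgue_on (cube \<rho>)) (\<lambda>y. (norm (f (T y \<omega>)))\<^sup>2)"
    using integrable_cube[OF l, of \<rho>] by (subst integral_lebesgue_on_cube(2)) auto
  then show "(\<lambda>y. f (T y \<omega>)) \<in> L2 (lebesgue_on (cube \<rho>))"
    unfolding L2_def using borel_measurable_lebesgue_on[OF orbit_borel[OF f \<omega>]] by auto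
  show "(L2norm (lebesgue_on (cube \<rho>)) (\<lambda>y. f (T y \<omega>)))\<^sup>2 = (2 * \<rho>) ^ CARD('d) * ravg (\<lambda>\<omega>. (norm (f \<omega>))\<^sup>2) \<rho> \<omega>"
    unfolding L2norm_sq by (rule ravg_eq_integral[of "\<lambda>\<omega>. (norm (f \<omega>))\<^sup>2", OF _ \<omega> \<open>\<rho> > 0\<close>]) measurable
qed

lemma AE_orbit_L2:
  assumes "f \<in> L2 M"
  shows "AE \<omega> in M. loc_int (\<lambda>y. (norm (f (T y \<omega>)))\<^sup>2)"
  by (rule AE_loc_int[OF L2D(2)[OF assms]])

lemma mol_L2:
  fixes f :: "'w \<Rightarrow> real"
  assumes "mollifier r k" "f \<in> L2 M"
  shows "mol k f \<in> L2 M"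
proof (rule mol_L2_approx(1)[OF assms])
  show "L2norm M (\<lambda>\<omega>. f (T z \<omega>) - f \<omega>) \<le> 2 * L2norm M f" for z
    using L2norm_triangle_diff[OF L2_shift[OF assms(2), of z] assms(2)] L2norm_shift[OF assms(2), of z] by simp
qed simp

section \<open>Smooth stationary approximants of potential and solenoidal fields\<close>

lemma L2_potE:
  assumes "w \<in> L2_pot M T" "e > 0"
  obtains \<psi> where "\<psi> \<in> dom_shift M T" "L2norm M (\<lambda>\<omega>. w \<omega> - (\<chi> i. shift_deriv M T i \<psi> \<omega>)) < e"
proof -
  have "\<exists>g\<in>(\<lambda>\<psi> \<omega>. \<chi> i. shift_deriv M T i \<psi> \<omega>) ` dom_shift M T. L2norm M (\<lambda>\<omega>. w \<omega> - g \<omega>) < e"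
    using assms by (simp only: L2_pot_def L2_closure_def mem_Collect_eq)
  then show ?thesis using that by (elim bexE imageE) simp
qed

lemma L2_solE:
  fixes \<sigma> :: "'w \<Rightarrow> real^'d"
  assumes "\<sigma> \<in> L2_sol M T" "e > 0"
  obtains \<psi> :: "'w \<Rightarrow> real^'d" where "\<forall>i. (\<lambda>\<omega>. \<psi> \<omega> $ i) \<in> dom_shift M T"
    "AE \<omega> in M. (\<Sum>i\<in>UNIV. shift_deriv M T i (\<lambda>\<omega>'. \<psi> \<omega>' $ i) \<omega>) = 0"
    "L2norm M (\<lambda>\<omega>. \<sigma> \<omega> - \<psi> \<omega>) < e"
proof -
  have "\<exists>\<psi>\<in>{\<psi>. (\<forall>i. (\<lambda>\<omega>. \<psi> \<omega> $ i) \<in> dom_shift M T) \<and>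
       (AE \<omega> in M. (\<Sum>i\<in>UNIV. shift_deriv M T i (\<lambda>\<omega>'. \<psi> \<omega>' $ i) \<omega>) = 0)}. L2norm M (\<lambda>\<omega>. \<sigma> \<omega> - \<psi> \<omega>) < e"
    using assms by (simp only: L2_sol_def L2_closure_def mem_Collect_eq)
  then show ?thesis by (elim bexE CollectE conjE) (rule that)
qed

text \<open>A stationary gradient close to \<open>w\<close> is smoothed. By
  \<open>mol_pderiv_eq\<close> smoothing commutes with the stochastic gradient, and it moves an L2
  field only slightly, so the gradient of the smoothed potential is still close to \<open>w\<close>.
  The potential \<open>p\<close> is itself stationary and square integrable, which makes the cut-off
  in \<open>corrector_approx\<close> harmless.\<close>

lemma L2_pot_smooth_approx:
  fixes w :: "'w \<Rightarrow> real^'d"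
  assumes w: "w \<in> L2_pot M T" and "e > 0"
  shows "\<exists>p g. p \<in> L2 M \<and> g \<in> L2 M \<and> L2norm M (\<lambda>\<omega>. g \<omega> - w \<omega>) < e \<and>
    (AE \<omega> in M. (\<forall>n. Ck n (\<lambda>y. p (T y \<omega>))) \<and> (\<forall>y. cgrad (\<lambda>y. p (T y \<omega>)) y = g (T y \<omega>)))"
proof -
  have wL: "w \<in> L2 M" using w by (simp add: L2_pot_def L2_closure_def)
  obtain \<psi> where \<psi>: "\<psi> \<in> dom_shift M T" "L2norm M (\<lambda>\<omega>. w \<omega> - (\<chi> i. shift_deriv M T i \<psi> \<omega>)) < e / 2"
    by (rule L2_potE[OF w, of "e / 2"]) (use \<open>e > 0\<close> in auto)
  have d: "has_shift_deriv M T i \<psi> (shift_deriv M T i \<psi>)" for i by (rule dom_shift_deriv[OF \<psi>(1)[rule_format]])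
  note \<psi>L = has_shift_derivD(1)[OF d] and dL = has_shift_derivD(2)[OF d]
  have \<psi>i: "integrable M \<psi>" by (rule L2_imp_integrable[OF \<psi>L])
  note [measurable] = L2D(1)[OF \<psi>L]
  define e' where "e' = e / (2 * (real CARD('d) + 1))"
  have e': "e' > 0" "real CARD('d) * e' < e / 2"
    using \<open>e > 0\<close> by (auto simp: e'_def field_simps)
  obtain r k where k: "r > 0" "mollifier r k" "\<And>i. mol k (shift_deriv M T i \<psi>) \<in> L2 M"
    "\<And>i. L2norm M (\<lambda>\<omega>. mol k (shift_deriv M T i \<psi>) \<omega> - shift_deriv M T i \<psi> \<omega>) \<le> e'"
    using mollifier_family[where f="\<lambda>i. shift_deriv M T i \<psi>", OF dL e'(1)] by blast
  note kt = mollifierD(1)[OF k(2)]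
  note [measurable] = test_functionsD(4)[OF kt] test_functionsD(4)[OF pderiv_at_test_functions[OF kt]]
  \<comment> \<open>Written with the derivatives of the kernel, \<open>g\<close> is the classical
    gradient of the smoothed \<psi> at every point of almost every orbit; with the smoothed
    stochastic gradient it agrees only almost surely.\<close>
  define g where "g \<omega> = (\<chi> i. - mol (pderiv_at k i) \<psi> \<omega>)" for \<omega>
  have gm [measurable]: "g \<in> borel_measurable M" unfolding g_def by (intro borel_measurable_vec_lambda) measurable
  have "AE \<omega> in M. \<forall>i\<in>UNIV. - mol (pderiv_at k i) \<psi> \<omega> = mol k (shift_deriv M T i \<psi>) \<omega>"
    by (rule AE_finite_allI) (auto intro: mol_pderiv_eq[OF kt d, simplified])
  then have ge: "AE \<omega> in M. (\<chi> i. mol k (shift_deriv M T i \<psi>) \<omega>) = g \<omega>"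
    by (rule eventually_mono) (simp add: g_def vec_eq_iff)
  have mL: "(\<lambda>\<omega>. \<chi> i. mol k (shift_deriv M T i \<psi>) \<omega>) \<in> L2 M" by (rule L2_vec[OF k(3)])
  have gL: "g \<in> L2 M" by (rule L2_cong_AE[OF mL gm ge])
  have sL: "(\<lambda>\<omega>. \<chi> i. shift_deriv M T i \<psi> \<omega>) \<in> L2 M" by (rule L2_vec[OF dL])
  have "L2norm M (\<lambda>\<omega>. g \<omega> - w \<omega>) \<le> L2norm M (\<lambda>\<omega>. g \<omega> - (\<chi> i. shift_deriv M T i \<psi> \<omega>)) + L2norm M (\<lambda>\<omega>. (\<chi> i. shift_deriv M T i \<psi> \<omega>) - w \<omega>)"
    by (rule L2norm_triangle3[OF gL sL wL])
  also have "L2norm M (\<lambda>\<omega>. g \<omega> - (\<chi> i. shift_deriv M T i \<psi> \<omega>)) = L2norm M (\<lambda>\<omega>. \<chi> i. mol k (shift_deriv M T i \<psi>) \<omega> - shift_deriv M T i \<psi> \<omega>)"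
  proof (rule L2norm_cong_AE)
    show "AE \<omega> in M. g \<omega> - (\<chi> i. shift_deriv M T i \<psi> \<omega>) = (\<chi> i. mol k (shift_deriv M T i \<psi>) \<omega> - shift_deriv M T i \<psi> \<omega>)"
      using ge by (rule eventually_mono) (auto simp: vec_eq_iff dest!: sym)
  qed (use L2D(1)[OF L2_diff[OF gL sL]] L2D(1)[OF L2_vec[OF L2_diff[OF k(3) dL]]] in auto)
  also have "\<dots> \<le> (\<Sum>i\<in>(UNIV::'d set). L2norm M (\<lambda>\<omega>. mol k (shift_deriv M T i \<psi>) \<omega> - shift_deriv M T i \<psi> \<omega>))"
    by (rule L2norm_vec_le[OF L2_diff[OF k(3) dL]])
  also have "\<dots> \<le> real CARD('d) * e'" using sum_mono[of "UNIV :: 'd set", OF k(4)] by simp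
  finally have "L2norm M (\<lambda>\<omega>. g \<omega> - w \<omega>) < e"
    using e'(2) \<psi>(2) by (simp add: L2norm_diff_commute[of M w])
  moreover have "AE \<omega> in M. (\<forall>n. Ck n (\<lambda>y. mol k \<psi> (T y \<omega>))) \<and> (\<forall>y. cgrad (\<lambda>y. mol k \<psi> (T y \<omega>)) y = g (T y \<omega>))"
    using AE_loc_int[OF \<psi>i] AE_space
  proof eventually_elim
    case (elim \<omega>)
    show ?case using mol_smooth[OF elim(2) kt _ elim(1)] by (auto simp: g_def vec_eq_iff)
  qed
  ultimately show ?thesis using mol_L2[OF k(2) \<psi>L] gL by blast
qed

text \<open>Smoothing keeps the approximant \<psi> divergence free: by \<open>mol_pderiv_eq\<close>
  the divergence of the smoothed field is the smoothed stochastic divergence, which is 0.\<close>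

lemma L2_sol_smooth_approx:
  fixes \<sigma> :: "'w \<Rightarrow> real^'d"
  assumes \<sigma>: "\<sigma> \<in> L2_sol M T" and "e > 0"
  shows "\<exists>s. s \<in> L2 M \<and> L2norm M (\<lambda>\<omega>. s \<omega> - \<sigma> \<omega>) < e \<and>
    (AE \<omega> in M. (\<forall>i n. Ck n (\<lambda>y. s (T y \<omega>) $ i)) \<and> (AE y in lborel. (\<Sum>i\<in>UNIV. pderiv_at (\<lambda>y. s (T y \<omega>) $ i) i y) = 0))"
proof -
  have \<sigma>L: "\<sigma> \<in> L2 M" using \<sigma> by (simp add: L2_sol_def L2_closure_def)
  obtain \<psi> where \<psi>: "\<forall>i. (\<lambda>\<omega>. \<psi> \<omega> $ i) \<in> dom_shift M T" "AE \<omega> in M. (\<Sum>i\<in>UNIV. shift_deriv M T i (\<lambda>\<omega>'. \<psi> \<omega>' $ i) \<omega>) = 0"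
    "L2norm M (\<lambda>\<omega>. \<sigma> \<omega> - \<psi> \<omega>) < e / 2"
    by (rule L2_solE[OF \<sigma>, of "e / 2"]) (use \<open>e > 0\<close> in auto)
  define f where "f i = shift_deriv M T i (\<lambda>\<omega>. \<psi> \<omega> $ i)" for i
  have d: "has_shift_deriv M T i (\<lambda>\<omega>. \<psi> \<omega> $ i) (f i)" for i unfolding f_def by (rule dom_shift_deriv[OF \<psi>(1)[rule_format]])
  note \<psi>L = has_shift_derivD(1)[OF d] and fL = has_shift_derivD(2)[OF d]
  have \<psi>i: "integrable M (\<lambda>\<omega>. \<psi> \<omega> $ i)" "integrable M (f i)" for i
    by (rule L2_imp_integrable[OF \<psi>L]) (rule L2_imp_integrable[OF fL])
  note [measurable] = L2D(1)[OF \<psi>L] L2D(1)[OF fL]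
  have \<psi>V: "\<psi> \<in> L2 M" using L2_vec[where f="\<lambda>i \<omega>. \<psi> \<omega> $ i", OF \<psi>L] by simp
  define e' where "e' = e / (2 * (real CARD('d) + 1))"
  have e': "e' > 0" "real CARD('d) * e' < e / 2"
    using \<open>e > 0\<close> by (auto simp: e'_def field_simps)
  obtain r k where k: "r > 0" "mollifier r k" "\<And>i. mol k (\<lambda>\<omega>. \<psi> \<omega> $ i) \<in> L2 M"
    "\<And>i. L2norm M (\<lambda>\<omega>. mol k (\<lambda>\<omega>. \<psi> \<omega> $ i) \<omega> - \<psi> \<omega> $ i) \<le> e'"
    using mollifier_family[where f="\<lambda>i \<omega>. \<psi> \<omega> $ i", OF \<psi>L e'(1)] by blast
  note kt = mollifierD(1)[OF k(2)]
  note [measurable] = test_functionsD(4)[OF kt] test_functionsD(4)[OF pderiv_at_test_functions[OF kt]]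
  define s where "s \<omega> = (\<chi> i. mol k (\<lambda>\<omega>. \<psi> \<omega> $ i) \<omega>)" for \<omega>
  have sL: "s \<in> L2 M" unfolding s_def by (rule L2_vec[OF k(3)])
  have "L2norm M (\<lambda>\<omega>. s \<omega> - \<sigma> \<omega>) \<le> L2norm M (\<lambda>\<omega>. s \<omega> - \<psi> \<omega>) + L2norm M (\<lambda>\<omega>. \<psi> \<omega> - \<sigma> \<omega>)"
    by (rule L2norm_triangle3[OF sL \<psi>V \<sigma>L])
  also have "(\<lambda>\<omega>. s \<omega> - \<psi> \<omega>) = (\<lambda>\<omega>. \<chi> i. mol k (\<lambda>\<omega>. \<psi> \<omega> $ i) \<omega> - \<psi> \<omega> $ i)"
    by (auto simp: s_def vec_eq_iff)
  also have "L2norm M \<dots> \<le> (\<Sum>i\<in>(UNIV::'d set). L2norm M (\<lambda>\<omega>. mol k (\<lambda>\<omega>. \<psi> \<omega> $ i) \<omega> - \<psi> \<omega> $ i))"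
    by (rule L2norm_vec_le[OF L2_diff[OF k(3) \<psi>L]])
  also have "\<dots> \<le> real CARD('d) * e'" using sum_mono[of "UNIV :: 'd set", OF k(4)] by simp
  finally have n: "L2norm M (\<lambda>\<omega>. s \<omega> - \<sigma> \<omega>) < e"
    using e'(2) \<psi>(3) by (simp add: L2norm_diff_commute[of M \<sigma>])
  have "AE \<omega> in M. \<forall>i\<in>UNIV. - mol (pderiv_at k i) (\<lambda>\<omega>. \<psi> \<omega> $ i) \<omega> = mol k (f i) \<omega>"
    by (rule AE_finite_allI) (auto intro: mol_pderiv_eq[OF kt d, simplified])
  moreover have "AE \<omega> in M. AE y in lborel. (\<Sum>i\<in>UNIV. f i (T y \<omega>)) = 0"
    using AE_orbit[OF \<psi>(2)] by (simp add: f_def)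
  moreover have "AE \<omega> in M. \<forall>i\<in>UNIV. loc_int (\<lambda>y. f i (T y \<omega>))"
    by (rule AE_finite_allI) (auto intro: AE_loc_int[OF \<psi>i(2)])
  ultimately have "AE \<omega> in M. (\<Sum>i\<in>UNIV. - mol (pderiv_at k i) (\<lambda>\<omega>. \<psi> \<omega> $ i) \<omega>) = 0"
  proof eventually_elim
    case (elim \<omega>)
    have "(\<Sum>i\<in>UNIV. - mol (pderiv_at k i) (\<lambda>\<omega>. \<psi> \<omega> $ i) \<omega>) = (\<Sum>i\<in>UNIV. mol k (f i) \<omega>)"
      using elim(1) by simp
    also have "\<dots> = (LINT z|lborel. (\<Sum>i\<in>UNIV. k z * f i (T z \<omega>)))"
      unfolding mol_def using elim(3) by (subst Bochner_Integration.integral_sum) (auto intro: test_functions_integrable_mult[OF kt])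
    also have "\<dots> = 0"
      by (rule integral_eq_zero_AE) (use elim(2) in \<open>auto simp: sum_distrib_left[symmetric] elim: eventually_mono\<close>)
    finally show ?case .
  qed
  then have o: "AE \<omega> in M. AE y in lborel. (\<Sum>i\<in>UNIV. - mol (pderiv_at k i) (\<lambda>\<omega>. \<psi> \<omega> $ i) (T y \<omega>)) = 0"
    by (rule AE_orbit)
  have "AE \<omega> in M. \<forall>i\<in>UNIV. loc_int (\<lambda>y. \<psi> (T y \<omega>) $ i)"
    by (rule AE_finite_allI) (auto intro: AE_loc_int[OF \<psi>i(1)])
  then have "AE \<omega> in M. (\<forall>i n. Ck n (\<lambda>y. s (T y \<omega>) $ i)) \<and> (AE y in lborel. (\<Sum>i\<in>UNIV. pderiv_at (\<lambda>y. s (T y \<omega>) $ i) i y) = 0)"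
    using o AE_space
  proof eventually_elim
    case (elim \<omega>)
    have l: "loc_int (\<lambda>y. \<psi> (T y \<omega>) $ i)" for i using elim(1) by blast
    show ?case
      using mol_smooth[OF elim(3) kt L2D(1)[OF \<psi>L] l] elim(2) by (simp add: s_def)
  qed
  then show ?thesis using sL n by blast
qed

text \<open>Smooth approximants are divergence free in the classical sense along almost every orbit,
  and on a fixed cube suitable ones come arbitrarily close to \<sigma> in L2. Since \<rho> is real,
  closeness is arranged on the countably many cubes of half side \<open>Suc N\<close> and inherited
  by smaller ones.\<close>

lemma L2_sol_orbit_divergence_free:
  fixes \<sigma> :: "'w \<Rightarrow> real^'d"
  assumes \<sigma>: "\<sigma> \<in> L2_sol M T"
  shows "AE \<omega> in M. \<forall>\<rho>>0. \<forall>\<phi>\<in>H10 (cube \<rho>). (LINT y|lebesgue_on (cube \<rho>). \<sigma> (T y \<omega>) \<bullet> wgrad (cube \<rho>) \<phi> y) = 0"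
proof -
  have \<sigma>L: "\<sigma> \<in> L2 M" using \<sigma> by (simp add: L2_sol_def L2_closure_def)
  have "\<forall>n::nat. \<exists>s. s \<in> L2 M \<and> L2norm M (\<lambda>\<omega>. s \<omega> - \<sigma> \<omega>) < sqrt (inverse (real (Suc n))) \<and>
    (AE \<omega> in M. (\<forall>i n. Ck n (\<lambda>y. s (T y \<omega>) $ i)) \<and> (AE y in lborel. (\<Sum>i\<in>UNIV. pderiv_at (\<lambda>y. s (T y \<omega>) $ i) i y) = 0))"
    by (intro allI L2_sol_smooth_approx[OF \<sigma>]) simp
  from choice[OF this] obtain s where s: "\<And>n. s n \<in> L2 M" "\<And>n. L2norm M (\<lambda>\<omega>. s n \<omega> - \<sigma> \<omega>) < sqrt (inverse (real (Suc n)))"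
    "\<And>n. AE \<omega> in M. (\<forall>i m. Ck m (\<lambda>y. s n (T y \<omega>) $ i)) \<and> (AE y in lborel. (\<Sum>i\<in>UNIV. pderiv_at (\<lambda>y. s n (T y \<omega>) $ i) i y) = 0)"
    by blast
  note [measurable] = L2D(1)[OF \<sigma>L] L2D(1)[OF s(1)]
  define h where "h n \<omega> = (norm (s n \<omega> - \<sigma> \<omega>))\<^sup>2" for n \<omega>
  have [measurable]: "h n \<in> borel_measurable M" for n unfolding h_def by measurable
  have sd: "(\<lambda>\<omega>. s n \<omega> - \<sigma> \<omega>) \<in> L2 M" for n by (rule L2_diff[OF s(1) \<sigma>L])
  have hi: "integrable M (h n)" for n using L2D(2)[OF sd[of n]] unfolding h_def[abs_def] .
  have h0: "h n \<omega> \<ge> 0" for n \<omega> by (simp add: h_def)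
  have hE: "(\<integral>\<^sup>+\<omega>. ennreal (h n \<omega>) \<partial>M) \<le> ennreal (inverse (real (Suc n)))" for n
  proof -
    have "(LINT \<omega>|M. h n \<omega>) = (L2norm M (\<lambda>\<omega>. s n \<omega> - \<sigma> \<omega>))\<^sup>2" by (simp add: L2norm_sq h_def)
    also have "\<dots> \<le> (sqrt (inverse (real (Suc n))))\<^sup>2" using s(2)[of n] by (intro power_mono) auto
    finally have "(LINT \<omega>|M. h n \<omega>) \<le> inverse (real (Suc n))" by simp
    then show ?thesis using nn_integral_eq_integral[OF hi[of n]] h0 by (simp add: ennreal_leI)
  qed
  \<comment> \<open>Convergence in the mean yields, by Fatou, only a lower limit 0 along the orbit,
    but that is enough: one good index \<open>n\<close> is picked after the tolerance.\<close>
  have lim0: "AE \<omega> in M. liminf (\<lambda>n. eavg (\<lambda>\<omega>. ennreal (h n \<omega>)) (real (Suc N)) \<omega>) = 0" for N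
  proof -
    let ?v = "ennreal ((2 * real (Suc N)) ^ CARD('d))"
    have v: "?v \<noteq> 0" "?v \<noteq> \<top>" by (auto simp del: of_nat_Suc)
    have "(\<integral>\<^sup>+\<omega>. eavg (\<lambda>\<omega>. ennreal (h n \<omega>)) (real (Suc N)) \<omega> \<partial>M) \<le> ennreal (inverse (real (Suc n)))" for n
    proof -
      have "(\<integral>\<^sup>+\<omega>. eavg (\<lambda>\<omega>. ennreal (h n \<omega>)) (real (Suc N)) \<omega> \<partial>M) = (\<integral>\<^sup>+\<omega>. ennreal (h n \<omega>) \<partial>M) * ?v / ?v"
        unfolding eavg_def
        by (subst nn_integral_divide, measurable) (subst nn_integral_orbit, auto simp: emeasure_cube)
      also have "\<dots> = (\<integral>\<^sup>+\<omega>. ennreal (h n \<omega>) \<partial>M)" by (rule ennreal_mult_divide_eq[OF v])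
      finally show ?thesis using hE by simp
    qed
    then have "liminf (\<lambda>n. \<integral>\<^sup>+\<omega>. eavg (\<lambda>\<omega>. ennreal (h n \<omega>)) (real (Suc N)) \<omega> \<partial>M) \<le> liminf (\<lambda>n. ennreal (inverse (real (Suc n))))"
      by (intro Liminf_mono always_eventually) blast
    also have "\<dots> = 0"
      using tendsto_ennrealI[OF LIMSEQ_inverse_real_of_nat] by (intro lim_imp_Liminf) auto
    finally have "(\<integral>\<^sup>+\<omega>. liminf (\<lambda>n. eavg (\<lambda>\<omega>. ennreal (h n \<omega>)) (real (Suc N)) \<omega>) \<partial>M) = 0"
      using nn_integral_liminf[of "\<lambda>n. eavg (\<lambda>\<omega>. ennreal (h n \<omega>)) (real (Suc N))" M] by (simp add: le_zero_eq)
    then show ?thesis by (subst (asm) nn_integral_0_iff_AE) auto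
  qed
  then have "AE \<omega> in M. \<forall>N. liminf (\<lambda>n. eavg (\<lambda>\<omega>. ennreal (h n \<omega>)) (real (Suc N)) \<omega>) = 0"
    by (simp add: AE_all_countable)
  moreover have "AE \<omega> in M. \<forall>n. (\<forall>i m. Ck m (\<lambda>y. s n (T y \<omega>) $ i)) \<and> (AE y in lborel. (\<Sum>i\<in>UNIV. pderiv_at (\<lambda>y. s n (T y \<omega>) $ i) i y) = 0)"
    using s(3) by (subst AE_all_countable) blast
  moreover have "AE \<omega> in M. \<forall>n. loc_int (\<lambda>y. h n (T y \<omega>))"
    using AE_loc_int[OF hi] by (subst AE_all_countable) blast
  moreover have "AE \<omega> in M. \<forall>n. loc_int (\<lambda>y. (norm (s n (T y \<omega>)))\<^sup>2)"
    using AE_orbit_L2[OF s(1)] by (subst AE_all_countable) blast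
  ultimately show ?thesis
    using AE_orbit_L2[OF \<sigma>L] AE_space
  proof eventually_elim
    case (elim \<omega>)
    show ?case
    proof (intro allI impI ballI)
      fix \<rho> :: real and \<phi> :: "real^'d \<Rightarrow> real" assume \<rho>: "\<rho> > 0" and \<phi>: "\<phi> \<in> H10 (cube \<rho>)"
      let ?L = "lebesgue_on (cube \<rho>)"
      note \<sigma>o = orbit_L2(1)[OF L2D(1)[OF \<sigma>L] elim(6,5) \<rho>]
      show "(LINT y|?L. \<sigma> (T y \<omega>) \<bullet> wgrad (cube \<rho>) \<phi> y) = 0"
      proof (rule divergence_free_H10[OF \<sigma>o open_cube \<phi>])
        fix \<theta> :: "real^'d \<Rightarrow> real" assume \<theta>: "\<theta> \<in> test_functions (cube \<rho>)"
        have cL: "cgrad \<theta> \<in> L2 ?L" by (rule cgrad_test_functions_L2[OF \<theta> open_cube])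
        let ?c = "L2norm ?L (cgrad \<theta>)"
        obtain N :: nat where N: "\<rho> \<le> real (Suc N)" using real_arch_simple[of \<rho>] by (metis of_nat_Suc add_increasing zero_le_one)
        let ?V = "(2 * real (Suc N)) ^ CARD('d)"
        have V: "?V > 0" by (simp del: of_nat_Suc)
        have "\<bar>LINT y|?L. \<sigma> (T y \<omega>) \<bullet> cgrad \<theta> y\<bar> \<le> 0"
        proof (rule field_le_epsilon)
          fix e :: real assume "e > 0"
          define e' where "e' = (e / (?c + 1))\<^sup>2 / ?V"
          have c1: "?c + 1 > 0" by (rule add_nonneg_pos) simp_all
          then have "e' > 0" using \<open>e > 0\<close> V by (simp add: e'_def)
          have "\<exists>n. eavg (\<lambda>\<omega>. ennreal (h n \<omega>)) (real (Suc N)) \<omega> < ennreal e'"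
          proof (rule ccontr)
            assume "\<not> ?thesis"
            then have "ennreal e' \<le> liminf (\<lambda>n. eavg (\<lambda>\<omega>. ennreal (h n \<omega>)) (real (Suc N)) \<omega>)"
              by (intro Liminf_bounded always_eventually) (simp add: not_less)
            then show False using elim(1) \<open>e' > 0\<close> by simp
          qed
          then obtain n where "eavg (\<lambda>\<omega>. ennreal (h n \<omega>)) (real (Suc N)) \<omega> < ennreal e'" by blast
          moreover have "0 \<le> ravg (h n) (real (Suc N)) \<omega>" using h0 by (simp add: ravg_def)
          ultimately have n: "ravg (h n) (real (Suc N)) \<omega> < e'"
            using eavg_eq_ravg[OF elim(3)[rule_format, of n] h0, of "real (Suc N)"] \<open>e' > 0\<close> by (simp add: ennreal_less_iff)
          note so = orbit_L2(1)[OF L2D(1)[OF s(1)] elim(6) elim(4)[rule_format] \<rho>, of n]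
          have "(L2norm ?L (\<lambda>y. s n (T y \<omega>) - \<sigma> (T y \<omega>)))\<^sup>2 = (2 * \<rho>) ^ CARD('d) * ravg (h n) \<rho> \<omega>"
            unfolding h_def[abs_def]
            by (rule orbit_L2(2)[OF L2D(1)[OF sd] elim(6) _ \<rho>]) (use elim(3) in \<open>simp only: h_def\<close>)
          also have "\<dots> \<le> ?V * ravg (h n) (real (Suc N)) \<omega>"
            by (rule ravg_mono_cube[OF elim(3)[rule_format] h0 \<rho> N])
          also have "\<dots> \<le> ?V * e'" using n V by (intro mult_left_mono) auto
          also have "\<dots> = (e / (?c + 1))\<^sup>2" using V by (simp add: e'_def)
          finally have sn: "L2norm ?L (\<lambda>y. s n (T y \<omega>) - \<sigma> (T y \<omega>)) \<le> e / (?c + 1)"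
            by (rule power2_le_imp_le) (use \<open>e > 0\<close> c1 in simp)
          have 0: "(LINT y|?L. s n (T y \<omega>) \<bullet> cgrad \<theta> y) = 0"
            by (rule integral_inner_cgrad_smooth[OF _ \<theta> open_cube]) (use elim(2) in auto)
          have "(LINT y|?L. \<sigma> (T y \<omega>) \<bullet> cgrad \<theta> y) = - (LINT y|?L. (s n (T y \<omega>) - \<sigma> (T y \<omega>)) \<bullet> cgrad \<theta> y)"
            using 0 L2_integrable_inner[OF so cL] L2_integrable_inner[OF \<sigma>o cL] by (simp add: inner_diff_left)
          then have "\<bar>LINT y|?L. \<sigma> (T y \<omega>) \<bullet> cgrad \<theta> y\<bar> \<le> L2norm ?L (\<lambda>y. s n (T y \<omega>) - \<sigma> (T y \<omega>)) * ?c"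
            using L2_Cauchy_Schwarz[OF L2_diff[OF so \<sigma>o] cL] by simp
          also have "\<dots> \<le> e / (?c + 1) * ?c" by (rule mult_right_mono[OF sn]) simp
          also have "\<dots> \<le> e" using \<open>e > 0\<close> c1 by (simp add: field_simps)
          finally show "\<bar>LINT y|?L. \<sigma> (T y \<omega>) \<bullet> cgrad \<theta> y\<bar> \<le> 0 + e" by simp
        qed
        then show "(LINT y|?L. \<sigma> (T y \<omega>) \<bullet> cgrad \<theta> y) = 0" by simp
      qed
    qed
  qed
qed

section \<open>Integration by parts on the probability space\<close>

lemma L2_tendsto_mult:
  fixes a :: "'x \<Rightarrow> 'w \<Rightarrow> real"
  assumes a: "\<And>t. a t \<in> L2 M" "a' \<in> L2 M" "b \<in> L2 M" and l: "((\<lambda>t. L2norm M (\<lambda>\<omega>. a t \<omega> - a' \<omega>)) \<longlongrightarrow> 0) F"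
  shows "((\<lambda>t. \<integral>\<omega>. a t \<omega> * b \<omega> \<partial>M) \<longlongrightarrow> (LINT \<omega>|M. a' \<omega> * b \<omega>)) F"
proof (rule LIM_zero_cancel, rule Lim_null_comparison[OF always_eventually])
  show "\<forall>t. norm ((LINT \<omega>|M. a t \<omega> * b \<omega>) - (LINT \<omega>|M. a' \<omega> * b \<omega>)) \<le> L2norm M (\<lambda>\<omega>. a t \<omega> - a' \<omega>) * L2norm M b"
    using L2_Cauchy_Schwarz[OF L2_diff[OF a(1,2)] a(3)] L2_integrable_mult[OF a(1,3)] L2_integrable_mult[OF a(2,3)]
    by (simp add: left_diff_distrib)
  show "((\<lambda>t. L2norm M (\<lambda>\<omega>. a t \<omega> - a' \<omega>) * L2norm M b) \<longlongrightarrow> 0) F" using tendsto_mult_left_zero[OF l] .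
qed

text \<open>Invariance moves the shift from \<open>g\<close> to \<open>f\<close>: the difference
  quotient of \<open>g\<close> at \<open>- t\<close> corresponds to minus that of \<open>f\<close>
  at \<open>t\<close>. Composing the two shifts leaves \<open>T 0\<close>, which acts trivially only
  almost surely.\<close>

lemma shift_deriv_by_parts:
  assumes "has_shift_deriv M T i f f'" "has_shift_deriv M T i g g'"
  shows "(LINT \<omega>|M. f \<omega> * g' \<omega>) = - (LINT \<omega>|M. f' \<omega> * g \<omega>)"
proof -
  note fL = has_shift_derivD(1,2)[OF assms(1)] and gL = has_shift_derivD(1,2)[OF assms(2)]
  note [measurable] = L2D(1)[OF fL(1)] L2D(1)[OF gL(1)]
  define h where "h t = t *\<^sub>R axis i (1::real)" for t
  define q where "q f t \<omega> = (f (T (h t) \<omega>) - f \<omega>) / t" for f :: "'w \<Rightarrow> real" and t \<omega>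
  have qL: "q f t \<in> L2 M" if "f \<in> L2 M" for f t
    using L2_mult[OF L2_diff[OF L2_shift[OF that, of "h t"] that], of "1 / t"] by (simp add: q_def[abs_def])
  have qf: "((\<lambda>t. L2norm M (\<lambda>\<omega>. q f t \<omega> - f' \<omega>)) \<longlongrightarrow> 0) (at 0)"
    and qg: "((\<lambda>t. L2norm M (\<lambda>\<omega>. q g t \<omega> - g' \<omega>)) \<longlongrightarrow> 0) (at 0)"
    using has_shift_derivD(3)[OF assms(1)] has_shift_derivD(3)[OF assms(2)] by (simp_all add: q_def h_def)
  have m: "filterlim uminus (at (0::real)) (at 0)"
    unfolding filterlim_at by (auto simp: eventually_at_filter intro!: tendsto_eq_intros)
  have eq: "(LINT \<omega>|M. q g (- t) \<omega> * f \<omega>) = - (LINT \<omega>|M. q f t \<omega> * g \<omega>)" for t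
  proof -
    have fh: "(\<lambda>\<omega>. f (T (h t) \<omega>)) \<in> L2 M" and gh: "(\<lambda>\<omega>. g (T (h (- t)) \<omega>)) \<in> L2 M" by (intro L2_shift fL gL)+
    have "(LINT \<omega>|M. g (T (h (- t)) \<omega>) * f \<omega>) = (LINT \<omega>|M. g (T (h (- t)) (T (h t) \<omega>)) * f (T (h t) \<omega>))"
      by (rule integral_shift[symmetric, of "\<lambda>\<omega>. g (T (h (- t)) \<omega>) * f \<omega>"]) measurable
    also have "\<dots> = (LINT \<omega>|M. f (T (h t) \<omega>) * g \<omega>)"
    proof (rule integral_cong_AE)
      show "AE \<omega> in M. g (T (h (- t)) (T (h t) \<omega>)) * f (T (h t) \<omega>) = f (T (h t) \<omega>) * g \<omega>"
        using AE_T0[OF L2D(1)[OF gL(1)]] AE_space by eventually_elim (simp add: T_add h_def)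
    qed measurable
    finally show ?thesis
      using L2_integrable_mult[OF fh gL(1)] L2_integrable_mult[OF gh fL(1)] L2_integrable_mult[OF fL(1) gL(1)]
      by (simp add: q_def left_diff_distrib right_diff_distrib minus_divide_left[symmetric] mult.commute)
  qed
  have "((\<lambda>t. \<integral>\<omega>. q g (- t) \<omega> * f \<omega> \<partial>M) \<longlongrightarrow> (LINT \<omega>|M. g' \<omega> * f \<omega>)) (at 0)"
    by (rule L2_tendsto_mult[OF qL[OF gL(1)] gL(2) fL(1) filterlim_compose[OF qg m]])
  moreover have "((\<lambda>t. \<integral>\<omega>. q g (- t) \<omega> * f \<omega> \<partial>M) \<longlongrightarrow> - (LINT \<omega>|M. f' \<omega> * g \<omega>)) (at 0)"
    unfolding eq by (intro tendsto_minus L2_tendsto_mult[OF qL[OF fL(1)] fL(2) gL(1) qf])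
  ultimately show ?thesis using tendsto_unique[OF at_neq_bot] by (simp add: mult.commute)
qed

text \<open>On the generating fields this is \<open>shift_deriv_by_parts\<close>, and Cauchy-Schwarz
  carries it to the closures. It turns \<open>A0\<close> into an energy form and yields the bound on
  the cell solutions.\<close>

lemma L2_sol_pot_orthogonal:
  fixes \<sigma> w :: "'w \<Rightarrow> real^'d"
  assumes \<sigma>: "\<sigma> \<in> L2_sol M T" and w: "w \<in> L2_pot M T"
  shows "(LINT \<omega>|M. \<sigma> \<omega> \<bullet> w \<omega>) = 0"
proof -
  have \<sigma>L: "\<sigma> \<in> L2 M" using \<sigma> by (simp add: L2_sol_def L2_closure_def)
  have wL: "w \<in> L2 M" using w by (simp add: L2_pot_def L2_closure_def)
  have "\<bar>LINT \<omega>|M. \<sigma> \<omega> \<bullet> w \<omega>\<bar> \<le> 0"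
  proof (rule field_le_epsilon)
    fix e :: real assume "e > 0"
    \<comment> \<open>Bounds the norm of \<sigma> and also that of the approximant of
      \<open>w\<close>, which exceeds the norm of \<open>w\<close> by at most
      \<open>e' \<le> 1\<close>.\<close>
    define C where "C = L2norm M \<sigma> + L2norm M w + 2"
    have C: "C > 0" "L2norm M \<sigma> \<le> C" "L2norm M w + 1 \<le> C" unfolding C_def using L2norm_nonneg[of M \<sigma>] L2norm_nonneg[of M w] by linarith+
    define e' where "e' = min 1 (e / (2 * C))"
    have e': "e' > 0" "e' \<le> 1" "e' \<le> e / (2 * C)" using \<open>e > 0\<close> C by (auto simp: e'_def)
    obtain \<chi>' where c: "\<chi>' \<in> dom_shift M T" "L2norm M (\<lambda>\<omega>. w \<omega> - (\<chi> i. shift_deriv M T i \<chi>' \<omega>)) < e'"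
      by (rule L2_potE[OF w e'(1)])
    obtain \<psi> where \<psi>: "\<forall>i. (\<lambda>\<omega>. \<psi> \<omega> $ i) \<in> dom_shift M T" "AE \<omega> in M. (\<Sum>i\<in>UNIV. shift_deriv M T i (\<lambda>\<omega>'. \<psi> \<omega>' $ i) \<omega>) = 0"
      "L2norm M (\<lambda>\<omega>. \<sigma> \<omega> - \<psi> \<omega>) < e'"
      by (rule L2_solE[OF \<sigma> e'(1)])
    define d where "d \<omega> = (\<chi> i. shift_deriv M T i \<chi>' \<omega>)" for \<omega>
    note hc = dom_shift_deriv[OF c(1)]
    have hp: "has_shift_deriv M T i (\<lambda>\<omega>. \<psi> \<omega> $ i) (shift_deriv M T i (\<lambda>\<omega>. \<psi> \<omega> $ i))" for i by (rule dom_shift_deriv[OF \<psi>(1)[rule_format]])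
    have dL: "d \<in> L2 M" unfolding d_def by (rule L2_vec[OF has_shift_derivD(2)[OF hc]])
    have \<psi>L: "\<psi> \<in> L2 M" using L2_vec[where f="\<lambda>i \<omega>. \<psi> \<omega> $ i", OF has_shift_derivD(1)[OF hp]] by simp
    have "(LINT \<omega>|M. \<psi> \<omega> \<bullet> d \<omega>) = (\<Sum>i\<in>UNIV. \<integral>\<omega>. \<psi> \<omega> $ i * shift_deriv M T i \<chi>' \<omega> \<partial>M)"
      unfolding inner_vec_def d_def
      using L2_integrable_mult[OF has_shift_derivD(1)[OF hp] has_shift_derivD(2)[OF hc]] by simp
    also have "\<dots> = - (\<Sum>i\<in>UNIV. \<integral>\<omega>. shift_deriv M T i (\<lambda>\<omega>. \<psi> \<omega> $ i) \<omega> * \<chi>' \<omega> \<partial>M)"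
      by (simp add: shift_deriv_by_parts[OF hp hc] sum_negf)
    also have "(\<Sum>i\<in>UNIV. \<integral>\<omega>. shift_deriv M T i (\<lambda>\<omega>. \<psi> \<omega> $ i) \<omega> * \<chi>' \<omega> \<partial>M) = (LINT \<omega>|M. (\<Sum>i\<in>UNIV. shift_deriv M T i (\<lambda>\<omega>. \<psi> \<omega> $ i) \<omega>) * \<chi>' \<omega>)"
      unfolding sum_distrib_right
      by (rule Bochner_Integration.integral_sum[symmetric]) (rule L2_integrable_mult[OF has_shift_derivD(2)[OF hp] has_shift_derivD(1)[OF hc]])
    also have "\<dots> = 0"
      by (rule integral_eq_zero_AE) (use \<psi>(2) in \<open>auto elim: eventually_mono\<close>)
    finally have 0: "(LINT \<omega>|M. \<psi> \<omega> \<bullet> d \<omega>) = 0" by simp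
    have "(LINT \<omega>|M. \<sigma> \<omega> \<bullet> w \<omega>) = (LINT \<omega>|M. \<sigma> \<omega> \<bullet> (w \<omega> - d \<omega>)) + (LINT \<omega>|M. (\<sigma> \<omega> - \<psi> \<omega>) \<bullet> d \<omega>)"
      using 0 L2_integrable_inner[OF \<sigma>L wL] L2_integrable_inner[OF \<sigma>L dL] L2_integrable_inner[OF \<psi>L dL]
      by (simp add: inner_diff_left inner_diff_right)
    moreover have "\<bar>LINT \<omega>|M. \<sigma> \<omega> \<bullet> (w \<omega> - d \<omega>)\<bar> \<le> C * e'"
      by (rule L2_Cauchy_Schwarz_le[OF \<sigma>L L2_diff[OF wL dL] C(2)]) (use c(2) in \<open>simp add: d_def\<close>)
    moreover have "\<bar>LINT \<omega>|M. (\<sigma> \<omega> - \<psi> \<omega>) \<bullet> d \<omega>\<bar> \<le> C * e'"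
    proof -
      have "L2norm M (\<lambda>\<omega>. (d \<omega> - w \<omega>) + w \<omega>) \<le> L2norm M (\<lambda>\<omega>. d \<omega> - w \<omega>) + L2norm M w"
        by (rule L2norm_triangle[OF L2_diff[OF dL wL] wL])
      moreover have "L2norm M (\<lambda>\<omega>. d \<omega> - w \<omega>) < e'"
        unfolding d_def using c(2) by (subst L2norm_diff_commute)
      ultimately have "L2norm M d \<le> C" using e'(2) C(3) by simp
      then show ?thesis unfolding mult.commute[of C]
        by (intro L2_Cauchy_Schwarz_le[OF L2_diff[OF \<sigma>L \<psi>L] dL]) (use \<psi>(3) in simp)
    qed
    moreover have "C * e' \<le> e / 2" using e'(3) C(1) by (simp add: field_simps)
    ultimately show "\<bar>LINT \<omega>|M. \<sigma> \<omega> \<bullet> w \<omega>\<bar> \<le> 0 + e" by linarith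
  qed
  then show ?thesis by simp
qed

end

subsection \<open>Correctors on truncated cubes\<close>

lemma test_functions_dilate:
  fixes \<eta> :: "real^'d::finite \<Rightarrow> real"
  assumes "\<eta> \<in> test_functions (cube 1)" "\<rho> > 0"
  shows "(\<lambda>y. \<eta> (inverse \<rho> *\<^sub>R y)) \<in> test_functions (cube \<rho>)"
proof -
  obtain K where K: "compact K" "K \<subseteq> cube 1" "\<forall>x. x \<notin> K \<longrightarrow> \<eta> x = 0" using assms(1) by (auto simp: test_functions_iff)
  have "compact ((\<lambda>y. \<rho> *\<^sub>R y) ` K)" by (intro compact_scaling K)
  moreover have "(\<lambda>y. \<rho> *\<^sub>R y) ` K \<subseteq> cube \<rho>"
  proof
    fix y assume "y \<in> (\<lambda>y. \<rho> *\<^sub>R y) ` K"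
    then obtain z where z: "z \<in> cube 1" "y = \<rho> *\<^sub>R z" using K(2) by blast
    then have "- 1 < z $ i" "z $ i < 1" for i by (auto simp: cube_def)
    then have "\<rho> * (- 1) < \<rho> * z $ i" "\<rho> * z $ i < \<rho> * 1" for i
      using assms(2) by (intro mult_strict_left_mono; simp)+
    then show "y \<in> cube \<rho>" using z(2) by (simp add: cube_def)
  qed
  moreover have "\<eta> (inverse \<rho> *\<^sub>R y) = 0" if "y \<notin> (\<lambda>y. \<rho> *\<^sub>R y) ` K" for y
  proof -
    have "y = \<rho> *\<^sub>R (inverse \<rho> *\<^sub>R y)" using assms(2) by simp
    then have "inverse \<rho> *\<^sub>R y \<notin> K" using that by blast
    then show ?thesis using K(3) by blast
  qed
  moreover have "Ck k (\<lambda>y. \<eta> (inverse \<rho> *\<^sub>R y))" for k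
    using Ck_affine[OF test_functionsD(1)[OF assms(1)], of k "inverse \<rho>" 0] by simp
  ultimately show ?thesis unfolding test_functions_iff by blast
qed

lemma cube_scale: "\<rho> > 0 \<Longrightarrow> y \<in> cube (s * \<rho>) \<longleftrightarrow> inverse \<rho> *\<^sub>R y \<in> cube s"
  by (simp add: cube_def field_simps)

context ergodic
begin

text \<open>The corrector is \<open>P y * \<zeta> y\<close> with \<open>P\<close> a smooth
  stationary potential and \<zeta> a cut-off equal to 1 on \<open>cube (s * \<rho>)\<close>. Three
  errors arise: the distance of the smooth gradient from \<open>w\<close>, controlled by the ergodic
  theorem; the energy of \<open>w\<close> in the boundary layer, whose share of the volume is 1 -
  s^d; and \<open>P\<close> times the gradient of \<zeta>, which is of order 1/\<rho> because the
  mean squares of \<open>P\<close> stay bounded.\<close>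

lemma corrector_approx:
  fixes w :: "'w \<Rightarrow> real^'d"
  assumes w: "w \<in> L2_pot M T" and "e > 0"
  shows "AE \<omega> in M. \<forall>\<^sub>F \<rho> in at_top. \<exists>v\<in>H10 (cube \<rho>).
     L2norm (lebesgue_on (cube \<rho>)) (\<lambda>y. wgrad (cube \<rho>) v y - w (T y \<omega>)) \<le> e * sqrt ((2 * \<rho>) ^ CARD('d))"
proof -
  let ?d = "CARD('d)"
  have wL: "w \<in> L2 M" using w by (simp add: L2_pot_def L2_closure_def)
  obtain p g where p: "p \<in> L2 M" and g: "g \<in> L2 M" and gw: "L2norm M (\<lambda>\<omega>. g \<omega> - w \<omega>) < e / 4"
    and sm: "AE \<omega> in M. (\<forall>n. Ck n (\<lambda>y. p (T y \<omega>))) \<and> (\<forall>y. cgrad (\<lambda>y. p (T y \<omega>)) y = g (T y \<omega>))"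
    using L2_pot_smooth_approx[OF w, of "e / 4"] \<open>e > 0\<close> by auto
  note [measurable] = L2D(1)[OF wL] L2D(1)[OF p] L2D(1)[OF g]
  have gwL: "(\<lambda>\<omega>. g \<omega> - w \<omega>) \<in> L2 M" by (rule L2_diff[OF g wL])
  define W where "W = (LINT \<omega>|M. (norm (w \<omega>))\<^sup>2)"
  have "W \<ge> 0" by (simp add: W_def)
  \<comment> \<open>\<open>W * (1 - s ^ ?d)\<close> is the limiting energy of \<open>w\<close> in
    the layer between \<open>cube (s * \<rho>)\<close> and \<open>cube \<rho>\<close>, relative to
    the volume of the whole cube.\<close>
  obtain s where s: "0 < s" "s < 1" "W * (1 - s ^ ?d) < (e / 4)\<^sup>2"
  proof -
    have "((\<lambda>s. W * (1 - s ^ ?d)) \<longlongrightarrow> W * (1 - 1 ^ ?d)) (at_left (1::real))" by (intro tendsto_intros)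
    then have "\<forall>\<^sub>F s in at_left (1::real). W * (1 - s ^ ?d) < (e / 4)\<^sup>2"
      using \<open>e > 0\<close> by (intro order_tendstoD) auto
    moreover have "\<forall>\<^sub>F s in at_left (1::real). 0 < s" by (rule eventually_at_left_real[of 0 1, THEN eventually_mono]) auto
    moreover have "\<forall>\<^sub>F s in at_left (1::real). s < 1" by (simp add: eventually_at_filter)
    ultimately have "\<forall>\<^sub>F s in at_left (1::real). W * (1 - s ^ ?d) < (e / 4)\<^sup>2 \<and> 0 < s \<and> s < 1" by eventually_elim blast
    then show ?thesis using that eventually_happens'[OF trivial_limit_at_left_real] by blast
  qed
  obtain \<eta> :: "real^'d \<Rightarrow> real" where \<eta>: "\<eta> \<in> test_functions (cube 1)" "\<And>y. 0 \<le> \<eta> y" "\<And>y. \<eta> y \<le> 1" "\<And>y. y \<in> cube s \<Longrightarrow> \<eta> y = 1"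
    using cutoff_exists[OF s(1,2)] by blast
  have \<eta>': "\<eta> \<in> test_functions UNIV" using \<eta>(1) test_functions_mono by blast
  have \<eta>c: "continuous_on UNIV (cgrad \<eta>)"
    unfolding cgrad_def by (intro continuous_on_vec_lambda test_functionsD(3)[OF pderiv_at_test_functions[OF \<eta>']])
  obtain C where C: "C \<ge> 0" "\<And>y. norm (cgrad \<eta> y) \<le> C"
  proof (rule continuous_compact_support_bounded[OF \<eta>c])
    fix y :: "real^'d" assume "sqrt ?d + 1 \<le> norm y"
    then have "y \<notin> cube 1" using norm_le_cube[of y 1] by auto
    then show "cgrad \<eta> y = 0"
      using pderiv_at_test_functions[OF \<eta>(1)] by (auto simp: test_functions_iff vec_eq_iff)
  qed blast
  have W2: "integrable M (\<lambda>\<omega>. (norm (w \<omega>))\<^sup>2)" "integrable M (\<lambda>\<omega>. (norm (g \<omega> - w \<omega>))\<^sup>2)" "integrable M (\<lambda>\<omega>. (norm (p \<omega>))\<^sup>2)"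
    using L2D(2)[OF wL] L2D(2)[OF gwL] L2D(2)[OF p] by auto
  show ?thesis
    using sm pointwise_ergodic[OF W2(1)] pointwise_ergodic[OF W2(2)] pointwise_ergodic[OF W2(3)]
      AE_loc_int[OF W2(1)] AE_loc_int[OF W2(2)] AE_loc_int[OF W2(3)] AE_orbit_L2[OF g] AE_space
  proof eventually_elim
    case (elim \<omega>)
    note \<omega> = elim(9)
    let ?R1 = "ravg (\<lambda>\<omega>. (norm (w \<omega>))\<^sup>2)" and ?R2 = "ravg (\<lambda>\<omega>. (norm (g \<omega> - w \<omega>))\<^sup>2)" and ?R3 = "ravg (\<lambda>\<omega>. (norm (p \<omega>))\<^sup>2)"
    have fs: "filterlim (\<lambda>\<rho>. s * \<rho>) at_top at_top"
      by (rule filterlim_tendsto_pos_mult_at_top[OF tendsto_const s(1) filterlim_ident])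
    \<comment> \<open>The layer is a difference of two cubes, so the ergodic theorem is used at both
      half sides \<rho> and \<open>s * \<rho>\<close>.\<close>
    have l1: "((\<lambda>\<rho>. ?R1 \<rho> \<omega> - s ^ ?d * ?R1 (s * \<rho>) \<omega>) \<longlongrightarrow> W - s ^ ?d * W) at_top"
      unfolding W_def by (intro tendsto_intros elim(2) filterlim_compose[OF elim(2) fs])
    have "\<forall>\<^sub>F \<rho> in at_top. ?R1 \<rho> \<omega> - s ^ ?d * ?R1 (s * \<rho>) \<omega> < (e / 4)\<^sup>2"
      using s(3) by (intro order_tendstoD[OF l1]) (simp add: algebra_simps)
    moreover have "\<forall>\<^sub>F \<rho> in at_top. ?R2 \<rho> \<omega> < (e / 4)\<^sup>2"
    proof (rule order_tendstoD(2)[OF elim(3)])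
      have "(L2norm M (\<lambda>\<omega>. g \<omega> - w \<omega>))\<^sup>2 < (e / 4)\<^sup>2" using gw by (intro power_strict_mono) auto
      then show "(LINT \<omega>|M. (norm (g \<omega> - w \<omega>))\<^sup>2) < (e / 4)\<^sup>2" by (simp add: L2norm_sq)
    qed
    moreover have "\<forall>\<^sub>F \<rho> in at_top. C * (inverse \<rho> * sqrt (?R3 \<rho> \<omega>)) < e / 4"
    proof (rule order_tendstoD(2))
      show "((\<lambda>\<rho>. C * (inverse \<rho> * sqrt (?R3 \<rho> \<omega>))) \<longlongrightarrow> C * (0 * sqrt (LINT \<omega>|M. (norm (p \<omega>))\<^sup>2))) at_top"
        by (intro tendsto_intros elim(4) tendsto_inverse_0_at_top filterlim_ident)
    qed (use \<open>e > 0\<close> in simp)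
    ultimately show ?case
      using eventually_gt_at_top[of 0]
    proof eventually_elim
      case ev: (elim \<rho>)
      note \<rho> = ev(4)
      let ?Q = "cube \<rho> :: (real^'d) set"
      let ?L = "lebesgue_on ?Q"
      let ?V = "(2 * \<rho>) ^ ?d"
      have V: "?V > 0" using \<rho> by simp
      define \<zeta> where "\<zeta> y = \<eta> (inverse \<rho> *\<^sub>R y)" for y
      have \<zeta>t: "\<zeta> \<in> test_functions ?Q" unfolding \<zeta>_def by (rule test_functions_dilate[OF \<eta>(1) \<rho>])
      define P where "P y = p (T y \<omega>)" for y
      define v where "v y = P y * \<zeta> y" for y
      have P: "\<And>n. Ck n P" "\<And>y. cgrad P y = g (T y \<omega>)" using elim(1) unfolding P_def by auto
      have vt: "v \<in> test_functions ?Q" unfolding v_def by (rule test_functions_mult_smooth[OF \<zeta>t P(1)])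
      have dP: "P differentiable (at y)" for y using P(1)[of 1] by simp
      have gz: "cgrad \<zeta> y = inverse \<rho> *\<^sub>R cgrad \<eta> (inverse \<rho> *\<^sub>R y)" for y
        using pderiv_at_affine(2)[where c="inverse \<rho>" and b=0 and x=y, OF test_functionsD(2)[OF \<eta>(1)]]
        by (simp add: vec_eq_iff \<zeta>_def[abs_def])
      have gv: "cgrad v y = \<zeta> y *\<^sub>R g (T y \<omega>) + P y *\<^sub>R (inverse \<rho> *\<^sub>R cgrad \<eta> (inverse \<rho> *\<^sub>R y))" for y
      proof -
        have "cgrad v y = P y *\<^sub>R cgrad \<zeta> y + \<zeta> y *\<^sub>R cgrad P y"
          unfolding v_def[abs_def] by (simp add: vec_eq_iff pderiv_at_mult[OF dP test_functionsD(2)[OF \<zeta>t]] mult.commute)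
        then show ?thesis by (simp add: gz P(2))
      qed
      define f1 where "f1 y = \<zeta> y *\<^sub>R (g (T y \<omega>) - w (T y \<omega>))" for y
      define f2 where "f2 y = (1 - \<zeta> y) *\<^sub>R w (T y \<omega>)" for y
      define f3 where "f3 y = P y *\<^sub>R (inverse \<rho> *\<^sub>R cgrad \<eta> (inverse \<rho> *\<^sub>R y))" for y
      have eq: "cgrad v y - w (T y \<omega>) = (f1 y - f2 y) + f3 y" for y
        unfolding gv f1_def f2_def f3_def by (simp add: algebra_simps)
      note wo = orbit_L2[OF L2D(1)[OF wL] \<omega> elim(5) \<rho>]
      note gwo = orbit_L2[OF L2D(1)[OF gwL] \<omega> elim(6) \<rho>]
      note po = orbit_L2[OF L2D(1)[OF p] \<omega> elim(7) \<rho>]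
      have \<zeta>m: "\<zeta> \<in> borel_measurable ?L" by (rule borel_measurable_lebesgue_on[OF test_functionsD(4)[OF \<zeta>t]])
      have \<zeta>01: "0 \<le> \<zeta> y" "\<zeta> y \<le> 1" for y using \<eta>(2,3) by (auto simp: \<zeta>_def)
      have cm: "(\<lambda>y. cgrad \<eta> (inverse \<rho> *\<^sub>R y)) \<in> borel_measurable ?L"
      proof (rule borel_measurable_lebesgue_on)
        have "continuous_on UNIV (\<lambda>y. cgrad \<eta> (inverse \<rho> *\<^sub>R y))"
          by (rule continuous_on_compose2[OF \<eta>c]) (auto intro!: continuous_intros)
        then show "(\<lambda>y. cgrad \<eta> (inverse \<rho> *\<^sub>R y)) \<in> borel_measurable borel" by (rule borel_measurable_continuous_onI)
      qed
      have f1: "f1 \<in> L2 ?L" "L2norm ?L f1 \<le> 1 * L2norm ?L (\<lambda>y. g (T y \<omega>) - w (T y \<omega>))"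
      proof -
        have m: "f1 \<in> borel_measurable ?L" unfolding f1_def using \<zeta>m L2D(1)[OF gwo(1)] by measurable
        have b: "AE y in ?L. norm (f1 y) \<le> 1 * norm (g (T y \<omega>) - w (T y \<omega>))"
          using \<zeta>01 by (intro AE_I2) (simp add: f1_def mult_left_le_one_le)
        show "f1 \<in> L2 ?L" by (rule L2_dominated[OF gwo(1) m b])
        show "L2norm ?L f1 \<le> 1 * L2norm ?L (\<lambda>y. g (T y \<omega>) - w (T y \<omega>))" by (rule L2norm_mono[OF gwo(1) m b]) simp
      qed
      have f3: "f3 \<in> L2 ?L" "L2norm ?L f3 \<le> (C * inverse \<rho>) * L2norm ?L (\<lambda>y. p (T y \<omega>))"
      proof -
        have m: "f3 \<in> borel_measurable ?L" unfolding f3_def P_def using cm L2D(1)[OF po(1)] by measurable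
        have b: "AE y in ?L. norm (f3 y) \<le> (C * inverse \<rho>) * norm (p (T y \<omega>))"
        proof (rule AE_I2)
          fix y
          have "norm (f3 y) = \<bar>p (T y \<omega>)\<bar> * inverse \<rho> * norm (cgrad \<eta> (inverse \<rho> *\<^sub>R y))"
            using \<rho> by (simp add: f3_def P_def abs_mult)
          also have "\<dots> \<le> \<bar>p (T y \<omega>)\<bar> * inverse \<rho> * C" using \<rho> C by (intro mult_left_mono) auto
          finally show "norm (f3 y) \<le> (C * inverse \<rho>) * norm (p (T y \<omega>))" by (simp add: mult_ac)
        qed
        show "f3 \<in> L2 ?L" by (rule L2_dominated[OF po(1) m b])
        show "L2norm ?L f3 \<le> (C * inverse \<rho>) * L2norm ?L (\<lambda>y. p (T y \<omega>))" by (rule L2norm_mono[OF po(1) m b]) (use C \<rho> in simp)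
      qed
      have f2L: "f2 \<in> L2 ?L"
      proof (rule L2_dominated[OF wo(1), where C=1])
        show "f2 \<in> borel_measurable ?L" unfolding f2_def using \<zeta>m L2D(1)[OF wo(1)] by measurable
        show "AE y in ?L. norm (f2 y) \<le> 1 * norm (w (T y \<omega>))"
          using \<zeta>01 by (intro AE_I2) (simp add: f2_def mult_left_le_one_le)
      qed
      have f2n: "(L2norm ?L f2)\<^sup>2 \<le> ?V * (?R1 \<rho> \<omega> - s ^ ?d * ?R1 (s * \<rho>) \<omega>)"
      proof -
        define H where "H y = (norm (w (T y \<omega>)))\<^sup>2" for y
        have H0: "H y \<ge> 0" for y by (simp add: H_def)
        have lH: "loc_int H" using elim(5) by (simp add: H_def[abs_def])
        have [measurable]: "H \<in> borel_measurable borel" using lH by (simp add: loc_int_def)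
        have sr: "s * \<rho> > 0" "s * \<rho> \<le> \<rho>" using s \<rho> by (auto simp: mult_le_cancel_right1)
        have HL: "integrable ?L H" using L2D(2)[OF wo(1)] by (simp add: H_def[abs_def])
        have HB: "integrable ?L (\<lambda>y. indicator (cube (s * \<rho>)) y * H y)"
          by (rule Bochner_Integration.integrable_bound[OF HL])
             (auto intro!: borel_measurable_lebesgue_on simp: indicator_def H0)
        have "(L2norm ?L f2)\<^sup>2 \<le> (LINT y|?L. H y - indicator (cube (s * \<rho>)) y * H y)"
          unfolding L2norm_sq
        proof (rule integral_mono[OF L2D(2)[OF f2L]])
          show "integrable ?L (\<lambda>y. H y - indicator (cube (s * \<rho>)) y * H y)" using HL HB by simp
          fix y
          show "(norm (f2 y))\<^sup>2 \<le> H y - indicator (cube (s * \<rho>)) y * H y"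
          proof (cases "y \<in> cube (s * \<rho>)")
            case True
            then have "inverse \<rho> *\<^sub>R y \<in> cube s" by (simp only: cube_scale[OF \<rho>])
            then have "\<zeta> y = 1" unfolding \<zeta>_def by (rule \<eta>(4))
            then show ?thesis using True by (simp add: f2_def)
          next
            case False
            have "norm (f2 y) \<le> norm (w (T y \<omega>))" using \<zeta>01 by (simp add: f2_def mult_left_le_one_le)
            then show ?thesis using False by (simp add: H_def power_mono)
          qed
        qed
        also have "\<dots> = (LINT y|?L. H y) - (LINT y|?L. indicator (cube (s * \<rho>)) y * H y)" using HL HB by simp
        also have "(LINT y|?L. indicator (cube (s * \<rho>)) y * H y) = (LINT y|lborel. indicator (cube (s * \<rho>)) y * H y)"
          by (subst integral_lebesgue_on_cube(1), measurable)
            (intro Bochner_Integration.integral_cong, use cube_mono[OF sr(2)] in \<open>auto simp: indicator_def\<close>)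
        also have "\<dots> = (2 * (s * \<rho>)) ^ ?d * ?R1 (s * \<rho>) \<omega>" using s(1) \<rho> by (simp add: ravg_def H_def)
        also have "(LINT y|?L. H y) = ?V * ?R1 \<rho> \<omega>"
          unfolding H_def by (rule ravg_eq_integral[of "\<lambda>\<omega>. (norm (w \<omega>))\<^sup>2", OF _ \<omega> \<rho>]) measurable
        also have "(2 * (s * \<rho>)) ^ ?d = ?V * s ^ ?d"
          unfolding power_mult_distrib[symmetric] by (simp only: mult_ac)
        finally show ?thesis by (simp add: right_diff_distrib mult.assoc)
      qed
      have sq: "sqrt (?V * x) \<le> c * sqrt ?V" if "x \<le> c\<^sup>2" "c \<ge> 0" for x c
      proof -
        have "sqrt (?V * x) \<le> sqrt (?V * c\<^sup>2)" using that V by (intro real_sqrt_le_mono mult_left_mono) auto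
        then show ?thesis using that by (simp add: real_sqrt_mult mult.commute)
      qed
      have n1: "L2norm ?L f1 \<le> e / 4 * sqrt ?V"
      proof -
        have "L2norm ?L (\<lambda>y. g (T y \<omega>) - w (T y \<omega>)) = sqrt (?V * ?R2 \<rho> \<omega>)"
          by (rule real_sqrt_unique[symmetric, OF gwo(2)]) simp
        also have "\<dots> \<le> e / 4 * sqrt ?V" by (rule sq) (use ev(2) \<open>e > 0\<close> in auto)
        finally show ?thesis using f1(2) by simp
      qed
      have n2: "L2norm ?L f2 \<le> e / 4 * sqrt ?V"
      proof -
        have "L2norm ?L f2 \<le> sqrt (?V * (?R1 \<rho> \<omega> - s ^ ?d * ?R1 (s * \<rho>) \<omega>))" using f2n by (rule real_le_rsqrt)
        also have "\<dots> \<le> e / 4 * sqrt ?V" by (rule sq) (use ev(1) \<open>e > 0\<close> in auto)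
        finally show ?thesis .
      qed
      have n3: "L2norm ?L f3 \<le> e / 4 * sqrt ?V"
      proof -
        have "L2norm ?L (\<lambda>y. p (T y \<omega>)) = sqrt (?V * ?R3 \<rho> \<omega>)"
          by (rule real_sqrt_unique[symmetric, OF po(2)]) simp
        then have "L2norm ?L f3 \<le> C * (inverse \<rho> * sqrt (?R3 \<rho> \<omega>)) * sqrt ?V"
          using f3(2) by (simp add: real_sqrt_mult mult_ac)
        also have "\<dots> \<le> e / 4 * sqrt ?V" using ev(3) V by (intro mult_right_mono) auto
        finally show ?thesis .
      qed
      have vL: "cgrad v \<in> L2 ?L" by (rule cgrad_test_functions_L2[OF vt open_cube])
      have "L2norm ?L (\<lambda>y. cgrad v y - w (T y \<omega>)) \<le> L2norm ?L f1 + L2norm ?L f2 + L2norm ?L f3"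
        unfolding eq using L2norm_triangle[OF L2_diff[OF f1(1) f2L] f3(1)] L2norm_triangle_diff[OF f1(1) f2L] by linarith
      also have "\<dots> \<le> e * sqrt ?V"
      proof -
        have "L2norm ?L f1 + L2norm ?L f2 + L2norm ?L f3 \<le> e / 4 * sqrt ?V + e / 4 * sqrt ?V + e / 4 * sqrt ?V"
          using n1 n2 n3 by linarith
        also have "\<dots> = (3 * e / 4) * sqrt ?V" by (simp add: field_simps)
        also have "\<dots> \<le> e * sqrt ?V" using \<open>e > 0\<close> V by (intro mult_right_mono) auto
        finally show ?thesis .
      qed
      finally have main: "L2norm ?L (\<lambda>y. cgrad v y - w (T y \<omega>)) \<le> e * sqrt ?V" .
      have vg: "has_weak_gradient ?Q v (cgrad v)" by (rule test_functions_has_weak_gradient[OF vt open_cube])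
      have "L2norm ?L (\<lambda>y. wgrad ?Q v y - w (T y \<omega>)) = L2norm ?L (\<lambda>y. cgrad v y - w (T y \<omega>))"
      proof (rule L2norm_cong_AE)
        have vH: "v \<in> H10 ?Q" by (rule test_functions_subset_H10[OF vt open_cube])
        show "(\<lambda>y. wgrad ?Q v y - w (T y \<omega>)) \<in> borel_measurable ?L"
          by (rule L2D(1)[OF L2_diff[OF H10_wgrad_L2[OF vH] wo(1)]])
        show "(\<lambda>y. cgrad v y - w (T y \<omega>)) \<in> borel_measurable ?L" by (rule L2D(1)[OF L2_diff[OF vL wo(1)]])
        show "AE y in ?L. wgrad ?Q v y - w (T y \<omega>) = cgrad v y - w (T y \<omega>)"
          using wgrad_eq[OF vg open_cube] by (rule eventually_mono) simp
      qed
      then show ?case using main test_functions_subset_H10[OF vt open_cube] by (intro bexI[of _ v]) auto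
    qed
  qed
qed

end

subsection \<open>Elliptic coefficients\<close>

lemma matrix_vector_mult_entry_bound:
  fixes m :: "real^'n::finite^'n"
  assumes "\<And>i j. \<bar>m $ i $ j\<bar> \<le> e"
  shows "norm (m *v \<xi>) \<le> (real CARD('n))\<^sup>2 * e * norm \<xi>"
proof -
  have "0 \<le> e" using assms[of undefined undefined] by linarith
  have "\<bar>(m *v \<xi>) $ i\<bar> \<le> real CARD('n) * (e * norm \<xi>)" for i
  proof -
    have "\<bar>(m *v \<xi>) $ i\<bar> \<le> (\<Sum>j\<in>UNIV. \<bar>m $ i $ j * \<xi> $ j\<bar>)"
      unfolding matrix_vector_mult_def by (simp add: sum_abs)
    also have "\<dots> \<le> (\<Sum>j\<in>(UNIV::'n set). e * norm \<xi>)"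
      using assms \<open>0 \<le> e\<close> component_le_norm_cart[of \<xi>]
      by (intro sum_mono) (simp add: abs_mult mult_mono)
    finally show ?thesis by simp
  qed
  then have "(\<Sum>i\<in>UNIV. \<bar>(m *v \<xi>) $ i\<bar>) \<le> (\<Sum>i\<in>(UNIV::'n set). real CARD('n) * (e * norm \<xi>))"
    by (intro sum_mono)
  then show ?thesis using norm_le_l1_cart[of "m *v \<xi>"] by (simp add: power2_eq_square mult_ac)
qed

lemma symmetric_matrix_inner:
  fixes m :: "real^'n::finite^'n"
  assumes "transpose m = m"
  shows "(m *v u) \<bullet> v = (m *v v) \<bullet> u"
proof -
  have "(m *v u) \<bullet> v = (transpose m *v u) \<bullet> v" using assms by simp
  also have "\<dots> = u \<bullet> (m *v v)" by (simp add: dot_lmul_matrix)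
  finally show ?thesis by (simp add: inner_commute)
qed

lemma continuous_on_matrix_vector_mult:
  fixes m :: "real^'n::finite^'n"
  assumes "continuous_on S f"
  shows "continuous_on S (\<lambda>x. m *v f x)"
  by (rule bounded_linear.continuous_on[OF matrix_vector_mul_bounded_linear assms])

lemma borel_measurable_matrix_vector_mult [measurable (raw)]:
  fixes f :: "'a \<Rightarrow> real^'n::finite^'n"
  assumes [measurable]: "f \<in> borel_measurable N" "g \<in> borel_measurable N"
  shows "(\<lambda>x. f x *v g x) \<in> borel_measurable N"
  unfolding matrix_vector_mult_def by measurable

definition elliptic :: "real \<Rightarrow> real \<Rightarrow> real^'n::finite^'n \<Rightarrow> bool" where
  "elliptic c1 c2 m \<longleftrightarrow> (\<forall>\<xi>. c1 * (norm \<xi>)\<^sup>2 \<le> (m *v \<xi>) \<bullet> \<xi> \<and> norm (m *v \<xi>) \<le> c2 * norm \<xi>)"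

text \<open>The exceptional null sets in the ellipticity hypothesis depend on the two test vectors, so only
  countably many of them may be used.\<close>

lemma elliptic_countable:
  fixes c1 c2 :: real
  obtains S :: "((real^'n) \<times> (real^'n)) set" where "countable S"
    "\<And>m :: real^'n::finite^'n. (\<And>\<xi> \<zeta>. (\<xi>, \<zeta>) \<in> S \<Longrightarrow> c1 * (norm \<xi>)\<^sup>2 \<le> (m *v \<xi>) \<bullet> \<xi> \<and> (m *v \<xi>) \<bullet> \<zeta> \<le> c2 * norm \<xi> * norm \<zeta>) \<Longrightarrow> elliptic c1 c2 m"
proof -
  obtain S :: "((real^'n) \<times> (real^'n)) set" where S: "countable S" "\<And>X. open X \<Longrightarrow> X \<noteq> {} \<Longrightarrow> \<exists>d\<in>S. d \<in> X"
    using countable_dense_setE by blast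
  show ?thesis
  proof (rule that[OF S(1)])
    fix m :: "real^'n^'n"
    assume a: "\<And>\<xi> \<zeta>. (\<xi>, \<zeta>) \<in> S \<Longrightarrow> c1 * (norm \<xi>)\<^sup>2 \<le> (m *v \<xi>) \<bullet> \<xi> \<and> (m *v \<xi>) \<bullet> \<zeta> \<le> c2 * norm \<xi> * norm \<zeta>"
    let ?C = "{q. c1 * (norm (fst q))\<^sup>2 \<le> (m *v fst q) \<bullet> fst q} \<inter> {q. (m *v fst q) \<bullet> snd q \<le> c2 * norm (fst q) * norm (snd q)}"
    have "closed ?C"
      by (intro closed_Int closed_Collect_le continuous_intros continuous_on_matrix_vector_mult)
    then have "open (- ?C)" by (rule open_Compl)
    have "- ?C = {}"
    proof (rule ccontr)
      assume "- ?C \<noteq> {}"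
      then obtain q where "q \<in> S" "q \<in> - ?C" using S(2)[OF \<open>open (- ?C)\<close>] by blast
      then show False using a[of "fst q" "snd q"] by auto
    qed
    then have C: "q \<in> ?C" for q by blast
    show "elliptic c1 c2 m"
      unfolding elliptic_def
    proof (intro allI conjI)
      fix \<xi> :: "real^'n"
      show "c1 * (norm \<xi>)\<^sup>2 \<le> (m *v \<xi>) \<bullet> \<xi>" using C[of "(\<xi>, 0)"] by simp
      \<comment> \<open>Choosing \<open>m *v \<xi>\<close> as second vector turns the bilinear bound
        into a bound on the norm.\<close>
      have "norm (m *v \<xi>) * norm (m *v \<xi>) \<le> c2 * norm \<xi> * norm (m *v \<xi>)"
        using C[of "(\<xi>, m *v \<xi>)"] by (simp add: power2_norm_eq_inner[symmetric] power2_eq_square)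
      then show "norm (m *v \<xi>) \<le> c2 * norm \<xi>"
      proof (cases "norm (m *v \<xi>) = 0")
        case True
        have "c1 * (norm \<xi>)\<^sup>2 \<le> (m *v \<xi>) \<bullet> \<xi>" by fact
        show ?thesis
        proof (cases "\<xi> = 0")
          case False
          \<comment> \<open>The sign of \<open>c2\<close> is not prescribed here; the pair of \<xi>
            with itself shows that \<open>c2 * norm \<xi>\<close> is nonnegative.\<close>
          have "(m *v \<xi>) \<bullet> \<xi> \<le> c2 * norm \<xi> * norm \<xi>" using C[of "(\<xi>, \<xi>)"] by simp
          then have "0 \<le> c2 * norm \<xi> * norm \<xi>" using True by simp
          then show ?thesis using True False by (simp add: zero_le_mult_iff)
        qed simp
      next
        case False
        then have "norm (m *v \<xi>) > 0" by (simp only: norm_ge_zero less_le) simp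
        then show ?thesis using \<open>norm (m *v \<xi>) * norm (m *v \<xi>) \<le> _\<close> by (rule mult_right_le_imp_le[rotated])
      qed
    qed
  qed
qed

lemma AE_lebesgue_on_dense:
  assumes "open D" "x \<in> D" "AE x in lebesgue_on D. Q x" "r > 0"
  shows "\<exists>x'\<in>D. dist x' x < r \<and> Q x'"
proof (rule ccontr)
  assume n: "\<not> ?thesis"
  have D: "D \<in> sets lebesgue" by (rule open_sets_lebesgue[OF assms(1)])
  have "AE x in lborel. x \<in> D \<longrightarrow> Q x" using assms(3) by (simp add: AE_lebesgue_on_iff[OF D])
  then have "AE x in lebesgue. x \<in> D \<longrightarrow> Q x" by (rule AE_completion)
  then have "AE y in lebesgue. y \<notin> D \<inter> ball x r"
    by (rule eventually_mono) (use n in \<open>auto simp: dist_commute\<close>)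
  moreover have o: "open (D \<inter> ball x r)" using assms(1) by (intro open_Int open_ball)
  ultimately have "D \<inter> ball x r \<in> null_sets lebesgue"
    using open_sets_lebesgue[OF o] by (simp add: AE_iff_null_sets)
  then have "negligible (D \<inter> ball x r)" by (simp add: negligible_iff_null_sets)
  moreover have "D \<inter> ball x r \<noteq> {}" using assms(2,4) by auto
  ultimately show False using open_not_negligible[OF o] by blast
qed

locale homogenization = ergodic M T for M :: "'w measure" and T :: "real^'d::finite \<Rightarrow> 'w \<Rightarrow> 'w" +
  fixes D :: "(real^'d) set" and A :: "real^'d \<Rightarrow> 'w \<Rightarrow> real^'d^'d" and c1 c2 :: real
    and w :: "'d \<Rightarrow> real^'d \<Rightarrow> 'w \<Rightarrow> real^'d"
  assumes D: "open D" "bounded D" "D \<noteq> {}" and c1: "c1 > 0" and c2: "c2 > 0"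
    and adm: "admissible_coefficient D M c1 c2 A"
    and cell: "\<And>x i. x \<in> D \<Longrightarrow> cell_solution M T (A x) i (w i x)"
begin

lemma D_sets: "D \<in> sets lebesgue" by (rule open_sets_lebesgue[OF D(1)])

sublocale LD: finite_measure "lebesgue_on D"
  using D by (simp add: finite_measure_lebesgue_on lmeasurable_open)

sublocale DY: pair_sigma_finite "lebesgue_on D" "lborel :: (real^'d) measure" ..

sublocale DYM: pair_sigma_finite "lebesgue_on D \<Otimes>\<^sub>M (lborel :: (real^'d) measure)" M ..

sublocale DM: pair_sigma_finite "lebesgue_on D" M ..

lemma A_pair: "(\<lambda>(x, \<omega>). A x \<omega>) \<in> borel_measurable (borel \<Otimes>\<^sub>M M)"
  using adm by (simp add: admissible_coefficient_def)

lemma A_comp [measurable (raw)]: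
  assumes "f \<in> borel_measurable N" "g \<in> N \<rightarrow>\<^sub>M M"
  shows "(\<lambda>z. A (f z) (g z)) \<in> borel_measurable N"
proof -
  have "(\<lambda>z. (f z, g z)) \<in> N \<rightarrow>\<^sub>M borel \<Otimes>\<^sub>M M" using assms by measurable
  from measurable_compose[OF this A_pair] show ?thesis by simp
qed

lemma id_lebesgue_on [measurable]: "(\<lambda>x. x) \<in> borel_measurable (lebesgue_on D)"
  by (rule borel_measurable_lebesgue_on) simp

lemma A_symmetric: "\<omega> \<in> space M \<Longrightarrow> transpose (A x \<omega>) = A x \<omega>"
  using adm by (simp add: admissible_coefficient_def)

section \<open>Freezing the coefficient at finitely many points\<close>

definition near :: "real \<Rightarrow> real^'d \<Rightarrow> real^'d \<Rightarrow> 'w \<Rightarrow> bool" where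
  "near e x x' \<omega> \<longleftrightarrow> (\<forall>i j. \<bar>A x \<omega> $ i $ j - A x' \<omega> $ i $ j\<bar> \<le> e)"

definition K :: real where "K = (real CARD('d))\<^sup>2"

lemma K_pos: "K > 0" by (simp add: K_def)

lemma near_norm:
  assumes "near e x x' \<omega>"
  shows "norm (A x \<omega> *v \<xi> - A x' \<omega> *v \<xi>) \<le> K * e * norm \<xi>"
  using matrix_vector_mult_entry_bound[of "A x \<omega> - A x' \<omega>" e \<xi>] assms
  by (simp add: near_def K_def matrix_vector_mult_diff_rdistrib)

lemma coefficient_near:
  assumes x: "x \<in> closure D" and "e > 0"
  shows "\<exists>r>0. \<forall>x'\<in>closure D. dist x' x < r \<longrightarrow> (AE \<omega> in M. near e x' x \<omega>)"
proof -
  have "((\<lambda>x'. Linf_norm M (\<lambda>\<omega>. A x' \<omega> $ i $ j - A x \<omega> $ i $ j)) \<longlongrightarrow> 0) (at x within closure D)" for i j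
    using adm x by (simp add: admissible_coefficient_def continuous_Linf_def)
  then have "\<forall>\<^sub>F x' in at x within closure D. Linf_norm M (\<lambda>\<omega>. A x' \<omega> $ i $ j - A x \<omega> $ i $ j) < ereal e" for i j
    using \<open>e > 0\<close> by (intro order_tendstoD(2)) auto
  then have "\<forall>\<^sub>F x' in at x within closure D. \<forall>i j. Linf_norm M (\<lambda>\<omega>. A x' \<omega> $ i $ j - A x \<omega> $ i $ j) < ereal e"
    by (intro eventually_all_finite)
  then obtain r where r: "r > 0" "\<And>x'. x' \<in> closure D \<Longrightarrow> x' \<noteq> x \<Longrightarrow> dist x' x < r \<Longrightarrow>
      \<forall>i j. Linf_norm M (\<lambda>\<omega>. A x' \<omega> $ i $ j - A x \<omega> $ i $ j) < ereal e"
    unfolding eventually_at by blast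
  have "AE \<omega> in M. near e x' x \<omega>" if x': "x' \<in> closure D" "dist x' x < r" for x'
  proof (cases "x' = x")
    case False
    have "AE \<omega> in M. \<bar>A x' \<omega> $ i $ j - A x \<omega> $ i $ j\<bar> \<le> e" for i j
    proof -
      have "AE \<omega> in M. ereal \<bar>A x' \<omega> $ i $ j - A x \<omega> $ i $ j\<bar> \<le> Linf_norm M (\<lambda>\<omega>. A x' \<omega> $ i $ j - A x \<omega> $ i $ j)"
        unfolding Linf_norm_def by (rule esssup_AE)
      then show ?thesis
      proof (rule eventually_mono)
        fix \<omega> assume "ereal \<bar>A x' \<omega> $ i $ j - A x \<omega> $ i $ j\<bar> \<le> Linf_norm M (\<lambda>\<omega>. A x' \<omega> $ i $ j - A x \<omega> $ i $ j)"
        also have "\<dots> < ereal e" using r(2)[OF x'(1) False x'(2)] by blast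
        finally show "\<bar>A x' \<omega> $ i $ j - A x \<omega> $ i $ j\<bar> \<le> e" by simp
      qed
    qed
    then have "AE \<omega> in M. \<forall>i\<in>UNIV. \<forall>j\<in>UNIV. \<bar>A x' \<omega> $ i $ j - A x \<omega> $ i $ j\<bar> \<le> e"
      by (intro AE_finite_allI) auto
    then show ?thesis by (simp add: near_def)
  qed (use \<open>e > 0\<close> in \<open>simp add: near_def\<close>)
  then show ?thesis using r(1) by blast
qed

lemma near_trans: "near e x y \<omega> \<Longrightarrow> near e' y z \<omega> \<Longrightarrow> near (e + e') x z \<omega>"
proof -
  assume a: "near e x y \<omega>" "near e' y z \<omega>"
  have "\<bar>A x \<omega> $ i $ j - A z \<omega> $ i $ j\<bar> \<le> e + e'" for i j
  proof -
    have "\<bar>A x \<omega> $ i $ j - A y \<omega> $ i $ j\<bar> \<le> e" "\<bar>A y \<omega> $ i $ j - A z \<omega> $ i $ j\<bar> \<le> e'"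
      using a by (auto simp: near_def)
    then show ?thesis by linarith
  qed
  then show ?thesis by (simp add: near_def)
qed

lemma near_sym: "near e x y \<omega> \<Longrightarrow> near e y x \<omega>"
  unfolding near_def by (simp add: abs_minus_commute)

text \<open>Compactness of the closure of \<open>D\<close> gives finitely many balls. Their centres
  may lie on the boundary, where no cell problem is posed, so each is replaced by a point of
  \<open>D\<close> in the same ball, which costs the second half of the tolerance.\<close>

lemma coefficient_partition:
  assumes "e > 0"
  obtains \<kappa> where "simple_function (lebesgue_on D) \<kappa>" "\<And>x. x \<in> D \<Longrightarrow> \<kappa> x \<in> D"
    "\<And>x. x \<in> D \<Longrightarrow> AE \<omega> in M. near e x (\<kappa> x) \<omega>"
proof -
  have "\<forall>p. \<exists>r. p \<in> closure D \<longrightarrow> r > 0 \<and> (\<forall>x'\<in>closure D. dist x' p < r \<longrightarrow> (AE \<omega> in M. near (e/2) x' p \<omega>))"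
    using coefficient_near[of _ "e/2"] assms by (metis half_gt_zero)
  from choice[OF this] obtain r where r: "\<And>p. p \<in> closure D \<Longrightarrow> r p > 0"
    "\<And>p x'. p \<in> closure D \<Longrightarrow> x' \<in> closure D \<Longrightarrow> dist x' p < r p \<Longrightarrow> AE \<omega> in M. near (e/2) x' p \<omega>" by blast
  have "compact (closure D)" using D(2) by (simp add: compact_closure)
  moreover have "closure D \<subseteq> (\<Union>p\<in>closure D. ball p (r p))" using r(1) by force
  ultimately obtain P where P: "P \<subseteq> closure D" "finite P" "closure D \<subseteq> (\<Union>p\<in>P. ball p (r p))"
    using compactE_image[of "closure D" "closure D" "\<lambda>p. ball p (r p)"] by (metis open_ball)
  obtain x0 where x0: "x0 \<in> D" using D(3) by blast
  have q: "\<exists>q\<in>D. dist q p < r p" if "p \<in> closure D" for p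
    using that r(1)[OF that] closure_approachable by blast
  have "\<exists>\<kappa>. simple_function (lebesgue_on D) \<kappa> \<and> (\<forall>x\<in>D. \<kappa> x \<in> D) \<and>
     (\<forall>x\<in>D. x \<in> (\<Union>p\<in>P. ball p (r p)) \<longrightarrow> (AE \<omega> in M. near e x (\<kappa> x) \<omega>))"
    using P(2,1)
  proof (induction P rule: finite_induct)
    case empty
    then show ?case using x0 by (intro exI[of _ "\<lambda>x. x0"]) auto
  next
    case (insert p P)
    then obtain \<kappa> where \<kappa>: "simple_function (lebesgue_on D) \<kappa>" "\<forall>x\<in>D. \<kappa> x \<in> D"
      "\<forall>x\<in>D. x \<in> (\<Union>p\<in>P. ball p (r p)) \<longrightarrow> (AE \<omega> in M. near e x (\<kappa> x) \<omega>)" by auto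
    have p: "p \<in> closure D" using insert by simp
    obtain q where q: "q \<in> D" "dist q p < r p" using q[OF p] by blast
    show ?case
    proof (intro exI[of _ "\<lambda>x. if x \<in> ball p (r p) then q else \<kappa> x"] conjI ballI impI)
      have "ball p (r p) \<inter> space (lebesgue_on D) \<in> sets (lebesgue_on D)"
      proof -
        have "ball p (r p) \<in> sets lebesgue" by (rule open_sets_lebesgue) simp
        then show ?thesis using D_sets by (auto simp: sets_restrict_space space_restrict_space)
      qed
      then show "simple_function (lebesgue_on D) (\<lambda>x. if x \<in> ball p (r p) then q else \<kappa> x)"
        by (intro simple_function_If_set \<kappa>(1) simple_function_const)
      fix x assume x: "x \<in> D"
      then show "(if x \<in> ball p (r p) then q else \<kappa> x) \<in> D" using q(1) \<kappa>(2) by auto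
      assume xP: "x \<in> (\<Union>p\<in>insert p P. ball p (r p))"
      show "AE \<omega> in M. near e x (if x \<in> ball p (r p) then q else \<kappa> x) \<omega>"
      proof (cases "x \<in> ball p (r p)")
        case True
        have "AE \<omega> in M. near (e/2) x p \<omega>" using True x closure_subset[of D] by (intro r(2)[OF p]) (auto simp: dist_commute)
        moreover have "AE \<omega> in M. near (e/2) q p \<omega>" using q closure_subset[of D] by (intro r(2)[OF p]) auto
        ultimately have "AE \<omega> in M. near (e/2 + e/2) x q \<omega>"
          by eventually_elim (blast intro: near_trans near_sym)
        then show ?thesis using True by simp
      next
        case False
        then show ?thesis using xP x \<kappa>(3) by auto
      qed
    qed
  qed
  then obtain \<kappa> where \<kappa>: "simple_function (lebesgue_on D) \<kappa>" "\<forall>x\<in>D. \<kappa> x \<in> D"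
     "\<forall>x\<in>D. x \<in> (\<Union>p\<in>P. ball p (r p)) \<longrightarrow> (AE \<omega> in M. near e x (\<kappa> x) \<omega>)" by blast
  have "x \<in> (\<Union>p\<in>P. ball p (r p))" if "x \<in> D" for x using that P(3) closure_subset[of D] by blast
  then show ?thesis using that[of \<kappa>] \<kappa> by blast
qed

lemma A_elliptic:
  assumes x: "x \<in> D"
  shows "AE \<omega> in M. elliptic c1 c2 (A x \<omega>)"
proof -
  obtain S :: "((real^'d) \<times> (real^'d)) set" where S: "countable S"
    "\<And>m :: real^'d^'d. (\<And>\<xi> \<zeta>. (\<xi>, \<zeta>) \<in> S \<Longrightarrow> c1 * (norm \<xi>)\<^sup>2 \<le> (m *v \<xi>) \<bullet> \<xi> \<and> (m *v \<xi>) \<bullet> \<zeta> \<le> c2 * norm \<xi> * norm \<zeta>) \<Longrightarrow> elliptic c1 c2 m"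
    using elliptic_countable by blast
  have "AE \<omega> in M. c1 * (norm \<xi>)\<^sup>2 \<le> (A x \<omega> *v \<xi>) \<bullet> \<xi> \<and> (A x \<omega> *v \<xi>) \<bullet> \<zeta> \<le> c2 * norm \<xi> * norm \<zeta>" for \<xi> \<zeta>
  proof -
    have "AE q in lebesgue_on D \<Otimes>\<^sub>M M. c1 * (norm \<xi>)\<^sup>2 \<le> (A (fst q) (snd q) *v \<xi>) \<bullet> \<xi> \<and> (A (fst q) (snd q) *v \<xi>) \<bullet> \<zeta> \<le> c2 * norm \<xi> * norm \<zeta>"
      using adm by (simp add: admissible_coefficient_def case_prod_beta)
    from DM.AE_pair[OF this]
    have ae: "AE x in lebesgue_on D. AE \<omega> in M. c1 * (norm \<xi>)\<^sup>2 \<le> (A x \<omega> *v \<xi>) \<bullet> \<xi> \<and> (A x \<omega> *v \<xi>) \<bullet> \<zeta> \<le> c2 * norm \<xi> * norm \<zeta>"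
      by simp
    have "AE \<omega> in M. c1 * (norm \<xi>)\<^sup>2 \<le> (A x \<omega> *v \<xi>) \<bullet> \<xi> + K * inverse (real (Suc n)) * norm \<xi> * norm \<xi> \<and>
       (A x \<omega> *v \<xi>) \<bullet> \<zeta> \<le> c2 * norm \<xi> * norm \<zeta> + K * inverse (real (Suc n)) * norm \<xi> * norm \<zeta>" for n
    proof -
      have xc: "x \<in> closure D" using x closure_subset by blast
      obtain r where r: "r > 0" "\<forall>x'\<in>closure D. dist x' x < r \<longrightarrow> (AE \<omega> in M. near (inverse (real (Suc n))) x' x \<omega>)"
        using coefficient_near[OF xc, of "inverse (real (Suc n))"] by auto
      obtain x' where x': "x' \<in> D" "dist x' x < r"
        "AE \<omega> in M. c1 * (norm \<xi>)\<^sup>2 \<le> (A x' \<omega> *v \<xi>) \<bullet> \<xi> \<and> (A x' \<omega> *v \<xi>) \<bullet> \<zeta> \<le> c2 * norm \<xi> * norm \<zeta>"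
        using AE_lebesgue_on_dense[OF D(1) x ae r(1)] by blast
      have "AE \<omega> in M. near (inverse (real (Suc n))) x' x \<omega>" using r(2) x'(1,2) closure_subset[of D] by blast
      then show ?thesis using x'(3)
      proof eventually_elim
        case (elim \<omega>)
        have b: "\<bar>(A x' \<omega> *v \<xi> - A x \<omega> *v \<xi>) \<bullet> \<zeta>'\<bar> \<le> K * inverse (real (Suc n)) * norm \<xi> * norm \<zeta>'" for \<zeta>'
          by (rule order_trans[OF Cauchy_Schwarz_ineq2 mult_right_mono[OF near_norm[OF elim(1)]]]) simp
        show ?case using elim(2) b[of \<xi>] b[of \<zeta>] unfolding inner_diff_left by (auto simp only: abs_le_iff)
      qed
    qed
    then have "AE \<omega> in M. \<forall>n. c1 * (norm \<xi>)\<^sup>2 \<le> (A x \<omega> *v \<xi>) \<bullet> \<xi> + K * inverse (real (Suc n)) * norm \<xi> * norm \<xi> \<and>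
       (A x \<omega> *v \<xi>) \<bullet> \<zeta> \<le> c2 * norm \<xi> * norm \<zeta> + K * inverse (real (Suc n)) * norm \<xi> * norm \<zeta>"
      by (subst AE_all_countable) blast
    then show ?thesis
    proof (rule eventually_mono)
      fix \<omega> assume a: "\<forall>n. c1 * (norm \<xi>)\<^sup>2 \<le> (A x \<omega> *v \<xi>) \<bullet> \<xi> + K * inverse (real (Suc n)) * norm \<xi> * norm \<xi> \<and>
       (A x \<omega> *v \<xi>) \<bullet> \<zeta> \<le> c2 * norm \<xi> * norm \<zeta> + K * inverse (real (Suc n)) * norm \<xi> * norm \<zeta>"
      have l: "(\<lambda>n. y + K * inverse (real (Suc n)) * norm \<xi> * z) \<longlonglongrightarrow> y + K * 0 * norm \<xi> * z" for y z
        by (intro tendsto_intros LIMSEQ_inverse_real_of_nat)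
      have "c1 * (norm \<xi>)\<^sup>2 \<le> (A x \<omega> *v \<xi>) \<bullet> \<xi> + K * 0 * norm \<xi> * norm \<xi>"
        by (rule LIMSEQ_le_const[OF l]) (use a in blast)
      moreover have "(A x \<omega> *v \<xi>) \<bullet> \<zeta> \<le> c2 * norm \<xi> * norm \<zeta> + K * 0 * norm \<xi> * norm \<zeta>"
        by (rule LIMSEQ_le_const[OF l]) (use a in blast)
      ultimately show "c1 * (norm \<xi>)\<^sup>2 \<le> (A x \<omega> *v \<xi>) \<bullet> \<xi> \<and> (A x \<omega> *v \<xi>) \<bullet> \<zeta> \<le> c2 * norm \<xi> * norm \<zeta>" by simp
    qed
  qed
  then have "AE \<omega> in M. \<forall>q\<in>S. c1 * (norm (fst q))\<^sup>2 \<le> (A x \<omega> *v fst q) \<bullet> fst q \<and> (A x \<omega> *v fst q) \<bullet> snd q \<le> c2 * norm (fst q) * norm (snd q)"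
    by (subst AE_ball_countable[OF S(1)]) blast
  then show ?thesis
    by (rule eventually_mono) (rule S(2), force)
qed

text \<open>For each pair of \<open>x\<close> and \<open>y\<close> the property holds almost surely
  by invariance; the joint measurability in \<open>m\<close> permits exchanging the quantifiers over
  the pair and over \<omega>.\<close>

lemma AE_orbit_joint:
  fixes Q :: "real^'d \<Rightarrow> 'w \<Rightarrow> bool"
  assumes m: "{z \<in> space ((lebesgue_on D \<Otimes>\<^sub>M (lborel :: (real^'d) measure)) \<Otimes>\<^sub>M M). Q (fst (fst z)) (T (snd (fst z)) (snd z))} \<in> sets ((lebesgue_on D \<Otimes>\<^sub>M (lborel :: (real^'d) measure)) \<Otimes>\<^sub>M M)"
    and Q: "\<And>x. x \<in> D \<Longrightarrow> AE \<omega> in M. Q x \<omega>"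
  shows "AE \<omega> in M. AE x in lebesgue_on D. AE y in (lborel :: (real^'d) measure). Q x (T y \<omega>)"
proof -
  have "AE z in lebesgue_on D \<Otimes>\<^sub>M (lborel :: (real^'d) measure). AE \<omega> in M. Q (fst z) (T (snd z) \<omega>)"
  proof (rule AE_I2)
    fix z assume "z \<in> space (lebesgue_on D \<Otimes>\<^sub>M (lborel :: (real^'d) measure))"
    then have "fst z \<in> D" by (auto simp: space_pair_measure)
    from AE_shift[OF Q[OF this]] show "AE \<omega> in M. Q (fst z) (T (snd z) \<omega>)" .
  qed
  then have "AE \<omega> in M. AE z in lebesgue_on D \<Otimes>\<^sub>M (lborel :: (real^'d) measure). Q (fst z) (T (snd z) \<omega>)"
    by (subst (asm) DYM.AE_commute[OF m])
  then show ?thesis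
    by (rule eventually_mono) (drule DY.AE_pair, simp)
qed

text \<open>The exchange of quantifiers is made for each of countably many pairs of vectors
  separately, where measurability is plain, and only then is \<open>elliptic\<close>
  assembled.\<close>

lemma A_elliptic_orbit:
  "AE \<omega> in M. AE x in lebesgue_on D. AE y in (lborel :: (real^'d) measure). elliptic c1 c2 (A x (T y \<omega>))"
proof -
  obtain S :: "((real^'d) \<times> (real^'d)) set" where S: "countable S"
    "\<And>m :: real^'d^'d. (\<And>\<xi> \<zeta>. (\<xi>, \<zeta>) \<in> S \<Longrightarrow> c1 * (norm \<xi>)\<^sup>2 \<le> (m *v \<xi>) \<bullet> \<xi> \<and> (m *v \<xi>) \<bullet> \<zeta> \<le> c2 * norm \<xi> * norm \<zeta>) \<Longrightarrow> elliptic c1 c2 m"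
    using elliptic_countable by blast
  let ?Q = "\<lambda>q x \<omega>. c1 * (norm (fst q))\<^sup>2 \<le> (A x \<omega> *v fst q) \<bullet> fst q \<and> (A x \<omega> *v fst q) \<bullet> snd q \<le> c2 * norm (fst q) * norm (snd q)"
  have "AE \<omega> in M. AE x in lebesgue_on D. AE y in (lborel :: (real^'d) measure). ?Q q x (T y \<omega>)" for q
  proof (rule AE_orbit_joint)
    show "AE \<omega> in M. ?Q q x \<omega>" if "x \<in> D" for x
      using A_elliptic[OF that]
    proof (rule eventually_mono)
      fix \<omega> assume e: "elliptic c1 c2 (A x \<omega>)"
      have "(A x \<omega> *v fst q) \<bullet> snd q \<le> norm (A x \<omega> *v fst q) * norm (snd q)" by (rule norm_cauchy_schwarz)
      also have "\<dots> \<le> c2 * norm (fst q) * norm (snd q)" using e by (intro mult_right_mono) (auto simp: elliptic_def)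
      finally show "?Q q x \<omega>" using e by (simp add: elliptic_def)
    qed
  qed measurable
  then have "AE \<omega> in M. \<forall>q\<in>S. AE x in lebesgue_on D. AE y in (lborel :: (real^'d) measure). ?Q q x (T y \<omega>)"
    by (subst AE_ball_countable[OF S(1)]) blast
  then show ?thesis
  proof (rule eventually_mono)
    fix \<omega> assume "\<forall>q\<in>S. AE x in lebesgue_on D. AE y in (lborel :: (real^'d) measure). ?Q q x (T y \<omega>)"
    then have "AE x in lebesgue_on D. \<forall>q\<in>S. AE y in (lborel :: (real^'d) measure). ?Q q x (T y \<omega>)"
      by (subst AE_ball_countable[OF S(1)])
    then show "AE x in lebesgue_on D. AE y in (lborel :: (real^'d) measure). elliptic c1 c2 (A x (T y \<omega>))"
    proof (rule eventually_mono)
      fix x assume "\<forall>q\<in>S. AE y in (lborel :: (real^'d) measure). ?Q q x (T y \<omega>)"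
      then have "AE y in (lborel :: (real^'d) measure). \<forall>q\<in>S. ?Q q x (T y \<omega>)"
        by (subst AE_ball_countable[OF S(1)])
      then show "AE y in (lborel :: (real^'d) measure). elliptic c1 c2 (A x (T y \<omega>))"
        by (rule eventually_mono) (rule S(2), force)
    qed
  qed
qed

lemma near_orbit:
  assumes \<kappa>: "simple_function (lebesgue_on D) \<kappa>" and n: "\<And>x. x \<in> D \<Longrightarrow> AE \<omega> in M. near e x (\<kappa> x) \<omega>"
  shows "AE \<omega> in M. AE x in lebesgue_on D. AE y in (lborel :: (real^'d) measure). near e x (\<kappa> x) (T y \<omega>)"
proof (rule AE_orbit_joint[OF _ n])
  have [measurable]: "\<kappa> \<in> borel_measurable (lebesgue_on D)" by (rule borel_measurable_simple_function[OF \<kappa>])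
  show "{z \<in> space ((lebesgue_on D \<Otimes>\<^sub>M (lborel :: (real^'d) measure)) \<Otimes>\<^sub>M M). near e (fst (fst z)) (\<kappa> (fst (fst z))) (T (snd (fst z)) (snd z))}
      \<in> sets ((lebesgue_on D \<Otimes>\<^sub>M (lborel :: (real^'d) measure)) \<Otimes>\<^sub>M M)"
    unfolding near_def by measurable
qed

subsection \<open>The homogenized coefficient\<close>

definition V :: "'d \<Rightarrow> real^'d \<Rightarrow> 'w \<Rightarrow> real^'d" where "V j x \<omega> = w j x \<omega> + axis j 1"

definition flux :: "'d \<Rightarrow> real^'d \<Rightarrow> 'w \<Rightarrow> real^'d" where "flux j x \<omega> = A x \<omega> *v V j x \<omega>"

abbreviation A0 :: "real^'d \<Rightarrow> real^'d^'d" where "A0 \<equiv> homogenized_coefficient M A w"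

lemma w_pot: "x \<in> D \<Longrightarrow> w j x \<in> L2_pot M T"
  using cell[of x j] by (simp add: cell_solution_def)

lemma flux_sol: "x \<in> D \<Longrightarrow> flux j x \<in> L2_sol M T"
  using cell[of x j] by (simp add: cell_solution_def flux_def[abs_def] V_def)

lemma w_L2: "x \<in> D \<Longrightarrow> w j x \<in> L2 M"
  using w_pot[of x j] by (simp add: L2_pot_def L2_closure_def)

lemma flux_L2: "x \<in> D \<Longrightarrow> flux j x \<in> L2 M"
  using flux_sol[of x j] by (simp add: L2_sol_def L2_closure_def)

lemma V_L2: "x \<in> D \<Longrightarrow> V j x \<in> L2 M"
  unfolding V_def[abs_def] by (intro L2_add w_L2 L2_const)

lemma A0_eq:
  assumes "x \<in> D"
  shows "A0 x $ i $ j = (LINT \<omega>|M. flux j x \<omega> $ i)"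
  by (simp add: homogenized_coefficient_def flux_def V_def matrix_vector_mult_def axis_def)

text \<open>The flux is solenoidal and \<open>w i x'\<close> is potential, hence they are
  orthogonal. That \<open>x'\<close> may differ from \<open>x\<close> is what \<open>A0_near\<close>
  relies on.\<close>

lemma A0_eq_form:
  assumes "x \<in> D" "x' \<in> D"
  shows "A0 x $ i $ j = (LINT \<omega>|M. flux j x \<omega> \<bullet> V i x' \<omega>)"
proof -
  have "(LINT \<omega>|M. flux j x \<omega> \<bullet> V i x' \<omega>) = (LINT \<omega>|M. flux j x \<omega> \<bullet> w i x' \<omega>) + (LINT \<omega>|M. flux j x \<omega> \<bullet> axis i 1)"
    unfolding V_def inner_add_right
    by (rule Bochner_Integration.integral_add)
      (intro L2_integrable_inner flux_L2 w_L2 assms L2_const)+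
  then show ?thesis using L2_sol_pot_orthogonal[OF flux_sol[OF assms(1)] w_pot[OF assms(2)]]
    by (simp add: A0_eq[OF assms(1)] inner_axis)
qed

text \<open>Energy estimate: \<open>c1\<close> times the squared norm is at most the expected
  energy, which by orthogonality equals the mean of one flux component and is therefore at most
  \<open>c2\<close> times the norm.\<close>

lemma V_norm:
  assumes x: "x \<in> D"
  shows "L2norm M (V j x) \<le> c2 / c1"
proof -
  let ?n = "L2norm M (V j x)"
  have e: "AE \<omega> in M. elliptic c1 c2 (A x \<omega>)" by (rule A_elliptic[OF x])
  have fn: "L2norm M (flux j x) \<le> c2 * ?n"
    by (rule L2norm_mono[OF V_L2[OF x] L2D(1)[OF flux_L2[OF x]]])
      (use e c2 in \<open>auto simp: flux_def elliptic_def elim: eventually_mono\<close>)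
  have "c1 * ?n\<^sup>2 = (LINT \<omega>|M. c1 * (norm (V j x \<omega>))\<^sup>2)" by (simp add: L2norm_sq)
  also have "\<dots> \<le> (LINT \<omega>|M. flux j x \<omega> \<bullet> V j x \<omega>)"
  proof (rule integral_mono_AE)
    show "AE \<omega> in M. c1 * (norm (V j x \<omega>))\<^sup>2 \<le> flux j x \<omega> \<bullet> V j x \<omega>"
      using e by (rule eventually_mono) (simp add: flux_def elliptic_def)
  qed (use L2D(2)[OF V_L2[OF x, of j]] L2_integrable_inner[OF flux_L2[OF x, of j] V_L2[OF x, of j]] in auto)
  also have "\<dots> = (LINT \<omega>|M. flux j x \<omega> \<bullet> axis j 1)"
    using A0_eq_form[OF x x, of j j] A0_eq[OF x, of j j] by (simp add: inner_axis)
  also have "\<dots> \<le> L2norm M (flux j x) * L2norm M (\<lambda>\<omega>. axis j 1 :: real^'d)"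
    using L2_Cauchy_Schwarz[OF flux_L2[OF x, of j] L2_const[of "axis j 1"]] by linarith
  also have "L2norm M (\<lambda>\<omega>. axis j 1 :: real^'d) = 1" by (simp add: L2norm_def norm_axis_1 prob_space)
  finally have "c1 * ?n\<^sup>2 \<le> c2 * ?n" using fn by simp
  then have m: "?n * (c1 * ?n) \<le> ?n * c2" by (simp add: power2_eq_square mult_ac)
  show ?thesis
  proof (cases "?n = 0")
    case False
    then have "?n > 0" using L2norm_nonneg[of M "V j x"] by linarith
    from mult_left_le_imp_le[OF m this] c1 show ?thesis by (simp add: pos_le_divide_eq mult.commute)
  qed (use c1 c2 in simp)
qed

text \<open>By symmetry of \<open>A\<close>, the entry of \<open>A0 x'\<close> can be written with
  the fields \<open>V j x\<close> and \<open>V i x'\<close>, the same pair as for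
  \<open>A0 x\<close>. The difference then contains only the difference of \<open>A x\<close> and
  \<open>A x'\<close>, and the cell solutions at the two points need not be compared.\<close>

lemma A0_near:
  assumes x: "x \<in> D" "x' \<in> D" and n: "AE \<omega> in M. near e x x' \<omega>" and "e \<ge> 0"
  shows "\<bar>A0 x $ i $ j - A0 x' $ i $ j\<bar> \<le> K * e * (c2 / c1)\<^sup>2"
proof -
  have sym: "(LINT \<omega>|M. flux i x' \<omega> \<bullet> V j z \<omega>) = (LINT \<omega>|M. (A x' \<omega> *v V j z \<omega>) \<bullet> V i x' \<omega>)" for z i j
  proof (rule Bochner_Integration.integral_cong[OF refl])
    fix \<omega> assume "\<omega> \<in> space M"
    then show "flux i x' \<omega> \<bullet> V j z \<omega> = (A x' \<omega> *v V j z \<omega>) \<bullet> V i x' \<omega>"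
      unfolding flux_def by (intro symmetric_matrix_inner A_symmetric)
  qed
  have "A0 x' $ i $ j = (LINT \<omega>|M. flux j x' \<omega> \<bullet> V i x' \<omega>)" by (rule A0_eq_form[OF x(2) x(2)])
  also have "\<dots> = (LINT \<omega>|M. flux i x' \<omega> \<bullet> V j x' \<omega>)" using sym[of i j x'] by (simp add: flux_def)
  also have "\<dots> = A0 x' $ j $ i" by (rule A0_eq_form[OF x(2) x(2), symmetric])
  also have "\<dots> = (LINT \<omega>|M. flux i x' \<omega> \<bullet> V j x \<omega>)" by (rule A0_eq_form[OF x(2) x(1)])
  also have "\<dots> = (LINT \<omega>|M. (A x' \<omega> *v V j x \<omega>) \<bullet> V i x' \<omega>)" by (rule sym)
  finally have 1: "A0 x' $ i $ j = (LINT \<omega>|M. (A x' \<omega> *v V j x \<omega>) \<bullet> V i x' \<omega>)" .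
  have [measurable]: "V j x \<in> borel_measurable M" using L2D(1)[OF V_L2[OF x(1)]] .
  have m': "(\<lambda>\<omega>. A x' \<omega> *v V j x \<omega>) \<in> borel_measurable M" by measurable
  have L': "(\<lambda>\<omega>. A x' \<omega> *v V j x \<omega>) \<in> L2 M"
    by (rule L2_dominated[OF V_L2[OF x(1)] m', where C=c2])
      (use A_elliptic[OF x(2)] in \<open>auto simp: elliptic_def elim: eventually_mono\<close>)
  have Ld: "(\<lambda>\<omega>. flux j x \<omega> - A x' \<omega> *v V j x \<omega>) \<in> L2 M" by (rule L2_diff[OF flux_L2[OF x(1)] L'])
  have "A0 x $ i $ j - A0 x' $ i $ j = (LINT \<omega>|M. (flux j x \<omega> - A x' \<omega> *v V j x \<omega>) \<bullet> V i x' \<omega>)"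
    unfolding 1 A0_eq_form[OF x(1,2)] inner_diff_left
    by (rule Bochner_Integration.integral_diff[symmetric]) (intro L2_integrable_inner flux_L2 V_L2 L' x)+
  moreover have "\<bar>LINT \<omega>|M. (flux j x \<omega> - A x' \<omega> *v V j x \<omega>) \<bullet> V i x' \<omega>\<bar> \<le> (K * e * (c2 / c1)) * (c2 / c1)"
  proof (rule L2_Cauchy_Schwarz_le[OF Ld V_L2[OF x(2)] _ V_norm[OF x(2)]])
    have "L2norm M (\<lambda>\<omega>. flux j x \<omega> - A x' \<omega> *v V j x \<omega>) \<le> K * e * L2norm M (V j x)"
      by (rule L2norm_mono[OF V_L2[OF x(1)] L2D(1)[OF Ld]])
        (use n K_pos \<open>e \<ge> 0\<close> in \<open>auto simp: flux_def intro: near_norm elim!: eventually_mono\<close>)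
    also have "\<dots> \<le> K * e * (c2 / c1)" using V_norm[OF x(1)] K_pos \<open>e \<ge> 0\<close> by (intro mult_left_mono) auto
    finally show "L2norm M (\<lambda>\<omega>. flux j x \<omega> - A x' \<omega> *v V j x \<omega>) \<le> K * e * (c2 / c1)" .
  qed
  ultimately show ?thesis by (simp add: power2_eq_square mult_ac)
qed

text \<open>Nothing is known about how \<open>w j x\<close> depends on \<open>x\<close>;
  measurability comes from continuity of the entries, through \<open>A0_near\<close>.\<close>

lemma A0_measurable: "A0 \<in> borel_measurable (lebesgue_on D)"
proof -
  have "continuous_on D (\<lambda>x. A0 x $ i $ j)" for i j
    unfolding continuous_on_iff
  proof (intro ballI allI impI)
    fix x and e :: real assume x: "x \<in> D" and "e > 0"
    define P where "P = K * (c2 / c1)\<^sup>2"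
    define e' where "e' = e / (2 * P)"
    have p: "P > 0" using K_pos c1 c2 by (simp add: P_def)
    then have "e' > 0" "P * e' < e" using \<open>e > 0\<close> by (auto simp: e'_def)
    then have e': "e' > 0" "K * e' * (c2 / c1)\<^sup>2 < e" by (auto simp: P_def mult_ac)
    have "x \<in> closure D" using x closure_subset by blast
    then obtain r where r: "r > 0" "\<forall>x'\<in>closure D. dist x' x < r \<longrightarrow> (AE \<omega> in M. near e' x' x \<omega>)"
      using coefficient_near e'(1) by blast
    show "\<exists>d>0. \<forall>x'\<in>D. dist x' x < d \<longrightarrow> dist (A0 x' $ i $ j) (A0 x $ i $ j) < e"
    proof (intro exI[of _ r] conjI ballI impI r(1))
      fix x' assume x': "x' \<in> D" "dist x' x < r"
      then have "AE \<omega> in M. near e' x' x \<omega>" using r(2) closure_subset[of D] by blast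
      from A0_near[OF x'(1) x this, of i j] show "dist (A0 x' $ i $ j) (A0 x $ i $ j) < e"
        using e' by (simp add: dist_real_def)
    qed
  qed
  then have "continuous_on D (\<lambda>x. \<chi> i. \<chi> j. A0 x $ i $ j)" by (intro continuous_on_vec_lambda)
  then have "continuous_on D A0"
    by simp
  then show ?thesis by (rule continuous_imp_measurable_on_sets_lebesgue) (rule D_sets)
qed

end

subsection \<open>Strongly measurable Sobolev functions\<close>

lemma lebesgue_on_measurable_cong_AE:
  fixes f g :: "'a::euclidean_space \<Rightarrow> real"
  assumes S: "S \<in> sets lebesgue" and f: "f \<in> borel_measurable (lebesgue_on S)" and e: "AE x in lebesgue_on S. f x = g x"
  shows "g \<in> borel_measurable (lebesgue_on S)"
proof -
  have 1: "(\<lambda>x. if x \<in> S then f x else 0) \<in> borel_measurable lebesgue"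
    using f by (subst borel_measurable_if[OF S])
  have "AE x in lebesgue. x \<in> S \<longrightarrow> f x = g x"
    using e S by (subst (asm) AE_restrict_space_iff) auto
  then have "AE x in lebesgue. (if x \<in> S then f x else 0) = (if x \<in> S then g x else 0)"
    by (rule eventually_mono) auto
  from borel_measurable_AE[OF 1 this] show ?thesis by (subst (asm) borel_measurable_if[OF S])
qed

text \<open>Completeness of Lebesgue measure allows limits almost everywhere without altering the
  functions on a null set.\<close>

lemma lebesgue_on_measurable_LIMSEQ_AE:
  fixes f :: "nat \<Rightarrow> 'a::euclidean_space \<Rightarrow> real"
  assumes S: "S \<in> sets lebesgue" and f: "\<And>n. f n \<in> borel_measurable (lebesgue_on S)"
    and e: "AE x in lebesgue_on S. (\<lambda>n. f n x) \<longlonglongrightarrow> g x"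
  shows "g \<in> borel_measurable (lebesgue_on S)"
proof (rule lebesgue_on_measurable_cong_AE[OF S])
  show "(\<lambda>x. lim (\<lambda>n. f n x)) \<in> borel_measurable (lebesgue_on S)"
    by (rule borel_measurable_lim_metric) (rule f)
  show "AE x in lebesgue_on S. lim (\<lambda>n. f n x) = g x"
    using e by (rule eventually_mono) (rule limI)
qed

lemma V_norm_diff:
  assumes "u \<in> H10 Y" "v \<in> H10 Y" "open Y"
  shows "V_norm Y (\<lambda>y. u y - v y) = L2norm (lebesgue_on Y) (\<lambda>y. wgrad Y u y - wgrad Y v y)"
  using assms by (intro V_norm_eq has_weak_gradient_diff H10_has_weak_gradient)

lemma V_norm_abs_diff_le:
  assumes "u \<in> H10 Y" "v \<in> H10 Y" "open Y"
  shows "\<bar>V_norm Y u - V_norm Y v\<bar> \<le> V_norm Y (\<lambda>y. u y - v y)"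
proof -
  have 0: "(\<lambda>_. 0) \<in> L2 (lebesgue_on Y)" by simp
  note L = H10_wgrad_L2[OF assms(1)] H10_wgrad_L2[OF assms(2)]
  have "V_norm Y u \<le> V_norm Y (\<lambda>y. u y - v y) + V_norm Y v"
    using L2norm_triangle3[OF L 0] assms by (simp add: V_norm_diff) (simp add: V_norm_def)
  moreover have "V_norm Y v \<le> V_norm Y (\<lambda>y. u y - v y) + V_norm Y u"
    using L2norm_triangle3[OF L(2,1) 0] assms L2norm_diff_commute[of "lebesgue_on Y" "wgrad Y u" "wgrad Y v"]
    by (simp add: V_norm_diff) (simp add: V_norm_def)
  ultimately show ?thesis by linarith
qed

text \<open>The norm of \<open>u x\<close> is an almost everywhere limit of finitely valued
  functions, hence measurable, so a majorant \<open>b\<close> gives integrability of its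
  square.\<close>

lemma L2_H10I:
  fixes u :: "real^'d::finite \<Rightarrow> real^'d \<Rightarrow> real"
  assumes D: "D \<in> sets lebesgue" and Y: "open Y" and u: "\<And>x. x \<in> D \<Longrightarrow> u x \<in> H10 Y"
    and s: "\<And>n. simple_function (lebesgue_on D) (s n)" "\<And>n x. x \<in> D \<Longrightarrow> s n x \<in> H10 Y"
    and l: "AE x in lebesgue_on D. (\<lambda>n. V_norm Y (\<lambda>y. u x y - s n x y)) \<longlonglongrightarrow> 0"
    and b: "integrable (lebesgue_on D) b" "AE x in lebesgue_on D. (V_norm Y (u x))\<^sup>2 \<le> b x"
  shows "u \<in> L2_H10 D Y"
proof -
  have "(\<lambda>x. (V_norm Y (u x))\<^sup>2) \<in> borel_measurable (lebesgue_on D)"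
  proof (rule lebesgue_on_measurable_LIMSEQ_AE[OF D])
    show "(\<lambda>x. (V_norm Y (s n x))\<^sup>2) \<in> borel_measurable (lebesgue_on D)" for n
      using simple_function_compose1[OF s(1)[of n]] by (rule borel_measurable_simple_function)
    show "AE x in lebesgue_on D. (\<lambda>n. (V_norm Y (s n x))\<^sup>2) \<longlonglongrightarrow> (V_norm Y (u x))\<^sup>2"
      using l AE_space
    proof eventually_elim
      case (elim x)
      then have x: "x \<in> D" by simp
      have "(\<lambda>n. V_norm Y (s n x)) \<longlonglongrightarrow> V_norm Y (u x)"
      proof (rule metric_LIMSEQ_I)
        fix r :: real assume "r > 0"
        from metric_LIMSEQ_D[OF elim(1) this] obtain n0 where n0: "\<forall>n\<ge>n0. \<bar>V_norm Y (\<lambda>y. u x y - s n x y)\<bar> < r" by (auto simp: dist_real_def)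
        show "\<exists>n0. \<forall>n\<ge>n0. dist (V_norm Y (s n x)) (V_norm Y (u x)) < r"
        proof (intro exI[of _ n0] allI impI)
          fix n assume "n \<ge> n0"
          then show "dist (V_norm Y (s n x)) (V_norm Y (u x)) < r"
            using n0 V_norm_abs_diff_le[OF u[OF x] s(2)[OF x, of n] Y] by (auto simp: dist_real_def abs_minus_commute)
        qed
      qed
      then show ?case by (rule tendsto_power)
    qed
  qed
  moreover have "AE x in lebesgue_on D. norm ((V_norm Y (u x))\<^sup>2) \<le> norm (b x)"
    using b(2) by (rule eventually_mono) simp
  ultimately have "integrable (lebesgue_on D) (\<lambda>x. (V_norm Y (u x))\<^sup>2)"
    by (rule Bochner_Integration.integrable_bound[OF b(1)])
  then show ?thesis using u s l unfolding L2_H10_def by blast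
qed

lemma L2_H10D:
  assumes "u \<in> L2_H10 D Y"
  shows "x \<in> D \<Longrightarrow> u x \<in> H10 Y" "integrable (lebesgue_on D) (\<lambda>x. (V_norm Y (u x))\<^sup>2)"
  using assms by (auto simp: L2_H10_def)

lemma L2_H10_simple_approx:
  assumes "u \<in> L2_H10 D Y"
  shows "\<exists>s. (\<forall>n. simple_function (lebesgue_on D) (s n)) \<and> (\<forall>n. \<forall>x\<in>D. s n x \<in> H10 Y) \<and>
    (AE x in lebesgue_on D. (\<lambda>n. V_norm Y (\<lambda>y. u x y - s n x y)) \<longlonglongrightarrow> 0)"
  using assms unfolding L2_H10_def by blast

lemma L2_H10_diff:
  fixes u v :: "real^'d::finite \<Rightarrow> real^'d \<Rightarrow> real"
  assumes D: "D \<in> sets lebesgue" and Y: "open Y" and u: "u \<in> L2_H10 D Y" and v: "v \<in> L2_H10 D Y"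
  shows "(\<lambda>x y. u x y - v x y) \<in> L2_H10 D Y"
proof -
  obtain s where s: "\<And>n. simple_function (lebesgue_on D) (s n)" "\<And>n x. x \<in> D \<Longrightarrow> s n x \<in> H10 Y"
    "AE x in lebesgue_on D. (\<lambda>n. V_norm Y (\<lambda>y. u x y - s n x y)) \<longlonglongrightarrow> 0" using L2_H10_simple_approx[OF u] by blast
  obtain t where t: "\<And>n. simple_function (lebesgue_on D) (t n)" "\<And>n x. x \<in> D \<Longrightarrow> t n x \<in> H10 Y"
    "AE x in lebesgue_on D. (\<lambda>n. V_norm Y (\<lambda>y. v x y - t n x y)) \<longlonglongrightarrow> 0" using L2_H10_simple_approx[OF v] by blast
  have tri: "L2norm (lebesgue_on Y) (\<lambda>y. (a y - b y) - (a' y - b' y)) \<le> L2norm (lebesgue_on Y) (\<lambda>y. a y - a' y) + L2norm (lebesgue_on Y) (\<lambda>y. b y - b' y)"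
    if "a \<in> L2 (lebesgue_on Y)" "b \<in> L2 (lebesgue_on Y)" "a' \<in> L2 (lebesgue_on Y)" "b' \<in> L2 (lebesgue_on Y)" for a b a' b' :: "real^'d \<Rightarrow> real^'d"
    using L2norm_triangle_diff[OF L2_diff[OF that(1,3)] L2_diff[OF that(2,4)]] by (simp add: algebra_simps)
  show ?thesis
  proof (rule L2_H10I[OF D Y, where s="\<lambda>n x y. s n x y - t n x y" and b="\<lambda>x. 2 * (V_norm Y (u x))\<^sup>2 + 2 * (V_norm Y (v x))\<^sup>2"])
    show "(\<lambda>y. u x y - v x y) \<in> H10 Y" if "x \<in> D" for x by (intro H10_diff L2_H10D(1)[OF u] L2_H10D(1)[OF v] that Y)
    show "(\<lambda>y. s n x y - t n x y) \<in> H10 Y" if "x \<in> D" for n x by (intro H10_diff s(2) t(2) that Y)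
    show "simple_function (lebesgue_on D) (\<lambda>x y. s n x y - t n x y)" for n
      by (rule simple_function_compose2[OF s(1) t(1), where h="\<lambda>f g y. f y - g y"])
    show "integrable (lebesgue_on D) (\<lambda>x. 2 * (V_norm Y (u x))\<^sup>2 + 2 * (V_norm Y (v x))\<^sup>2)"
      using L2_H10D(2)[OF u] L2_H10D(2)[OF v] by (intro Bochner_Integration.integrable_add integrable_mult_right)
    show "AE x in lebesgue_on D. (V_norm Y (\<lambda>y. u x y - v x y))\<^sup>2 \<le> 2 * (V_norm Y (u x))\<^sup>2 + 2 * (V_norm Y (v x))\<^sup>2"
    proof (rule AE_I2)
      fix x assume "x \<in> space (lebesgue_on D)"
      then have x: "x \<in> D" by simp
      note ux = L2_H10D(1)[OF u x] and vx = L2_H10D(1)[OF v x]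
      have "V_norm Y (\<lambda>y. u x y - v x y) \<le> V_norm Y (u x) + V_norm Y (v x)"
        unfolding V_norm_diff[OF ux vx Y] by (simp add: V_norm_def L2norm_triangle_diff H10_wgrad_L2 ux vx)
      then have "(V_norm Y (\<lambda>y. u x y - v x y))\<^sup>2 \<le> (V_norm Y (u x) + V_norm Y (v x))\<^sup>2"
        by (rule power_mono) (simp add: V_norm_def)
      then show "(V_norm Y (\<lambda>y. u x y - v x y))\<^sup>2 \<le> 2 * (V_norm Y (u x))\<^sup>2 + 2 * (V_norm Y (v x))\<^sup>2"
        using norm_add_sq_le[of "V_norm Y (u x)" "V_norm Y (v x)"] by (simp only: real_norm_def power2_abs)
    qed
    show "AE x in lebesgue_on D. (\<lambda>n. V_norm Y (\<lambda>y. u x y - v x y - (s n x y - t n x y))) \<longlonglongrightarrow> 0"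
      using s(3) t(3) AE_space
    proof eventually_elim
      case (elim x)
      then have x: "x \<in> D" by simp
      note h = L2_H10D(1)[OF u x] L2_H10D(1)[OF v x] s(2)[OF x] t(2)[OF x]
      note g = h[THEN H10_has_weak_gradient]
      have le: "V_norm Y (\<lambda>y. u x y - v x y - (s n x y - t n x y)) \<le> V_norm Y (\<lambda>y. u x y - s n x y) + V_norm Y (\<lambda>y. v x y - t n x y)" for n
      proof -
        have "V_norm Y (\<lambda>y. u x y - v x y - (s n x y - t n x y)) =
           L2norm (lebesgue_on Y) (\<lambda>y. (wgrad Y (u x) y - wgrad Y (v x) y) - (wgrad Y (s n x) y - wgrad Y (t n x) y))"
          by (intro V_norm_eq has_weak_gradient_diff g Y)
        then show ?thesis using tri[OF h(1)[THEN H10_wgrad_L2] h(2)[THEN H10_wgrad_L2] h(3)[THEN H10_wgrad_L2, of n] h(4)[THEN H10_wgrad_L2, of n]]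
          by (simp add: V_norm_diff h Y)
      qed
      show ?case
        by (rule tendsto_sandwich[OF _ _ tendsto_const tendsto_add_zero[OF elim(1,2)]])
          (use le in \<open>auto simp: V_norm_def intro!: always_eventually\<close>)
    qed
  qed
qed

text \<open>Only the scalar coefficients take more than finitely many values, so approximating them
  by simple functions suffices. \<open>C\<close> bounds the norms of all correctors at once, by
  summing over the finite image of \<kappa>.\<close>

lemma L2_H10_combination:
  fixes v :: "'i::finite \<Rightarrow> 'p \<Rightarrow> real^'d::finite \<Rightarrow> real" and a :: "'i \<Rightarrow> real^'d \<Rightarrow> real"
  assumes D: "D \<in> sets lebesgue" and Y: "open Y" and \<kappa>: "simple_function (lebesgue_on D) \<kappa>"
    and v: "\<And>x i. x \<in> D \<Longrightarrow> v i (\<kappa> x) \<in> H10 Y" and a: "\<And>i. a i \<in> L2 (lebesgue_on D)"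
  shows "(\<lambda>x y. \<Sum>i\<in>UNIV. a i x * v i (\<kappa> x) y) \<in> L2_H10 D Y"
proof -
  have Vc: "V_norm Y (\<lambda>y. \<Sum>i\<in>(UNIV::'i set). c i * v i (\<kappa> x) y) \<le> (\<Sum>i\<in>UNIV. \<bar>c i\<bar> * V_norm Y (v i (\<kappa> x)))" if "x \<in> D" for c x
  proof -
    have "V_norm Y (\<lambda>y. \<Sum>i\<in>(UNIV::'i set). c i * v i (\<kappa> x) y) = L2norm (lebesgue_on Y) (\<lambda>y. \<Sum>i\<in>(UNIV::'i set). c i *\<^sub>R wgrad Y (v i (\<kappa> x)) y)"
      by (intro V_norm_eq has_weak_gradient_sum has_weak_gradient_cmult H10_has_weak_gradient v that Y)
    also have "\<dots> \<le> (\<Sum>i\<in>UNIV. L2norm (lebesgue_on Y) (\<lambda>y. c i *\<^sub>R wgrad Y (v i (\<kappa> x)) y))"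
      by (intro L2norm_sum L2_scaleR H10_wgrad_L2 v that)
    finally show ?thesis by (simp add: L2norm_scaleR V_norm_def)
  qed
  have "\<forall>i. \<exists>s. (\<forall>n. simple_function (lebesgue_on D) (s n)) \<and> (\<forall>x\<in>space (lebesgue_on D). (\<lambda>n. s n x) \<longlonglongrightarrow> a i x)"
    using borel_measurable_implies_sequence_metric[OF L2D(1)[OF a], where z=0] by (meson)
  from choice[OF this] obtain s where s: "\<And>i n. simple_function (lebesgue_on D) (s i n)" "\<And>i x. x \<in> D \<Longrightarrow> (\<lambda>n. s i n x) \<longlonglongrightarrow> a i x" by auto
  have fin: "finite (\<kappa> ` D)" using simple_functionD(1)[OF \<kappa>] by simp
  define C where "C = (\<Sum>p\<in>\<kappa> ` D. \<Sum>i\<in>(UNIV::'i set). (V_norm Y (v i p))\<^sup>2)"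
  have C: "(\<Sum>i\<in>(UNIV::'i set). (V_norm Y (v i (\<kappa> x)))\<^sup>2) \<le> C" if "x \<in> D" for x
    unfolding C_def by (rule member_le_sum[of "\<kappa> x"]) (use that fin in \<open>auto intro!: sum_nonneg\<close>)
  show ?thesis
  proof (rule L2_H10I[OF D Y, where s="\<lambda>n x y. \<Sum>i\<in>UNIV. s i n x * v i (\<kappa> x) y" and b="\<lambda>x. (\<Sum>i\<in>UNIV. (a i x)\<^sup>2) * C"])
    show "(\<lambda>y. \<Sum>i\<in>UNIV. a i x * v i (\<kappa> x) y) \<in> H10 Y" if "x \<in> D" for x by (intro H10_sum H10_cmult v that Y)
    show "(\<lambda>y. \<Sum>i\<in>UNIV. s i n x * v i (\<kappa> x) y) \<in> H10 Y" if "x \<in> D" for n x by (intro H10_sum H10_cmult v that Y)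
    show "simple_function (lebesgue_on D) (\<lambda>x y. \<Sum>i\<in>UNIV. s i n x * v i (\<kappa> x) y)" for n
    proof -
      have "simple_function (lebesgue_on D) (\<lambda>x y. \<Sum>i\<in>I. s i n x * v i (\<kappa> x) y)" if "finite I" for I
        using that
      proof (induction I)
        case (insert i I)
        have "simple_function (lebesgue_on D) (\<lambda>x y. s i n x * v i (\<kappa> x) y)"
          by (rule simple_function_compose2[OF s(1) \<kappa>, where h="\<lambda>b p y. b * v i p y"])
        from simple_function_compose2[OF this insert.IH, where h="\<lambda>f g y. f y + g y"]
        show ?case using insert.hyps by simp
      qed simp
      then show ?thesis by simp
    qed
    show "integrable (lebesgue_on D) (\<lambda>x. (\<Sum>i\<in>UNIV. (a i x)\<^sup>2) * C)"
      using L2D(2)[OF a] by (intro integrable_mult_left Bochner_Integration.integrable_sum) simp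
    show "AE x in lebesgue_on D. (V_norm Y (\<lambda>y. \<Sum>i\<in>UNIV. a i x * v i (\<kappa> x) y))\<^sup>2 \<le> (\<Sum>i\<in>UNIV. (a i x)\<^sup>2) * C"
    proof (rule AE_I2)
      fix x assume "x \<in> space (lebesgue_on D)"
      then have x: "x \<in> D" by simp
      have "(V_norm Y (\<lambda>y. \<Sum>i\<in>UNIV. a i x * v i (\<kappa> x) y))\<^sup>2 \<le> (\<Sum>i\<in>UNIV. \<bar>a i x\<bar> * V_norm Y (v i (\<kappa> x)))\<^sup>2"
        by (rule power_mono[OF Vc[OF x]]) (simp add: V_norm_def)
      also have "\<dots> \<le> (\<Sum>i\<in>UNIV. \<bar>a i x\<bar>\<^sup>2) * (\<Sum>i\<in>UNIV. (V_norm Y (v i (\<kappa> x)))\<^sup>2)"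
        by (rule Cauchy_Schwarz_ineq_sum)
      also have "\<dots> \<le> (\<Sum>i\<in>UNIV. (a i x)\<^sup>2) * C" using C[OF x] by (simp add: mult_left_mono sum_nonneg)
      finally show "(V_norm Y (\<lambda>y. \<Sum>i\<in>UNIV. a i x * v i (\<kappa> x) y))\<^sup>2 \<le> (\<Sum>i\<in>UNIV. (a i x)\<^sup>2) * C" .
    qed
    show "AE x in lebesgue_on D. (\<lambda>n. V_norm Y (\<lambda>y. (\<Sum>i\<in>UNIV. a i x * v i (\<kappa> x) y) - (\<Sum>i\<in>UNIV. s i n x * v i (\<kappa> x) y))) \<longlonglongrightarrow> 0"
    proof (rule AE_I2)
      fix x assume "x \<in> space (lebesgue_on D)"
      then have x: "x \<in> D" by simp
      have "(\<lambda>n. \<Sum>i\<in>UNIV. \<bar>a i x - s i n x\<bar> * V_norm Y (v i (\<kappa> x))) \<longlonglongrightarrow> (\<Sum>i\<in>(UNIV::'i set). \<bar>a i x - a i x\<bar> * V_norm Y (v i (\<kappa> x)))"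
        by (intro tendsto_intros s(2) x)
      then have l: "(\<lambda>n. \<Sum>i\<in>UNIV. \<bar>a i x - s i n x\<bar> * V_norm Y (v i (\<kappa> x))) \<longlonglongrightarrow> 0" by simp
      have le: "V_norm Y (\<lambda>y. (\<Sum>i\<in>UNIV. a i x * v i (\<kappa> x) y) - (\<Sum>i\<in>UNIV. s i n x * v i (\<kappa> x) y)) \<le> (\<Sum>i\<in>UNIV. \<bar>a i x - s i n x\<bar> * V_norm Y (v i (\<kappa> x)))" for n
        using Vc[OF x, of "\<lambda>i. a i x - s i n x"] by (simp add: left_diff_distrib sum_subtractf)
      show "(\<lambda>n. V_norm Y (\<lambda>y. (\<Sum>i\<in>UNIV. a i x * v i (\<kappa> x) y) - (\<Sum>i\<in>UNIV. s i n x * v i (\<kappa> x) y))) \<longlonglongrightarrow> 0"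
        by (rule tendsto_sandwich[OF _ _ tendsto_const l]) (use le in \<open>auto simp: V_norm_def intro!: always_eventually\<close>)
    qed
  qed
qed

text \<open>\<open>wgrad Y\<close> is an arbitrary choice at each function, so joint measurability
  in both variables is directly available only where finitely many functions occur.\<close>

lemma simple_wgrad_measurable:
  assumes s: "simple_function N s" "\<And>x. x \<in> space N \<Longrightarrow> s x \<in> H10 Y"
  shows "(\<lambda>z. wgrad Y (s (fst z)) (snd z)) \<in> borel_measurable (N \<Otimes>\<^sub>M lebesgue_on Y)"
proof (rule measurable_compose_countable'[where I="s ` space N" and g="\<lambda>z. s (fst z)" and f="\<lambda>v z. wgrad Y v (snd z)"])
  fix v assume "v \<in> s ` space N"
  then have [measurable]: "wgrad Y v \<in> borel_measurable (lebesgue_on Y)" using s(2) H10_wgrad_L2 L2D(1) by blast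
  show "(\<lambda>z. wgrad Y v (snd z)) \<in> borel_measurable (N \<Otimes>\<^sub>M lebesgue_on Y)" by measurable
next
  have "finite (s ` space N)" by (rule simple_functionD(1)[OF s(1)])
  then show "countable (s ` space N)" by (rule countable_finite)
  have "s \<in> N \<rightarrow>\<^sub>M count_space (s ` space N)"
    using \<open>finite (s ` space N)\<close> simple_functionD(2)[OF s(1)] by (subst measurable_count_space_eq2) auto
  then show "(\<lambda>z. s (fst z)) \<in> N \<Otimes>\<^sub>M lebesgue_on Y \<rightarrow>\<^sub>M count_space (s ` space N)"
    by (rule measurable_compose[OF measurable_fst])
qed

subsection \<open>The deterministic error estimate\<close>

lemma elliptic_apply_L2:
  fixes b :: "'a \<Rightarrow> real^'n::finite^'n"
  assumes b: "b \<in> borel_measurable N" "AE y in N. elliptic c1 c2 (b y)" and F: "F \<in> L2 N" and "c2 \<ge> 0"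
  shows "(\<lambda>y. b y *v F y) \<in> L2 N" "L2norm N (\<lambda>y. b y *v F y) \<le> c2 * L2norm N F"
proof -
  have m: "(\<lambda>y. b y *v F y) \<in> borel_measurable N" by (rule borel_measurable_matrix_vector_mult[OF b(1) L2D(1)[OF F]])
  have le: "AE y in N. norm (b y *v F y) \<le> c2 * norm (F y)"
    using b(2) by (rule eventually_mono) (simp add: elliptic_def)
  show "(\<lambda>y. b y *v F y) \<in> L2 N" by (rule L2_dominated[OF F m le])
  show "L2norm N (\<lambda>y. b y *v F y) \<le> c2 * L2norm N F" by (rule L2norm_mono[OF F m le \<open>c2 \<ge> 0\<close>])
qed

lemma elliptic_form_bound:
  fixes b :: "'a \<Rightarrow> real^'n::finite^'n"
  assumes b: "b \<in> borel_measurable N" "AE y in N. elliptic c1 c2 (b y)" and F: "F \<in> L2 N" and E: "E \<in> L2 N" and "c2 \<ge> 0"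
  shows "integrable N (\<lambda>y. (b y *v F y) \<bullet> E y)"
    "\<bar>LINT y|N. (b y *v F y) \<bullet> E y\<bar> \<le> c2 * L2norm N F * L2norm N E"
proof -
  note bF = elliptic_apply_L2[OF b F \<open>c2 \<ge> 0\<close>]
  show "integrable N (\<lambda>y. (b y *v F y) \<bullet> E y)" by (rule L2_integrable_inner[OF bF(1) E])
  show "\<bar>LINT y|N. (b y *v F y) \<bullet> E y\<bar> \<le> c2 * L2norm N F * L2norm N E"
    by (rule L2_Cauchy_Schwarz_le[OF bF(1) E bF(2) order_refl])
qed

lemma elliptic_form_diff:
  fixes b :: "'a \<Rightarrow> real^'n::finite^'n"
  assumes b: "b \<in> borel_measurable N" "AE y in N. elliptic c1 c2 (b y)" and "c2 \<ge> 0"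
    and F: "F \<in> L2 N" "F' \<in> L2 N" and E: "E \<in> L2 N" "E' \<in> L2 N"
  shows "\<bar>(LINT y|N. (b y *v F' y) \<bullet> E' y) - (LINT y|N. (b y *v F y) \<bullet> E y)\<bar>
    \<le> c2 * L2norm N (\<lambda>y. F' y - F y) * L2norm N E' + c2 * L2norm N F * L2norm N (\<lambda>y. E' y - E y)"
proof -
  note B = elliptic_form_bound[OF b _ _ \<open>c2 \<ge> 0\<close>]
  note dF = L2_diff[OF F(2,1)] and dE = L2_diff[OF E(2,1)]
  have "(LINT y|N. (b y *v F' y) \<bullet> E' y) - (LINT y|N. (b y *v F y) \<bullet> E y) = (LINT y|N. (b y *v F' y) \<bullet> E' y - (b y *v F y) \<bullet> E y)"
    by (rule Bochner_Integration.integral_diff[symmetric]) (rule B(1)[OF F(2) E(2)], rule B(1)[OF F(1) E(1)])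
  also have "\<dots> = (LINT y|N. (b y *v (F' y - F y)) \<bullet> E' y + (b y *v F y) \<bullet> (E' y - E y))"
    by (simp add: matrix_vector_mult_diff_distrib inner_diff_left inner_diff_right)
  also have "\<dots> = (LINT y|N. (b y *v (F' y - F y)) \<bullet> E' y) + (LINT y|N. (b y *v F y) \<bullet> (E' y - E y))"
    by (rule Bochner_Integration.integral_add) (rule B(1)[OF dF E(2)], rule B(1)[OF F(1) dE])
  finally show ?thesis using B(2)[OF dF E(2)] B(2)[OF F(1) dE] by linarith
qed

lemma L2norm_const_lebesgue_on:
  assumes "Y \<in> sets lebesgue"
  shows "(L2norm (lebesgue_on Y) (\<lambda>_. c))\<^sup>2 = measure lebesgue Y * (norm c)\<^sup>2"
  using assms by (simp add: L2norm_sq measure_restrict_space)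

lemma finite_measure_lebesgue_on_open: "open Y \<Longrightarrow> bounded Y \<Longrightarrow> finite_measure (lebesgue_on Y)"
  by (simp add: finite_measure_lebesgue_on lmeasurable_open)

text \<open>Joint measurability of the integrand cannot be expected for general \<open>u\<close> and
  \<open>v\<close>, so the inner integral is exhibited as a limit of inner integrals with simple
  functions. Integrability matters because the error estimate integrates a pointwise inequality in
  \<open>x\<close>.\<close>

lemma two_scale_form_integrable:
  fixes B :: "real^'d::finite \<Rightarrow> real^'d \<Rightarrow> real^'d^'d"
  assumes D: "D \<in> sets lebesgue" and Y: "open Y" "bounded Y" and c2: "c2 \<ge> 0"
    and Bm: "(\<lambda>z. B (fst z) (snd z)) \<in> borel_measurable (lebesgue_on D \<Otimes>\<^sub>M lebesgue_on Y)"
    and Be: "AE x in lebesgue_on D. AE y in lebesgue_on Y. elliptic c1 c2 (B x y)"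
    and g: "g \<in> L2 (lebesgue_on D)" and h: "h \<in> L2 (lebesgue_on D)"
    and u: "u \<in> L2_H10 D Y" and v: "v \<in> L2_H10 D Y"
  shows "integrable (lebesgue_on D) (\<lambda>x. \<integral>y. (B x y *v (g x + wgrad Y (u x) y)) \<bullet> (h x + wgrad Y (v x) y) \<partial>lebesgue_on Y)"
    (is "integrable _ ?J")
proof -
  interpret Y: finite_measure "lebesgue_on Y" by (rule finite_measure_lebesgue_on_open[OF Y])
  let ?m = "measure lebesgue Y"
  have Bx: "B x \<in> borel_measurable (lebesgue_on Y)" if "x \<in> D" for x
    using measurable_compose[OF measurable_Pair1'[of x "lebesgue_on D" "lebesgue_on Y"] Bm] that by simp
  obtain s where s: "\<And>n. simple_function (lebesgue_on D) (s n)" "\<And>n x. x \<in> D \<Longrightarrow> s n x \<in> H10 Y"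
    "AE x in lebesgue_on D. (\<lambda>n. V_norm Y (\<lambda>y. u x y - s n x y)) \<longlonglongrightarrow> 0" using L2_H10_simple_approx[OF u] by blast
  obtain t where t: "\<And>n. simple_function (lebesgue_on D) (t n)" "\<And>n x. x \<in> D \<Longrightarrow> t n x \<in> H10 Y"
    "AE x in lebesgue_on D. (\<lambda>n. V_norm Y (\<lambda>y. v x y - t n x y)) \<longlonglongrightarrow> 0" using L2_H10_simple_approx[OF v] by blast
  have G: "(\<lambda>y. a + wgrad Y p y) \<in> L2 (lebesgue_on Y)" if "p \<in> H10 Y" for a p
    by (intro L2_add Y.L2_const H10_wgrad_L2 that)
  have Gd: "L2norm (lebesgue_on Y) (\<lambda>y. (a + wgrad Y q y) - (a + wgrad Y p y)) = V_norm Y (\<lambda>y. p y - q y)"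
    if "p \<in> H10 Y" "q \<in> H10 Y" for a p q
    using V_norm_diff[OF that Y(1)] L2norm_diff_commute[of "lebesgue_on Y" "wgrad Y p" "wgrad Y q"] by simp
  have Gn: "(L2norm (lebesgue_on Y) (\<lambda>y. a + wgrad Y p y))\<^sup>2 \<le> 2 * (?m * (norm a)\<^sup>2) + 2 * (V_norm Y p)\<^sup>2"
    if "p \<in> H10 Y" for a p
  proof -
    have "(L2norm (lebesgue_on Y) (\<lambda>y. a + wgrad Y p y))\<^sup>2 \<le> (L2norm (lebesgue_on Y) (\<lambda>y. a) + V_norm Y p)\<^sup>2"
      using L2norm_triangle[OF Y.L2_const H10_wgrad_L2[OF that], of a] by (intro power_mono) (simp_all add: V_norm_def)
    also have "\<dots> \<le> 2 * (L2norm (lebesgue_on Y) (\<lambda>y. a))\<^sup>2 + 2 * (V_norm Y p)\<^sup>2"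
      using norm_add_sq_le[of "L2norm (lebesgue_on Y) (\<lambda>y. a)" "V_norm Y p"] by (simp only: real_norm_def power2_abs)
    finally show ?thesis by (simp add: L2norm_const_lebesgue_on open_sets_lebesgue Y(1))
  qed
  let ?Jn = "\<lambda>n x. \<integral>y. (B x y *v (g x + wgrad Y (s n x) y)) \<bullet> (h x + wgrad Y (t n x) y) \<partial>lebesgue_on Y"
  have Jm: "?J \<in> borel_measurable (lebesgue_on D)"
  proof (rule lebesgue_on_measurable_LIMSEQ_AE[OF D, where f="?Jn"])
    fix n
    note [measurable] = L2D(1)[OF g] L2D(1)[OF h] Bm
    have [measurable]: "(\<lambda>z. wgrad Y (s n (fst z)) (snd z)) \<in> borel_measurable (lebesgue_on D \<Otimes>\<^sub>M lebesgue_on Y)"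
      "(\<lambda>z. wgrad Y (t n (fst z)) (snd z)) \<in> borel_measurable (lebesgue_on D \<Otimes>\<^sub>M lebesgue_on Y)"
      by (rule simple_wgrad_measurable; use s t in simp)+
    show "?Jn n \<in> borel_measurable (lebesgue_on D)"
      by (rule Y.borel_measurable_lebesgue_integral) (simp only: case_prod_unfold, measurable)
  next
    show "AE x in lebesgue_on D. (\<lambda>n. ?Jn n x) \<longlonglongrightarrow> ?J x"
      using s(3) t(3) Be AE_space
    proof eventually_elim
      case (elim x)
      then have x: "x \<in> D" by simp
      note ux = L2_H10D(1)[OF u x] and vx = L2_H10D(1)[OF v x]
      let ?F = "\<lambda>y. g x + wgrad Y (u x) y" and ?E = "\<lambda>y. h x + wgrad Y (v x) y"
      let ?d = "\<lambda>n. V_norm Y (\<lambda>y. u x y - s n x y)" and ?e = "\<lambda>n. V_norm Y (\<lambda>y. v x y - t n x y)"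
      let ?n = "L2norm (lebesgue_on Y)"
      have le: "norm (?Jn n x - ?J x) \<le> c2 * ?d n * (?n ?E + ?e n) + c2 * ?n ?F * ?e n" for n
      proof -
        let ?En = "\<lambda>y. h x + wgrad Y (t n x) y"
        have "?n ?En \<le> ?n ?E + ?e n"
          using L2norm_triangle[OF G[OF vx, of "h x"] L2_diff[OF G[OF t(2)[OF x, of n], of "h x"] G[OF vx, of "h x"]]] Gd[OF vx t(2)[OF x, of n], of "h x"]
          by simp
        then have "c2 * ?d n * ?n ?En \<le> c2 * ?d n * (?n ?E + ?e n)" by (intro mult_left_mono) (simp_all add: c2 V_norm_def)
        then show ?thesis
          using elliptic_form_diff[OF Bx[OF x] elim(3) c2 G[OF ux, of "g x"] G[OF s(2)[OF x, of n], of "g x"] G[OF vx, of "h x"] G[OF t(2)[OF x, of n], of "h x"]]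
          unfolding Gd[OF ux s(2)[OF x, of n]] Gd[OF vx t(2)[OF x, of n]] by simp
      qed
      have "(\<lambda>n. c2 * ?d n * (?n ?E + ?e n) + c2 * ?n ?F * ?e n) \<longlonglongrightarrow> c2 * 0 * (?n ?E + 0) + c2 * ?n ?F * 0"
        by (intro tendsto_intros elim(1,2))
      then have "(\<lambda>n. c2 * ?d n * (?n ?E + ?e n) + c2 * ?n ?F * ?e n) \<longlonglongrightarrow> 0" by simp
      then have "(\<lambda>n. ?Jn n x - ?J x) \<longlonglongrightarrow> 0" by (rule Lim_null_comparison[OF always_eventually, rotated]) (use le in blast)
      then show ?case by (rule LIM_zero_cancel)
    qed
  qed
  let ?b = "\<lambda>x. c2 * ((2 * (?m * (norm (g x))\<^sup>2) + 2 * (V_norm Y (u x))\<^sup>2) + (2 * (?m * (norm (h x))\<^sup>2) + 2 * (V_norm Y (v x))\<^sup>2))"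
  have "integrable (lebesgue_on D) ?b"
    by (intro integrable_mult_right Bochner_Integration.integrable_add L2D(2)[OF g] L2D(2)[OF h] L2_H10D(2)[OF u] L2_H10D(2)[OF v])
  moreover have "AE x in lebesgue_on D. norm (?J x) \<le> norm (?b x)"
    using Be AE_space
  proof eventually_elim
    case (elim x)
    then have x: "x \<in> D" by simp
    note ux = L2_H10D(1)[OF u x] and vx = L2_H10D(1)[OF v x]
    let ?p = "L2norm (lebesgue_on Y) (\<lambda>y. g x + wgrad Y (u x) y)" and ?q = "L2norm (lebesgue_on Y) (\<lambda>y. h x + wgrad Y (v x) y)"
    have "0 \<le> ?p * ?q" by simp
    then have "?p * ?q \<le> ?p\<^sup>2 + ?q\<^sup>2" using sum_squares_bound[of ?p ?q] by linarith
    also have "\<dots> \<le> (2 * (?m * (norm (g x))\<^sup>2) + 2 * (V_norm Y (u x))\<^sup>2) + (2 * (?m * (norm (h x))\<^sup>2) + 2 * (V_norm Y (v x))\<^sup>2)"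
      by (intro add_mono Gn ux vx)
    finally have "c2 * (?p * ?q) \<le> ?b x" by (rule mult_left_mono[OF _ c2])
    then have "\<bar>?J x\<bar> \<le> ?b x"
      using elliptic_form_bound(2)[OF Bx[OF x] elim(1) G[OF ux, of "g x"] G[OF vx, of "h x"] c2] by (simp only: mult.assoc)
    then show ?case by (simp only: real_norm_def)
  qed
  ultimately show ?thesis by (rule Bochner_Integration.integrable_bound[OF _ Jm])
qed

text \<open>The estimate at one fixed \<open>x\<close>: \<open>g\<close> is the gradient of
  \<open>u0\<close> there, \<open>h\<close> that of the error, \<open>F\<close> the truncated
  two-scale field and \<open>E\<close> its deviation from the corrected gradient. In the expansion
  of \<open>F\<close> the corrected fields are replaced by the fluxes \<sigma>, at cost
  \<open>\<theta>1\<close>; tested with \<open>E\<close> these see only \<open>h\<close>, and their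
  means are given by \<open>a0\<close> up to \<open>\<theta>2\<close>. Ellipticity retains the
  square of \<open>E\<close>.\<close>

lemma cell_estimate:
  fixes b :: "real^'d::finite \<Rightarrow> real^'d^'d" and \<sigma> :: "'d \<Rightarrow> real^'d \<Rightarrow> real^'d" and a0 :: "real^'d^'d"
  assumes Y: "open Y" "bounded Y" and c: "c1 > 0" "c2 > 0" and N: "N = measure lebesgue Y"
    and b: "b \<in> borel_measurable (lebesgue_on Y)" "AE y in lebesgue_on Y. elliptic c1 c2 (b y)"
    and v: "\<And>j. v j \<in> H10 Y" and \<sigma>: "\<And>j. \<sigma> j \<in> L2 (lebesgue_on Y)"
    and df: "\<And>j \<phi>. \<phi> \<in> H10 Y \<Longrightarrow> (LINT y|lebesgue_on Y. \<sigma> j y \<bullet> wgrad Y \<phi> y) = 0"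
    and t1: "\<And>j. L2norm (lebesgue_on Y) (\<lambda>y. b y *v (axis j 1 + wgrad Y (v j) y) - \<sigma> j y) \<le> \<theta>1 * sqrt N"
    and t2: "\<And>j. norm ((LINT y|lebesgue_on Y. \<sigma> j y) - N *\<^sub>R (a0 *v axis j 1)) \<le> \<theta>2 * N"
    and \<theta>: "\<theta>1 \<ge> 0" "\<theta>2 \<ge> 0"
    and \<phi>: "\<phi> \<in> H10 Y" and E: "E = (\<lambda>y. h + wgrad Y \<phi> y)" and F: "F \<in> L2 (lebesgue_on Y)"
    and FE: "AE y in lebesgue_on Y. F y = (\<Sum>j\<in>UNIV. g $ j *\<^sub>R (axis j 1 + wgrad Y (v j) y)) + E y"
  shows "c1 * (L2norm (lebesgue_on Y) E)\<^sup>2 + N * ((a0 *v g) \<bullet> h)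
      - real CARD('d) * norm g * sqrt N * (\<theta>1 + \<theta>2) * L2norm (lebesgue_on Y) E
      \<le> (LINT y|lebesgue_on Y. (b y *v F y) \<bullet> E y)"
    "N * (norm h)\<^sup>2 \<le> (L2norm (lebesgue_on Y) E)\<^sup>2"
proof -
  interpret Y: finite_measure "lebesgue_on Y" by (rule finite_measure_lebesgue_on_open[OF Y])
  let ?I = "\<lambda>f. \<integral>y. f y \<partial>lebesgue_on Y" and ?n = "L2norm (lebesgue_on Y)"
  define P where "P j y = axis j 1 + wgrad Y (v j) y" for j y
  have PL: "P j \<in> L2 (lebesgue_on Y)" for j unfolding P_def[abs_def] by (intro L2_add Y.L2_const H10_wgrad_L2 v)
  have c2: "c2 \<ge> 0" using c by simp
  note w = H10_wgrad_L2[OF \<phi>]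
  have EL: "E \<in> L2 (lebesgue_on Y)" unfolding E by (intro L2_add Y.L2_const w)
  have N0: "N \<ge> 0" by (simp add: N)
  \<comment> \<open>Gradients of functions in \<open>H10 Y\<close> are orthogonal to constants, so
    the mixed term drops out.\<close>
  have "(?n E)\<^sup>2 = ?I (\<lambda>y. (norm h)\<^sup>2 + (2 * (h \<bullet> wgrad Y \<phi> y) + (norm (wgrad Y \<phi> y))\<^sup>2))"
    unfolding L2norm_sq E by (simp add: power2_norm_eq_inner inner_add_left inner_add_right inner_commute algebra_simps)
  also have "\<dots> = ?I (\<lambda>y. (norm h)\<^sup>2) + (2 * ?I (\<lambda>y. h \<bullet> wgrad Y \<phi> y) + (?n (wgrad Y \<phi>))\<^sup>2)"
    unfolding L2norm_sq using L2D(2)[OF w] L2_integrable_inner[OF Y.L2_const w, of h]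
    by (subst Bochner_Integration.integral_add; simp)+
  also have "\<dots> = N * (norm h)\<^sup>2 + (?n (wgrad Y \<phi>))\<^sup>2"
    by (simp add: integral_const_inner_wgrad[OF Y \<phi>] N measure_restrict_space open_sets_lebesgue Y(1))
  finally show h: "N * (norm h)\<^sup>2 \<le> (?n E)\<^sup>2" by simp
  have sh: "sqrt N * norm h \<le> ?n E"
    using real_sqrt_le_mono[OF h] by (simp add: real_sqrt_mult)
  note form = elliptic_form_bound[OF b _ _ c2]
  define r where "r j = ?I (\<lambda>y. (b y *v P j y - \<sigma> j y) \<bullet> E y)" for j
  define s where "s j = (?I (\<sigma> j) - N *\<^sub>R (a0 *v axis j 1)) \<bullet> h" for j
  have dL: "(\<lambda>y. b y *v P j y - \<sigma> j y) \<in> L2 (lebesgue_on Y)" for j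
    by (rule L2_diff[OF elliptic_apply_L2(1)[OF b PL c2] \<sigma>])
  have r: "\<bar>r j\<bar> \<le> \<theta>1 * sqrt N * ?n E" for j
    unfolding r_def using t1[of j] by (intro L2_Cauchy_Schwarz_le[OF dL EL _ order_refl]) (simp add: P_def)
  have s: "\<bar>s j\<bar> \<le> \<theta>2 * sqrt N * ?n E" for j
  proof -
    have "\<bar>s j\<bar> \<le> norm (?I (\<sigma> j) - N *\<^sub>R (a0 *v axis j 1)) * norm h"
      unfolding s_def by (rule Cauchy_Schwarz_ineq2)
    also have "\<dots> \<le> \<theta>2 * N * norm h" by (rule mult_right_mono[OF t2]) simp
    also have "\<dots> = \<theta>2 * sqrt N * (sqrt N * norm h)" using N0 by simp
    also have "\<dots> \<le> \<theta>2 * sqrt N * ?n E" by (intro mult_left_mono sh) (use \<theta> N0 in simp)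
    finally show ?thesis .
  qed
  \<comment> \<open>The gradient part of \<open>E\<close> is annihilated by \<open>df\<close>; what
    is left of \<open>\<sigma> j\<close> is its mean against \<open>h\<close>.\<close>
  have Pj: "?I (\<lambda>y. (b y *v P j y) \<bullet> E y) = r j + s j + N * ((a0 *v axis j 1) \<bullet> h)" for j
  proof -
    have "?I (\<lambda>y. (b y *v P j y) \<bullet> E y) = ?I (\<lambda>y. (b y *v P j y - \<sigma> j y) \<bullet> E y + (\<sigma> j y \<bullet> h + \<sigma> j y \<bullet> wgrad Y \<phi> y))"
      by (simp add: E inner_diff_left inner_add_right)
    also have "\<dots> = r j + (?I (\<lambda>y. \<sigma> j y \<bullet> h) + ?I (\<lambda>y. \<sigma> j y \<bullet> wgrad Y \<phi> y))"
      unfolding r_def using L2_integrable_inner[OF dL EL, of j] L2_integrable_inner[OF \<sigma> Y.L2_const, of j h] L2_integrable_inner[OF \<sigma> w, of j]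
      by (subst Bochner_Integration.integral_add; simp)+
    also have "?I (\<lambda>y. \<sigma> j y \<bullet> h) = ?I (\<sigma> j) \<bullet> h"
      by (rule integral_inner_left) (use Y.L2_imp_integrable[OF \<sigma>] in blast)
    finally show ?thesis using df[OF \<phi>, of j] by (simp add: s_def inner_diff_left)
  qed
  have a0: "(\<Sum>j\<in>UNIV. g $ j * ((a0 *v axis j 1) \<bullet> h)) = (a0 *v g) \<bullet> h"
  proof -
    have "a0 *v g = a0 *v (\<Sum>j\<in>UNIV. g $ j *\<^sub>R axis j 1)" using basis_expansion[of g] by (simp add: scalar_mult_eq_scaleR)
    also have "\<dots> = (\<Sum>j\<in>UNIV. g $ j *\<^sub>R (a0 *v axis j 1))"
      by (simp add: linear_sum[OF matrix_vector_mul_linear] linear_scale[OF matrix_vector_mul_linear])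
    finally show ?thesis by (simp add: inner_sum_left)
  qed
  have bE: "c1 * (?n E)\<^sup>2 \<le> ?I (\<lambda>y. (b y *v E y) \<bullet> E y)"
  proof -
    have "c1 * (?n E)\<^sup>2 = ?I (\<lambda>y. c1 * (norm (E y))\<^sup>2)" by (simp add: L2norm_sq)
    also have "\<dots> \<le> ?I (\<lambda>y. (b y *v E y) \<bullet> E y)"
    proof (rule integral_mono_AE)
      show "AE y in lebesgue_on Y. c1 * (norm (E y))\<^sup>2 \<le> (b y *v E y) \<bullet> E y"
        using b(2) by (rule eventually_mono) (simp add: elliptic_def)
    qed (use L2D(2)[OF EL] form(1)[OF EL EL] in auto)
    finally show ?thesis .
  qed
  have bm: "(\<lambda>y. b y *v F y) \<in> borel_measurable (lebesgue_on Y)" by (rule borel_measurable_matrix_vector_mult[OF b(1) L2D(1)[OF F]])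
  have "?I (\<lambda>y. (b y *v F y) \<bullet> E y) = ?I (\<lambda>y. (\<Sum>j\<in>UNIV. g $ j * ((b y *v P j y) \<bullet> E y)) + (b y *v E y) \<bullet> E y)"
  proof (rule integral_cong_AE)
    show "AE y in lebesgue_on Y. (b y *v F y) \<bullet> E y = (\<Sum>j\<in>UNIV. g $ j * ((b y *v P j y) \<bullet> E y)) + (b y *v E y) \<bullet> E y"
      using FE
    proof (rule eventually_mono)
      fix y assume "F y = (\<Sum>j\<in>UNIV. g $ j *\<^sub>R (axis j 1 + wgrad Y (v j) y)) + E y"
      then have "b y *v F y = (\<Sum>j\<in>UNIV. g $ j *\<^sub>R (b y *v P j y)) + b y *v E y"
        by (simp add: P_def matrix_vector_right_distrib linear_sum[OF matrix_vector_mul_linear] linear_scale[OF matrix_vector_mul_linear])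
      then show "(b y *v F y) \<bullet> E y = (\<Sum>j\<in>UNIV. g $ j * ((b y *v P j y) \<bullet> E y)) + (b y *v E y) \<bullet> E y"
        by (simp add: inner_add_left inner_sum_left)
    qed
    show "(\<lambda>y. (b y *v F y) \<bullet> E y) \<in> borel_measurable (lebesgue_on Y)" using form(1)[OF F EL] by (rule borel_measurable_integrable)
    show "(\<lambda>y. (\<Sum>j\<in>UNIV. g $ j * ((b y *v P j y) \<bullet> E y)) + (b y *v E y) \<bullet> E y) \<in> borel_measurable (lebesgue_on Y)"
      using form(1)[OF PL EL] form(1)[OF EL EL]
      by (intro borel_measurable_integrable Bochner_Integration.integrable_add Bochner_Integration.integrable_sum integrable_mult_right)
  qed
  also have "\<dots> = (\<Sum>j\<in>UNIV. g $ j * ?I (\<lambda>y. (b y *v P j y) \<bullet> E y)) + ?I (\<lambda>y. (b y *v E y) \<bullet> E y)"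
    using form(1)[OF PL EL] form(1)[OF EL EL]
    by (subst Bochner_Integration.integral_add) (auto simp: Bochner_Integration.integral_sum)
  also have "(\<Sum>j\<in>UNIV. g $ j * ?I (\<lambda>y. (b y *v P j y) \<bullet> E y)) = (\<Sum>j\<in>UNIV. g $ j * (r j + s j)) + N * ((a0 *v g) \<bullet> h)"
    unfolding Pj a0[symmetric] by (simp add: distrib_left sum.distrib sum_distrib_left mult_ac)
  finally have eq: "?I (\<lambda>y. (b y *v F y) \<bullet> E y) = (\<Sum>j\<in>UNIV. g $ j * (r j + s j)) + N * ((a0 *v g) \<bullet> h) + ?I (\<lambda>y. (b y *v E y) \<bullet> E y)" .
  have "\<bar>\<Sum>j\<in>UNIV. g $ j * (r j + s j)\<bar> \<le> (\<Sum>j\<in>(UNIV::'d set). \<bar>g $ j * (r j + s j)\<bar>)" by (rule sum_abs)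
  also have "\<dots> \<le> (\<Sum>j\<in>(UNIV::'d set). norm g * ((\<theta>1 + \<theta>2) * sqrt N * ?n E))"
  proof (rule sum_mono)
    fix j
    have "\<bar>r j + s j\<bar> \<le> (\<theta>1 + \<theta>2) * sqrt N * ?n E"
      using r[of j] s[of j] by (simp add: distrib_right)
    then show "\<bar>g $ j * (r j + s j)\<bar> \<le> norm g * ((\<theta>1 + \<theta>2) * sqrt N * ?n E)"
      unfolding abs_mult by (intro mult_mono component_le_norm_cart) auto
  qed
  finally have "\<bar>\<Sum>j\<in>UNIV. g $ j * (r j + s j)\<bar> \<le> real CARD('d) * norm g * sqrt N * (\<theta>1 + \<theta>2) * ?n E"
    by (simp add: mult_ac)
  then show "c1 * (?n E)\<^sup>2 + N * ((a0 *v g) \<bullet> h) - real CARD('d) * norm g * sqrt N * (\<theta>1 + \<theta>2) * ?n E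
      \<le> ?I (\<lambda>y. (b y *v F y) \<bullet> E y)"
    using bE unfolding eq by linarith
qed

text \<open>Both problems are tested with \<open>u\<^sub>r - u\<^sub>0\<close>, the truncated one with the corrector part
  \<open>u\<^sub>1 - \<Sum>\<^sub>j (\<nabla>u\<^sub>0)\<^sub>j v\<^sub>j\<close>. Then the right-hand sides cancel, and no regularity of \<open>u\<^sub>0\<close> is used.\<close>

lemma two_scale_error:
  fixes B :: "real^'d::finite \<Rightarrow> real^'d \<Rightarrow> real^'d^'d" and A0 :: "real^'d \<Rightarrow> real^'d^'d"
  assumes D: "open D" "bounded D" and Y: "open Y" "bounded Y" and c: "c1 > 0" "c2 > 0" and N: "N = measure lebesgue Y" "N > 0"
    and Bm: "(\<lambda>z. B (fst z) (snd z)) \<in> borel_measurable (lebesgue_on D \<Otimes>\<^sub>M lebesgue_on Y)"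
    and Be: "AE x in lebesgue_on D. AE y in lebesgue_on Y. elliptic c1 c2 (B x y)"
    and \<kappa>: "simple_function (lebesgue_on D) \<kappa>"
    and v: "\<And>x j. x \<in> D \<Longrightarrow> v j (\<kappa> x) \<in> H10 Y" and \<sigma>: "\<And>x j. x \<in> D \<Longrightarrow> \<sigma> j (\<kappa> x) \<in> L2 (lebesgue_on Y)"
    and df: "\<And>x j \<phi>. x \<in> D \<Longrightarrow> \<phi> \<in> H10 Y \<Longrightarrow> (LINT y|lebesgue_on Y. \<sigma> j (\<kappa> x) y \<bullet> wgrad Y \<phi> y) = 0"
    and t1: "AE x in lebesgue_on D. \<forall>j. L2norm (lebesgue_on Y) (\<lambda>y. B x y *v (axis j 1 + wgrad Y (v j (\<kappa> x)) y) - \<sigma> j (\<kappa> x) y) \<le> \<theta>1 * sqrt N"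
    and t2: "\<And>x j. x \<in> D \<Longrightarrow> norm ((LINT y|lebesgue_on Y. \<sigma> j (\<kappa> x) y) - N *\<^sub>R (A0 x *v axis j 1)) \<le> \<theta>2 * N"
    and \<theta>: "\<theta>1 \<ge> 0" "\<theta>2 \<ge> 0"
    and u: "u0 \<in> H10 D" "ur \<in> H10 D" "u1 \<in> L2_H10 D Y"
    and A0L: "(\<lambda>x. A0 x *v wgrad D u0 x) \<in> L2 (lebesgue_on D)"
    and hom: "\<And>\<phi>. \<phi> \<in> H10 D \<Longrightarrow> (LINT x|lebesgue_on D. (A0 x *v wgrad D u0 x) \<bullet> wgrad D \<phi> x) = f \<phi>"
    and tr: "\<And>\<phi>0 \<phi>1. \<phi>0 \<in> H10 D \<Longrightarrow> \<phi>1 \<in> L2_H10 D Y \<Longrightarrow>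
      1 / N * (LINT x|lebesgue_on D. (LINT y|lebesgue_on Y. (B x y *v (wgrad D ur x + wgrad Y (u1 x) y)) \<bullet> (wgrad D \<phi>0 x + wgrad Y (\<phi>1 x) y))) = f \<phi>0"
  shows "c1 * V_norm D (\<lambda>x. ur x - u0 x) \<le> real CARD('d) * (\<theta>1 + \<theta>2) * V_norm D u0"
proof -
  interpret Y: finite_measure "lebesgue_on Y" by (rule finite_measure_lebesgue_on_open[OF Y])
  have Ds: "D \<in> sets lebesgue" by (rule open_sets_lebesgue[OF D(1)])
  let ?d = "\<lambda>x. ur x - u0 x"
  define g where "g = wgrad D u0"
  define h where "h = wgrad D ?d"
  have d: "?d \<in> H10 D" by (intro H10_diff u D)
  have gL: "g \<in> L2 (lebesgue_on D)" and hL: "h \<in> L2 (lebesgue_on D)" unfolding g_def h_def by (intro H10_wgrad_L2 u d)+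
  have gh: "AE x in lebesgue_on D. wgrad D ur x = g x + h x"
    using wgrad_eq[OF has_weak_gradient_diff[OF H10_has_weak_gradient[OF u(2)] H10_has_weak_gradient[OF u(1)] D(1)] D(1)]
    by (rule eventually_mono) (simp add: g_def h_def)
  let ?U = "\<lambda>x y. \<Sum>j\<in>UNIV. g x $ j * v j (\<kappa> x) y"
  have U: "?U \<in> L2_H10 D Y"
    by (rule L2_H10_combination[where v=v and a="\<lambda>j x. g x $ j" and \<kappa>=\<kappa>]) (auto intro: L2_component gL Ds Y v \<kappa>)
  let ?p = "\<lambda>x y. u1 x y - ?U x y"
  have p: "?p \<in> L2_H10 D Y" by (rule L2_H10_diff[OF Ds Y(1) u(3) U])
  let ?J = "\<lambda>x. \<integral>y. (B x y *v (wgrad D ur x + wgrad Y (u1 x) y)) \<bullet> (h x + wgrad Y (?p x) y) \<partial>lebesgue_on Y"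
  have J: "integrable (lebesgue_on D) ?J"
    by (rule two_scale_form_integrable[OF Ds Y _ Bm Be H10_wgrad_L2[OF u(2)] hL u(3) p]) (use c in simp)
  have Jf: "(LINT x|lebesgue_on D. ?J x) = N * f ?d"
    using tr[OF d p] N(2) by (simp add: h_def field_simps)
  define q where "q = real CARD('d) * (\<theta>1 + \<theta>2)"
  have q0: "q \<ge> 0" using \<theta> by (simp add: q_def)
  \<comment> \<open>The pointwise lower bound after Young's inequality. Its first term integrates to
    \<open>N * f ?d\<close> by the homogenized problem and so cancels the right-hand side in
    \<open>Jf\<close>.\<close>
  let ?L = "\<lambda>x. N * ((A0 x *v g x) \<bullet> h x) + N / (2 * c1) * (c1\<^sup>2 * (norm (h x))\<^sup>2 - q\<^sup>2 * (norm (g x))\<^sup>2)"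
  have A0L': "(\<lambda>x. A0 x *v g x) \<in> L2 (lebesgue_on D)" using A0L by (simp add: g_def)
  have Li: "integrable (lebesgue_on D) ?L"
    by (intro Bochner_Integration.integrable_add Bochner_Integration.integrable_diff integrable_mult_right L2_integrable_inner A0L' hL L2D(2) gL)
  have "AE x in lebesgue_on D. ?L x \<le> ?J x"
    using Be t1 gh AE_space
  proof eventually_elim
    case (elim x)
    then have x: "x \<in> D" by simp
    note u1x = L2_H10D(1)[OF u(3) x] and px = L2_H10D(1)[OF p x]
    have Bx: "B x \<in> borel_measurable (lebesgue_on Y)"
      using measurable_compose[OF measurable_Pair1'[of x "lebesgue_on D" "lebesgue_on Y"] Bm] x by simp
    have FL: "(\<lambda>y. wgrad D ur x + wgrad Y (u1 x) y) \<in> L2 (lebesgue_on Y)"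
      by (intro L2_add Y.L2_const H10_wgrad_L2 u1x)
    have ge: "g x = (\<Sum>j\<in>UNIV. g x $ j *\<^sub>R axis j 1)" using basis_expansion[of "g x"] by (simp add: scalar_mult_eq_scaleR)
    have "has_weak_gradient Y (?p x) (\<lambda>y. wgrad Y (u1 x) y - (\<Sum>j\<in>UNIV. g x $ j *\<^sub>R wgrad Y (v j (\<kappa> x)) y))"
      by (intro has_weak_gradient_diff has_weak_gradient_sum has_weak_gradient_cmult H10_has_weak_gradient u1x v x Y)
    from wgrad_eq[OF this Y(1)]
    have FE: "AE y in lebesgue_on Y. wgrad D ur x + wgrad Y (u1 x) y =
        (\<Sum>j\<in>UNIV. g x $ j *\<^sub>R (axis j 1 + wgrad Y (v j (\<kappa> x)) y)) + (h x + wgrad Y (?p x) y)"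
    proof (rule eventually_mono)
      fix y assume "wgrad Y (?p x) y = wgrad Y (u1 x) y - (\<Sum>j\<in>UNIV. g x $ j *\<^sub>R wgrad Y (v j (\<kappa> x)) y)"
      then show "wgrad D ur x + wgrad Y (u1 x) y =
        (\<Sum>j\<in>UNIV. g x $ j *\<^sub>R (axis j 1 + wgrad Y (v j (\<kappa> x)) y)) + (h x + wgrad Y (?p x) y)"
        unfolding elim(3) scaleR_add_right sum.distrib ge[symmetric] by simp
    qed
    let ?e = "L2norm (lebesgue_on Y) (\<lambda>y. h x + wgrad Y (?p x) y)"
    note est = cell_estimate[OF Y c N(1) Bx elim(1) v[OF x] \<sigma>[OF x] df[OF x] elim(2)[rule_format] t2[OF x] \<theta> px refl FL FE]
    \<comment> \<open>Young's inequality, weighted so that exactly half of the coercivity survives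
      and the final bound compares \<open>c1\<close> times the norm of \<open>h\<close> with
      \<open>q\<close> times that of \<open>g\<close>.\<close>
    have "0 \<le> (c1 * ?e - q * norm (g x) * sqrt N)\<^sup>2" by simp
    then have "2 * c1 * (q * norm (g x) * sqrt N * ?e) \<le> c1\<^sup>2 * ?e\<^sup>2 + q\<^sup>2 * (norm (g x))\<^sup>2 * N"
      using N(2) by (simp add: power2_diff power_mult_distrib mult_ac)
    then have "2 * c1 * (c1 * ?e\<^sup>2 - q * norm (g x) * sqrt N * ?e) \<ge> c1\<^sup>2 * ?e\<^sup>2 - q\<^sup>2 * (norm (g x))\<^sup>2 * N"
      by (simp add: right_diff_distrib power2_eq_square mult_ac)
    moreover have "c1\<^sup>2 * (N * (norm (h x))\<^sup>2) \<le> c1\<^sup>2 * ?e\<^sup>2" by (rule mult_left_mono[OF est(2) zero_le_power2])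
    ultimately have "N * (c1\<^sup>2 * (norm (h x))\<^sup>2 - q\<^sup>2 * (norm (g x))\<^sup>2) \<le> 2 * c1 * (c1 * ?e\<^sup>2 - q * norm (g x) * sqrt N * ?e)"
      by (simp add: right_diff_distrib mult_ac)
    then have "N / (2 * c1) * (c1\<^sup>2 * (norm (h x))\<^sup>2 - q\<^sup>2 * (norm (g x))\<^sup>2) \<le> c1 * ?e\<^sup>2 - q * norm (g x) * sqrt N * ?e"
      using c(1) by (simp add: pos_divide_le_eq mult_ac)
    moreover have "real CARD('d) * norm (g x) * sqrt N * (\<theta>1 + \<theta>2) * ?e = q * norm (g x) * sqrt N * ?e"
      by (simp add: q_def mult_ac)
    ultimately show ?case using est(1) by linarith
  qed
  then have "(LINT x|lebesgue_on D. ?L x) \<le> (LINT x|lebesgue_on D. ?J x)" by (rule integral_mono_AE[OF Li J])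
  also have "(LINT x|lebesgue_on D. ?L x) = N * f ?d + N / (2 * c1) * (c1\<^sup>2 * (L2norm (lebesgue_on D) h)\<^sup>2 - q\<^sup>2 * (L2norm (lebesgue_on D) g)\<^sup>2)"
    using L2D(2)[OF hL] L2D(2)[OF gL] L2_integrable_inner[OF A0L' hL] hom[OF d]
    by (simp add: L2norm_sq g_def h_def)
  finally have "N / (2 * c1) * (c1\<^sup>2 * (L2norm (lebesgue_on D) h)\<^sup>2 - q\<^sup>2 * (L2norm (lebesgue_on D) g)\<^sup>2) \<le> 0"
    unfolding Jf by linarith
  moreover have "N / (2 * c1) > 0" using N(2) c(1) by simp
  ultimately have "c1\<^sup>2 * (L2norm (lebesgue_on D) h)\<^sup>2 - q\<^sup>2 * (L2norm (lebesgue_on D) g)\<^sup>2 \<le> 0"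
    using mult_le_cancel_left_pos[of "N / (2 * c1)" _ 0] by (simp only: mult_zero_right)
  then have "(c1 * L2norm (lebesgue_on D) h)\<^sup>2 \<le> (q * L2norm (lebesgue_on D) g)\<^sup>2"
    by (simp add: power_mult_distrib)
  then have "c1 * L2norm (lebesgue_on D) h \<le> q * L2norm (lebesgue_on D) g"
    by (rule power2_le_imp_le) (use q0 in simp)
  then show ?thesis by (simp add: V_norm_def g_def h_def q_def)
qed

subsection \<open>Convergence of the truncated problems\<close>

lemma AE_lborel_lebesgue_on:
  assumes "U \<in> sets lebesgue" "AE y in lborel. P y"
  shows "AE y in lebesgue_on U. P y"
  unfolding AE_lebesgue_on_iff[OF assms(1)] using assms(2) by (rule eventually_mono) simp

context homogenization
begin

lemma A0_bound:
  assumes x: "x \<in> D"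
  shows "\<bar>A0 x $ i $ j\<bar> \<le> c2 * (c2 / c1)"
proof -
  have [measurable]: "V j x \<in> borel_measurable M" by (rule L2D(1)[OF V_L2[OF x]])
  have m: "A x \<in> borel_measurable M" by measurable
  have "L2norm M (flux j x) \<le> c2 * L2norm M (V j x)"
    using elliptic_apply_L2(2)[OF m A_elliptic[OF x] V_L2[OF x, of j]] c2 by (simp add: flux_def[abs_def])
  also have "\<dots> \<le> c2 * (c2 / c1)" by (rule mult_left_mono[OF V_norm[OF x]]) (use c2 in simp)
  finally have f: "L2norm M (flux j x) \<le> c2 * (c2 / c1)" .
  have "L2norm M (\<lambda>\<omega>. axis i 1 :: real^'d) \<le> 1" by (simp add: L2norm_def norm_axis_1 prob_space)
  from L2_Cauchy_Schwarz_le[OF flux_L2[OF x, of j] L2_const f this]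
  show ?thesis by (simp add: A0_eq[OF x] inner_axis)
qed

lemma A0_apply_L2:
  assumes g: "g \<in> L2 (lebesgue_on D)"
  shows "(\<lambda>x. A0 x *v g x) \<in> L2 (lebesgue_on D)"
proof (rule L2_dominated[OF g])
  show "(\<lambda>x. A0 x *v g x) \<in> borel_measurable (lebesgue_on D)"
    by (rule borel_measurable_matrix_vector_mult[OF A0_measurable L2D(1)[OF g]])
  show "AE x in lebesgue_on D. norm (A0 x *v g x) \<le> ((real CARD('d))\<^sup>2 * (c2 * (c2 / c1))) * norm (g x)"
  proof (rule AE_I2)
    fix x assume "x \<in> space (lebesgue_on D)"
    then have "x \<in> D" by simp
    from matrix_vector_mult_entry_bound[OF A0_bound[OF this]]
    show "norm (A0 x *v g x) \<le> ((real CARD('d))\<^sup>2 * (c2 * (c2 / c1))) * norm (g x)" .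
  qed
qed

text \<open>The norm of \<open>V j x\<close> is at most \<open>c2 / c1\<close>; the additional 1
  leaves room for the orbit averages of its square to fall strictly below the square of
  \<open>R\<close> eventually.\<close>

definition R :: real where "R = c2 / c1 + 1"

lemma R_pos: "R > 0" using c1 c2 by (simp add: R_def add_pos_pos)

lemma orbit_V_norm:
  assumes p: "p \<in> D"
  shows "AE \<omega> in M. \<forall>\<^sub>F \<rho> in at_top. (\<lambda>y. V j p (T y \<omega>)) \<in> L2 (lebesgue_on (cube \<rho>)) \<and>
    L2norm (lebesgue_on (cube \<rho>)) (\<lambda>y. V j p (T y \<omega>)) \<le> R * sqrt ((2 * \<rho>) ^ CARD('d))"
proof -
  have lim: "(LINT \<omega>|M. (norm (V j p \<omega>))\<^sup>2) < R\<^sup>2"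
  proof -
    have "L2norm M (V j p) < R" using V_norm[OF p, of j] by (simp add: R_def)
    then have "(L2norm M (V j p))\<^sup>2 < R\<^sup>2" by (rule power_strict_mono) simp_all
    then show ?thesis by (simp add: L2norm_sq)
  qed
  show ?thesis
    using pointwise_ergodic[OF L2D(2)[OF V_L2[OF p, of j]]] AE_orbit_L2[OF V_L2[OF p, of j]] AE_space
  proof eventually_elim
    case (elim \<omega>)
    have "\<forall>\<^sub>F \<rho> in at_top. ravg (\<lambda>\<omega>. (norm (V j p \<omega>))\<^sup>2) \<rho> \<omega> < R\<^sup>2"
      by (rule order_tendstoD(2)[OF elim(1) lim])
    then show ?case using eventually_gt_at_top[of 0]
    proof eventually_elim
      case (elim \<rho>)
      note o = orbit_L2[OF L2D(1)[OF V_L2[OF p, of j]] \<open>\<omega> \<in> space M\<close> \<open>loc_int _\<close> \<open>0 < \<rho>\<close>]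
      have "(L2norm (lebesgue_on (cube \<rho>)) (\<lambda>y. V j p (T y \<omega>)))\<^sup>2 \<le> (2 * \<rho>) ^ CARD('d) * R\<^sup>2"
        unfolding o(2) using elim by (intro mult_left_mono) auto
      also have "\<dots> = (R * sqrt ((2 * \<rho>) ^ CARD('d)))\<^sup>2" using elim by (simp add: power_mult_distrib)
      finally have "L2norm (lebesgue_on (cube \<rho>)) (\<lambda>y. V j p (T y \<omega>)) \<le> R * sqrt ((2 * \<rho>) ^ CARD('d))"
        by (rule power2_le_imp_le) (use R_pos elim in simp)
      then show ?case using o(1) by blast
    qed
  qed
qed

lemma orbit_flux_average:
  assumes p: "p \<in> D" and "e > 0"
  shows "AE \<omega> in M. \<forall>\<^sub>F \<rho> in at_top. (\<lambda>y. flux j p (T y \<omega>)) \<in> L2 (lebesgue_on (cube \<rho>)) \<and>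
    (\<forall>i. \<bar>(LINT y|lebesgue_on (cube \<rho>). flux j p (T y \<omega>)) $ i - (2 * \<rho>) ^ CARD('d) * A0 p $ i $ j\<bar> \<le> (2 * \<rho>) ^ CARD('d) * e)"
proof -
  have fi: "flux j p \<in> L2 M" by (rule flux_L2[OF p])
  have "AE \<omega> in M. ((\<lambda>\<rho>. ravg (\<lambda>\<omega>. flux j p \<omega> $ i) \<rho> \<omega>) \<longlongrightarrow> A0 p $ i $ j) at_top" for i
    using pointwise_ergodic[OF L2_imp_integrable[OF L2_component[OF fi, of i]]] by (simp add: A0_eq[OF p])
  then have "AE \<omega> in M. \<forall>i\<in>UNIV. ((\<lambda>\<rho>. ravg (\<lambda>\<omega>. flux j p \<omega> $ i) \<rho> \<omega>) \<longlongrightarrow> A0 p $ i $ j) at_top"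
    by (intro AE_finite_allI) auto
  then show ?thesis using AE_orbit_L2[OF fi] AE_space
  proof eventually_elim
    case (elim \<omega>)
    have "\<forall>\<^sub>F \<rho> in at_top. \<bar>ravg (\<lambda>\<omega>. flux j p \<omega> $ i) \<rho> \<omega> - A0 p $ i $ j\<bar> < e" for i
      using elim(1) \<open>e > 0\<close> by (auto dest!: tendstoD[of _ _ _ e] simp: dist_real_def)
    then have "\<forall>\<^sub>F \<rho> in at_top. \<forall>i. \<bar>ravg (\<lambda>\<omega>. flux j p \<omega> $ i) \<rho> \<omega> - A0 p $ i $ j\<bar> < e"
      by (intro eventually_all_finite)
    then show ?case using eventually_gt_at_top[of 0]
    proof eventually_elim
      case (elim \<rho>)
      note o = orbit_L2(1)[OF L2D(1)[OF fi] \<open>\<omega> \<in> space M\<close> \<open>loc_int _\<close> \<open>0 < \<rho>\<close>]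
      interpret Y: finite_measure "lebesgue_on (cube \<rho> :: (real^'d) set)" by (rule finite_measure_lebesgue_on_open) auto
      have "\<bar>(LINT y|lebesgue_on (cube \<rho>). flux j p (T y \<omega>)) $ i - (2 * \<rho>) ^ CARD('d) * A0 p $ i $ j\<bar> \<le> (2 * \<rho>) ^ CARD('d) * e" for i
      proof -
        have "(LINT y|lebesgue_on (cube \<rho>). flux j p (T y \<omega>)) $ i = (LINT y|lebesgue_on (cube \<rho>). flux j p (T y \<omega>)) \<bullet> axis i 1"
          by (simp add: inner_axis)
        also have "\<dots> = (LINT y|lebesgue_on (cube \<rho>). flux j p (T y \<omega>) \<bullet> axis i 1)"
          by (rule integral_inner_left[symmetric]) (use Y.L2_imp_integrable[OF o] in blast)
        also have "\<dots> = (2 * \<rho>) ^ CARD('d) * ravg (\<lambda>\<omega>. flux j p \<omega> $ i) \<rho> \<omega>"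
          using ravg_eq_integral[OF L2D(1)[OF L2_component[OF fi, of i]] \<open>\<omega> \<in> space M\<close> \<open>0 < \<rho>\<close>] by (simp add: inner_axis)
        finally have "\<bar>(LINT y|lebesgue_on (cube \<rho>). flux j p (T y \<omega>)) $ i - (2 * \<rho>) ^ CARD('d) * A0 p $ i $ j\<bar>
            = (2 * \<rho>) ^ CARD('d) * \<bar>ravg (\<lambda>\<omega>. flux j p \<omega> $ i) \<rho> \<omega> - A0 p $ i $ j\<bar>"
          using \<open>0 < \<rho>\<close> by (simp add: right_diff_distrib[symmetric] abs_mult)
        then show ?thesis using elim by (simp add: less_imp_le mult_left_mono)
      qed
      then show ?case using o by blast
    qed
  qed
qed

text \<open>Since \<open>P\<close> is finite, one null set and one threshold for \<rho> serve all
  points and indices. The correctors depend on \<omega> and \<rho> and are chosen last.\<close>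

lemma corrector_family:
  assumes P: "finite P" "P \<subseteq> D" and "e > 0"
  shows "AE \<omega> in M. \<forall>\<^sub>F \<rho> in at_top. \<exists>v. \<forall>p\<in>P. \<forall>j.
    v j p \<in> H10 (cube \<rho>) \<and>
    L2norm (lebesgue_on (cube \<rho>)) (\<lambda>y. wgrad (cube \<rho>) (v j p) y - w j p (T y \<omega>)) \<le> e * sqrt ((2 * \<rho>) ^ CARD('d)) \<and>
    (\<lambda>y. V j p (T y \<omega>)) \<in> L2 (lebesgue_on (cube \<rho>)) \<and>
    L2norm (lebesgue_on (cube \<rho>)) (\<lambda>y. V j p (T y \<omega>)) \<le> R * sqrt ((2 * \<rho>) ^ CARD('d)) \<and>
    (\<lambda>y. flux j p (T y \<omega>)) \<in> L2 (lebesgue_on (cube \<rho>)) \<and>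
    (\<forall>\<phi>\<in>H10 (cube \<rho>). (LINT y|lebesgue_on (cube \<rho>). flux j p (T y \<omega>) \<bullet> wgrad (cube \<rho>) \<phi> y) = 0) \<and>
    (\<forall>i. \<bar>(LINT y|lebesgue_on (cube \<rho>). flux j p (T y \<omega>)) $ i - (2 * \<rho>) ^ CARD('d) * A0 p $ i $ j\<bar> \<le> (2 * \<rho>) ^ CARD('d) * e)"
    (is "AE \<omega> in M. \<forall>\<^sub>F \<rho> in at_top. \<exists>v. \<forall>p\<in>P. \<forall>j. ?Q \<omega> \<rho> p j (v j p)")
proof -
  have "AE \<omega> in M. \<forall>\<^sub>F \<rho> in at_top. \<exists>v. ?Q \<omega> \<rho> p j v" if p: "p \<in> P" for p j
  proof -
    have pD: "p \<in> D" using p P by blast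
    show ?thesis
      using corrector_approx[OF w_pot[OF pD, of j] \<open>e > 0\<close>] orbit_V_norm[OF pD, of j]
        orbit_flux_average[OF pD \<open>e > 0\<close>, of j] L2_sol_orbit_divergence_free[OF flux_sol[OF pD, of j]]
    proof eventually_elim
      case (elim \<omega>)
      note df = elim(4)
      show ?case using elim(1-3) eventually_gt_at_top[of 0]
      proof eventually_elim
        case (elim \<rho>)
        then show ?case using df by blast
      qed
    qed
  qed
  then have "AE \<omega> in M. \<forall>p\<in>P. \<forall>j\<in>UNIV. \<forall>\<^sub>F \<rho> in at_top. \<exists>v. ?Q \<omega> \<rho> p j v"
    by (intro AE_finite_allI P) auto
  then show ?thesis
  proof (rule eventually_mono)
    fix \<omega> assume "\<forall>p\<in>P. \<forall>j\<in>UNIV. \<forall>\<^sub>F \<rho> in at_top. \<exists>v. ?Q \<omega> \<rho> p j v"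
    then have "\<forall>\<^sub>F \<rho> in at_top. \<forall>p\<in>P. \<forall>j\<in>UNIV. \<exists>v. ?Q \<omega> \<rho> p j v"
      by (intro eventually_ball_finite P ballI) auto
    then show "\<forall>\<^sub>F \<rho> in at_top. \<exists>v. \<forall>p\<in>P. \<forall>j. ?Q \<omega> \<rho> p j (v j p)"
    proof (rule eventually_mono)
      fix \<rho> assume "\<forall>p\<in>P. \<forall>j\<in>UNIV. \<exists>v. ?Q \<omega> \<rho> p j v"
      then have "\<forall>q. \<exists>v. fst q \<in> P \<longrightarrow> ?Q \<omega> \<rho> (fst q) (snd q) v" by blast
      from choice[OF this] obtain v where v: "\<forall>q. fst q \<in> P \<longrightarrow> ?Q \<omega> \<rho> (fst q) (snd q) (v q)" by blast
      show "\<exists>v. \<forall>p\<in>P. \<forall>j. ?Q \<omega> \<rho> p j (v j p)"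
      proof (intro exI[of _ "\<lambda>j p. v (p, j)"] ballI allI)
        fix p j assume "p \<in> P"
        then show "?Q \<omega> \<rho> p j (v (p, j))" using v[rule_format, of "(p, j)"] by simp
      qed
    qed
  qed
qed

text \<open>\<open>c2\<close> comes from the corrector error under the coefficient,
  \<open>K * R\<close> from freezing the coefficient, \<open>1\<close> from the ergodic fluctuation
  of the flux, and the last term from the variation of \<open>A0\<close>. The inner dimension factor
  passes from entries to norms, the outer one from the sum over directions in
  \<open>cell_estimate\<close>.\<close>

definition error_const :: real where
  "error_const = real CARD('d) * ((c2 + K * R) + real CARD('d) * (1 + K * (c2 / c1)\<^sup>2))"

text \<open>The solutions are quantified inside the almost sure statement: the null set depends on
  \<open>e\<close> and the coefficient but not on the solutions, whose dependence on \<omega> is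
  unrestricted.\<close>

lemma truncation_error:
  assumes "e > 0" and u0: "homogenized_solution D A0 f u0"
  shows "AE \<omega> in M. \<forall>\<^sub>F \<rho> in at_top. \<forall>ur u1. truncated_solution D T A f \<rho> \<omega> ur u1 \<longrightarrow>
    c1 * V_norm D (\<lambda>x. ur x - u0 x) \<le> e * error_const * V_norm D u0"
proof -
  obtain \<kappa> where \<kappa>: "simple_function (lebesgue_on D) \<kappa>" "\<And>x. x \<in> D \<Longrightarrow> \<kappa> x \<in> D"
    "\<And>x. x \<in> D \<Longrightarrow> AE \<omega> in M. near e x (\<kappa> x) \<omega>"
    using coefficient_partition[OF \<open>e > 0\<close>] by blast
  have P: "finite (\<kappa> ` D)" "\<kappa> ` D \<subseteq> D" using simple_functionD(1)[OF \<kappa>(1)] \<kappa>(2) by auto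
  have u0H: "u0 \<in> H10 D" and hom: "\<And>\<phi>. \<phi> \<in> H10 D \<Longrightarrow> (LINT x|lebesgue_on D. (A0 x *v wgrad D u0 x) \<bullet> wgrad D \<phi> x) = f \<phi>"
    using u0 by (auto simp: homogenized_solution_def)
  have nr: "AE \<omega> in M. AE x in lebesgue_on D. AE y in lborel. near e x (\<kappa> x) (T y \<omega>)"
    by (rule near_orbit[OF \<kappa>(1)]) (rule \<kappa>(3))
  show ?thesis
    using corrector_family[OF P \<open>e > 0\<close>] A_elliptic_orbit nr AE_space
  proof eventually_elim
    case (elim \<omega>)
    note ell = elim(2) and nr = elim(3) and \<omega> = elim(4)
    show ?case using elim(1) eventually_gt_at_top[of 0]
    proof eventually_elim
      case (elim \<rho>)
      let ?Y = "cube \<rho> :: (real^'d) set"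
      define N where "N = (2 * \<rho>) ^ CARD('d)"
      have "measure lborel ?Y = N" unfolding N_def by (rule measure_cube) (use \<open>0 < \<rho>\<close> in simp)
      then have N: "N = measure lebesgue ?Y" "N > 0" using \<open>0 < \<rho>\<close> by (simp_all add: N_def)
      have Ys: "?Y \<in> sets lebesgue" by (rule open_sets_lebesgue) simp
      interpret Y: finite_measure "lebesgue_on ?Y" by (rule finite_measure_lebesgue_on_open) auto
      obtain v where v: "\<And>p j. p \<in> \<kappa> ` D \<Longrightarrow> v j p \<in> H10 ?Y"
        "\<And>p j. p \<in> \<kappa> ` D \<Longrightarrow> L2norm (lebesgue_on ?Y) (\<lambda>y. wgrad ?Y (v j p) y - w j p (T y \<omega>)) \<le> e * sqrt N"
        "\<And>p j. p \<in> \<kappa> ` D \<Longrightarrow> (\<lambda>y. V j p (T y \<omega>)) \<in> L2 (lebesgue_on ?Y)"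
        "\<And>p j. p \<in> \<kappa> ` D \<Longrightarrow> L2norm (lebesgue_on ?Y) (\<lambda>y. V j p (T y \<omega>)) \<le> R * sqrt N"
        "\<And>p j. p \<in> \<kappa> ` D \<Longrightarrow> (\<lambda>y. flux j p (T y \<omega>)) \<in> L2 (lebesgue_on ?Y)"
        "\<And>p j \<phi>. p \<in> \<kappa> ` D \<Longrightarrow> \<phi> \<in> H10 ?Y \<Longrightarrow> (\<integral>y. flux j p (T y \<omega>) \<bullet> wgrad ?Y \<phi> y \<partial>lebesgue_on ?Y) = 0"
        "\<And>p j i. p \<in> \<kappa> ` D \<Longrightarrow> \<bar>(\<integral>y. flux j p (T y \<omega>) \<partial>lebesgue_on ?Y) $ i - N * A0 p $ i $ j\<bar> \<le> N * e"
        using elim(1) unfolding N_def[symmetric] by blast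
      have [measurable]: "(\<lambda>y. y) \<in> borel_measurable (lebesgue_on ?Y)" by (rule borel_measurable_lebesgue_on) simp
      have [measurable]: "(\<lambda>z. \<omega>) \<in> X \<rightarrow>\<^sub>M M" for X :: "'z measure" using \<omega> by simp
      have Bm: "(\<lambda>z. A (fst z) (T (snd z) \<omega>)) \<in> borel_measurable (lebesgue_on D \<Otimes>\<^sub>M lebesgue_on ?Y)"
        using \<omega> by measurable
      have Bx: "(\<lambda>y. A x (T y \<omega>)) \<in> borel_measurable (lebesgue_on ?Y)" for x
        using \<omega> by measurable
      have Be: "AE x in lebesgue_on D. AE y in lebesgue_on ?Y. elliptic c1 c2 (A x (T y \<omega>))"
        using ell by (rule eventually_mono) (rule AE_lborel_lebesgue_on[OF Ys])
      have t1: "AE x in lebesgue_on D. \<forall>j. L2norm (lebesgue_on ?Y)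
          (\<lambda>y. A x (T y \<omega>) *v (axis j 1 + wgrad ?Y (v j (\<kappa> x)) y) - flux j (\<kappa> x) (T y \<omega>)) \<le> (e * (c2 + K * R)) * sqrt N"
        using Be nr AE_space
      proof eventually_elim
        case (elim x)
        then have x: "x \<in> D" and q: "\<kappa> x \<in> \<kappa> ` D" by auto
        have nx: "AE y in lebesgue_on ?Y. near e x (\<kappa> x) (T y \<omega>)" by (rule AE_lborel_lebesgue_on[OF Ys elim(2)])
        show ?case
        proof
          fix j
          let ?p = "\<kappa> x"
          let ?g = "\<lambda>y. wgrad ?Y (v j ?p) y - w j ?p (T y \<omega>)"
          have "(\<lambda>y. wgrad ?Y (v j ?p) y - (V j ?p (T y \<omega>) - axis j 1)) \<in> L2 (lebesgue_on ?Y)"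
            by (intro L2_diff H10_wgrad_L2 v(1)[OF q] v(3)[OF q] Y.L2_const)
          then have gL: "?g \<in> L2 (lebesgue_on ?Y)" by (simp add: V_def)
          note Bg = elliptic_apply_L2[OF Bx elim(1) gL]
          have BV: "(\<lambda>y. A x (T y \<omega>) *v V j ?p (T y \<omega>)) \<in> L2 (lebesgue_on ?Y)"
            using elliptic_apply_L2(1)[OF Bx elim(1) v(3)[OF q, of j]] c2 by simp
          have dL: "(\<lambda>y. A x (T y \<omega>) *v V j ?p (T y \<omega>) - flux j ?p (T y \<omega>)) \<in> L2 (lebesgue_on ?Y)"
            by (rule L2_diff[OF BV v(5)[OF q]])
          have "L2norm (lebesgue_on ?Y) (\<lambda>y. A x (T y \<omega>) *v V j ?p (T y \<omega>) - flux j ?p (T y \<omega>))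
              \<le> (K * e) * L2norm (lebesgue_on ?Y) (\<lambda>y. V j ?p (T y \<omega>))"
          proof (rule L2norm_mono[OF v(3)[OF q] L2D(1)[OF dL]])
            show "AE y in lebesgue_on ?Y. norm (A x (T y \<omega>) *v V j ?p (T y \<omega>) - flux j ?p (T y \<omega>)) \<le> (K * e) * norm (V j ?p (T y \<omega>))"
              using nx by (rule eventually_mono) (simp only: flux_def near_norm)
          qed (use K_pos \<open>e > 0\<close> in simp)
          also have "\<dots> \<le> (K * e) * (R * sqrt N)"
            by (rule mult_left_mono[OF v(4)[OF q]]) (use K_pos \<open>e > 0\<close> in simp)
          finally have 2: "L2norm (lebesgue_on ?Y) (\<lambda>y. A x (T y \<omega>) *v V j ?p (T y \<omega>) - flux j ?p (T y \<omega>)) \<le> (K * e) * (R * sqrt N)" .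
          have "L2norm (lebesgue_on ?Y) (\<lambda>y. A x (T y \<omega>) *v ?g y) \<le> c2 * (e * sqrt N)"
            using c2 by (intro order_trans[OF Bg(2) mult_left_mono[OF v(2)[OF q, of j]]]) simp_all
          moreover have "L2norm (lebesgue_on ?Y) (\<lambda>y. A x (T y \<omega>) *v ?g y + (A x (T y \<omega>) *v V j ?p (T y \<omega>) - flux j ?p (T y \<omega>)))
              \<le> L2norm (lebesgue_on ?Y) (\<lambda>y. A x (T y \<omega>) *v ?g y) + L2norm (lebesgue_on ?Y) (\<lambda>y. A x (T y \<omega>) *v V j ?p (T y \<omega>) - flux j ?p (T y \<omega>))"
            using Bg(1) dL c2 by (intro L2norm_triangle) simp_all
          moreover have "A x (T y \<omega>) *v ?g y + (A x (T y \<omega>) *v V j ?p (T y \<omega>) - flux j ?p (T y \<omega>))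
              = A x (T y \<omega>) *v (axis j 1 + wgrad ?Y (v j ?p) y) - flux j ?p (T y \<omega>)" for y
            by (simp add: V_def matrix_vector_right_distrib matrix_vector_mult_diff_distrib)
          ultimately show "L2norm (lebesgue_on ?Y)
              (\<lambda>y. A x (T y \<omega>) *v (axis j 1 + wgrad ?Y (v j ?p) y) - flux j ?p (T y \<omega>)) \<le> (e * (c2 + K * R)) * sqrt N"
            using 2 by (simp add: algebra_simps)
        qed
      qed
      have t2: "norm ((\<integral>y. flux j (\<kappa> x) (T y \<omega>) \<partial>lebesgue_on ?Y) - N *\<^sub>R (A0 x *v axis j 1))
          \<le> (e * (real CARD('d) * (1 + K * (c2 / c1)\<^sup>2))) * N" if x: "x \<in> D" for x j
      proof -
        let ?z = "(\<integral>y. flux j (\<kappa> x) (T y \<omega>) \<partial>lebesgue_on ?Y) - N *\<^sub>R (A0 x *v axis j 1)"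
        have "\<bar>?z $ i\<bar> \<le> N * e + N * (K * e * (c2 / c1)\<^sup>2)" for i
        proof -
          have a: "(A0 x *v axis j 1) $ i = A0 x $ i $ j" by (simp add: matrix_vector_mult_basis column_def)
          have "\<bar>A0 x $ i $ j - A0 (\<kappa> x) $ i $ j\<bar> \<le> K * e * (c2 / c1)\<^sup>2"
            using A0_near[OF x \<kappa>(2)[OF x] \<kappa>(3)[OF x]] \<open>e > 0\<close> by simp
          then have "\<bar>N * A0 x $ i $ j - N * A0 (\<kappa> x) $ i $ j\<bar> \<le> N * (K * e * (c2 / c1)\<^sup>2)"
            using N(2) by (simp add: right_diff_distrib[symmetric] abs_mult)
          moreover have "\<bar>(\<integral>y. flux j (\<kappa> x) (T y \<omega>) \<partial>lebesgue_on ?Y) $ i - N * A0 (\<kappa> x) $ i $ j\<bar> \<le> N * e"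
            using v(7) x by blast
          ultimately show ?thesis unfolding vector_minus_component vector_scaleR_component a real_scaleR_def by linarith
        qed
        then have "(\<Sum>i\<in>UNIV. \<bar>?z $ i\<bar>) \<le> (\<Sum>i\<in>(UNIV::'d set). N * e + N * (K * e * (c2 / c1)\<^sup>2))" by (intro sum_mono)
        also have "\<dots> = (e * (real CARD('d) * (1 + K * (c2 / c1)\<^sup>2))) * N" by (simp add: algebra_simps)
        finally show ?thesis using norm_le_l1_cart[of ?z] by linarith
      qed
      show ?case
      proof (intro allI impI)
        fix ur u1 assume tr: "truncated_solution D T A f \<rho> \<omega> ur u1"
        have "c1 * V_norm D (\<lambda>x. ur x - u0 x) \<le> real CARD('d) * (e * (c2 + K * R) + e * (real CARD('d) * (1 + K * (c2 / c1)\<^sup>2))) * V_norm D u0"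
        proof (rule two_scale_error[where Y="?Y" and B="\<lambda>x y. A x (T y \<omega>)" and \<kappa>=\<kappa> and v=v and \<sigma>="\<lambda>j p y. flux j p (T y \<omega>)" and ?u1.0=u1 and f=f, OF D(1,2) _ _ c1 c2 N Bm Be \<kappa>(1) _ _ _ t1 t2 _ _ u0H _ _ A0_apply_L2[OF H10_wgrad_L2[OF u0H]] hom])
          show "ur \<in> H10 D" "u1 \<in> L2_H10 D ?Y" using tr by (auto simp: truncated_solution_def)
          show "1 / N * (LINT x|lebesgue_on D. (\<integral>y. (A x (T y \<omega>) *v (wgrad D ur x + wgrad ?Y (u1 x) y)) \<bullet> (wgrad D \<phi>0 x + wgrad ?Y (\<phi>1 x) y) \<partial>lebesgue_on ?Y)) = f \<phi>0"
            if "\<phi>0 \<in> H10 D" "\<phi>1 \<in> L2_H10 D ?Y" for \<phi>0 \<phi>1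
            using tr that unfolding truncated_solution_def N(1) by blast
          show "0 \<le> e * (c2 + K * R)" "0 \<le> e * (real CARD('d) * (1 + K * (c2 / c1)\<^sup>2))"
            using \<open>e > 0\<close> c2 K_pos R_pos by auto
        qed (use v in auto)
        then show "c1 * V_norm D (\<lambda>x. ur x - u0 x) \<le> e * error_const * V_norm D u0"
          by (simp add: error_const_def algebra_simps)
      qed
    qed
  qed
qed

lemma truncation_convergence:
  assumes u0: "homogenized_solution D A0 f u0"
    and tr: "AE \<omega> in M. \<forall>\<rho>>0. truncated_solution D T A f \<rho> \<omega> (ur \<rho> \<omega>) (u1 \<rho> \<omega>)"
  shows "AE \<omega> in M. ((\<lambda>\<rho>. V_norm D (\<lambda>x. u0 x - ur \<rho> \<omega> x)) \<longlongrightarrow> 0) at_top"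
proof -
  \<comment> \<open>Tolerances 1 / (n + 1) suffice, which keeps the union of the exceptional sets
    null.\<close>
  have "AE \<omega> in M. \<forall>n. \<forall>\<^sub>F \<rho> in at_top. \<forall>ur u1. truncated_solution D T A f \<rho> \<omega> ur u1 \<longrightarrow>
      c1 * V_norm D (\<lambda>x. ur x - u0 x) \<le> inverse (real (Suc n)) * error_const * V_norm D u0"
    using truncation_error[OF _ u0] by (subst AE_all_countable) simp
  then show ?thesis using tr
  proof eventually_elim
    case (elim \<omega>)
    have u0H: "u0 \<in> H10 D" using u0 by (simp add: homogenized_solution_def)
    let ?c = "error_const * V_norm D u0 / c1"
    show ?case
    proof (rule tendstoI)
      fix r :: real assume "r > 0"
      have "(\<lambda>n. inverse (real (Suc n)) * ?c) \<longlonglongrightarrow> 0 * ?c"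
        by (intro tendsto_intros LIMSEQ_inverse_real_of_nat)
      then have "\<forall>\<^sub>F n in sequentially. inverse (real (Suc n)) * ?c < r"
        using \<open>r > 0\<close> by (intro order_tendstoD(2)) auto
      then obtain n where n: "inverse (real (Suc n)) * ?c < r" by (auto simp: eventually_sequentially)
      show "\<forall>\<^sub>F \<rho> in at_top. dist (V_norm D (\<lambda>x. u0 x - ur \<rho> \<omega> x)) 0 < r"
        using elim(1)[rule_format, of n] eventually_gt_at_top[of 0]
      proof eventually_elim
        case (elim \<rho>)
        have t: "truncated_solution D T A f \<rho> \<omega> (ur \<rho> \<omega>) (u1 \<rho> \<omega>)"
          using \<open>\<forall>\<rho>>0. truncated_solution D T A f \<rho> \<omega> (ur \<rho> \<omega>) (u1 \<rho> \<omega>)\<close> elim(2) by blast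
        then have H: "ur \<rho> \<omega> \<in> H10 D" by (simp add: truncated_solution_def)
        have "c1 * V_norm D (\<lambda>x. ur \<rho> \<omega> x - u0 x) \<le> inverse (real (Suc n)) * error_const * V_norm D u0"
          using elim(1) t by blast
        then have "V_norm D (\<lambda>x. ur \<rho> \<omega> x - u0 x) \<le> inverse (real (Suc n)) * ?c"
          using c1 by (simp add: pos_le_divide_eq mult.commute mult.left_commute)
        moreover have "V_norm D (\<lambda>x. ur \<rho> \<omega> x - u0 x) = V_norm D (\<lambda>x. u0 x - ur \<rho> \<omega> x)"
          unfolding V_norm_diff[OF H u0H D(1)] V_norm_diff[OF u0H H D(1)] by (rule L2norm_diff_commute)
        ultimately show ?case using n by (simp add: V_norm_def)
      qed
    qed
  qed
qed

end

theorem proposition3p7: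
  fixes D :: "(real^'d::finite) set"
    and M :: "'w measure"
    and T :: "real^'d \<Rightarrow> 'w \<Rightarrow> 'w"
    and A :: "real^'d \<Rightarrow> 'w \<Rightarrow> real^'d^'d"
    and c1 c2 :: real
    and f :: "(real^'d \<Rightarrow> real) \<Rightarrow> real"
    and w :: "'d \<Rightarrow> real^'d \<Rightarrow> 'w \<Rightarrow> real^'d"
    and u0 :: "real^'d \<Rightarrow> real"
    and u0\<rho> :: "real \<Rightarrow> 'w \<Rightarrow> real^'d \<Rightarrow> real"
    and u1\<rho> :: "real \<Rightarrow> 'w \<Rightarrow> real^'d \<Rightarrow> real^'d \<Rightarrow> real"
  assumes "bounded_lipschitz_domain D"
    and "in_V_dual D f"
    and "prob_space M"
    and "ergodic_system M T"
    and "c1 > 0" and "c2 > 0"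
    and "admissible_coefficient D M c1 c2 A"
    and "\<forall>x\<in>D. \<forall>i. cell_solution M T (A x) i (w i x)"
    and "homogenized_solution D (homogenized_coefficient M A w) f u0"
    and "AE \<omega> in M. \<forall>\<rho>>0. truncated_solution D T A f \<rho> \<omega> (u0\<rho> \<rho> \<omega>) (u1\<rho> \<rho> \<omega>)"
  shows "AE \<omega> in M. ((\<lambda>\<rho>. V_norm D (\<lambda>x. u0 x - u0\<rho> \<rho> \<omega> x)) \<longlongrightarrow> 0) at_top"
proof -
  have D: "open D" "bounded D" "D \<noteq> {}"
    using assms(1) by (auto simp: bounded_lipschitz_domain_def)
  interpret prob_space M by fact
  interpret homogenization M T D A c1 c2 w
    by unfold_locales (use D assms in auto)
  show ?thesis by (rule truncation_convergence[OF assms(9,10)])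
qed

end
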